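(* Let $(i_r,k_r,l_r)\in I\times\mathbb Z\times\mathbb Z_{>0}$ for $r=1,\dots,s$, and set $W=\bigoplus_rW_{i_r,k_r,l_r}$, $\gamma=\bigoplus_r\gamma_{i_r,k_r,l_r}$, $K_\gamma=\bigoplus_rK_{i_r,k_r,l_r}$. There are homeomorphisms (a) $\mathrm{crit}(\tilde f_\gamma)\cap\widetilde{\mathfrak L}(v,W)=\widetilde{\mathrm{Gr}}_v(K_\gamma)$, for $v\in\mathbb NI$, (b) $\mathrm{crit}(\tilde f^\bullet_\gamma)\cap\widetilde{\mathfrak L}^\bullet(v,W)=\widetilde{\mathrm{Gr}}{}^\bullet_v(K_\gamma)$, for $v\in\mathbb N(I\times\mathbb Z)$.
   Context: **Quiver varieties.** $\mathbf c=(c_{ij})_{i,j\in I}$ is the Cartan matrix of a simple complex Lie algebra, $(d_i)$ its minimal symmetrizer, $b_{ij}=d_ic_{ij}=b_{ji}$. Fix an orientation $O\subset I\times I$: for $i\ne j$ with $c_{ij}<0$ exactly one of $(i,j),(j,i)$ is in $O$, and no other pairs are; $o_{ij}=1$ if $(i,j)\in O$, $-1$ if $(j,i)\in O$, $0$ otherwise. For $I$-graded finite dimensional $V,W$, $\widetilde X(V,W)$ is the space of tuples $x=(\alpha_{ij},a_i,a_i^*,\varepsilon_i)$ with $\alpha_{ij}:V_j\to V_i$ (for $c_{ij}<0$), $a_i:V_i\to W_i$, $a_i^*:W_i\to V_i$, $\varepsilon_i:V_i\to V_i$. It is stable if no non-zero $I$-graded subspace of $V$ is preserved by all $\alpha_{ij},\varepsilon_i$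 and contained in $\bigoplus\mathrm{Ker}(a_i)$. $\widetilde{\mathfrak M}(v,W)=\widetilde X(V,W)_s/G_V$ ($\dim V=v$, $G_V=\prod_iGL(V_i)$), and $\widetilde{\mathfrak L}(v,W)$ is the fibre over $0$ of the projective map from $\widetilde{\mathfrak M}(v,W)$ to the affine quotient of $\widetilde X(V,W)$ by $G_V$. Graded versions (superscript $\bullet$): $V,W$ are $I\times\mathbb Z$-graded, $\alpha_{ij},a_i,a_i^*,\varepsilon_i$ are homogeneous of degrees $b_{ij},-d_i,-d_i,2d_i$, and one divides by the degree $0$ automorphisms of $V$. $W_{i,k,l}$ is an $I\times\mathbb Z$-graded vector space of dimension $\delta_{i,k-(l-1)d_i}+\delta_{i,k-(l-3)d_i}+\cdots+\delta_{i,k+(l-1)d_i}$ and $\gamma_{i,k,l}$ a regular nilpotent endomorphism of it, homogeneous of degree $2d_i$. The function is $\tilde f_\gamma(x)=\sum_{i,j}o_{ij}\mathrm{Tr}(\varepsilon_i^{-c_{ij}}\alpha_{ij}\alpha_{ji})+\sum_i\mathrm{Tr}(\varepsilon_ia_i^*a_i)-\sum_i\mathrm{Tr}(\gamma_ia_ia_i^* )$, and $\tilde f^\bullet_\gamma$ is its analogue on $\widetilde{\mathfrak M}^\bullet(v,W)$. In (a), $W$ is viewed as an $I$-graded space. **Preprojective algebra.** $\widetilde\Pi$ is the quotient of the path algebra of the quiver with vertices $I$, arrows $\alpha_{ij}:j\to i$ ($c_{ij}<0$) and loops $\varepsilon_i:i\to i$, by the relations $\varepsilon_i^{-c_{ij}}\alpha_{ij}=\alpha_{ij}\varepsilon_j^{-c_{ji}}$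 and, for each $i$, $\sum_j\sum_{k=0}^{-c_{ij}-1}o_{ij}\varepsilon_i^k\alpha_{ij}\alpha_{ji}\varepsilon_i^{-c_{ij}-1-k}=0$. It is graded by $\deg\alpha_{ij}=b_{ij}$, $\deg\varepsilon_i=2d_i$; $e_i$ is the trivial path at $i$. $\tau$ is the anti-automorphism with $\tau(e_i)=e_i$, $\tau(\varepsilon_i)=\varepsilon_i$, $\tau(\alpha_{ij})=\alpha_{ji}$. For a graded module $M$, $M^\vee$ is the graded dual, $(M^\vee)_k=(M_{-k})^\vee$, with the transposed action twisted by $\tau$, and $M[n]_m=M_{n+m}$. $K_{i,k,l}=\big(\widetilde\Pi e_i/\widetilde\Pi\varepsilon_i^l\big)^\vee[-k-ld_i]$. For a $\widetilde\Pi$-module (resp. graded module) $M$, $\widetilde{\mathrm{Gr}}_v(M)$ (resp. $\widetilde{\mathrm{Gr}}{}^\bullet_v(M)$) is the Grassmannian of submodules (resp. graded submodules) of dimension $v$. *)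

theory Defs
  imports
    "HOL-Analysis.Function_Topology"
    "HOL-Library.Function_Algebras"
    "HOL-Library.Poly_Mapping"
    "HOL-Algebra.QuotRing"
    "Jordan_Normal_Form.Jordan_Normal_Form"
begin

section \<open>Cartan data\<close>

definition symmetrizer :: "('i \<Rightarrow> 'i \<Rightarrow> int) \<Rightarrow> ('i \<Rightarrow> int) \<Rightarrow> bool" where
  "symmetrizer c d \<longleftrightarrow> (\<forall>i. 0 < d i) \<and> (\<forall>i j. d i * c i j = d j * c j i)"

definition minimal_symmetrizer :: "('i \<Rightarrow> 'i \<Rightarrow> int) \<Rightarrow> ('i \<Rightarrow> int) \<Rightarrow> bool" where
  "minimal_symmetrizer c d \<longleftrightarrow>
     symmetrizer c d \<and> (\<forall>d'. symmetrizer c d' \<longrightarrow> (\<forall>i. d i \<le> d' i))"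

text \<open>The Cartan matrices of the simple complex Lie algebras are the indecomposable generalized
  Cartan matrices of finite type; the Lie algebra itself is not used anywhere.\<close>

definition simple_cartan_matrix :: "('i::finite \<Rightarrow> 'i \<Rightarrow> int) \<Rightarrow> bool" where
  "simple_cartan_matrix c \<longleftrightarrow>
     (\<forall>i. c i i = 2) \<and>
     (\<forall>i j. i \<noteq> j \<longrightarrow> c i j \<le> 0) \<and>
     (\<forall>i j. c i j = 0 \<longleftrightarrow> c j i = 0) \<and>
     (\<forall>J. J \<noteq> {} \<and> J \<noteq> UNIV \<longrightarrow> (\<exists>i\<in>J. \<exists>j\<in>-J. c i j \<noteq> 0)) \<and>
     (\<exists>d. symmetrizer c d \<and>
        (\<forall>x :: 'i \<Rightarrow> real. (\<exists>i. x i \<noteq> 0) \<longrightarrow>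
           0 < (\<Sum>i\<in>UNIV. \<Sum>j\<in>UNIV. real_of_int (d i * c i j) * x i * x j)))"

definition orientation :: "('i \<Rightarrow> 'i \<Rightarrow> int) \<Rightarrow> ('i \<times> 'i) set \<Rightarrow> bool" where
  "orientation c Or \<longleftrightarrow>
     (\<forall>i j. i \<noteq> j \<and> c i j < 0 \<longrightarrow> ((i, j) \<in> Or) \<noteq> ((j, i) \<in> Or)) \<and>
     (\<forall>(i, j)\<in>Or. i \<noteq> j \<and> c i j < 0)"

definition osign :: "('i \<times> 'i) set \<Rightarrow> 'i \<Rightarrow> 'i \<Rightarrow> complex" where
  "osign Or i j = (if (i, j) \<in> Or then 1 else if (j, i) \<in> Or then -1 else 0)"

definition bform :: "('i \<Rightarrow> 'i \<Rightarrow> int) \<Rightarrow> ('i \<Rightarrow> int) \<Rightarrow> 'i \<Rightarrow> 'i \<Rightarrow> int" where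
  "bform c d i j = d i * c i j"


section \<open>Polynomial functions and topologies\<close>

inductive polyfun :: "(('c \<Rightarrow> complex) \<Rightarrow> complex) \<Rightarrow> bool" where
  polyfun_const: "polyfun (\<lambda>x. a)"
| polyfun_coord: "polyfun (\<lambda>x. x z)"
| polyfun_add: "polyfun f \<Longrightarrow> polyfun g \<Longrightarrow> polyfun (\<lambda>x. f x + g x)"
| polyfun_mult: "polyfun f \<Longrightarrow> polyfun g \<Longrightarrow> polyfun (\<lambda>x. f x * g x)"

text \<open>The spaces below are presented as subspaces of function spaces \<open>'c \<Rightarrow> complex\<close>.  On a
  finite dimensional linear subspace the product topology \<^term>\<open>euclidean\<close> induces the classical
  topology and \<open>zariski\<close> the Zariski topology.\<close>

definition zariski :: "('c \<Rightarrow> complex) topology" where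
  "zariski = topology (\<lambda>U. \<exists>F. (\<forall>f\<in>F. polyfun f) \<and> U = {x. \<exists>f\<in>F. f x \<noteq> 0})"

definition quotient_top :: "'a topology \<Rightarrow> ('a \<Rightarrow> 'b) \<Rightarrow> 'b topology" where
  "quotient_top T p = topology (\<lambda>U. U \<subseteq> p ` topspace T \<and> openin T {x \<in> topspace T. p x \<in> U})"

lemma istopology_zariski:
  "istopology (\<lambda>U :: ('c \<Rightarrow> complex) set. \<exists>F. (\<forall>f\<in>F. polyfun f) \<and> U = {x. \<exists>f\<in>F. f x \<noteq> 0})"
  (is "istopology ?P")
  unfolding istopology_def
proof (intro conjI allI impI)
  fix S T assume "?P S" "?P T"
  then obtain F G where F: "\<forall>f\<in>F. polyfun f" "S = {x. \<exists>f\<in>F. f x \<noteq> 0}"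
    and G: "\<forall>f\<in>G. polyfun f" "T = {x. \<exists>f\<in>G. f x \<noteq> 0}" by auto
  let ?H = "{(\<lambda>x. f x * g x) | f g. f \<in> F \<and> g \<in> G}"
  have "\<forall>h\<in>?H. polyfun h" using F(1) G(1) by (auto intro: polyfun_mult)
  moreover have "S \<inter> T = {x. \<exists>h\<in>?H. h x \<noteq> 0}" unfolding F(2) G(2) by fastforce
  ultimately show "?P (S \<inter> T)" by blast
next
  fix K :: "('c \<Rightarrow> complex) set set" assume "\<forall>S\<in>K. ?P S"
  then have "\<exists>F. \<forall>S\<in>K. (\<forall>f\<in>F S. polyfun f) \<and> S = {x. \<exists>f\<in>F S. f x \<noteq> 0}"
    by (rule bchoice)
  then obtain F where F: "\<forall>S\<in>K. (\<forall>f\<in>F S. polyfun f) \<and> S = {x. \<exists>f\<in>F S. f x \<noteq> 0}" by blast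
  have 1: "\<forall>f\<in>\<Union>(F ` K). polyfun f" using F by blast
  have 2: "\<Union>K = {x. \<exists>f\<in>\<Union>(F ` K). f x \<noteq> 0}"
  proof (intro Set.set_eqI iffI)
    fix x assume "x \<in> \<Union>K"
    then obtain S where S: "S \<in> K" "x \<in> S" by blast
    then have "x \<in> {x. \<exists>f\<in>F S. f x \<noteq> 0}" using F by blast
    then show "x \<in> {x. \<exists>f\<in>\<Union>(F ` K). f x \<noteq> 0}" using S by blast
  next
    fix x assume "x \<in> {x. \<exists>f\<in>\<Union>(F ` K). f x \<noteq> 0}"
    then obtain S f where S: "S \<in> K" "f \<in> F S" "f x \<noteq> 0" by blast
    then have "x \<in> {x. \<exists>f\<in>F S. f x \<noteq> 0}" by blast
    then have "x \<in> S" using F S(1) by blast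
    then show "x \<in> \<Union>K" using S by blast
  qed
  show "?P (\<Union>K)" using 1 2 by blast
qed

lemma istopology_quotient_top:
  "istopology (\<lambda>U. U \<subseteq> p ` topspace T \<and> openin T {x \<in> topspace T. p x \<in> U})"
  unfolding istopology_def
proof (intro conjI allI impI)
  fix S S'
  assume "S \<subseteq> p ` topspace T \<and> openin T {x \<in> topspace T. p x \<in> S}"
    and "S' \<subseteq> p ` topspace T \<and> openin T {x \<in> topspace T. p x \<in> S'}"
  moreover have "{x \<in> topspace T. p x \<in> S \<inter> S'}
      = {x \<in> topspace T. p x \<in> S} \<inter> {x \<in> topspace T. p x \<in> S'}" by blast
  ultimately show "S \<inter> S' \<subseteq> p ` topspace T" "openin T {x \<in> topspace T. p x \<in> S \<inter> S'}"
    by auto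
next
  fix K assume K: "\<forall>S\<in>K. S \<subseteq> p ` topspace T \<and> openin T {x \<in> topspace T. p x \<in> S}"
  then show "\<Union>K \<subseteq> p ` topspace T" by blast
  have "{x \<in> topspace T. p x \<in> \<Union>K} = (\<Union>S\<in>K. {x \<in> topspace T. p x \<in> S})" by blast
  then show "openin T {x \<in> topspace T. p x \<in> \<Union>K}" using K by auto
qed

definition cscale :: "complex \<Rightarrow> ('c \<Rightarrow> complex) \<Rightarrow> 'c \<Rightarrow> complex" where
  "cscale a f = (\<lambda>x. a * f x)"

interpretation cfun: Vector_Spaces.vector_space "cscale :: complex \<Rightarrow> ('c \<Rightarrow> complex) \<Rightarrow> _"
  by unfold_locales (auto simp: cscale_def fun_eq_iff algebra_simps)


section \<open>Quiver varieties\<close>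

text \<open>\<open>V\<close> and \<open>W\<close> are given with bases, so that \<open>V i = \<complex>^(v i)\<close> and \<open>W i = \<complex>^(w i)\<close>.
  A tuple \<open>x\<close> is the family of its matrix entries: \<open>CAlpha i j p q\<close> is the \<open>(p, q)\<close> entry
  of \<open>\<alpha>\<^sub>i\<^sub>j : V j \<rightarrow> V i\<close>, and likewise \<open>CA\<close>, \<open>CAs\<close>, \<open>CEps\<close> are the entries of \<open>a\<^sub>i\<close>, \<open>a\<^sub>i\<^sup>*\<close>
  and \<open>\<epsilon>\<^sub>i\<close>.\<close>

datatype 'i coord = CAlpha 'i 'i nat nat | CA 'i nat nat | CAs 'i nat nat | CEps 'i nat nat

type_synonym 'i rep = "'i coord \<Rightarrow> complex"

definition alphaM :: "('i \<Rightarrow> nat) \<Rightarrow> 'i rep \<Rightarrow> 'i \<Rightarrow> 'i \<Rightarrow> complex mat" where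
  "alphaM v x i j = mat (v i) (v j) (\<lambda>(p, q). x (CAlpha i j p q))"

definition aM :: "('i \<Rightarrow> nat) \<Rightarrow> ('i \<Rightarrow> nat) \<Rightarrow> 'i rep \<Rightarrow> 'i \<Rightarrow> complex mat" where
  "aM v w x i = mat (w i) (v i) (\<lambda>(p, q). x (CA i p q))"

definition asM :: "('i \<Rightarrow> nat) \<Rightarrow> ('i \<Rightarrow> nat) \<Rightarrow> 'i rep \<Rightarrow> 'i \<Rightarrow> complex mat" where
  "asM v w x i = mat (v i) (w i) (\<lambda>(p, q). x (CAs i p q))"

definition epsM :: "('i \<Rightarrow> nat) \<Rightarrow> 'i rep \<Rightarrow> 'i \<Rightarrow> complex mat" where
  "epsM v x i = mat (v i) (v i) (\<lambda>(p, q). x (CEps i p q))"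

definition coords :: "('i \<Rightarrow> 'i \<Rightarrow> int) \<Rightarrow> ('i \<Rightarrow> nat) \<Rightarrow> ('i \<Rightarrow> nat) \<Rightarrow> 'i coord set" where
  "coords c v w =
     {CAlpha i j p q | i j p q. c i j < 0 \<and> p < v i \<and> q < v j} \<union>
     {CA i p q | i p q. p < w i \<and> q < v i} \<union>
     {CAs i p q | i p q. p < v i \<and> q < w i} \<union>
     {CEps i p q | i p q. p < v i \<and> q < v i}"

definition Xrep :: "('i \<Rightarrow> 'i \<Rightarrow> int) \<Rightarrow> ('i \<Rightarrow> nat) \<Rightarrow> ('i \<Rightarrow> nat) \<Rightarrow> 'i rep set" where
  "Xrep c v w = {x. \<forall>z. z \<notin> coords c v w \<longrightarrow> x z = 0}"

definition GLrep :: "('i \<Rightarrow> nat) \<Rightarrow> ('i \<Rightarrow> complex mat) set" where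
  "GLrep v = {g. \<forall>i. g i \<in> carrier_mat (v i) (v i) \<and> invertible_mat (g i)}"

text \<open>An \<open>I \<times> \<int>\<close>-graded space is an \<open>I\<close>-graded space with a homogeneous basis: \<open>vd i\<close> lists the
  degrees of the basis vectors of \<open>V i\<close>.\<close>

definition dims :: "('i \<Rightarrow> int list) \<Rightarrow> 'i \<Rightarrow> nat" where
  "dims vd i = length (vd i)"

definition deg_list :: "('i \<Rightarrow> int \<Rightarrow> nat) \<Rightarrow> 'i \<Rightarrow> int list" where
  "deg_list v i = concat (map (\<lambda>m. replicate (v i m) m) (sorted_list_of_set {m. v i m \<noteq> 0}))"

definition homogeneous_mat :: "int \<Rightarrow> int list \<Rightarrow> int list \<Rightarrow> complex mat \<Rightarrow> bool" where
  "homogeneous_mat n tdeg sdeg A \<longleftrightarrow>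
     (\<forall>p<length tdeg. \<forall>q<length sdeg. A $$ (p, q) \<noteq> 0 \<longrightarrow> tdeg ! p = sdeg ! q + n)"

definition Xrep_gr ::
  "('i \<Rightarrow> 'i \<Rightarrow> int) \<Rightarrow> ('i \<Rightarrow> int) \<Rightarrow> ('i \<Rightarrow> int list) \<Rightarrow> ('i \<Rightarrow> int list) \<Rightarrow> 'i rep set" where
  "Xrep_gr c d vd wd = {x \<in> Xrep c (dims vd) (dims wd).
     (\<forall>i j. homogeneous_mat (bform c d i j) (vd i) (vd j) (alphaM (dims vd) x i j)) \<and>
     (\<forall>i. homogeneous_mat (- d i) (wd i) (vd i) (aM (dims vd) (dims wd) x i)) \<and>
     (\<forall>i. homogeneous_mat (- d i) (vd i) (wd i) (asM (dims vd) (dims wd) x i)) \<and>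
     (\<forall>i. homogeneous_mat (2 * d i) (vd i) (vd i) (epsM (dims vd) x i))}"

definition GLrep_gr :: "('i \<Rightarrow> int list) \<Rightarrow> ('i \<Rightarrow> complex mat) set" where
  "GLrep_gr vd = {g \<in> GLrep (dims vd). \<forall>i. homogeneous_mat 0 (vd i) (vd i) (g i)}"

text \<open>\<open>acts_to v w g x y\<close> says \<open>y = g \<cdot> x\<close> for the action of \<open>G\<^sub>V\<close> by conjugation, with the
  inverses of the \<open>g i\<close> moved to the other side.\<close>

definition acts_to ::
  "('i \<Rightarrow> nat) \<Rightarrow> ('i \<Rightarrow> nat) \<Rightarrow> ('i \<Rightarrow> complex mat) \<Rightarrow> 'i rep \<Rightarrow> 'i rep \<Rightarrow> bool" where
  "acts_to v w g x y \<longleftrightarrow>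
     (\<forall>i j. alphaM v y i j * g j = g i * alphaM v x i j) \<and>
     (\<forall>i. aM v w y i * g i = aM v w x i) \<and>
     (\<forall>i. asM v w y i = g i * asM v w x i) \<and>
     (\<forall>i. epsM v y i * g i = g i * epsM v x i)"

definition linear_subspace :: "nat \<Rightarrow> complex vec set \<Rightarrow> bool" where
  "linear_subspace n S \<longleftrightarrow> S \<subseteq> carrier_vec n \<and> 0\<^sub>v n \<in> S \<and>
     (\<forall>x\<in>S. \<forall>y\<in>S. x + y \<in> S) \<and> (\<forall>a. \<forall>x\<in>S. a \<cdot>\<^sub>v x \<in> S)"

definition stable ::
  "('i \<Rightarrow> 'i \<Rightarrow> int) \<Rightarrow> ('i \<Rightarrow> nat) \<Rightarrow> ('i \<Rightarrow> nat) \<Rightarrow> 'i rep \<Rightarrow> bool" where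
  "stable c v w x \<longleftrightarrow>
     (\<forall>S. (\<forall>i. linear_subspace (v i) (S i)) \<and>
          (\<forall>i j. c i j < 0 \<longrightarrow> (\<forall>u\<in>S j. alphaM v x i j *\<^sub>v u \<in> S i)) \<and>
          (\<forall>i. \<forall>u\<in>S i. epsM v x i *\<^sub>v u \<in> S i) \<and>
          (\<forall>i. \<forall>u\<in>S i. aM v w x i *\<^sub>v u = 0\<^sub>v (w i))
        \<longrightarrow> (\<forall>i. S i = {0\<^sub>v (v i)}))"

text \<open>In the rest of this section \<open>X\<close> is \<open>Xrep\<close> or \<open>Xrep_gr\<close> and \<open>G\<close> is the corresponding group,
  \<open>GLrep\<close> or \<open>GLrep_gr\<close>.  Points of the quotient are orbits.\<close>

definition stable_points ::
  "('i \<Rightarrow> 'i \<Rightarrow> int) \<Rightarrow> ('i \<Rightarrow> nat) \<Rightarrow> ('i \<Rightarrow> nat) \<Rightarrow> 'i rep set \<Rightarrow> 'i rep set" where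
  "stable_points c v w X = {x \<in> X. stable c v w x}"

definition orbit_of ::
  "('i \<Rightarrow> nat) \<Rightarrow> ('i \<Rightarrow> nat) \<Rightarrow> 'i rep set \<Rightarrow> ('i \<Rightarrow> complex mat) set \<Rightarrow> 'i rep \<Rightarrow> 'i rep set" where
  "orbit_of v w X G x = {y \<in> X. \<exists>g\<in>G. acts_to v w g x y}"

definition quiver_variety_top ::
  "'i rep topology \<Rightarrow> ('i \<Rightarrow> 'i \<Rightarrow> int) \<Rightarrow> ('i \<Rightarrow> nat) \<Rightarrow> ('i \<Rightarrow> nat) \<Rightarrow> 'i rep set
     \<Rightarrow> ('i \<Rightarrow> complex mat) set \<Rightarrow> 'i rep set topology" where
  "quiver_variety_top T c v w X G =
     quotient_top (subtopology T (stable_points c v w X)) (orbit_of v w X G)"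

definition invariant_polys ::
  "('i \<Rightarrow> nat) \<Rightarrow> ('i \<Rightarrow> nat) \<Rightarrow> 'i rep set \<Rightarrow> ('i \<Rightarrow> complex mat) set \<Rightarrow> ('i rep \<Rightarrow> complex) set" where
  "invariant_polys v w X G =
     {f. polyfun f \<and> (\<forall>g\<in>G. \<forall>x\<in>X. \<forall>y\<in>X. acts_to v w g x y \<longrightarrow> f x = f y)}"

text \<open>A point of the affine quotient, i.e. of the spectrum of the ring of invariants, is determined
  by the values of the invariant polynomials; \<open>0\<close> is the image of \<open>0 \<in> X\<close>.\<close>

definition nilpotent_fibre ::
  "('i \<Rightarrow> 'i \<Rightarrow> int) \<Rightarrow> ('i \<Rightarrow> nat) \<Rightarrow> ('i \<Rightarrow> nat) \<Rightarrow> 'i rep set \<Rightarrow> ('i \<Rightarrow> complex mat) set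
     \<Rightarrow> 'i rep set set" where
  "nilpotent_fibre c v w X G =
     {orbit_of v w X G x | x. x \<in> stable_points c v w X \<and>
        (\<forall>f\<in>invariant_polys v w X G. f x = f (\<lambda>z. 0))}"

text \<open>The orbit map on stable points is a principal \<open>G\<^sub>V\<close>-bundle, in particular a submersion.  So
  the differential of the function induced by an invariant \<open>F\<close> vanishes at an orbit iff the
  differential of \<open>F\<close> on the vector space \<open>X\<close> vanishes at a point of it.\<close>

definition critical_locus ::
  "('i \<Rightarrow> 'i \<Rightarrow> int) \<Rightarrow> ('i \<Rightarrow> nat) \<Rightarrow> ('i \<Rightarrow> nat) \<Rightarrow> 'i rep set \<Rightarrow> ('i \<Rightarrow> complex mat) set
     \<Rightarrow> ('i rep \<Rightarrow> complex) \<Rightarrow> 'i rep set set" where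
  "critical_locus c v w X G F =
     {orbit_of v w X G x | x. x \<in> stable_points c v w X \<and>
        (\<forall>y\<in>X. ((\<lambda>t. F (\<lambda>z. x z + t * y z)) has_field_derivative 0) (at 0))}"

definition mtrace :: "complex mat \<Rightarrow> complex" where
  "mtrace A = (\<Sum>p<dim_row A. A $$ (p, p))"

definition potential ::
  "('i::finite \<Rightarrow> 'i \<Rightarrow> int) \<Rightarrow> ('i \<times> 'i) set \<Rightarrow> ('i \<Rightarrow> complex mat) \<Rightarrow> ('i \<Rightarrow> nat) \<Rightarrow> ('i \<Rightarrow> nat)
     \<Rightarrow> 'i rep \<Rightarrow> complex" where
  "potential c Or \<gamma> v w x =
     (\<Sum>i\<in>UNIV. \<Sum>j\<in>UNIV. osign Or i j *
        mtrace (epsM v x i ^\<^sub>m nat (- c i j) * alphaM v x i j * alphaM v x j i)) +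
     (\<Sum>i\<in>UNIV. mtrace (epsM v x i * asM v w x i * aM v w x i)) -
     (\<Sum>i\<in>UNIV. mtrace (\<gamma> i * aM v w x i * asM v w x i))"

definition crit_fibre_top ::
  "'i::finite rep topology \<Rightarrow> ('i \<Rightarrow> 'i \<Rightarrow> int) \<Rightarrow> ('i \<times> 'i) set \<Rightarrow> ('i \<Rightarrow> complex mat)
     \<Rightarrow> ('i \<Rightarrow> nat) \<Rightarrow> ('i \<Rightarrow> nat) \<Rightarrow> 'i rep set topology" where
  "crit_fibre_top T c Or \<gamma> v w =
     (let X = Xrep c v w; G = GLrep v in
      subtopology (quiver_variety_top T c v w X G)
        (critical_locus c v w X G (potential c Or \<gamma> v w) \<inter> nilpotent_fibre c v w X G))"

definition crit_fibre_top_gr ::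
  "'i::finite rep topology \<Rightarrow> ('i \<Rightarrow> 'i \<Rightarrow> int) \<Rightarrow> ('i \<Rightarrow> int) \<Rightarrow> ('i \<times> 'i) set
     \<Rightarrow> ('i \<Rightarrow> complex mat) \<Rightarrow> ('i \<Rightarrow> int list) \<Rightarrow> ('i \<Rightarrow> int list) \<Rightarrow> 'i rep set topology" where
  "crit_fibre_top_gr T c d Or \<gamma> vd wd =
     (let X = Xrep_gr c d vd wd; G = GLrep_gr vd; v = dims vd; w = dims wd in
      subtopology (quiver_variety_top T c v w X G)
        (critical_locus c v w X G (potential c Or \<gamma> v w) \<inter> nilpotent_fibre c v w X G))"


section \<open>The framing\<close>

text \<open>The degrees \<open>k - (l-1)d, k - (l-3)d, \<dots>, k + (l-1)d\<close> of a homogeneous basis of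
  \<open>W\<^bsub>i,k,l\<^esub>\<close>, where \<open>d = d\<^sub>i\<close>.\<close>

definition block_degs :: "int \<Rightarrow> int \<Rightarrow> nat \<Rightarrow> int list" where
  "block_degs d k l = map (\<lambda>m. k - (int l - 1) * d + 2 * int m * d) [0..<l]"

text \<open>A nilpotent endomorphism is regular iff it has a single Jordan block.\<close>

definition regular_nilpotent :: "nat \<Rightarrow> complex mat \<Rightarrow> bool" where
  "regular_nilpotent l A \<longleftrightarrow> A \<in> carrier_mat l l \<and> similar_mat A (jordan_block l 0)"

definition block_indices :: "nat \<Rightarrow> (nat \<Rightarrow> 'i) \<Rightarrow> 'i \<Rightarrow> nat list" where
  "block_indices s ii i = filter (\<lambda>r. ii r = i) [1..<Suc s]"

definition W_degs ::
  "('i \<Rightarrow> int) \<Rightarrow> nat \<Rightarrow> (nat \<Rightarrow> 'i) \<Rightarrow> (nat \<Rightarrow> int) \<Rightarrow> (nat \<Rightarrow> nat) \<Rightarrow> 'i \<Rightarrow> int list" where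
  "W_degs d s ii k l i =
     concat (map (\<lambda>r. block_degs (d i) (k r) (l r)) (block_indices s ii i))"

definition gamma_sum :: "nat \<Rightarrow> (nat \<Rightarrow> 'i) \<Rightarrow> (nat \<Rightarrow> complex mat) \<Rightarrow> 'i \<Rightarrow> complex mat" where
  "gamma_sum s ii \<gamma> i = diag_block_mat (map \<gamma> (block_indices s ii i))"


section \<open>The preprojective algebra\<close>

datatype 'i arrow = Al 'i 'i | Ep 'i

fun asource :: "'i arrow \<Rightarrow> 'i" where
  "asource (Al i j) = j"
| "asource (Ep i) = i"

fun atarget :: "'i arrow \<Rightarrow> 'i" where
  "atarget (Al i j) = i"
| "atarget (Ep i) = i"

fun aflip :: "'i arrow \<Rightarrow> 'i arrow" where
  "aflip (Al i j) = Al j i"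
| "aflip (Ep i) = Ep i"

fun adeg :: "('i \<Rightarrow> 'i \<Rightarrow> int) \<Rightarrow> ('i \<Rightarrow> int) \<Rightarrow> 'i arrow \<Rightarrow> int" where
  "adeg c d (Al i j) = bform c d i j"
| "adeg c d (Ep i) = 2 * d i"

text \<open>A path is a pair of its target and the list of its arrows, composed as maps, so the last
  arrow of the list comes first; \<open>(i, [])\<close> is the trivial path at \<open>i\<close>.\<close>

type_synonym 'i qpath = "'i \<times> 'i arrow list"

fun is_path :: "('i \<Rightarrow> 'i \<Rightarrow> int) \<Rightarrow> 'i qpath \<Rightarrow> bool" where
  "is_path c (i, []) = True"
| "is_path c (i, a # as) =
     (atarget a = i \<and> (case a of Al i' j \<Rightarrow> c i' j < 0 | Ep _ \<Rightarrow> True) \<and> is_path c (asource a, as))"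

fun psource :: "'i qpath \<Rightarrow> 'i" where
  "psource (i, []) = i"
| "psource (i, a # as) = psource (asource a, as)"

definition pflip :: "'i qpath \<Rightarrow> 'i qpath" where
  "pflip p = (psource p, rev (map aflip (snd p)))"

definition pdeg :: "('i \<Rightarrow> 'i \<Rightarrow> int) \<Rightarrow> ('i \<Rightarrow> int) \<Rightarrow> 'i qpath \<Rightarrow> int" where
  "pdeg c d p = sum_list (map (adeg c d) (snd p))"

type_synonym 'i palg = "'i qpath \<Rightarrow>\<^sub>0 complex"

definition pmult :: "'i palg \<Rightarrow> 'i palg \<Rightarrow> 'i palg" where
  "pmult f g = (\<Sum>p\<in>Poly_Mapping.keys f. \<Sum>q\<in>Poly_Mapping.keys g.
     if psource p = fst q
     then Poly_Mapping.single (fst p, snd p @ snd q) (Poly_Mapping.lookup f p * Poly_Mapping.lookup g q)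
     else 0)"

definition path_algebra :: "('i::finite \<Rightarrow> 'i \<Rightarrow> int) \<Rightarrow> 'i palg ring" where
  "path_algebra c = \<lparr>carrier = {f. \<forall>p\<in>Poly_Mapping.keys f. is_path c p}, monoid.mult = pmult,
     one = (\<Sum>i\<in>UNIV. Poly_Mapping.single (i, []) 1), zero = 0, add = (+)\<rparr>"

definition commutation_rel :: "('i \<Rightarrow> 'i \<Rightarrow> int) \<Rightarrow> 'i \<Rightarrow> 'i \<Rightarrow> 'i palg" where
  "commutation_rel c i j =
     Poly_Mapping.single (i, replicate (nat (- c i j)) (Ep i) @ [Al i j]) 1 -
     Poly_Mapping.single (i, Al i j # replicate (nat (- c j i)) (Ep j)) 1"

definition mesh_rel :: "('i::finite \<Rightarrow> 'i \<Rightarrow> int) \<Rightarrow> ('i \<times> 'i) set \<Rightarrow> 'i \<Rightarrow> 'i palg" where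
  "mesh_rel c Or i = (\<Sum>j\<in>UNIV. \<Sum>k<nat (- c i j).
     Poly_Mapping.single
       (i, replicate k (Ep i) @ [Al i j, Al j i] @ replicate (nat (- c i j) - 1 - k) (Ep i))
       (osign Or i j))"

definition pi_ideal :: "('i::finite \<Rightarrow> 'i \<Rightarrow> int) \<Rightarrow> ('i \<times> 'i) set \<Rightarrow> 'i palg set" where
  "pi_ideal c Or = genideal (path_algebra c)
     ({commutation_rel c i j | i j. c i j < 0} \<union> range (mesh_rel c Or))"

definition Pi_alg :: "('i::finite \<Rightarrow> 'i \<Rightarrow> int) \<Rightarrow> ('i \<times> 'i) set \<Rightarrow> 'i palg set ring" where
  "Pi_alg c Or = FactRing (path_algebra c) (pi_ideal c Or)"

definition pi_class ::
  "('i::finite \<Rightarrow> 'i \<Rightarrow> int) \<Rightarrow> ('i \<times> 'i) set \<Rightarrow> 'i palg \<Rightarrow> 'i palg set" where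
  "pi_class c Or f = a_r_coset (path_algebra c) (pi_ideal c Or) f"

definition pi_e :: "('i::finite \<Rightarrow> 'i \<Rightarrow> int) \<Rightarrow> ('i \<times> 'i) set \<Rightarrow> 'i \<Rightarrow> 'i palg set" where
  "pi_e c Or i = pi_class c Or (Poly_Mapping.single (i, []) 1)"

definition pi_eps :: "('i::finite \<Rightarrow> 'i \<Rightarrow> int) \<Rightarrow> ('i \<times> 'i) set \<Rightarrow> 'i \<Rightarrow> 'i palg set" where
  "pi_eps c Or i = pi_class c Or (Poly_Mapping.single (i, [Ep i]) 1)"

definition pi_scalar :: "('i::finite \<Rightarrow> 'i \<Rightarrow> int) \<Rightarrow> ('i \<times> 'i) set \<Rightarrow> complex \<Rightarrow> 'i palg set" where
  "pi_scalar c Or a = pi_class c Or (\<Sum>i\<in>UNIV. Poly_Mapping.single (i, []) a)"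

definition pi_degree ::
  "('i::finite \<Rightarrow> 'i \<Rightarrow> int) \<Rightarrow> ('i \<Rightarrow> int) \<Rightarrow> ('i \<times> 'i) set \<Rightarrow> int \<Rightarrow> 'i palg set set" where
  "pi_degree c d Or n = pi_class c Or `
     {f \<in> carrier (path_algebra c). \<forall>p\<in>Poly_Mapping.keys f. pdeg c d p = n}"

text \<open>The ideal of relations is stable under the anti-automorphism, so the image of a coset is a
  coset.\<close>

definition palg_tau :: "'i palg \<Rightarrow> 'i palg" where
  "palg_tau f = (\<Sum>p\<in>Poly_Mapping.keys f. Poly_Mapping.single (pflip p) (Poly_Mapping.lookup f p))"

definition pi_tau :: "'i palg set \<Rightarrow> 'i palg set" where
  "pi_tau x = palg_tau ` x"


section \<open>Graded modules\<close>

text \<open>Graded left modules over \<open>Pi_alg c Or\<close>; \<open>mdegree M n\<close> is the homogeneous piece of degree \<open>n\<close>.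
  Complex scalars act through \<^const>\<open>pi_scalar\<close>.\<close>

record ('a, 'm) graded_module =
  mcarrier :: "'m set"
  madd :: "'m \<Rightarrow> 'm \<Rightarrow> 'm"
  mact :: "'a \<Rightarrow> 'm \<Rightarrow> 'm"
  mdegree :: "int \<Rightarrow> 'm set"

definition proj_module :: "('i::finite \<Rightarrow> 'i \<Rightarrow> int) \<Rightarrow> ('i \<times> 'i) set \<Rightarrow> 'i \<Rightarrow> 'i palg set set" where
  "proj_module c Or i = (\<lambda>x. x \<otimes>\<^bsub>Pi_alg c Or\<^esub> pi_e c Or i) ` carrier (Pi_alg c Or)"

definition eps_submodule ::
  "('i::finite \<Rightarrow> 'i \<Rightarrow> int) \<Rightarrow> ('i \<times> 'i) set \<Rightarrow> 'i \<Rightarrow> nat \<Rightarrow> 'i palg set set" where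
  "eps_submodule c Or i l =
     (\<lambda>x. x \<otimes>\<^bsub>Pi_alg c Or\<^esub> (pi_eps c Or i [^]\<^bsub>Pi_alg c Or\<^esub> l)) ` carrier (Pi_alg c Or)"

definition Q_module ::
  "('i::finite \<Rightarrow> 'i \<Rightarrow> int) \<Rightarrow> ('i \<Rightarrow> int) \<Rightarrow> ('i \<times> 'i) set \<Rightarrow> 'i \<Rightarrow> nat
     \<Rightarrow> ('i palg set, 'i palg set set) graded_module" where
  "Q_module c d Or i l = (let P = Pi_alg c Or; N = eps_submodule c Or i l in
     \<lparr>mcarrier = a_r_coset P N ` proj_module c Or i,
      madd = set_add P,
      mact = (\<lambda>p A. \<Union>x\<in>A. a_r_coset P N (p \<otimes>\<^bsub>P\<^esub> x)),
      mdegree = (\<lambda>n. a_r_coset P N ` (proj_module c Or i \<inter> pi_degree c d Or n))\<rparr>)"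

text \<open>The graded dual: linear forms, extended by \<open>0\<close> outside the carrier, that vanish on all but
  finitely many homogeneous pieces.\<close>

definition dual_module ::
  "('i::finite \<Rightarrow> 'i \<Rightarrow> int) \<Rightarrow> ('i \<times> 'i) set \<Rightarrow> ('i palg set, 'm) graded_module
     \<Rightarrow> ('i palg set, 'm \<Rightarrow> complex) graded_module" where
  "dual_module c Or M = (let D =
       {\<phi>. (\<forall>x. x \<notin> mcarrier M \<longrightarrow> \<phi> x = 0) \<and>
           (\<forall>x\<in>mcarrier M. \<forall>y\<in>mcarrier M. \<phi> (madd M x y) = \<phi> x + \<phi> y) \<and>
           (\<forall>a. \<forall>x\<in>mcarrier M. \<phi> (mact M (pi_scalar c Or a) x) = a * \<phi> x) \<and>
           finite {n. \<exists>x\<in>mdegree M n. \<phi> x \<noteq> 0}} in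
     \<lparr>mcarrier = D,
      madd = (+),
      mact = (\<lambda>p \<phi> x. if x \<in> mcarrier M then \<phi> (mact M (pi_tau p) x) else 0),
      mdegree = (\<lambda>k. {\<phi> \<in> D. \<forall>n. n \<noteq> - k \<longrightarrow> (\<forall>x\<in>mdegree M n. \<phi> x = 0)})\<rparr>)"

definition shift_module :: "int \<Rightarrow> ('a, 'm) graded_module \<Rightarrow> ('a, 'm) graded_module" where
  "shift_module n M = M\<lparr>mdegree := (\<lambda>m. mdegree M (n + m))\<rparr>"

text \<open>Direct sum over a finite set \<open>R\<close> of modules whose elements are complex valued functions with
  pointwise addition.\<close>

definition dsum_module ::
  "'r set \<Rightarrow> ('r \<Rightarrow> ('a, 'n \<Rightarrow> complex) graded_module) \<Rightarrow> ('a, 'r \<times> 'n \<Rightarrow> complex) graded_module" where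
  "dsum_module R M =
     \<lparr>mcarrier = {f. (\<forall>r\<in>R. (\<lambda>x. f (r, x)) \<in> mcarrier (M r)) \<and> (\<forall>r x. r \<notin> R \<longrightarrow> f (r, x) = 0)},
      madd = (+),
      mact = (\<lambda>p f (r, x). if r \<in> R then mact (M r) p (\<lambda>y. f (r, y)) x else 0),
      mdegree = (\<lambda>n. {f. (\<forall>r\<in>R. (\<lambda>x. f (r, x)) \<in> mdegree (M r) n) \<and>
                         (\<forall>r x. r \<notin> R \<longrightarrow> f (r, x) = 0)})\<rparr>"

definition K_module ::
  "('i::finite \<Rightarrow> 'i \<Rightarrow> int) \<Rightarrow> ('i \<Rightarrow> int) \<Rightarrow> ('i \<times> 'i) set \<Rightarrow> 'i \<Rightarrow> int \<Rightarrow> nat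
     \<Rightarrow> ('i palg set, 'i palg set set \<Rightarrow> complex) graded_module" where
  "K_module c d Or i k l =
     shift_module (- k - int l * d i) (dual_module c Or (Q_module c d Or i l))"

definition K_gamma ::
  "('i::finite \<Rightarrow> 'i \<Rightarrow> int) \<Rightarrow> ('i \<Rightarrow> int) \<Rightarrow> ('i \<times> 'i) set \<Rightarrow> nat \<Rightarrow> (nat \<Rightarrow> 'i) \<Rightarrow> (nat \<Rightarrow> int)
     \<Rightarrow> (nat \<Rightarrow> nat) \<Rightarrow> ('i palg set, nat \<times> 'i palg set set \<Rightarrow> complex) graded_module" where
  "K_gamma c d Or s ii k l = dsum_module {1..s} (\<lambda>r. K_module c d Or (ii r) (k r) (l r))"


section \<open>Grassmannians of submodules\<close>

definition pi_submodule ::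
  "('i::finite \<Rightarrow> 'i \<Rightarrow> int) \<Rightarrow> ('i \<times> 'i) set \<Rightarrow> ('i palg set, 'm) graded_module \<Rightarrow> 'm set \<Rightarrow> bool" where
  "pi_submodule c Or M U \<longleftrightarrow> U \<subseteq> mcarrier M \<and> U \<noteq> {} \<and>
     (\<forall>x\<in>U. \<forall>y\<in>U. madd M x y \<in> U) \<and> (\<forall>p\<in>carrier (Pi_alg c Or). \<forall>x\<in>U. mact M p x \<in> U)"

definition graded_submodule ::
  "('i::finite \<Rightarrow> 'i \<Rightarrow> int) \<Rightarrow> ('i \<times> 'i) set \<Rightarrow> ('i palg set, 'c \<Rightarrow> complex) graded_module
     \<Rightarrow> ('c \<Rightarrow> complex) set \<Rightarrow> bool" where
  "graded_submodule c Or M U \<longleftrightarrow>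
     pi_submodule c Or M U \<and> U = cfun.span (\<Union>n. U \<inter> mdegree M n)"

definition piece ::
  "('i::finite \<Rightarrow> 'i \<Rightarrow> int) \<Rightarrow> ('i \<times> 'i) set \<Rightarrow> ('i palg set, 'm) graded_module
     \<Rightarrow> 'm set \<Rightarrow> 'i \<Rightarrow> 'm set" where
  "piece c Or M U i = mact M (pi_e c Or i) ` U"

definition piece_gr ::
  "('i::finite \<Rightarrow> 'i \<Rightarrow> int) \<Rightarrow> ('i \<times> 'i) set \<Rightarrow> ('i palg set, 'm) graded_module
     \<Rightarrow> 'm set \<Rightarrow> 'i \<times> int \<Rightarrow> 'm set" where
  "piece_gr c Or M U = (\<lambda>(i, n). piece c Or M U i \<inter> mdegree M n)"

definition ordered_basis ::
  "nat \<Rightarrow> ('c \<Rightarrow> complex) set \<Rightarrow> (nat \<Rightarrow> 'c \<Rightarrow> complex) \<Rightarrow> bool" where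
  "ordered_basis n S b \<longleftrightarrow> inj_on b {..<n} \<and> \<not> cfun.dependent (b ` {..<n}) \<and>
     cfun.span (b ` {..<n}) = S"

text \<open>\<open>cfun.dim\<close> is not used here since it does not tell infinite dimensional spaces from \<open>0\<close>.\<close>

definition has_dim :: "('c \<Rightarrow> complex) set \<Rightarrow> nat \<Rightarrow> bool" where
  "has_dim S n \<longleftrightarrow> (\<exists>b. ordered_basis n S b)"

definition Gr ::
  "('i::finite \<Rightarrow> 'i \<Rightarrow> int) \<Rightarrow> ('i \<times> 'i) set \<Rightarrow> ('i palg set, 'c \<Rightarrow> complex) graded_module
     \<Rightarrow> ('i \<Rightarrow> nat) \<Rightarrow> ('c \<Rightarrow> complex) set set" where
  "Gr c Or M v = {U. pi_submodule c Or M U \<and> (\<forall>i. has_dim (piece c Or M U i) (v i))}"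

definition Gr_gr ::
  "('i::finite \<Rightarrow> 'i \<Rightarrow> int) \<Rightarrow> ('i \<times> 'i) set \<Rightarrow> ('i palg set, 'c \<Rightarrow> complex) graded_module
     \<Rightarrow> ('i \<Rightarrow> int \<Rightarrow> nat) \<Rightarrow> ('c \<Rightarrow> complex) set set" where
  "Gr_gr c Or M v =
     {U. graded_submodule c Or M U \<and> (\<forall>i n. has_dim (piece_gr c Or M U (i, n)) (v i n))}"

text \<open>A Grassmannian \<open>\<G>\<close> has the quotient topology from the space of frames.  A frame \<open>\<Phi>\<close> of \<open>U\<close> is a
  family of ordered bases \<open>p \<mapsto> (\<lambda>x. \<Phi> (j, p, x))\<close>, \<open>p < v j\<close>, of the pieces \<open>U\<^sub>j\<close> of \<open>U\<close>, extended
  by \<open>0\<close>.\<close>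

definition frames ::
  "(('c \<Rightarrow> complex) set \<Rightarrow> 'j \<Rightarrow> ('c \<Rightarrow> complex) set) \<Rightarrow> ('j \<Rightarrow> nat) \<Rightarrow> ('c \<Rightarrow> complex) set set
     \<Rightarrow> ('j \<times> nat \<times> 'c \<Rightarrow> complex) set" where
  "frames pc v \<G> = {\<Phi>. (\<forall>j p x. v j \<le> p \<longrightarrow> \<Phi> (j, p, x) = 0) \<and>
     (\<exists>U\<in>\<G>. \<forall>j. ordered_basis (v j) (pc U j) (\<lambda>p x. \<Phi> (j, p, x)))}"

definition frame_span :: "('j \<times> nat \<times> 'c \<Rightarrow> complex) \<Rightarrow> ('c \<Rightarrow> complex) set" where
  "frame_span \<Phi> = cfun.span (range (\<lambda>(j, p) x. \<Phi> (j, p, x)))"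

definition Gr_top ::
  "('i \<times> nat \<times> 'c \<Rightarrow> complex) topology \<Rightarrow> ('i::finite \<Rightarrow> 'i \<Rightarrow> int) \<Rightarrow> ('i \<times> 'i) set
     \<Rightarrow> ('i palg set, 'c \<Rightarrow> complex) graded_module \<Rightarrow> ('i \<Rightarrow> nat) \<Rightarrow> ('c \<Rightarrow> complex) set topology" where
  "Gr_top T c Or M v =
     quotient_top (subtopology T (frames (piece c Or M) v (Gr c Or M v))) frame_span"

definition Gr_gr_top ::
  "(('i \<times> int) \<times> nat \<times> 'c \<Rightarrow> complex) topology \<Rightarrow> ('i::finite \<Rightarrow> 'i \<Rightarrow> int) \<Rightarrow> ('i \<times> 'i) set
     \<Rightarrow> ('i palg set, 'c \<Rightarrow> complex) graded_module \<Rightarrow> ('i \<Rightarrow> int \<Rightarrow> nat)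
     \<Rightarrow> ('c \<Rightarrow> complex) set topology" where
  "Gr_gr_top T c Or M v =
     quotient_top (subtopology T (frames (piece_gr c Or M) (\<lambda>(i, n). v i n) (Gr_gr c Or M v)))
       frame_span"

end

theory Submission
  imports Defs
begin

text \<open>An element of \<open>K\<^sub>\<gamma>\<close> is a linear form determined by its values on paths, so \<open>K\<^sub>\<gamma>\<close> becomes a space of
  functions on paths, on which an arrow acts by extending the path. On the nilpotent fibre \<open>a\<^sup>* = 0\<close>:
  the entries of \<open>a w a\<^sup>*\<close>, \<open>w\<close> a path, are invariants, and by stability the rows of all \<open>a w\<close> separate
  the vectors of \<open>V\<close>. If \<open>a\<^sup>* = 0\<close>, the differential of the potential vanishes iff the relations of
  the preprojective algebra and \<open>a \<epsilon> = \<gamma> a\<close> hold. For such a point, sending \<open>u\<close> to the function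
  that maps a path \<open>w\<close> to the last row in each block of \<open>a w u\<close> embeds \<open>V\<close> as a submodule of \<open>K\<^sub>\<gamma>\<close>.
  As \<open>\<gamma>\<close> is regular the point is recovered from this frame, rationally by Cramer's rule; the orbits
  are the fibres of the map from frames to submodules.

  That all these points lie in the nilpotent fibre uses finite type. If the vectors killed by
  all long paths did not exhaust \<open>V\<close>, a minimal subrepresentation above them would have, relative
  to them, dimensions \<open>m\<close> with \<open>\<Sum>\<^sub>j c\<^sub>i\<^sub>j m\<^sub>j \<le> 0\<close> for all \<open>i\<close>, because the mesh and commutation relations give
  a complex \<open>S\<^sub>i \<rightarrow> \<Oplus>\<^sub>j S\<^sub>j\<^sup>f \<rightarrow> S\<^sub>i\<close>, \<open>f = - c\<^sub>i\<^sub>j\<close>, injective on the left and surjective on the right; this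
  contradicts positive definiteness. Rescaling a basis adapted to the resulting filtration moves the
  point to \<open>0\<close> inside its orbit.\<close>

section \<open>The path algebra\<close>

text \<open>The loops \<epsilon> are the obstacle to the dimension count, since the Cartan matrix
  only sees the arrows \<alpha>. Their nilpotency has to come first, and it comes from the framing:
  a \<epsilon> = \<gamma> a kills high powers of \<epsilon> behind a, suitable powers together form
  a central element by the commutation relations, and stability carries the vanishing to all of V.
  After that a Nakayama argument generates S_i, modulo the vectors killed by long paths, by words
  \<epsilon>^k \<alpha>_ij with k < - c_ij, because the commutation relation absorbs the next power;
  this is the origin of the exponent f. Minimality of S supplies surjectivity; injectivity holds
  because a vector which every arrow sends into the lower space already lies in it.

  One argument serves the graded and the ungraded part, because the entries of the differential in
  directions of the wrong degree vanish by themselves. One notion, that of a locally rational map,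
  serves both topologies: the frame map is polynomial, its inverse is rational near each frame, and
  a closed saturated set of stable points inherits the quotient topology.\<close>

lemma psource_append: "psource (i, u @ w) = psource (psource (i, u), w)"
  by (induction u arbitrary: i) auto

lemma is_path_append: "is_path c (i, u @ w) \<longleftrightarrow> is_path c (i, u) \<and> is_path c (psource (i, u), w)"
  by (induction u arbitrary: i) (auto split: arrow.splits)

lemma is_path_replicate_Ep [simp]: "is_path c (i, replicate n (Ep j)) \<longleftrightarrow> n = 0 \<or> i = j"
  by (induction n arbitrary: i) auto

lemma psource_replicate_Ep [simp]: "psource (i, replicate n (Ep j)) = (if n = 0 then i else j)"
  by (induction n arbitrary: i) auto

text \<open>Keeping p among the keys of f makes p a path whenever f lies in \<open>vpalg c\<close>;
  the identities for the anti-automorphism hold only for paths.\<close>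

lemma palg_induct [case_names zero single add]:
  fixes f :: "'i palg"
  assumes "P 0" "\<And>p a. p \<in> Poly_Mapping.keys f \<Longrightarrow> P (Poly_Mapping.single p a)"
    "\<And>f g. P f \<Longrightarrow> P g \<Longrightarrow> P (f + g)"
  shows "P f"
proof -
  have "P (\<Sum>p\<in>A. Poly_Mapping.single p (Poly_Mapping.lookup f p))"
    if "finite A" "A \<subseteq> Poly_Mapping.keys f" for A
    using that by (induction A) (auto intro: assms)
  moreover have "(\<Sum>p\<in>Poly_Mapping.keys f. Poly_Mapping.single p (Poly_Mapping.lookup f p)) = f"
    by (rule poly_mapping_eqI) (auto simp: lookup_sum lookup_single when_def sum.delta in_keys_iff)
  ultimately show ?thesis by (metis finite_keys order_refl)
qed

text \<open>Keys can cancel in a sum, so the supports of f + g and of its summands differ; summing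
  over common finite supersets makes \<open>pmult\<close> visibly biadditive.\<close>

lemma pmult_alt:
  assumes "finite A" "finite B" "Poly_Mapping.keys f \<subseteq> A" "Poly_Mapping.keys g \<subseteq> B"
  shows "pmult f g = (\<Sum>p\<in>A. \<Sum>q\<in>B. if psource p = fst q
     then Poly_Mapping.single (fst p, snd p @ snd q) (Poly_Mapping.lookup f p * Poly_Mapping.lookup g q)
     else 0)"
proof -
  have "pmult f g = (\<Sum>p\<in>Poly_Mapping.keys f. \<Sum>q\<in>B. if psource p = fst q
     then Poly_Mapping.single (fst p, snd p @ snd q) (Poly_Mapping.lookup f p * Poly_Mapping.lookup g q)
     else 0)"
    unfolding pmult_def
    by (intro sum.cong refl sum.mono_neutral_left assms) (auto simp: in_keys_iff)
  also have "\<dots> = (\<Sum>p\<in>A. \<Sum>q\<in>B. if psource p = fst q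
     then Poly_Mapping.single (fst p, snd p @ snd q) (Poly_Mapping.lookup f p * Poly_Mapping.lookup g q)
     else 0)"
    by (intro sum.mono_neutral_left assms ballI sum.neutral) (auto simp: in_keys_iff)
  finally show ?thesis .
qed

lemma pmult_single [simp]:
  "pmult (Poly_Mapping.single p a) (Poly_Mapping.single q b) =
     (if psource p = fst q then Poly_Mapping.single (fst p, snd p @ snd q) (a * b) else 0)"
  by (subst pmult_alt[of "{p}" "{q}"]) auto

lemma pmult_add_left: "pmult (f + g) h = pmult f h + pmult g h"
proof -
  let ?A = "Poly_Mapping.keys f \<union> Poly_Mapping.keys g"
  have "pmult (f + g) h = (\<Sum>p\<in>?A. \<Sum>q\<in>Poly_Mapping.keys h. if psource p = fst q
     then Poly_Mapping.single (fst p, snd p @ snd q)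
       (Poly_Mapping.lookup (f + g) p * Poly_Mapping.lookup h q) else 0)"
    by (rule pmult_alt) (auto dest: Poly_Mapping.keys_add[THEN subsetD])
  also have "\<dots> = pmult f h + pmult g h"
    by (subst (1 2) pmult_alt[of ?A "Poly_Mapping.keys h"])
      (auto simp: sum.distrib[symmetric] lookup_add single_add distrib_right intro!: sum.cong)
  finally show ?thesis .
qed

lemma pmult_add_right: "pmult h (f + g) = pmult h f + pmult h g"
proof -
  let ?A = "Poly_Mapping.keys f \<union> Poly_Mapping.keys g"
  have "pmult h (f + g) = (\<Sum>p\<in>Poly_Mapping.keys h. \<Sum>q\<in>?A. if psource p = fst q
     then Poly_Mapping.single (fst p, snd p @ snd q)
       (Poly_Mapping.lookup h p * Poly_Mapping.lookup (f + g) q) else 0)"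
    by (rule pmult_alt) (auto dest: Poly_Mapping.keys_add[THEN subsetD])
  also have "\<dots> = pmult h f + pmult h g"
    by (subst (1 2) pmult_alt[of "Poly_Mapping.keys h" ?A])
      (auto simp: sum.distrib[symmetric] lookup_add single_add distrib_left intro!: sum.cong)
  finally show ?thesis .
qed

lemma pmult_zero [simp]: "pmult 0 f = 0" "pmult f 0 = 0"
  by (simp_all add: pmult_def)

lemma pmult_sum_left: "pmult (sum F A) h = (\<Sum>x\<in>A. pmult (F x) h)"
  by (induction A rule: infinite_finite_induct) (auto simp: pmult_add_left)

lemma pmult_sum_right: "pmult h (sum F A) = (\<Sum>x\<in>A. pmult h (F x))"
  by (induction A rule: infinite_finite_induct) (auto simp: pmult_add_right)

lemma pmult_assoc: "pmult (pmult f g) h = pmult f (pmult g h)"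
proof (induction f rule: palg_induct)
  case (single p a)
  show ?case
  proof (induction g rule: palg_induct)
    case (single q b)
    show ?case
    proof (induction h rule: palg_induct)
      case (single r d)
      show ?case by (cases p; cases q; cases r) (auto simp: psource_append mult.assoc)
    qed (auto simp: pmult_add_right)
  qed (auto simp: pmult_add_right pmult_add_left)
qed (auto simp: pmult_add_left)

text \<open>The scalars inside the path algebra, through which \<open>pi_scalar\<close> acts;
  \<open>pscalar 1\<close> is the unit because there are finitely many vertices.\<close>

definition pscalar :: "complex \<Rightarrow> 'i::finite palg" where
  "pscalar a = (\<Sum>i\<in>UNIV. Poly_Mapping.single (i, []) a)"

lemma pmult_pscalar_single [simp]:
  "pmult (pscalar a) (Poly_Mapping.single p b) = Poly_Mapping.single p (a * b)"
  "pmult (Poly_Mapping.single p b) (pscalar a) = Poly_Mapping.single p (a * b)"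
  by (simp_all add: pscalar_def pmult_sum_left pmult_sum_right mult.commute)

lemma pmult_one [simp]: "pmult (pscalar 1) f = f" "pmult f (pscalar 1) = f"
  by (induction f rule: palg_induct) (auto simp: pmult_add_right pmult_add_left)

lemma pmult_uminus: "pmult (- f) g = - pmult f g" "pmult f (- g) = - pmult f g"
  using pmult_add_left[of f "- f" g] pmult_add_right[of f g "- g"]
  by (simp_all add: eq_neg_iff_add_eq_0 add.commute)

lemma keys_pmult:
  assumes "x \<in> Poly_Mapping.keys (pmult f g)"
  shows "\<exists>p\<in>Poly_Mapping.keys f. \<exists>q\<in>Poly_Mapping.keys g. psource p = fst q \<and> x = (fst p, snd p @ snd q)"
proof -
  have "Poly_Mapping.keys (pmult f g) \<subseteq> (\<Union>p\<in>Poly_Mapping.keys f. \<Union>q\<in>Poly_Mapping.keys g.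
      {x. psource p = fst q \<and> x = (fst p, snd p @ snd q)})"
    unfolding pmult_def
    by (intro order_trans[OF Poly_Mapping.keys_sum] UN_mono order_refl) (auto split: if_splits)
  then show ?thesis using assms by blast
qed

text \<open>The type \<open>palg\<close> also contains words whose arrows do not compose; only
  combinations of genuine paths form the path algebra.\<close>

definition vpalg :: "('i::finite \<Rightarrow> 'i \<Rightarrow> int) \<Rightarrow> 'i palg set" where
  "vpalg c = {f. \<forall>p\<in>Poly_Mapping.keys f. is_path c p}"

lemma carrier_path_algebra [simp]: "carrier (path_algebra c) = vpalg c"
  by (simp add: path_algebra_def vpalg_def)

lemma vpalg_add [intro]: "f \<in> vpalg c \<Longrightarrow> g \<in> vpalg c \<Longrightarrow> f + g \<in> vpalg c"
  unfolding vpalg_def by (auto dest: Poly_Mapping.keys_add[THEN subsetD])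

lemma vpalg_0 [simp, intro]: "0 \<in> vpalg c"
  by (simp add: vpalg_def)

lemma vpalg_uminus [intro]: "f \<in> vpalg c \<Longrightarrow> - f \<in> vpalg c"
  by (simp add: vpalg_def)

lemma vpalg_diff [intro]: "f \<in> vpalg c \<Longrightarrow> g \<in> vpalg c \<Longrightarrow> f - g \<in> vpalg c"
  using vpalg_add[of f c "- g"] by auto

lemma vpalg_sum: "(\<And>x. x \<in> A \<Longrightarrow> F x \<in> vpalg c) \<Longrightarrow> sum F A \<in> vpalg c"
  by (induction A rule: infinite_finite_induct) auto

lemma vpalg_single [intro]: "is_path c p \<Longrightarrow> Poly_Mapping.single p a \<in> vpalg c"
  by (simp add: vpalg_def)

lemma vpalg_pscalar [simp, intro]: "pscalar a \<in> vpalg c"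
  unfolding pscalar_def by (intro vpalg_sum vpalg_single) simp

lemma vpalg_pmult [intro]:
  assumes "f \<in> vpalg c" "g \<in> vpalg c" shows "pmult f g \<in> vpalg c"
proof -
  have "is_path c x" if x: "x \<in> Poly_Mapping.keys (pmult f g)" for x
  proof -
    obtain p q where pq: "p \<in> Poly_Mapping.keys f" "q \<in> Poly_Mapping.keys g" "psource p = fst q"
      "x = (fst p, snd p @ snd q)" using keys_pmult[OF x] by auto
    then have "is_path c (fst p, snd p)" "is_path c (fst q, snd q)"
      using assms by (auto simp: vpalg_def)
    then show ?thesis using pq by (metis is_path_append prod.collapse)
  qed
  then show ?thesis by (simp add: vpalg_def)
qed

lemma path_algebra_simps [simp]:
  "f \<otimes>\<^bsub>path_algebra c\<^esub> g = pmult f g" "f \<oplus>\<^bsub>path_algebra c\<^esub> g = f + g"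
  "\<zero>\<^bsub>path_algebra c\<^esub> = 0" "\<one>\<^bsub>path_algebra c\<^esub> = pscalar 1"
  by (simp_all add: path_algebra_def pscalar_def)

lemma ring_path_algebra: "ring (path_algebra c)"
proof (rule ringI)
  show "abelian_group (path_algebra c)"
  proof (rule abelian_groupI)
    fix x assume "x \<in> carrier (path_algebra c)"
    then show "\<exists>y\<in>carrier (path_algebra c). y \<oplus>\<^bsub>path_algebra c\<^esub> x = \<zero>\<^bsub>path_algebra c\<^esub>"
      by (intro bexI[of _ "- x"]) auto
  qed (auto simp: add.assoc add.commute)
  show "monoid (path_algebra c)"
    by (rule monoidI) (auto simp: pmult_assoc)
qed (auto simp: pmult_add_left pmult_add_right)

section \<open>The anti-automorphism tau on the path algebra\<close>

lemma palg_tau_alt: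
  assumes "finite A" "Poly_Mapping.keys f \<subseteq> A"
  shows "palg_tau f = (\<Sum>p\<in>A. Poly_Mapping.single (pflip p) (Poly_Mapping.lookup f p))"
  unfolding palg_tau_def by (intro sum.mono_neutral_left assms) (auto simp: in_keys_iff)

lemma palg_tau_single [simp]: "palg_tau (Poly_Mapping.single p a) = Poly_Mapping.single (pflip p) a"
  by (subst palg_tau_alt[of "{p}"]) auto

lemma palg_tau_0 [simp]: "palg_tau 0 = 0"
  by (simp add: palg_tau_def)

lemma palg_tau_add: "palg_tau (f + g) = palg_tau f + palg_tau g"
proof -
  let ?A = "Poly_Mapping.keys f \<union> Poly_Mapping.keys g"
  have "palg_tau (f + g)
      = (\<Sum>p\<in>?A. Poly_Mapping.single (pflip p) (Poly_Mapping.lookup (f + g) p))"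
    by (rule palg_tau_alt) (auto dest: Poly_Mapping.keys_add[THEN subsetD])
  also have "\<dots> = palg_tau f + palg_tau g"
    by (subst (1 2) palg_tau_alt[of ?A])
      (auto simp: sum.distrib[symmetric] lookup_add single_add intro!: sum.cong)
  finally show ?thesis .
qed

lemma palg_tau_uminus: "palg_tau (- f) = - palg_tau f"
  using palg_tau_add[of f "- f"] by (simp add: eq_neg_iff_add_eq_0 add.commute)

lemma palg_tau_diff: "palg_tau (f - g) = palg_tau f - palg_tau g"
  using palg_tau_add[of f "- g"] by (simp add: palg_tau_uminus)

lemma palg_tau_sum: "palg_tau (sum F A) = (\<Sum>x\<in>A. palg_tau (F x))"
  by (induction A rule: infinite_finite_induct) (auto simp: palg_tau_add)

definition flipw :: "'i arrow list \<Rightarrow> 'i arrow list" where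
  "flipw w = rev (map aflip w)"

lemma aflip_aflip [simp]: "aflip (aflip a) = a" by (cases a) auto
lemma asource_aflip [simp]: "asource (aflip a) = atarget a" by (cases a) auto
lemma atarget_aflip [simp]: "atarget (aflip a) = asource a" by (cases a) auto

lemma flipw_simps [simp]: "flipw [] = []" "flipw (a # w) = flipw w @ [aflip a]"
  "flipw (u @ w) = flipw w @ flipw u" "flipw (flipw w) = w" "length (flipw w) = length w"
  "flipw (replicate n (Ep i)) = replicate n (Ep i)"
  by (simp_all add: flipw_def rev_map o_def)

lemma pflip_eq: "pflip (i, w) = (psource (i, w), flipw w)"
  by (simp add: pflip_def flipw_def)

lemma psource_flipw: "is_path c (i, w) \<Longrightarrow> psource (psource (i, w), flipw w) = i"
proof (induction w arbitrary: i)
  case (Cons a w)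
  then have "psource (psource (asource a, w), flipw w) = asource a" "atarget a = i" by auto
  then show ?case by (auto simp: psource_append)
qed auto

lemma is_path_flipw:
  assumes "\<And>i j. c i j < 0 \<Longrightarrow> c j i < 0"
  shows "is_path c (i, w) \<Longrightarrow> is_path c (psource (i, w), flipw w)"
proof (induction w arbitrary: i)
  case (Cons a w)
  then have "is_path c (psource (asource a, w), flipw w)" "is_path c (asource a, w)" "atarget a = i"
    by auto
  with Cons.prems show ?case
    by (auto simp: is_path_append psource_flipw assms split: arrow.splits)
qed auto

text \<open>Composability of p and q is equivalent to composability of their flips only for genuine
  paths, where flipping exchanges the two end points (\<open>psource_flipw\<close>).\<close>

lemma palg_tau_pmult:
  assumes "f \<in> vpalg c" "g \<in> vpalg c"
  shows "palg_tau (pmult f g) = pmult (palg_tau g) (palg_tau f)"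

proof (induction f rule: palg_induct)
  case (single p a)
  show ?case
  proof (induction g rule: palg_induct)
    case (single q b)
    have p: "is_path c (fst p, snd p)" and q: "is_path c (fst q, snd q)"
      using \<open>p \<in> _\<close> \<open>q \<in> _\<close> assms by (auto simp: vpalg_def)
    show ?case
      using psource_flipw[OF p] psource_flipw[OF q]
      by (cases p; cases q) (auto simp: pflip_eq psource_append mult.commute)
  qed (auto simp: pmult_add_right pmult_add_left palg_tau_add)
qed (auto simp: pmult_add_right pmult_add_left palg_tau_add)

lemma palg_tau_tau:
  assumes "f \<in> vpalg c" shows "palg_tau (palg_tau f) = f"
proof (induction f rule: palg_induct)
  case (single p a)
  then have "is_path c p" using assms by (auto simp: vpalg_def)
  then show ?case using psource_flipw[of c "fst p" "snd p"] by (cases p) (auto simp: pflip_eq)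
qed (auto simp: palg_tau_add)

lemma palg_tau_vpalg:
  assumes "\<And>i j. c i j < 0 \<Longrightarrow> c j i < 0" "f \<in> vpalg c"
  shows "palg_tau f \<in> vpalg c"
  unfolding palg_tau_def
proof (intro vpalg_sum vpalg_single)
  fix p assume "p \<in> Poly_Mapping.keys f"
  then have "is_path c p" using assms by (auto simp: vpalg_def)
  then show "is_path c (pflip p)" 
    by (cases p) (auto simp: pflip_eq intro: is_path_flipw assms(1))
qed

section \<open>Linear forms given by their values on words\<close>

definition plin :: "('i qpath \<Rightarrow> complex) \<Rightarrow> 'i palg \<Rightarrow> complex" where
  "plin L f = (\<Sum>p\<in>Poly_Mapping.keys f. Poly_Mapping.lookup f p * L p)"

lemma plin_alt:
  assumes "finite A" "Poly_Mapping.keys f \<subseteq> A"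
  shows "plin L f = (\<Sum>p\<in>A. Poly_Mapping.lookup f p * L p)"
  unfolding plin_def by (intro sum.mono_neutral_left assms) (auto simp: in_keys_iff)

lemma plin_single [simp]: "plin L (Poly_Mapping.single p a) = a * L p"
  by (subst plin_alt[of "{p}"]) auto

lemma plin_0 [simp]: "plin L 0 = 0"
  by (simp add: plin_def)

lemma plin_add: "plin L (f + g) = plin L f + plin L g"
proof -
  let ?A = "Poly_Mapping.keys f \<union> Poly_Mapping.keys g"
  have "plin L (f + g) = (\<Sum>p\<in>?A. Poly_Mapping.lookup (f + g) p * L p)"
    by (rule plin_alt) (auto dest: Poly_Mapping.keys_add[THEN subsetD])
  also have "\<dots> = plin L f + plin L g"
    by (subst (1 2) plin_alt[of ?A])
      (auto simp: sum.distrib[symmetric] lookup_add distrib_right intro!: sum.cong)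
  finally show ?thesis .
qed

lemma plin_uminus: "plin L (- f) = - plin L f"
  using plin_add[of L f "- f"] by (simp add: eq_neg_iff_add_eq_0 add.commute)

lemma plin_diff: "plin L (f - g) = plin L f - plin L g"
  using plin_add[of L f "- g"] by (simp add: plin_uminus)

lemma plin_sum: "plin L (sum F A) = (\<Sum>x\<in>A. plin L (F x))"
  by (induction A rule: infinite_finite_induct) (auto simp: plin_add)

lemma plin_pscalar: "plin L (pmult (pscalar a) f) = a * plin L f"
  by (induction f rule: palg_induct) (auto simp: pmult_add_right plin_add distrib_left)

section \<open>The preprojective algebra and its modules\<close>

locale preproj =
  fixes c :: "'i::finite \<Rightarrow> 'i \<Rightarrow> int" and d :: "'i \<Rightarrow> int" and Or :: "('i \<times> 'i) set"
  assumes c_sym: "\<And>i j. c i j < 0 \<Longrightarrow> c j i < 0"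
begin

abbreviation "II \<equiv> pi_ideal c Or"
abbreviation "PP \<equiv> Pi_alg c Or"
abbreviation "cls \<equiv> pi_class c Or"

definition ee :: "'i \<Rightarrow> 'i palg" where "ee i = Poly_Mapping.single (i, []) 1"
definition eps :: "'i \<Rightarrow> nat \<Rightarrow> 'i palg" where
  "eps i l = Poly_Mapping.single (i, replicate l (Ep i)) 1"

lemma ee_vpalg [simp, intro]: "ee i \<in> vpalg c" by (simp add: ee_def vpalg_single)
lemma eps_vpalg [simp, intro]: "eps i l \<in> vpalg c" by (simp add: eps_def vpalg_single)

lemma ee_ee [simp]: "pmult (ee i) (ee i) = ee i" by (simp add: ee_def)
lemma eps_ee [simp]: "pmult (eps i l) (ee i) = eps i l" by (simp add: ee_def eps_def)

lemma relations_subset: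
  "{commutation_rel c i j | i j. c i j < 0} \<union> range (mesh_rel c Or) \<subseteq> vpalg c"
proof -
  have "commutation_rel c i j \<in> vpalg c" if "c i j < 0" for i j
    unfolding commutation_rel_def using that
    by (intro vpalg_diff vpalg_single) (auto simp: is_path_append)
  moreover have "mesh_rel c Or i \<in> vpalg c" for i
    unfolding mesh_rel_def
    by (intro vpalg_sum vpalg_single) (auto simp: is_path_append intro: c_sym)
  ultimately show ?thesis by auto
qed

lemma ideal_II: "ideal II (path_algebra c)"
  unfolding pi_ideal_def using relations_subset
  by (intro ring.genideal_ideal[OF ring_path_algebra]) simp

lemma II_induct:
  assumes "ideal J (path_algebra c)"
    "\<And>i j. c i j < 0 \<Longrightarrow> commutation_rel c i j \<in> J" "\<And>i. mesh_rel c Or i \<in> J"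
  shows "II \<subseteq> J"
  unfolding pi_ideal_def using assms(2,3)
  by (intro ring.genideal_minimal[OF ring_path_algebra assms(1)]) auto

lemma rel_in_II:
  "c i j < 0 \<Longrightarrow> commutation_rel c i j \<in> II" "mesh_rel c Or i \<in> II"
proof -
  have "{commutation_rel c i j | i j. c i j < 0} \<union> range (mesh_rel c Or) \<subseteq> II"
    unfolding pi_ideal_def using relations_subset
    by (intro ring.genideal_self[OF ring_path_algebra]) simp
  then show "c i j < 0 \<Longrightarrow> commutation_rel c i j \<in> II" "mesh_rel c Or i \<in> II" by auto
qed

lemma II_closed [intro]:
  "f \<in> II \<Longrightarrow> f \<in> vpalg c" "0 \<in> II" "f \<in> II \<Longrightarrow> g \<in> II \<Longrightarrow> f + g \<in> II" "f \<in> II \<Longrightarrow> - f \<in> II"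
  "f \<in> II \<Longrightarrow> g \<in> vpalg c \<Longrightarrow> pmult f g \<in> II" "f \<in> II \<Longrightarrow> g \<in> vpalg c \<Longrightarrow> pmult g f \<in> II"
proof -
  interpret ideal II "path_algebra c" by (rule ideal_II)
  show 1: "f \<in> II \<Longrightarrow> f \<in> vpalg c" for f using a_subset by auto
  show "0 \<in> II" using additive_subgroup.zero_closed[OF is_additive_subgroup] by simp
  show "f \<in> II \<Longrightarrow> g \<in> II \<Longrightarrow> f + g \<in> II"
    using additive_subgroup.a_closed[OF is_additive_subgroup, of f g] by simp
  show "f \<in> II \<Longrightarrow> g \<in> vpalg c \<Longrightarrow> pmult f g \<in> II" using I_r_closed[of f g] by simp
  show 2: "f \<in> II \<Longrightarrow> g \<in> vpalg c \<Longrightarrow> pmult g f \<in> II" for f g using I_l_closed[of f g] by simp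
  show "- f \<in> II" if "f \<in> II"
  proof -
    have "- pscalar 1 \<in> vpalg c" by auto
    from 2[OF that this] show ?thesis by (simp add: pmult_uminus)
  qed
qed

lemma II_diff [intro]: "f \<in> II \<Longrightarrow> g \<in> II \<Longrightarrow> f - g \<in> II"
  using II_closed(3)[of f "- g"] by auto

lemma cls_eq: "cls f = (\<lambda>h. h + f) ` II"
  by (auto simp: pi_class_def a_r_coset_def')

lemma cls_cong_iff: "cls f = cls g \<longleftrightarrow> f - g \<in> II"
proof
  assume "cls f = cls g"
  then have "f \<in> cls g" using II_closed(2) unfolding cls_eq by force
  then show "f - g \<in> II" unfolding cls_eq by auto
next
  assume fg: "f - g \<in> II"
  show "cls f = cls g"
  proof
    show "cls f \<subseteq> cls g"
    proof
      fix x assume "x \<in> cls f"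
      then obtain h where h: "h \<in> II" "x = h + f" by (auto simp: cls_eq)
      then have "x = (h + (f - g)) + g" "h + (f - g) \<in> II" using fg by auto
      then show "x \<in> cls g" unfolding cls_eq by blast
    qed
    show "cls g \<subseteq> cls f"
    proof
      fix x assume "x \<in> cls g"
      then obtain h where h: "h \<in> II" "x = h + g" by (auto simp: cls_eq)
      then have "x = (h - (f - g)) + f" "h - (f - g) \<in> II" using fg by auto
      then show "x \<in> cls f" unfolding cls_eq by blast
    qed
  qed
qed

lemma ring_PP: "ring PP"
  unfolding Pi_alg_def by (rule ideal.quotient_is_ring[OF ideal_II])

lemma carrier_PP: "carrier PP = cls ` vpalg c"
  by (auto simp: Pi_alg_def FactRing_def A_RCOSETS_def' pi_class_def)

lemma cls_mult [simp]:
  "f \<in> vpalg c \<Longrightarrow> g \<in> vpalg c \<Longrightarrow> cls f \<otimes>\<^bsub>PP\<^esub> cls g = cls (pmult f g)"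
  using ideal.rcoset_mult_add[OF ideal_II, of f g]
  by (simp add: Pi_alg_def FactRing_def pi_class_def)

lemma cls_add [simp]:
  "f \<in> vpalg c \<Longrightarrow> g \<in> vpalg c \<Longrightarrow> cls f \<oplus>\<^bsub>PP\<^esub> cls g = cls (f + g)"
  using ideal.a_rcos_sum[OF ideal_II, of f g]
  by (simp add: Pi_alg_def FactRing_def pi_class_def)

lemma cls_one: "\<one>\<^bsub>PP\<^esub> = cls (pscalar 1)"
  by (simp add: Pi_alg_def FactRing_def pi_class_def)

lemma pi_e_eq: "pi_e c Or i = cls (ee i)"
  by (simp add: pi_e_def ee_def)

text \<open>The exponent must be positive: the zeroth power is the unit of the algebra, whereas
  \<open>eps i 0\<close> is only the idempotent at i.\<close>

lemma pi_eps_pow: "0 < l \<Longrightarrow> pi_eps c Or i [^]\<^bsub>PP\<^esub> l = cls (eps i l)"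
proof (induction l)
  case (Suc l)
  interpret ring PP by (rule ring_PP)
  have e: "pi_eps c Or i = cls (eps i 1)" by (simp add: pi_eps_def eps_def)
  show ?case
  proof (cases "l = 0")
    case True
    then show ?thesis by (simp add: e cls_one)
  next
    case False
    have "replicate l (Ep i) @ [Ep i] = Ep i # replicate l (Ep i)"
      by (metis replicate_Suc replicate_append_same)
    then show ?thesis using Suc False by (simp add: e, simp add: eps_def)
  qed
qed simp

lemma pi_scalar_eq: "pi_scalar c Or a = cls (pscalar a)"
  by (simp add: pi_scalar_def pscalar_def)

text \<open>The elements whose image under \<open>palg_tau\<close> lies in the ideal form an ideal
  themselves, so generators suffice. The commutation relation of (i, j) goes to minus that of (j,
  i). The mesh relation goes to itself once k is replaced by f - 1 - k; the product \<alpha>_ij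
  \<alpha>_ji is fixed, because each factor is flipped and their order is reversed.\<close>

lemma tau_II: "f \<in> II \<Longrightarrow> palg_tau f \<in> II"
proof -
  let ?J = "{f \<in> vpalg c. palg_tau f \<in> II}"
  have "ideal ?J (path_algebra c)"
  proof (rule idealI[OF ring_path_algebra])
    interpret ring "path_algebra c" by (rule ring_path_algebra)
    have "0 \<in> ?J" by auto
    then have ne: "?J \<noteq> {}" by blast
    show "subgroup ?J (add_monoid (path_algebra c))"
    proof (rule group.subgroupI[OF a_group])
      fix f assume f: "f \<in> ?J"
      have "inv\<^bsub>add_monoid (path_algebra c)\<^esub> f = - f"
        using f minus_equality[of "- f" f] by (auto simp: a_inv_def)
      then show "inv\<^bsub>add_monoid (path_algebra c)\<^esub> f \<in> ?J" using f by (auto simp: palg_tau_uminus)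
    qed (use ne in \<open>auto simp: palg_tau_add\<close>)
  qed (auto simp: palg_tau_pmult II_closed(5)[OF _ palg_tau_vpalg[OF c_sym]]
      II_closed(6)[OF _ palg_tau_vpalg[OF c_sym]])
  moreover have "commutation_rel c i j \<in> ?J" if "c i j < 0" for i j
  proof -
    have "palg_tau (commutation_rel c i j) = - commutation_rel c j i"
      by (simp add: commutation_rel_def palg_tau_diff pflip_eq psource_append)
    then show ?thesis using rel_in_II(1)[of j i] rel_in_II(1)[of i j] that
      by (auto intro: c_sym)
  qed
  moreover have "mesh_rel c Or i \<in> ?J" for i
  proof -
    have "palg_tau (mesh_rel c Or i) = (\<Sum>j\<in>UNIV. \<Sum>k<nat (- c i j).
      Poly_Mapping.single
       (i, replicate (nat (- c i j) - 1 - k) (Ep i) @ [Al i j, Al j i] @ replicate k (Ep i))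
       (osign Or i j))"
      by (simp add: mesh_rel_def palg_tau_sum pflip_eq psource_append)
    also have "\<dots> = mesh_rel c Or i"
      unfolding mesh_rel_def
    proof (rule sum.cong[OF refl])
      fix j
      show "(\<Sum>k<nat (- c i j). Poly_Mapping.single
         (i, replicate (nat (- c i j) - 1 - k) (Ep i) @ [Al i j, Al j i] @ replicate k (Ep i))
         (osign Or i j)) = (\<Sum>k<nat (- c i j). Poly_Mapping.single
         (i, replicate k (Ep i) @ [Al i j, Al j i] @ replicate (nat (- c i j) - 1 - k) (Ep i))
         (osign Or i j))"
        by (rule sum.reindex_bij_witness[of _ "\<lambda>k. nat (- c i j) - 1 - k" "\<lambda>k. nat (- c i j) - 1 - k"])
          auto
    qed
    finally show ?thesis using rel_in_II(2)[of i] by auto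
  qed
  ultimately have "II \<subseteq> ?J" by (rule II_induct)
  then show "f \<in> II \<Longrightarrow> palg_tau f \<in> II" by auto
qed

lemma pi_tau_cls:
  assumes "f \<in> vpalg c" shows "pi_tau (cls f) = cls (palg_tau f)"
proof
  show "pi_tau (cls f) \<subseteq> cls (palg_tau f)"
    by (auto simp: pi_tau_def cls_eq palg_tau_add tau_II)
  show "cls (palg_tau f) \<subseteq> pi_tau (cls f)"
  proof
    fix x assume "x \<in> cls (palg_tau f)"
    then obtain h where h: "h \<in> II" "x = h + palg_tau f" by (auto simp: cls_eq)
    then have "x = palg_tau (palg_tau h + f)"
      by (simp add: palg_tau_add palg_tau_tau[of h c] II_closed(1))
    moreover have "palg_tau h + f \<in> cls f" using h tau_II by (auto simp: cls_eq)
    ultimately show "x \<in> pi_tau (cls f)" by (auto simp: pi_tau_def)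
  qed
qed

text \<open>Every element of the quotient module is the class of some g e_i, so this map
  parametrizes it by the whole path algebra and lets linear forms be evaluated on paths.\<close>

definition qcl :: "'i \<Rightarrow> nat \<Rightarrow> 'i palg \<Rightarrow> 'i palg set set" where
  "qcl i l g = a_r_coset PP (eps_submodule c Or i l) (cls (pmult g (ee i)))"

lemma eps_submodule_eq: "0 < l \<Longrightarrow> eps_submodule c Or i l = (\<lambda>q. cls (pmult q (eps i l))) ` vpalg c"
  by (auto simp: eps_submodule_def pi_eps_pow carrier_PP image_image)

lemma proj_module_eq: "proj_module c Or i = (\<lambda>g. cls (pmult g (ee i))) ` vpalg c"
  by (auto simp: proj_module_def carrier_PP pi_e_eq image_image)

lemma qcl_eq:
  assumes "0 < l" "g \<in> vpalg c"
  shows "qcl i l g = (\<lambda>q. cls (pmult q (eps i l) + pmult g (ee i))) ` vpalg c"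
  unfolding qcl_def a_r_coset_def' eps_submodule_eq[OF assms(1)] using assms(2)
  by (auto simp: vpalg_pmult)

text \<open>For positive l, the kernel of \<open>qcl i l\<close> on \<open>vpalg c\<close>; see
  \<open>qcl_cong_iff\<close>.\<close>

definition qnull :: "'i \<Rightarrow> nat \<Rightarrow> 'i palg set" where
  "qnull i l = {g. \<exists>q\<in>vpalg c. pmult g (ee i) - pmult q (eps i l) \<in> II}"

lemma qcl_cong_iff:
  assumes l: "0 < l" and f: "f \<in> vpalg c" and g: "g \<in> vpalg c"
  shows "qcl i l f = qcl i l g \<longleftrightarrow> f - g \<in> qnull i l"
proof
  assume eq: "qcl i l f = qcl i l g"
  have "cls (pmult 0 (eps i l) + pmult f (ee i)) \<in> qcl i l f"
    unfolding qcl_eq[OF l f] by (rule imageI) simp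
  then obtain q where q: "q \<in> vpalg c" "cls (pmult f (ee i)) = cls (pmult q (eps i l) + pmult g (ee i))"
    unfolding eq qcl_eq[OF l g] by auto
  then have "pmult f (ee i) - (pmult q (eps i l) + pmult g (ee i)) \<in> II" by (simp add: cls_cong_iff)
  also have "pmult f (ee i) - (pmult q (eps i l) + pmult g (ee i))
      = pmult (f - g) (ee i) - pmult q (eps i l)"
    using pmult_add_left[of "f - g" g "ee i"] by simp
  finally show "f - g \<in> qnull i l" using q by (auto simp: qnull_def)
next
  have sub: "qcl i l f \<subseteq> qcl i l g"
    if f: "f \<in> vpalg c" and g: "g \<in> vpalg c" and fg: "f - g \<in> qnull i l" for f g
  proof
    fix x assume "x \<in> qcl i l f"
    then obtain q' where q': "q' \<in> vpalg c" "x = cls (pmult q' (eps i l) + pmult f (ee i))"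
      by (auto simp: qcl_eq[OF l f])
    obtain q where q: "q \<in> vpalg c" "pmult (f - g) (ee i) - pmult q (eps i l) \<in> II"
      using fg by (auto simp: qnull_def)
    have "x = cls (pmult (q' + q) (eps i l) + pmult g (ee i))"
      unfolding q'(2) cls_cong_iff using q(2) pmult_add_left[of "f - g" g "ee i"]
      by (simp add: pmult_add_left algebra_simps)
    then show "x \<in> qcl i l g" unfolding qcl_eq[OF l g] using q q' by blast
  qed
  assume fg: "f - g \<in> qnull i l"
  then obtain q where q: "q \<in> vpalg c" "pmult (f - g) (ee i) - pmult q (eps i l) \<in> II"
    by (auto simp: qnull_def)
  have "pmult (g - f) (ee i) - pmult (- q) (eps i l) \<in> II"
    using II_closed(4)[OF q(2)] pmult_uminus(1)[of "f - g" "ee i"] pmult_uminus(1)[of q "eps i l"]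
    by (simp add: algebra_simps)
  then have "g - f \<in> qnull i l" using q unfolding qnull_def by blast
  then show "qcl i l f = qcl i l g" using sub f g fg by blast
qed

abbreviation "QM \<equiv> Q_module c d Or"

lemma Q_carrier: "mcarrier (QM i l) = qcl i l ` vpalg c"
  by (auto simp: Q_module_def Let_def proj_module_eq qcl_def image_image)

lemma Q_add:
  assumes l: "0 < l" and f: "f \<in> vpalg c" and g: "g \<in> vpalg c"
  shows "madd (QM i l) (qcl i l f) (qcl i l g) = qcl i l (f + g)"
proof -
  have fg: "f + g \<in> vpalg c" using f g by auto
  have *: "cls (pmult q (eps i l) + pmult f (ee i)) \<oplus>\<^bsub>PP\<^esub> cls (pmult q' (eps i l) + pmult g (ee i))
     = cls (pmult (q + q') (eps i l) + pmult (f + g) (ee i))" if "q \<in> vpalg c" "q' \<in> vpalg c" for q q'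
    using that f g by (subst cls_add) (auto simp: pmult_add_left ac_simps)
  have "madd (QM i l) (qcl i l f) (qcl i l g)
    = {a \<oplus>\<^bsub>PP\<^esub> b | a b. a \<in> qcl i l f \<and> b \<in> qcl i l g}"
    by (auto simp: Q_module_def Let_def set_add_def')
  also have "\<dots> = qcl i l (f + g)"
    unfolding qcl_eq[OF l f] qcl_eq[OF l g] qcl_eq[OF l fg]
  proof (intro equalityI subsetI, goal_cases)
    case (1 x)
    then show ?case by (auto simp: *)
  next
    case (2 x)
    then obtain q where q: "q \<in> vpalg c" "x = cls (pmult q (eps i l) + pmult (f + g) (ee i))" by auto
    then have "x = cls (pmult q (eps i l) + pmult f (ee i)) \<oplus>\<^bsub>PP\<^esub> cls (pmult 0 (eps i l) + pmult g (ee i))"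
      by (subst *) auto
    then show ?case using q(1) vpalg_0 by blast
  qed
  finally show ?thesis .
qed

text \<open>The action is defined as a union over a coset. Changing the representative changes the
  product by an element of the submodule, so all members of the union coincide.\<close>

lemma Q_act:
  assumes l: "0 < l" and f: "f \<in> vpalg c" and g: "g \<in> vpalg c"
  shows "mact (QM i l) (cls f) (qcl i l g) = qcl i l (pmult f g)"
proof -
  have *: "a_r_coset PP (eps_submodule c Or i l) (cls f \<otimes>\<^bsub>PP\<^esub> x) = qcl i l (pmult f g)"
    if x: "x \<in> qcl i l g" for x
  proof -
    obtain q where q: "q \<in> vpalg c" "x = cls (pmult q (eps i l) + pmult g (ee i))"
      using x by (auto simp: qcl_eq[OF l g])
    let ?h = "pmult f (pmult q (eps i l) + g)"
    have h: "?h \<in> vpalg c" using f g q by auto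
    have "cls f \<otimes>\<^bsub>PP\<^esub> x = cls (pmult ?h (ee i))"
      using f g q by (simp add: vpalg_add vpalg_pmult pmult_assoc pmult_add_right pmult_add_left)
    then have "a_r_coset PP (eps_submodule c Or i l) (cls f \<otimes>\<^bsub>PP\<^esub> x) = qcl i l ?h"
      by (simp add: qcl_def)
    also have "\<dots> = qcl i l (pmult f g)"
    proof -
      have "pmult (?h - pmult f g) (ee i) = pmult (pmult f q) (eps i l)"
        by (simp add: pmult_add_right pmult_add_left pmult_assoc)
      then have "?h - pmult f g \<in> qnull i l"
        unfolding qnull_def using f q II_closed(2) by (auto intro!: bexI[of _ "pmult f q"])
      then show ?thesis using qcl_cong_iff[OF l h] f g by auto
    qed
    finally show ?thesis .
  qed
  moreover have "qcl i l g \<noteq> {}" unfolding qcl_eq[OF l g] using vpalg_0 by blast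
  ultimately show ?thesis by (auto simp: Q_module_def Let_def)
qed

text \<open>A homogeneous f that represents an element of \<open>proj_module\<close> may be replaced
  by f e_i modulo the ideal. Conversely, right multiplication by e_i only drops keys, so it keeps
  degrees.\<close>

lemma Q_degree:
  assumes l: "0 < l"
  shows "mdegree (QM i l) n = qcl i l ` {f \<in> vpalg c. \<forall>p\<in>Poly_Mapping.keys f. pdeg c d p = n}"
    (is "_ = _ ` ?F")
proof -
  have 0: "mdegree (QM i l) n = a_r_coset PP (eps_submodule c Or i l) ` (proj_module c Or i \<inter> cls ` ?F)"
    by (simp add: Q_module_def Let_def pi_degree_def)
  have *: "a_r_coset PP (eps_submodule c Or i l) x = qcl i l f"
    if x: "x \<in> proj_module c Or i" "x = cls f" "f \<in> ?F" for x f
  proof -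
    obtain g where g: "g \<in> vpalg c" "x = cls (pmult g (ee i))" using x by (auto simp: proj_module_eq)
    then have "f - pmult g (ee i) \<in> II" using x cls_cong_iff by auto
    then have "pmult (f - pmult g (ee i)) (ee i) \<in> II" by auto
    also have "pmult (f - pmult g (ee i)) (ee i) = pmult f (ee i) - pmult g (ee i)"
      using pmult_add_left[of f "- pmult g (ee i)" "ee i"]
      by (simp add: pmult_uminus pmult_assoc)
    finally have "cls (pmult f (ee i)) = x" using g cls_cong_iff by auto
    then show ?thesis by (simp add: qcl_def)
  qed
  have "qcl i l f \<in> a_r_coset PP (eps_submodule c Or i l) ` (proj_module c Or i \<inter> cls ` ?F)"
    if f: "f \<in> ?F" for f
  proof -
    have "pdeg c d x = n" if x: "x \<in> Poly_Mapping.keys (pmult f (ee i))" for x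
      using keys_pmult[OF x] f by (auto simp: ee_def pdeg_def)
    then have "pmult f (ee i) \<in> ?F" using f by auto
    then show ?thesis unfolding qcl_def using f by (intro imageI) (auto simp: proj_module_eq)
  qed
  then show ?thesis unfolding 0 using * by force
qed

end

section \<open>Elements of the dual modules as functions on paths\<close>

locale preproj_dual = preproj c d Or for c :: "'i::finite \<Rightarrow> 'i \<Rightarrow> int" and d Or +
  fixes s :: nat and ii :: "nat \<Rightarrow> 'i" and kk :: "nat \<Rightarrow> int" and ll :: "nat \<Rightarrow> nat"
  assumes ll_pos: "\<And>r. r \<in> {1..s} \<Longrightarrow> 0 < ll r"
begin

abbreviation "RS \<equiv> {1..s}"
abbreviation "KG \<equiv> K_gamma c d Or s ii kk ll"
abbreviation "qc r \<equiv> qcl (ii r) (ll r)"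

lemma mcarrier_KG:
  "\<phi> \<in> mcarrier KG \<longleftrightarrow> (\<forall>r x. r \<notin> RS \<longrightarrow> \<phi> (r, x) = 0) \<and>
     (\<forall>r\<in>RS. (\<forall>x. x \<notin> qc r ` vpalg c \<longrightarrow> \<phi> (r, x) = 0) \<and>
       (\<forall>f\<in>vpalg c. \<forall>g\<in>vpalg c. \<phi> (r, qc r (f + g)) = \<phi> (r, qc r f) + \<phi> (r, qc r g)) \<and>
       (\<forall>a. \<forall>f\<in>vpalg c. \<phi> (r, qc r (pmult (pscalar a) f)) = a * \<phi> (r, qc r f)) \<and>
       finite {n. \<exists>f\<in>vpalg c. (\<forall>p\<in>Poly_Mapping.keys f. pdeg c d p = n) \<and> \<phi> (r, qc r f) \<noteq> 0})"
proof -
  have "(\<lambda>x. \<phi> (r, x)) \<in> mcarrier (K_module c d Or (ii r) (kk r) (ll r)) \<longleftrightarrow>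
     (\<forall>x. x \<notin> qc r ` vpalg c \<longrightarrow> \<phi> (r, x) = 0) \<and>
       (\<forall>f\<in>vpalg c. \<forall>g\<in>vpalg c. \<phi> (r, qc r (f + g)) = \<phi> (r, qc r f) + \<phi> (r, qc r g)) \<and>
       (\<forall>a. \<forall>f\<in>vpalg c. \<phi> (r, qc r (pmult (pscalar a) f)) = a * \<phi> (r, qc r f)) \<and>
       finite {n. \<exists>f\<in>vpalg c. (\<forall>p\<in>Poly_Mapping.keys f. pdeg c d p = n) \<and> \<phi> (r, qc r f) \<noteq> 0}"
    if "r \<in> RS" for r
  proof -
    have eq: "{n. \<exists>x\<in>mdegree (QM (ii r) (ll r)) n. \<phi> (r, x) \<noteq> 0}
      = {n. \<exists>f\<in>vpalg c. (\<forall>p\<in>Poly_Mapping.keys f. pdeg c d p = n) \<and> \<phi> (r, qc r f) \<noteq> 0}"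
      by (auto simp: Q_degree[OF ll_pos[OF that]])
    show ?thesis
      by (simp add: K_module_def shift_module_def dual_module_def Let_def Q_carrier
        pi_scalar_eq eq Q_add[OF ll_pos[OF that]] Q_act[OF ll_pos[OF that]] cong: conj_cong)
  qed
  then show ?thesis by (auto simp: K_gamma_def dsum_module_def)
qed

lemma madd_KG: "madd KG = (+)"
  by (simp add: K_gamma_def dsum_module_def)

lemma mact_KG:
  "mact KG p \<phi> (r, x) = (if r \<in> RS \<and> x \<in> qc r ` vpalg c
     then \<phi> (r, mact (QM (ii r) (ll r)) (pi_tau p) x) else 0)"
  by (simp add: K_gamma_def dsum_module_def K_module_def shift_module_def dual_module_def Let_def Q_carrier)

lemma mact_KG_qc:
  assumes "r \<in> RS" "f \<in> vpalg c" "g \<in> vpalg c"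
  shows "mact KG (cls f) \<phi> (r, qc r g) = \<phi> (r, qc r (pmult (palg_tau f) g))"
  using assms by (simp add: mact_KG pi_tau_cls Q_act ll_pos palg_tau_vpalg[OF c_sym])

text \<open>The dual reverses degrees and the shift is by - k - l d, so a form of degree n lives on
  the part of degree - (n - k - l d) = k + l d - n.\<close>

lemma mdegree_KG:
  "\<phi> \<in> mdegree KG n \<longleftrightarrow> \<phi> \<in> mcarrier KG \<and> (\<forall>r\<in>RS. \<forall>f\<in>vpalg c. \<forall>m.
     (\<forall>p\<in>Poly_Mapping.keys f. pdeg c d p = m) \<and> \<phi> (r, qc r f) \<noteq> 0 \<longrightarrow> m = kk r + int (ll r) * d (ii r) - n)"
proof -
  have "(\<lambda>x. \<phi> (r, x)) \<in> mdegree (K_module c d Or (ii r) (kk r) (ll r)) n \<longleftrightarrow>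
     (\<lambda>x. \<phi> (r, x)) \<in> mcarrier (K_module c d Or (ii r) (kk r) (ll r)) \<and> (\<forall>f\<in>vpalg c. \<forall>m.
     (\<forall>p\<in>Poly_Mapping.keys f. pdeg c d p = m) \<and> \<phi> (r, qc r f) \<noteq> 0 \<longrightarrow> m = kk r + int (ll r) * d (ii r) - n)"
    if "r \<in> RS" for r
  proof -
    define D where "D = kk r + int (ll r) * d (ii r) - n"
    have D: "- (- kk r - int (ll r) * d (ii r) + n) = D" by (simp add: D_def)
    have D': "int (ll r) * d (ii r) + kk r - n = D" by (simp add: D_def)
    have "mdegree (K_module c d Or (ii r) (kk r) (ll r)) n = {\<psi> \<in> mcarrier (K_module c d Or (ii r) (kk r) (ll r)).
      \<forall>m. m \<noteq> D \<longrightarrow> (\<forall>x\<in>mdegree (QM (ii r) (ll r)) m. \<psi> x = 0)}"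
      by (simp add: K_module_def shift_module_def dual_module_def Let_def D D')
    then have 1: "(\<lambda>x. \<phi> (r, x)) \<in> mdegree (K_module c d Or (ii r) (kk r) (ll r)) n \<longleftrightarrow>
      (\<lambda>x. \<phi> (r, x)) \<in> mcarrier (K_module c d Or (ii r) (kk r) (ll r)) \<and>
      (\<forall>m. m \<noteq> D \<longrightarrow> (\<forall>x\<in>mdegree (QM (ii r) (ll r)) m. \<phi> (r, x) = 0))"
      by (simp only: mem_Collect_eq)
    have 2: "(\<forall>m. m \<noteq> D \<longrightarrow> (\<forall>x\<in>mdegree (QM (ii r) (ll r)) m. \<phi> (r, x) = 0)) \<longleftrightarrow>
      (\<forall>f\<in>vpalg c. \<forall>m. (\<forall>p\<in>Poly_Mapping.keys f. pdeg c d p = m) \<and> \<phi> (r, qc r f) \<noteq> 0 \<longrightarrow> m = D)"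
      unfolding Q_degree[OF ll_pos[OF that]] ball_simps by blast
    show ?thesis by (simp only: 1 2 D_def[symmetric])
  qed
  then show ?thesis by (auto simp: K_gamma_def dsum_module_def)
qed

text \<open>Setting the values off the paths to 0 makes the image a linear space of functions on all
  words, on which the module structure becomes a shift of the argument.\<close>

definition hat :: "(nat \<times> 'i palg set set \<Rightarrow> complex) \<Rightarrow> nat \<times> 'i qpath \<Rightarrow> complex" where
  "hat \<phi> = (\<lambda>(r, p). if r \<in> RS \<and> is_path c p then \<phi> (r, qc r (Poly_Mapping.single p 1)) else 0)"

lemma hat_plin:
  assumes "\<phi> \<in> mcarrier KG" "r \<in> RS" "f \<in> vpalg c"
  shows "\<phi> (r, qc r f) = plin (\<lambda>p. hat \<phi> (r, p)) f"
proof -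
  have add: "\<phi> (r, qc r (f + g)) = \<phi> (r, qc r f) + \<phi> (r, qc r g)" if "f \<in> vpalg c" "g \<in> vpalg c" for f g
    using assms that by (auto simp: mcarrier_KG)
  have sc: "\<phi> (r, qc r (pmult (pscalar a) f)) = a * \<phi> (r, qc r f)" if "f \<in> vpalg c" for a f
    using assms that by (auto simp: mcarrier_KG)
  have "f \<in> vpalg c \<and> \<phi> (r, qc r f) = plin (\<lambda>p. hat \<phi> (r, p)) f"
  proof (induction f rule: palg_induct)
    case zero
    then show ?case using add[of 0 0] by auto
  next
    case (single p a)
    then have p: "is_path c p" using assms by (auto simp: vpalg_def)
    then show ?case using sc[of "Poly_Mapping.single p 1" a] assms(2)
      by (auto simp: hat_def vpalg_single)
  qed (auto simp: plin_add add)
  then show ?thesis by simp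
qed

text \<open>\<open>KP\<close> is the image of \<open>K\<^sub>\<gamma>\<close> under \<open>hat\<close>: the four conditions say that a function on paths descends
  to the quotients defining \<open>K\<^sub>\<gamma>\<close>, the last one that it lies in the graded dual.\<close>

definition KP :: "(nat \<times> 'i qpath \<Rightarrow> complex) set" where
  "KP = {L. (\<forall>r p. L (r, p) \<noteq> 0 \<longrightarrow> r \<in> RS \<and> is_path c p \<and> psource p = ii r) \<and>
    (\<forall>r t u w i j. c i j < 0 \<longrightarrow> L (r, t, u @ replicate (nat (- c i j)) (Ep i) @ [Al i j] @ w)
        = L (r, t, u @ [Al i j] @ replicate (nat (- c j i)) (Ep j) @ w)) \<and>
    (\<forall>r t u w i. (\<Sum>j\<in>UNIV. \<Sum>k<nat (- c i j). osign Or i j * L (r, t, u @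
       (replicate k (Ep i) @ [Al i j, Al j i] @ replicate (nat (- c i j) - 1 - k) (Ep i)) @ w)) = 0) \<and>
    (\<forall>r t u. L (r, t, u @ replicate (ll r) (Ep (ii r))) = 0) \<and>
    (\<forall>r. finite {n. \<exists>p. pdeg c d p = n \<and> L (r, p) \<noteq> 0})}"

lemma plin_hat_qnull:
  assumes "\<phi> \<in> mcarrier KG" "r \<in> RS" "f \<in> vpalg c" "f \<in> qnull (ii r) (ll r)"
  shows "plin (\<lambda>p. hat \<phi> (r, p)) f = 0"
proof -
  have "qc r f = qc r 0" using assms by (simp add: qcl_cong_iff ll_pos)
  then show ?thesis using hat_plin[OF assms(1,2), of f] hat_plin[OF assms(1,2), of 0] assms by simp
qed

lemma plin_hat_II:
  assumes "\<phi> \<in> mcarrier KG" "r \<in> RS" "f \<in> II"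
  shows "plin (\<lambda>p. hat \<phi> (r, p)) f = 0"
proof (rule plin_hat_qnull[OF assms(1,2)])
  show "f \<in> vpalg c" using assms by auto
  show "f \<in> qnull (ii r) (ll r)" unfolding qnull_def using II_closed(5)[OF assms(3)]
    by (auto intro!: bexI[of _ 0])
qed

text \<open>Each relation is the vanishing of \<phi> on an element of \<open>qnull\<close>: a
  relation enclosed between two paths, a path that does not start at \<open>ii r\<close>, or a path
  whose word ends with \<open>ll r\<close> loops. For the finiteness condition, a nonzero value at a
  path exhibits its degree as one in which \<phi> does not vanish.\<close>

lemma hat_KP:
  assumes \<phi>: "\<phi> \<in> mcarrier KG" shows "hat \<phi> \<in> KP"
  unfolding KP_def
proof (intro CollectI conjI allI impI)
  fix r p assume "hat \<phi> (r, p) \<noteq> 0"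
  then show r: "r \<in> RS" and p: "is_path c p" by (auto simp: hat_def split: if_splits)
  show "psource p = ii r"
  proof (rule ccontr)
    assume "psource p \<noteq> ii r"
    then have "Poly_Mapping.single p 1 \<in> qnull (ii r) (ll r)"
      unfolding qnull_def by (auto simp: ee_def II_closed intro!: bexI[of _ 0])
    then show False using plin_hat_qnull[OF \<phi> r vpalg_single[OF p], of 1] \<open>hat \<phi> (r, p) \<noteq> 0\<close> by simp
  qed
next
  fix r :: nat and t i j :: 'i and u w :: "'i arrow list" assume ij: "c i j < 0"
  let ?a = "(t, u @ replicate (nat (- c i j)) (Ep i) @ [Al i j] @ w)"
  let ?b = "(t, u @ [Al i j] @ replicate (nat (- c j i)) (Ep j) @ w)"
  \<comment> \<open>Either word is a path exactly when u and w are paths that fit to the edge;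
    otherwise \<open>hat\<close> is 0 on both sides.\<close>
  have valid: "is_path c ?a \<longleftrightarrow> is_path c (t, u) \<and> psource (t, u) = i \<and> is_path c (j, w)"
    "is_path c ?b \<longleftrightarrow> is_path c (t, u) \<and> psource (t, u) = i \<and> is_path c (j, w)"
    using ij c_sym[OF ij] by (auto simp: is_path_append psource_append)
  show "hat \<phi> (r, ?a) = hat \<phi> (r, ?b)"
  proof (cases "r \<in> RS \<and> is_path c (t, u) \<and> psource (t, u) = i \<and> is_path c (j, w)")
    case True
    have "pmult (pmult (Poly_Mapping.single (t, u) 1) (commutation_rel c i j)) (Poly_Mapping.single (j, w) 1) \<in> II"
      using rel_in_II(1)[OF ij] True by (intro II_closed(5,6) vpalg_single) auto
    also have "pmult (pmult (Poly_Mapping.single (t, u) 1) (commutation_rel c i j)) (Poly_Mapping.single (j, w) 1)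
       = Poly_Mapping.single ?a 1 - Poly_Mapping.single ?b 1"
      using True pmult_add_right[of _ _ "- _"] ij c_sym[OF ij]
      by (simp add: commutation_rel_def pmult_add_right[of _ _ "- _", simplified]
        pmult_add_left[of _ "- _", simplified] pmult_uminus psource_append)
    finally show ?thesis using plin_hat_II[OF \<phi>] True by (fastforce simp: plin_diff)
  next
    case False
    then have "\<not> (r \<in> RS \<and> is_path c ?a)" "\<not> (r \<in> RS \<and> is_path c ?b)" using valid by blast+
    then show ?thesis by (simp only: hat_def prod.case if_False)
  qed
next
  fix r :: nat and t i :: 'i and u w :: "'i arrow list"
  let ?q = "\<lambda>j k. replicate k (Ep i) @ [Al i j, Al j i] @ replicate (nat (- c i j) - 1 - k) (Ep i)"
  have valid: "is_path c (t, u @ ?q j k @ w) \<longleftrightarrow> is_path c (t, u) \<and> psource (t, u) = i \<and> is_path c (i, w)"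
    if "k < nat (- c i j)" for j k
  proof -
    have "c i j < 0" using that by simp
    then show ?thesis using c_sym[of i j] by (auto simp: is_path_append psource_append)
  qed
  show "(\<Sum>j\<in>UNIV. \<Sum>k<nat (- c i j). osign Or i j * hat \<phi> (r, t, u @ ?q j k @ w)) = 0"
  proof (cases "r \<in> RS \<and> is_path c (t, u) \<and> psource (t, u) = i \<and> is_path c (i, w)")
    case True
    have "pmult (pmult (Poly_Mapping.single (t, u) 1) (mesh_rel c Or i)) (Poly_Mapping.single (i, w) 1) \<in> II"
      using rel_in_II(2)[of i] True by (intro II_closed(5,6) vpalg_single) auto
    also have "pmult (pmult (Poly_Mapping.single (t, u) 1) (mesh_rel c Or i)) (Poly_Mapping.single (i, w) 1)
       = (\<Sum>j\<in>UNIV. \<Sum>k<nat (- c i j). Poly_Mapping.single (t, u @ ?q j k @ w) (osign Or i j))"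
      using True by (simp add: mesh_rel_def pmult_sum_left pmult_sum_right psource_append)
    finally have "plin (\<lambda>p. hat \<phi> (r, p)) (\<Sum>j\<in>UNIV. \<Sum>k<nat (- c i j).
        Poly_Mapping.single (t, u @ ?q j k @ w) (osign Or i j)) = 0"
      using plin_hat_II[OF \<phi>] True by blast
    then show ?thesis by (simp add: plin_sum)
  next
    case False
    then have "hat \<phi> (r, t, u @ ?q j k @ w) = 0" if "k < nat (- c i j)" for j k
      using valid[OF that] by (auto simp: hat_def)
    then show ?thesis by (simp add: sum.neutral)
  qed
next
  fix r :: nat and t :: 'i and u :: "'i arrow list"
  let ?p = "(t, u @ replicate (ll r) (Ep (ii r)))"
  show "hat \<phi> (r, ?p) = 0"
  proof (cases "r \<in> RS \<and> is_path c ?p")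
    case True
    have ps: "psource (t, u) = ii r" "is_path c (t, u)"
      using True ll_pos[of r] by (auto simp: is_path_append)
    have "Poly_Mapping.single ?p 1 \<in> qnull (ii r) (ll r)"
      unfolding qnull_def using ps True ll_pos[of r]
      by (auto simp: ee_def eps_def II_closed psource_append vpalg_single
          intro!: bexI[of _ "Poly_Mapping.single (t, u) 1"])
    then show ?thesis using plin_hat_qnull[OF \<phi>, of r "Poly_Mapping.single ?p 1"] True by (simp add: vpalg_single)
  qed (auto simp: hat_def)
next
  fix r
  show "finite {n. \<exists>p. pdeg c d p = n \<and> hat \<phi> (r, p) \<noteq> 0}"
  proof (cases "r \<in> RS")
    case True
    have "{n. \<exists>p. pdeg c d p = n \<and> hat \<phi> (r, p) \<noteq> 0}
      \<subseteq> {n. \<exists>f\<in>vpalg c. (\<forall>p\<in>Poly_Mapping.keys f. pdeg c d p = n) \<and> \<phi> (r, qc r f) \<noteq> 0}"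
    proof safe
      fix p assume "hat \<phi> (r, p) \<noteq> 0"
      then show "\<exists>f\<in>vpalg c. (\<forall>q\<in>Poly_Mapping.keys f. pdeg c d q = pdeg c d p) \<and> \<phi> (r, qc r f) \<noteq> 0"
        by (intro bexI[of _ "Poly_Mapping.single p 1"]) (auto simp: hat_def split: if_splits)
    qed
    then show ?thesis using \<phi> True finite_subset by (fastforce simp: mcarrier_KG)
  qed (auto simp: hat_def)
qed

lemma KP_D:
  assumes "L \<in> KP"
  shows "L (r, p) \<noteq> 0 \<Longrightarrow> r \<in> RS" "L (r, p) \<noteq> 0 \<Longrightarrow> is_path c p" "L (r, p) \<noteq> 0 \<Longrightarrow> psource p = ii r"
    "c i j < 0 \<Longrightarrow> L (r, t, u @ replicate (nat (- c i j)) (Ep i) @ [Al i j] @ w)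
        = L (r, t, u @ [Al i j] @ replicate (nat (- c j i)) (Ep j) @ w)"
    "(\<Sum>j\<in>UNIV. \<Sum>k<nat (- c i j). osign Or i j * L (r, t, u @
       (replicate k (Ep i) @ [Al i j, Al j i] @ replicate (nat (- c i j) - 1 - k) (Ep i)) @ w)) = 0"
    "L (r, t, u @ replicate (ll r) (Ep (ii r))) = 0"
    "finite {n. \<exists>p. pdeg c d p = n \<and> L (r, p) \<noteq> 0}"
  using assms unfolding KP_def by blast+

lemma KP_I:
  assumes "\<And>r p. L (r, p) \<noteq> 0 \<Longrightarrow> r \<in> RS" "\<And>r p. L (r, p) \<noteq> 0 \<Longrightarrow> is_path c p"
    "\<And>r p. L (r, p) \<noteq> 0 \<Longrightarrow> psource p = ii r"
    "\<And>r t u w i j. c i j < 0 \<Longrightarrow> L (r, t, u @ replicate (nat (- c i j)) (Ep i) @ [Al i j] @ w)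
        = L (r, t, u @ [Al i j] @ replicate (nat (- c j i)) (Ep j) @ w)"
    "\<And>r t u w i. (\<Sum>j\<in>UNIV. \<Sum>k<nat (- c i j). osign Or i j * L (r, t, u @
       (replicate k (Ep i) @ [Al i j, Al j i] @ replicate (nat (- c i j) - 1 - k) (Ep i)) @ w)) = 0"
    "\<And>r t u. L (r, t, u @ replicate (ll r) (Ep (ii r))) = 0"
    "\<And>r. finite {n. \<exists>p. pdeg c d p = n \<and> L (r, p) \<noteq> 0}"
  shows "L \<in> KP"
  unfolding KP_def by (intro CollectI conjI allI impI assms)

text \<open>The f for which L kills all products u f w form a two-sided ideal, and the conditions in
  \<open>KP\<close> put the defining relations into it. Passing from f to u f w is what makes the
  set stable under multiplication.\<close>

lemma KP_plin_II:
  assumes L: "L \<in> KP" and f: "f \<in> II"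
  shows "plin (\<lambda>p. L (r, p)) f = 0"
proof -
  let ?L = "plin (\<lambda>p. L (r, p))"
  let ?J = "{f \<in> vpalg c. \<forall>u\<in>vpalg c. \<forall>w\<in>vpalg c. ?L (pmult (pmult u f) w) = 0}"
  \<comment> \<open>By bilinearity the multipliers can be taken to be single paths with coefficient
    1, which is the form of the conditions in \<open>KP\<close>.\<close>
  have path_suff: "f \<in> ?J" if f: "f \<in> vpalg c"
    and *: "\<And>t u t' w. is_path c (t, u) \<Longrightarrow> is_path c (t', w) \<Longrightarrow>
      ?L (pmult (pmult (Poly_Mapping.single (t, u) 1) f) (Poly_Mapping.single (t', w) 1)) = 0" for f
  proof -
    have "?L (pmult (pmult u f) w) = 0" if u: "u \<in> vpalg c" and w: "w \<in> vpalg c" for u w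
    proof (induction u rule: palg_induct)
      case (single p a)
      have p: "is_path c p" using single u by (auto simp: vpalg_def)
      show ?case
      proof (induction w rule: palg_induct)
        case (single q b)
        have q: "is_path c q" using single w by (auto simp: vpalg_def)
        have s: "Poly_Mapping.single p a = pmult (pscalar a) (Poly_Mapping.single p 1)" for p :: "'i qpath" and a by simp
        have s': "Poly_Mapping.single q b = pmult (Poly_Mapping.single q 1) (pscalar b)" by simp
        let ?z = "pmult (pmult (Poly_Mapping.single p 1) f) (Poly_Mapping.single q 1)"
        have comm: "?L (pmult g (pscalar b)) = b * ?L g" for g
          by (induction g rule: palg_induct) (auto simp: pmult_add_left plin_add algebra_simps)
        have "?L (pmult (pmult (Poly_Mapping.single p a) f) (Poly_Mapping.single q b))
           = ?L (pmult (pmult (pscalar a) ?z) (pscalar b))"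
          unfolding s[of p a] s' by (simp only: pmult_assoc)
        also have "\<dots> = 0"
          using *[of "fst p" "snd p" "fst q" "snd q"] p q by (simp add: comm plin_pscalar)
        finally show ?case .
      qed (auto simp: pmult_add_right plin_add)
    qed (auto simp: pmult_add_left plin_add)
    then show ?thesis using f by auto
  qed
  have "ideal ?J (path_algebra c)"
  proof (rule idealI[OF ring_path_algebra])
    interpret ring "path_algebra c" by (rule ring_path_algebra)
    have "0 \<in> ?J" by auto
    then have ne: "?J \<noteq> {}" by blast
    show "subgroup ?J (add_monoid (path_algebra c))"
    proof (rule group.subgroupI[OF a_group])
      fix f assume f: "f \<in> ?J"
      have "inv\<^bsub>add_monoid (path_algebra c)\<^esub> f = - f"
        using f minus_equality[of "- f" f] by (auto simp: a_inv_def)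
      then show "inv\<^bsub>add_monoid (path_algebra c)\<^esub> f \<in> ?J" using f by (auto simp: pmult_uminus plin_uminus)
    qed (use ne in \<open>auto simp: pmult_add_right pmult_add_left plin_add\<close>)
  next
    fix a x assume a: "a \<in> ?J" and x: "x \<in> carrier (path_algebra c)"
    have "?L (pmult (pmult u (pmult x a)) w) = 0" if "u \<in> vpalg c" "w \<in> vpalg c" for u w
    proof -
      have "pmult (pmult u (pmult x a)) w = pmult (pmult (pmult u x) a) w" by (simp add: pmult_assoc)
      moreover have "pmult u x \<in> vpalg c" using that x by auto
      ultimately show ?thesis using a that by auto
    qed
    then show "x \<otimes>\<^bsub>path_algebra c\<^esub> a \<in> ?J" using a x by auto
    have "?L (pmult (pmult u (pmult a x)) w) = 0" if "u \<in> vpalg c" "w \<in> vpalg c" for u w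
    proof -
      have "pmult (pmult u (pmult a x)) w = pmult (pmult u a) (pmult x w)" by (simp add: pmult_assoc)
      moreover have "pmult x w \<in> vpalg c" using that x by auto
      ultimately show ?thesis using a that by auto
    qed
    then show "a \<otimes>\<^bsub>path_algebra c\<^esub> x \<in> ?J" using a x by auto
  qed
  moreover have "commutation_rel c i j \<in> ?J" if ij: "c i j < 0" for i j
  proof (rule path_suff)
    show "commutation_rel c i j \<in> vpalg c" using rel_in_II(1)[OF ij] by auto
    fix t u t' w
    have "pmult (pmult (Poly_Mapping.single (t, u) 1) (commutation_rel c i j)) (Poly_Mapping.single (t', w) 1)
      = (if psource (t, u) = i \<and> t' = j then
         Poly_Mapping.single (t, u @ replicate (nat (- c i j)) (Ep i) @ [Al i j] @ w) 1
         - Poly_Mapping.single (t, u @ [Al i j] @ replicate (nat (- c j i)) (Ep j) @ w) 1 else 0)"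
      using ij c_sym[OF ij]
      by (auto simp: commutation_rel_def pmult_add_right[of _ _ "- _", simplified]
        pmult_add_left[of _ "- _", simplified] pmult_uminus psource_append)
    then show "?L (pmult (pmult (Poly_Mapping.single (t, u) 1) (commutation_rel c i j)) (Poly_Mapping.single (t', w) 1)) = 0"
      using KP_D(4)[OF L ij, of r t u w] by (auto simp: plin_diff)
  qed
  moreover have "mesh_rel c Or i \<in> ?J" for i
  proof (rule path_suff)
    show "mesh_rel c Or i \<in> vpalg c" using rel_in_II(2) by auto
    fix t u t' w
    have "pmult (pmult (Poly_Mapping.single (t, u) 1) (mesh_rel c Or i)) (Poly_Mapping.single (t', w) 1)
       = (if psource (t, u) = i \<and> t' = i then (\<Sum>j\<in>UNIV. \<Sum>k<nat (- c i j). Poly_Mapping.single (t, u @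
         (replicate k (Ep i) @ [Al i j, Al j i] @ replicate (nat (- c i j) - 1 - k) (Ep i)) @ w) (osign Or i j))
         else 0)"
      by (auto simp: mesh_rel_def pmult_sum_left pmult_sum_right psource_append intro!: sum.neutral)
    then show "?L (pmult (pmult (Poly_Mapping.single (t, u) 1) (mesh_rel c Or i)) (Poly_Mapping.single (t', w) 1)) = 0"
      using KP_D(5)[OF L, of i r t u w] by (auto simp: plin_sum)
  qed
  ultimately have "II \<subseteq> ?J" by (rule II_induct)
  then have "f \<in> ?J" using f by auto
  then have "?L (pmult (pmult (pscalar 1) f) (pscalar 1)) = 0" by blast
  then show ?thesis by simp
qed

text \<open>Modulo the ideal, f e_i is a multiple of \<epsilon>^l. L does not notice the factor e_i,
  being supported on paths that start at i, and it vanishes on words whose list ends with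
  \<epsilon>^l.\<close>

lemma KP_plin_qnull:
  assumes L: "L \<in> KP" and f: "f \<in> qnull (ii r) (ll r)"
  shows "plin (\<lambda>p. L (r, p)) f = 0"
proof -
  let ?L = "plin (\<lambda>p. L (r, p))"
  obtain q where q: "q \<in> vpalg c" "pmult f (ee (ii r)) - pmult q (eps (ii r) (ll r)) \<in> II"
    using f by (auto simp: qnull_def)
  have 1: "?L (pmult f (ee (ii r))) = ?L f"
    using KP_D(3)[OF L]
    by (induction f rule: palg_induct) (auto simp: pmult_add_left plin_add ee_def)
  have 2: "?L (pmult q (eps (ii r) (ll r))) = 0"
    using KP_D(6)[OF L]
    by (induction q rule: palg_induct) (auto simp: pmult_add_left plin_add eps_def)
  show ?thesis using KP_plin_II[OF L q(2), of r] 1 2 by (simp add: plin_diff)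
qed

text \<open>An arbitrary representative. For L in \<open>KP\<close> the value does not depend on it,
  by \<open>KP_plin_qnull\<close>; choosing it independently of L keeps \<open>unhat\<close>
  linear.\<close>

definition qlift :: "nat \<Rightarrow> 'i palg set set \<Rightarrow> 'i palg" where
  "qlift r A = (SOME f. f \<in> vpalg c \<and> A = qc r f)"

definition unhat :: "(nat \<times> 'i qpath \<Rightarrow> complex) \<Rightarrow> nat \<times> 'i palg set set \<Rightarrow> complex" where
  "unhat L = (\<lambda>(r, A). if r \<in> RS \<and> A \<in> qc r ` vpalg c then plin (\<lambda>p. L (r, p)) (qlift r A) else 0)"

lemma unhat_qc:
  assumes "L \<in> KP" "r \<in> RS" "f \<in> vpalg c"
  shows "unhat L (r, qc r f) = plin (\<lambda>p. L (r, p)) f"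
proof -
  have "qlift r (qc r f) \<in> vpalg c \<and> qc r f = qc r (qlift r (qc r f))"
    unfolding qlift_def by (rule someI[of _ f]) (use assms in auto)
  then have "plin (\<lambda>p. L (r, p)) (qlift r (qc r f) - f) = 0"
    using assms qcl_cong_iff[of "ll r" "qlift r (qc r f)" f] by (intro KP_plin_qnull) (auto simp: ll_pos)
  then show ?thesis using assms by (auto simp: unhat_def plin_diff)
qed

lemma hat_unhat:
  assumes "L \<in> KP" shows "hat (unhat L) = L"
proof
  fix x :: "nat \<times> 'i qpath"
  obtain r p where x: "x = (r, p)" by (cases x) auto
  show "hat (unhat L) x = L x"
    using unhat_qc[OF assms, of r "Poly_Mapping.single p 1"] KP_D(1,2)[OF assms, of r p]
    by (auto simp: x hat_def vpalg_single)
qed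

lemma unhat_carrier:
  assumes L: "L \<in> KP" shows "unhat L \<in> mcarrier KG"
  unfolding mcarrier_KG
proof (intro conjI allI ballI impI)
  fix r assume r: "r \<in> RS"
  fix f g assume fg: "f \<in> vpalg c" "g \<in> vpalg c"
  then show "unhat L (r, qc r (f + g)) = unhat L (r, qc r f) + unhat L (r, qc r g)"
    by (simp add: unhat_qc[OF L r] vpalg_add plin_add)
next
  fix r a f assume r: "r \<in> RS" and "f \<in> vpalg c"
  then show "unhat L (r, qc r (pmult (pscalar a) f)) = a * unhat L (r, qc r f)"
    by (simp add: unhat_qc[OF L r] vpalg_pmult plin_pscalar)
next
  fix r assume r: "r \<in> RS"
  have "{n. \<exists>f\<in>vpalg c. (\<forall>p\<in>Poly_Mapping.keys f. pdeg c d p = n) \<and> unhat L (r, qc r f) \<noteq> 0}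
    \<subseteq> {n. \<exists>p. pdeg c d p = n \<and> L (r, p) \<noteq> 0}"
  proof safe
    fix n f assume f: "f \<in> vpalg c" "\<forall>p\<in>Poly_Mapping.keys f. pdeg c d p = n" "unhat L (r, qc r f) \<noteq> 0"
    then have "plin (\<lambda>p. L (r, p)) f \<noteq> 0" by (simp add: unhat_qc[OF L r])
    then obtain p where "p \<in> Poly_Mapping.keys f" "L (r, p) \<noteq> 0"
      unfolding plin_def by (metis (mono_tags, lifting) mult_zero_right sum.neutral)
    then show "\<exists>p. pdeg c d p = n \<and> L (r, p) \<noteq> 0" using f by (intro exI[of _ p]) simp
  qed
  then show "finite {n. \<exists>f\<in>vpalg c. (\<forall>p\<in>Poly_Mapping.keys f. pdeg c d p = n) \<and> unhat L (r, qc r f) \<noteq> 0}"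
    using KP_D(7)[OF L] finite_subset by blast
qed (auto simp: unhat_def)

lemma carrier_eqI:
  assumes "\<phi> \<in> mcarrier KG" "\<And>r x. (r, x) \<notin> (SIGMA r:RS. qc r ` vpalg c) \<Longrightarrow> \<psi> (r, x) = 0"
    "\<And>r f. r \<in> RS \<Longrightarrow> f \<in> vpalg c \<Longrightarrow> \<psi> (r, qc r f) = plin (\<lambda>p. hat \<phi> (r, p)) f"
  shows "\<psi> = \<phi>"
proof
  fix x :: "nat \<times> 'i palg set set"
  obtain r A where x: "x = (r, A)" by (cases x) auto
  show "\<psi> x = \<phi> x"
  proof (cases "r \<in> RS \<and> A \<in> qc r ` vpalg c")
    case True
    then show ?thesis using assms(3) hat_plin[OF assms(1)] unfolding x by auto
  next
    case False
    then have "\<phi> (r, A) = 0" using assms(1) unfolding mcarrier_KG by blast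
    then show ?thesis using False assms(2) unfolding x by auto
  qed
qed

lemma unhat_outside: "(r, x) \<notin> (SIGMA r:RS. qc r ` vpalg c) \<Longrightarrow> unhat L (r, x) = 0"
  unfolding unhat_def by (simp only: prod.case mem_Sigma_iff if_False)

lemma unhat_hat:
  assumes "\<phi> \<in> mcarrier KG" shows "unhat (hat \<phi>) = \<phi>"
  using assms unhat_outside unhat_qc[OF hat_KP[OF assms]] by (rule carrier_eqI)

end

section \<open>The functions on paths that come from the dual modules, as a vector space\<close>

context preproj_dual
begin

lemma hat_inj: "\<phi> \<in> mcarrier KG \<Longrightarrow> \<psi> \<in> mcarrier KG \<Longrightarrow> hat \<phi> = hat \<psi> \<Longrightarrow> \<phi> = \<psi>"
  by (metis unhat_hat)

lemma hat_add: "hat (\<phi> + \<psi>) = hat \<phi> + hat \<psi>"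
  by (auto simp: hat_def fun_eq_iff)

lemma hat_scale: "hat (cscale a \<phi>) = cscale a (hat \<phi>)"
  by (auto simp: hat_def fun_eq_iff cscale_def)

lemma hat_sum: "hat (sum F A) = (\<Sum>x\<in>A. hat (F x))"
proof (induction A rule: infinite_finite_induct)
  case (insert x A)
  show ?case unfolding sum.insert[OF insert(1,2)] hat_add insert(3) ..
qed (auto simp: hat_def fun_eq_iff)

lemma subspace_KP: "cfun.subspace KP"
proof (rule cfun.subspaceI)
  show "0 \<in> KP" by (rule KP_I) auto
next
  fix f g assume f: "f \<in> KP" and g: "g \<in> KP"
  have nz: "f (r, p) \<noteq> 0 \<or> g (r, p) \<noteq> 0" if "(f + g) (r, p) \<noteq> 0" for r p
    using that by auto
  show "f + g \<in> KP"
  proof (rule KP_I)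
    fix r
    show "finite {n. \<exists>p. pdeg c d p = n \<and> (f + g) (r, p) \<noteq> 0}"
    proof (rule finite_subset[OF _ finite_UnI[OF KP_D(7)[OF f, of r] KP_D(7)[OF g, of r]]])
      show "{n. \<exists>p. pdeg c d p = n \<and> (f + g) (r, p) \<noteq> 0} \<subseteq> {n. \<exists>p. pdeg c d p = n \<and> f (r, p) \<noteq> 0} \<union>
         {n. \<exists>p. pdeg c d p = n \<and> g (r, p) \<noteq> 0}"
        using nz by blast
    qed
  next
    fix r p assume "(f + g) (r, p) \<noteq> 0"
    with nz show "r \<in> RS" "is_path c p" "psource p = ii r" using KP_D(1-3)[OF f] KP_D(1-3)[OF g] by blast+
  next
    fix r t u w i j assume "c i j < 0"
    then show "(f + g) (r, t, u @ replicate (nat (- c i j)) (Ep i) @ [Al i j] @ w)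
        = (f + g) (r, t, u @ [Al i j] @ replicate (nat (- c j i)) (Ep j) @ w)"
      unfolding plus_fun_apply by (simp only: KP_D(4)[OF f] KP_D(4)[OF g])
  next
    fix r t u w i
    show "(\<Sum>j\<in>UNIV. \<Sum>k<nat (- c i j). osign Or i j * (f + g) (r, t, u @
       (replicate k (Ep i) @ [Al i j, Al j i] @ replicate (nat (- c i j) - 1 - k) (Ep i)) @ w)) = 0"
      unfolding plus_fun_apply distrib_left sum.distrib by (simp only: add_0 KP_D(5)[OF f] KP_D(5)[OF g])
  qed (simp add: KP_D(6)[OF f] KP_D(6)[OF g])
next
  fix a f assume f: "f \<in> KP"
  show "cscale a f \<in> KP"
  proof (rule KP_I)
    fix r
    show "finite {n. \<exists>p. pdeg c d p = n \<and> cscale a f (r, p) \<noteq> 0}"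
      by (rule finite_subset[OF _ KP_D(7)[OF f, of r]]) (auto simp: cscale_def)
  next
    fix r p assume "cscale a f (r, p) \<noteq> 0"
    then have "f (r, p) \<noteq> 0" by (auto simp: cscale_def)
    then show "r \<in> RS" "is_path c p" "psource p = ii r" using KP_D(1-3)[OF f] by blast+
  next
    fix r t u w i j assume "c i j < 0"
    then show "cscale a f (r, t, u @ replicate (nat (- c i j)) (Ep i) @ [Al i j] @ w)
        = cscale a f (r, t, u @ [Al i j] @ replicate (nat (- c j i)) (Ep j) @ w)"
      unfolding cscale_def by (simp only: KP_D(4)[OF f])
  next
    fix r t u w i
    have "(\<Sum>j\<in>UNIV. \<Sum>k<nat (- c i j). osign Or i j * cscale a f (r, t, u @
       (replicate k (Ep i) @ [Al i j, Al j i] @ replicate (nat (- c i j) - 1 - k) (Ep i)) @ w))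
      = a * (\<Sum>j\<in>UNIV. \<Sum>k<nat (- c i j). osign Or i j * f (r, t, u @
       (replicate k (Ep i) @ [Al i j, Al j i] @ replicate (nat (- c i j) - 1 - k) (Ep i)) @ w))"
      unfolding cscale_def sum_distrib_left by (intro sum.cong refl mult.left_commute)
    then show "(\<Sum>j\<in>UNIV. \<Sum>k<nat (- c i j). osign Or i j * cscale a f (r, t, u @
       (replicate k (Ep i) @ [Al i j, Al j i] @ replicate (nat (- c i j) - 1 - k) (Ep i)) @ w)) = 0"
      by (simp only: mult_zero_right KP_D(5)[OF f])
  qed (simp add: KP_D(6)[OF f] cscale_def)
qed

lemma unhat_add: "unhat (L + M) = unhat L + unhat M"
  by (auto simp: unhat_def fun_eq_iff plin_def distrib_left sum.distrib)

lemma unhat_scale: "unhat (cscale a L) = cscale a (unhat L)"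
  by (auto simp: unhat_def fun_eq_iff plin_def cscale_def sum_distrib_left mult.left_commute)

lemma mcarrier_KG_eq: "mcarrier KG = unhat ` KP"
proof (intro equalityI subsetI)
  fix \<phi> assume "\<phi> \<in> mcarrier KG"
  then have "\<phi> = unhat (hat \<phi>)" "hat \<phi> \<in> KP" by (rule unhat_hat[symmetric], rule hat_KP)
  then show "\<phi> \<in> unhat ` KP" by (rule image_eqI)
next
  fix \<phi> assume "\<phi> \<in> unhat ` KP"
  then show "\<phi> \<in> mcarrier KG" using unhat_carrier by blast
qed

lemma subspace_carrier: "cfun.subspace (mcarrier KG)"
  unfolding mcarrier_KG_eq
proof (rule cfun.subspaceI)
  have "unhat 0 = 0" by (auto simp: unhat_def fun_eq_iff plin_def)
  then show "0 \<in> unhat ` KP" 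
    by (intro image_eqI[of _ _ 0] cfun.subspace_0[OF subspace_KP]) (rule sym)
next
  fix x y assume "x \<in> unhat ` KP" "y \<in> unhat ` KP"
  then obtain L M where "L \<in> KP" "M \<in> KP" "x = unhat L" "y = unhat M" by blast
  then show "x + y \<in> unhat ` KP"
    by (intro image_eqI[of _ _ "L + M"] cfun.subspace_add[OF subspace_KP]) (simp only: unhat_add, assumption+)
next
  fix a x assume "x \<in> unhat ` KP"
  then obtain L where "L \<in> KP" "x = unhat L" by blast
  then show "cscale a x \<in> unhat ` KP"
    by (intro image_eqI[of _ _ "cscale a L"] cfun.subspace_scale[OF subspace_KP]) (simp only: unhat_scale, assumption)
qed

end

section \<open>The algebra acting on functions on paths\<close>

lemma plin_pscalar_right: "plin L (pmult f (pscalar a)) = a * plin L f"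
  by (induction f rule: palg_induct) (auto simp: pmult_add_left plin_add algebra_simps)

definition arrow_ok :: "('i \<Rightarrow> 'i \<Rightarrow> int) \<Rightarrow> 'i arrow \<Rightarrow> bool" where
  "arrow_ok c a \<longleftrightarrow> (case a of Al i j \<Rightarrow> c i j < 0 | Ep _ \<Rightarrow> True)"

lemma arrow_ok_simps [simp]: "arrow_ok c (Al i j) \<longleftrightarrow> c i j < 0" "arrow_ok c (Ep i)"
  by (simp_all add: arrow_ok_def)

lemma is_path_Cons: "is_path c (i, a # w) \<longleftrightarrow> atarget a = i \<and> arrow_ok c a \<and> is_path c (asource a, w)"
  by (simp add: arrow_ok_def)

context preproj_dual
begin

lemma tau_vpalg: "f \<in> vpalg c \<Longrightarrow> palg_tau f \<in> vpalg c"
  by (rule palg_tau_vpalg) (auto intro: c_sym)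

text \<open>The dual action is transposed and twisted by tau, so a acts by putting its flip in front
  of the argument; this fits only the paths p with target \<open>atarget a\<close>.\<close>

definition opa :: "'i arrow \<Rightarrow> (nat \<times> 'i qpath \<Rightarrow> complex) \<Rightarrow> nat \<times> 'i qpath \<Rightarrow> complex" where
  "opa a L = (\<lambda>(r, p). if fst p = atarget a then L (r, asource a, aflip a # snd p) else 0)"

definition opr :: "'i \<Rightarrow> (nat \<times> 'i qpath \<Rightarrow> complex) \<Rightarrow> nat \<times> 'i qpath \<Rightarrow> complex" where
  "opr i L = (\<lambda>(r, p). if fst p = i then L (r, p) else 0)"

definition opf :: "'i palg \<Rightarrow> (nat \<times> 'i qpath \<Rightarrow> complex) \<Rightarrow> nat \<times> 'i qpath \<Rightarrow> complex" where
  "opf f L = (\<lambda>(r, p). plin (\<lambda>q. L (r, q)) (pmult (palg_tau f) (Poly_Mapping.single p 1)))"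

lemma plin_opf: "plin (\<lambda>p. opf f L (r, p)) g = plin (\<lambda>q. L (r, q)) (pmult (palg_tau f) g)"
proof (induction g rule: palg_induct)
  case (single p a)
  have "Poly_Mapping.single p a = pmult (Poly_Mapping.single p 1) (pscalar a)" by simp
  then have "pmult (palg_tau f) (Poly_Mapping.single p a)
      = pmult (pmult (palg_tau f) (Poly_Mapping.single p 1)) (pscalar a)" by (simp add: pmult_assoc)
  then show ?case by (simp add: opf_def plin_pscalar_right)
qed (auto simp: pmult_add_right plin_add)

lemma opf_add: "opf (f + g) L = opf f L + opf g L"
  by (auto simp: opf_def fun_eq_iff palg_tau_add pmult_add_left plin_add)

lemma opf_trivial: "opf (Poly_Mapping.single (i, []) a) L = cscale a (opr i L)"
  by (auto simp: opf_def fun_eq_iff pflip_eq opr_def cscale_def)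

lemma opf_arrow: "opf (Poly_Mapping.single (atarget a, [a]) 1) L = opa a L"
  by (auto simp: opf_def fun_eq_iff pflip_eq opa_def)

lemma opf_mult:
  assumes "f \<in> vpalg c" "g \<in> vpalg c" shows "opf (pmult f g) L = opf f (opf g L)"
proof
  fix x :: "nat \<times> 'i qpath"
  obtain r p where x: "x = (r, p)" by (cases x) auto
  have "opf f (opf g L) (r, p) = plin (\<lambda>q. opf g L (r, q)) (pmult (palg_tau f) (Poly_Mapping.single p 1))"
    by (simp add: opf_def[of f])
  also have "\<dots> = plin (\<lambda>q. L (r, q)) (pmult (palg_tau g) (pmult (palg_tau f) (Poly_Mapping.single p 1)))"
    by (rule plin_opf)
  finally show "opf (pmult f g) L x = opf f (opf g L) x"
    by (simp add: x opf_def[of "pmult f g"] palg_tau_pmult[OF assms] pmult_assoc)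
qed

lemma opf_pscalar: "opf (pscalar a) L = cscale a L"
proof -
  have "palg_tau (pscalar a :: 'i palg) = pscalar a" by (simp add: pscalar_def palg_tau_sum pflip_eq)
  then show ?thesis by (auto simp: opf_def cscale_def fun_eq_iff)
qed

text \<open>Along paths this is the definition of the dual action. At a word that is not a path both
  sides vanish, since no product with such a tail is a path.\<close>

lemma hat_mact:
  assumes \<phi>: "\<phi> \<in> mcarrier KG" and f: "f \<in> vpalg c"
  shows "hat (mact KG (cls f) \<phi>) = opf f (hat \<phi>)"
proof
  fix x :: "nat \<times> 'i qpath"
  obtain r p where x: "x = (r, p)" by (cases x) auto
  have f': "palg_tau f \<in> vpalg c" using f by (rule tau_vpalg)
  show "hat (mact KG (cls f) \<phi>) x = opf f (hat \<phi>) x"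
  proof (cases "r \<in> RS \<and> is_path c p")
    case True
    then have p: "Poly_Mapping.single p 1 \<in> vpalg c" by (intro vpalg_single) simp
    have "hat (mact KG (cls f) \<phi>) (r, p) = mact KG (cls f) \<phi> (r, qc r (Poly_Mapping.single p 1))"
      using True by (simp add: hat_def)
    also have "\<dots> = \<phi> (r, qc r (pmult (palg_tau f) (Poly_Mapping.single p 1)))"
      using True f p by (intro mact_KG_qc) auto
    also have "\<dots> = plin (\<lambda>q. hat \<phi> (r, q)) (pmult (palg_tau f) (Poly_Mapping.single p 1))"
      using True f' p by (intro hat_plin[OF \<phi>] vpalg_pmult) auto
    finally show ?thesis by (simp add: x opf_def)
  next
    case False
    have "hat \<phi> (r, q) = 0" if q: "q \<in> Poly_Mapping.keys (pmult (palg_tau f) (Poly_Mapping.single p 1))" for q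
    proof (cases "r \<in> RS")
      case True
      then have "\<not> is_path c p" using False by auto
      moreover obtain a where "psource a = fst p" "q = (fst a, snd a @ snd p)"
        using keys_pmult[OF q] by auto
      then have "is_path c q \<Longrightarrow> is_path c p" by (cases a; cases p) (auto simp: is_path_append)
      ultimately show ?thesis by (auto simp: hat_def)
    qed (auto simp: hat_def)
    then have "plin (\<lambda>q. hat \<phi> (r, q)) (pmult (palg_tau f) (Poly_Mapping.single p 1)) = 0"
      unfolding plin_def by (intro sum.neutral) auto
    moreover have "hat (mact KG (cls f) \<phi>) (r, p) = 0" using False by (auto simp: hat_def)
    ultimately show ?thesis by (simp add: x opf_def)
  qed
qed

text \<open>Membership in \<open>KP\<close> is a premise because it will be supplied by a stable
  subspace of \<open>KP\<close> that contains \<open>hat \<phi>\<close>.\<close>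

lemma mact_eq_unhat:
  assumes \<phi>: "\<phi> \<in> mcarrier KG" and f: "f \<in> vpalg c" and L: "opf f (hat \<phi>) \<in> KP"
  shows "mact KG (cls f) \<phi> = unhat (opf f (hat \<phi>))"
proof (rule carrier_eqI[OF unhat_carrier[OF L]])
  have f': "palg_tau f \<in> vpalg c" using f by (rule tau_vpalg)
  show "mact KG (cls f) \<phi> (r, x) = 0" if "(r, x) \<notin> (SIGMA r:RS. qc r ` vpalg c)" for r x
    unfolding mact_KG using that by (simp only: mem_Sigma_iff if_False)
  fix r g assume r: "r \<in> RS" and g: "g \<in> vpalg c"
  have "mact KG (cls f) \<phi> (r, qc r g) = plin (\<lambda>q. hat \<phi> (r, q)) (pmult (palg_tau f) g)"
    unfolding mact_KG_qc[OF r f g] using f' g by (intro hat_plin[OF \<phi> r] vpalg_pmult)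
  then show "mact KG (cls f) \<phi> (r, qc r g) = plin (\<lambda>p. hat (unhat (opf f (hat \<phi>))) (r, p)) g"
    unfolding hat_unhat[OF L] plin_opf .
qed

text \<open>The form that submodules take among functions: the algebra is generated by arrows,
  trivial paths and scalars, so stability under these suffices (\<open>hsub_opf\<close>).\<close>

definition hsub :: "(nat \<times> 'i qpath \<Rightarrow> complex) set \<Rightarrow> bool" where
  "hsub H \<longleftrightarrow> cfun.subspace H \<and> H \<subseteq> KP \<and> (\<forall>a. arrow_ok c a \<longrightarrow> opa a ` H \<subseteq> H) \<and> (\<forall>i. opr i ` H \<subseteq> H)"

lemma hsub_opf:
  assumes H: "hsub H" and f: "f \<in> vpalg c" and L: "L \<in> H"
  shows "opf f L \<in> H"
  using L
proof (induction f arbitrary: L rule: palg_induct)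
  case zero
  have "opf 0 L = 0" by (auto simp: opf_def fun_eq_iff)
  then show ?case using H cfun.subspace_0[of H] by (simp only: hsub_def)
next
  case (add f g)
  then show ?case unfolding opf_add using H by (intro cfun.subspace_add) (auto simp: hsub_def)
next
  case (single p a)
  then have p: "is_path c p" using f by (auto simp: vpalg_def)
  obtain i w where "p = (i, w)" by (cases p) auto
  then have "is_path c (i, w)" using p by simp
  then have "opf (Poly_Mapping.single (i, w) a) L \<in> H"
  proof (induction w arbitrary: i)
    case Nil
    then show ?case unfolding opf_trivial using H single
      by (intro cfun.subspace_scale) (auto simp: hsub_def image_subset_iff)
  next
    case (Cons x w)
    have x: "atarget x = i" "arrow_ok c x" "is_path c (asource x, w)"
      using Cons.prems unfolding is_path_Cons by auto
    have "Poly_Mapping.single (i, x # w) a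
      = pmult (Poly_Mapping.single (atarget x, [x]) 1) (Poly_Mapping.single (asource x, w) a)"
      using x by simp
    moreover have "opf \<dots> L = opa x (opf (Poly_Mapping.single (asource x, w) a) L)"
      unfolding opf_arrow[symmetric] using x
      by (intro opf_mult vpalg_single) (auto simp: is_path_Cons simp del: is_path.simps(2))
    ultimately show ?case using H x Cons.IH by (auto simp: hsub_def image_subset_iff)
  qed
  then show ?case using \<open>p = (i, w)\<close> by simp
qed

lemma hat_mem:
  assumes "U \<subseteq> mcarrier KG" "x \<in> mcarrier KG" "hat x \<in> hat ` U"
  shows "x \<in> U"
proof -
  obtain y where y: "y \<in> U" "hat x = hat y" using assms(3) by blast
  have "y \<in> mcarrier KG" using y(1) assms(1) by (rule rev_subsetD)
  then have "x = y" using hat_inj[OF assms(2) _ y(2)] by simp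
  then show ?thesis using y(1) by simp
qed

text \<open>\<open>pi_submodule\<close> mentions no scalars; closure under them comes from the
  action of \<open>pscalar\<close>, by \<open>opf_pscalar\<close>. The converse rests on
  \<open>hat\<close> being injective and compatible with the action.\<close>

lemma pi_submodule_iff: "pi_submodule c Or KG U \<longleftrightarrow> U \<subseteq> mcarrier KG \<and> hsub (hat ` U)"
proof
  assume U: "pi_submodule c Or KG U"
  then have sub: "U \<subseteq> mcarrier KG" and ne: "U \<noteq> {}" and add: "\<And>x y. x \<in> U \<Longrightarrow> y \<in> U \<Longrightarrow> x + y \<in> U"
    and act: "\<And>f x. f \<in> vpalg c \<Longrightarrow> x \<in> U \<Longrightarrow> mact KG (cls f) x \<in> U"
    by (auto simp: pi_submodule_def madd_KG carrier_PP)
  have opf: "opf f L \<in> hat ` U" if L: "L \<in> hat ` U" and f: "f \<in> vpalg c" for f L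
  proof -
    obtain x where x: "x \<in> U" "L = hat x" using L by blast
    then have "opf f L = hat (mact KG (cls f) x)" using hat_mact[OF _ f] sub by auto
    then show ?thesis using act[OF f x(1)] by auto
  qed
  have sc: "cscale a L \<in> hat ` U" if "L \<in> hat ` U" for a L
    using opf[OF that vpalg_pscalar, of a] by (simp add: opf_pscalar)
  have "cfun.subspace (hat ` U)"
  proof (rule cfun.subspaceI)
    obtain x where "x \<in> U" using ne by blast
    then have "cscale 0 (hat x) \<in> hat ` U" by (intro sc) auto
    then show "0 \<in> hat ` U" by (simp add: cscale_def zero_fun_def)
    fix L M assume "L \<in> hat ` U" "M \<in> hat ` U"
    then obtain x y where xy: "x \<in> U" "y \<in> U" "L = hat x" "M = hat y" by blast
    show "L + M \<in> hat ` U" unfolding xy hat_add[symmetric] using add[OF xy(1,2)] by (rule imageI)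
  qed (rule sc)
  moreover have "hat ` U \<subseteq> KP" using sub hat_KP by blast
  moreover have "opa a L \<in> hat ` U" if "arrow_ok c a" "L \<in> hat ` U" for a L
    unfolding opf_arrow[symmetric] using that by (intro opf vpalg_single) (auto simp: arrow_ok_def)
  moreover have "opr i L \<in> hat ` U" if L: "L \<in> hat ` U" for i L
  proof -
    have "opf (Poly_Mapping.single (i, []) 1) L \<in> hat ` U" using L by (intro opf vpalg_single) auto
    then show ?thesis unfolding opf_trivial by (simp add: cscale_def)
  qed
  ultimately show "U \<subseteq> mcarrier KG \<and> hsub (hat ` U)" using sub unfolding hsub_def by blast
next
  assume U: "U \<subseteq> mcarrier KG \<and> hsub (hat ` U)"
  then have sub: "U \<subseteq> mcarrier KG" and H: "hsub (hat ` U)" by auto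
  have inU: "x \<in> U" if x: "x \<in> mcarrier KG" "hat x \<in> hat ` U" for x
    using sub x by (rule hat_mem)
  show "pi_submodule c Or KG U"
    unfolding pi_submodule_def
  proof (intro conjI ballI sub)
    have "0 \<in> hat ` U" using H by (simp add: hsub_def cfun.subspace_0)
    then show "U \<noteq> {}" by blast
    fix x assume x: "x \<in> U"
    show "madd KG x y \<in> U" if y: "y \<in> U" for y
    proof (rule inU)
      show "madd KG x y \<in> mcarrier KG" unfolding madd_KG
        using x y sub by (intro cfun.subspace_add[OF subspace_carrier]) auto
      show "hat (madd KG x y) \<in> hat ` U" unfolding madd_KG hat_add
        using H x y by (intro cfun.subspace_add) (auto simp: hsub_def)
    qed
    fix p assume "p \<in> carrier PP"
    then obtain f where f: "f \<in> vpalg c" "p = cls f" by (auto simp: carrier_PP)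
    have o: "opf f (hat x) \<in> hat ` U" using hsub_opf[OF H f(1)] x by auto
    then have K: "opf f (hat x) \<in> KP" using H by (auto simp: hsub_def)
    have "mact KG p x = unhat (opf f (hat x))" unfolding f(2) using x sub f K by (intro mact_eq_unhat) auto
    also obtain y where y: "y \<in> U" "opf f (hat x) = hat y" using o by blast
    have "unhat (opf f (hat x)) = y" unfolding y(2) using y(1) sub by (intro unhat_hat) auto
    finally show "mact KG p x \<in> U" using y(1) by simp
  qed
qed

lemma subspace_submodule:
  assumes "pi_submodule c Or KG U" shows "cfun.subspace U"
proof -
  have U: "U \<subseteq> mcarrier KG" "hsub (hat ` U)" using assms by (auto simp: pi_submodule_iff)
  have "U = {x \<in> mcarrier KG. hat x \<in> hat ` U}"
    using U(1) hat_mem[OF U(1)] by blast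
  moreover have "cfun.subspace {x \<in> mcarrier KG. hat x \<in> hat ` U}"
  proof (rule cfun.subspaceI)
    have "hat 0 = 0" by (auto simp: hat_def fun_eq_iff)
    then show "0 \<in> {x \<in> mcarrier KG. hat x \<in> hat ` U}"
      using cfun.subspace_0[OF subspace_carrier] cfun.subspace_0[of "hat ` U"] U(2)
      by (simp add: hsub_def)
  next
    fix x y assume "x \<in> {x \<in> mcarrier KG. hat x \<in> hat ` U}" "y \<in> {x \<in> mcarrier KG. hat x \<in> hat ` U}"
    then show "x + y \<in> {x \<in> mcarrier KG. hat x \<in> hat ` U}"
      using cfun.subspace_add[OF subspace_carrier] cfun.subspace_add[of "hat ` U"] U(2)
      by (simp add: hsub_def hat_add)
  next
    fix a x assume "x \<in> {x \<in> mcarrier KG. hat x \<in> hat ` U}"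
    then show "cscale a x \<in> {x \<in> mcarrier KG. hat x \<in> hat ` U}"
      using cfun.subspace_scale[OF subspace_carrier] cfun.subspace_scale[of "hat ` U"] U(2)
      by (simp add: hsub_def hat_scale)
  qed
  ultimately show ?thesis by simp
qed

lemma mact_ee:
  assumes U: "pi_submodule c Or KG U" and x: "x \<in> U"
  shows "mact KG (pi_e c Or i) x \<in> U" "hat (mact KG (pi_e c Or i) x) = opr i (hat x)"
proof -
  have "pi_e c Or i \<in> carrier PP" by (auto simp: pi_e_eq carrier_PP)
  then show "mact KG (pi_e c Or i) x \<in> U" using U x by (auto simp: pi_submodule_def)
  have "x \<in> mcarrier KG" using U x by (auto simp: pi_submodule_iff)
  then have "hat (mact KG (pi_e c Or i) x) = opf (ee i) (hat x)" unfolding pi_e_eq by (intro hat_mact) auto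
  then show "hat (mact KG (pi_e c Or i) x) = opr i (hat x)" by (simp add: ee_def opf_trivial cscale_def)
qed

text \<open>The idempotent e_i acts as restriction to the paths with target i, so its image in U is
  its fixed space.\<close>

lemma piece_eq:
  assumes U: "pi_submodule c Or KG U"
  shows "piece c Or KG U i = {\<phi> \<in> U. \<forall>r p. hat \<phi> (r, p) \<noteq> 0 \<longrightarrow> fst p = i}"
proof (intro equalityI subsetI)
  fix y assume "y \<in> piece c Or KG U i"
  then obtain x where x: "x \<in> U" "y = mact KG (pi_e c Or i) x" by (auto simp: piece_def)
  then show "y \<in> {\<phi> \<in> U. \<forall>r p. hat \<phi> (r, p) \<noteq> 0 \<longrightarrow> fst p = i}"
    using mact_ee[OF U x(1), of i] by (auto simp: opr_def split: if_splits)
next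
  fix y assume y: "y \<in> {\<phi> \<in> U. \<forall>r p. hat \<phi> (r, p) \<noteq> 0 \<longrightarrow> fst p = i}"
  then have yU: "y \<in> U" by simp
  have "opr i (hat y) = hat y" using y by (auto simp: opr_def fun_eq_iff)
  then have "mact KG (pi_e c Or i) y = y"
    using mact_ee[OF U yU, of i] yU U by (intro hat_inj) (auto simp: pi_submodule_iff)
  then show "y \<in> piece c Or KG U i" using yU by (auto simp: piece_def image_iff intro!: bexI[of _ y])
qed

text \<open>Paths form a homogeneous basis of the path algebra, so by linearity a form is
  homogeneous as soon as it is so on paths.\<close>

lemma mdegree_hat:
  assumes \<phi>: "\<phi> \<in> mcarrier KG"
  shows "\<phi> \<in> mdegree KG n \<longleftrightarrow>
    (\<forall>r p. hat \<phi> (r, p) \<noteq> 0 \<longrightarrow> pdeg c d p = kk r + int (ll r) * d (ii r) - n)"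
proof
  assume n: "\<phi> \<in> mdegree KG n"
  show "\<forall>r p. hat \<phi> (r, p) \<noteq> 0 \<longrightarrow> pdeg c d p = kk r + int (ll r) * d (ii r) - n"
  proof (intro allI impI)
    fix r p assume "hat \<phi> (r, p) \<noteq> 0"
    then have "r \<in> RS" "is_path c p" "\<phi> (r, qc r (Poly_Mapping.single p 1)) \<noteq> 0"
      by (auto simp: hat_def split: if_splits)
    moreover have "\<forall>q\<in>Poly_Mapping.keys (Poly_Mapping.single p (1::complex)). pdeg c d q = pdeg c d p" by simp
    ultimately show "pdeg c d p = kk r + int (ll r) * d (ii r) - n"
      using n vpalg_single unfolding mdegree_KG by blast
  qed
next
  assume *: "\<forall>r p. hat \<phi> (r, p) \<noteq> 0 \<longrightarrow> pdeg c d p = kk r + int (ll r) * d (ii r) - n"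
  show "\<phi> \<in> mdegree KG n" unfolding mdegree_KG
  proof (intro conjI ballI allI impI \<phi>)
    fix r f m assume r: "r \<in> RS" and f: "f \<in> vpalg c"
      and m: "(\<forall>p\<in>Poly_Mapping.keys f. pdeg c d p = m) \<and> \<phi> (r, qc r f) \<noteq> 0"
    then have "plin (\<lambda>p. hat \<phi> (r, p)) f \<noteq> 0" using hat_plin[OF \<phi> r f] by simp
    then obtain p where p: "p \<in> Poly_Mapping.keys f" "hat \<phi> (r, p) \<noteq> 0"
      unfolding plin_def by (metis (mono_tags, lifting) mult_zero_right sum.neutral)
    have "pdeg c d p = m" using m p by blast
    then show "m = kk r + int (ll r) * d (ii r) - n" using *[rule_format, OF p(2)] by simp
  qed
qed

end

section \<open>Ordered bases\<close>

lemma sum_cscale: "(\<Sum>p\<in>A. cscale (u p) (b p)) x = (\<Sum>p\<in>A. u p * b p x)"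
  by (induction A rule: infinite_finite_induct) (auto simp: cscale_def)

text \<open>Replaces sets of vectors by families with coefficients. Injectivity is contained in the
  right hand side: b p = b q would give the relation with coefficients 1 at p and - 1 at q.\<close>

lemma ordered_basis_iff:
  "ordered_basis n S b \<longleftrightarrow> (\<forall>u. (\<forall>x. (\<Sum>p<n. u p * b p x) = 0) \<longrightarrow> (\<forall>p<n. u p = 0)) \<and>
     S = {\<phi>. \<exists>u. \<forall>x. \<phi> x = (\<Sum>p<n. u p * b p x)}"
proof -
  have span: "cfun.span (b ` {..<n}) = {\<phi>. \<exists>u. \<forall>x. \<phi> x = (\<Sum>p<n. u p * b p x)}" if inj: "inj_on b {..<n}"
  proof -
    have "cfun.span (b ` {..<n}) = range (\<lambda>u. \<Sum>v\<in>b ` {..<n}. cscale (u v) v)"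
      by (rule cfun.span_finite) simp
    also have "\<dots> = range (\<lambda>u. \<Sum>p<n. cscale (u (b p)) (b p))"
      by (simp add: sum.reindex[OF inj] o_def)
    also have "\<dots> = range (\<lambda>u. \<Sum>p<n. cscale (u p) (b p))"
    proof (intro equalityI subsetI; elim rangeE)
      fix x u assume "x = (\<Sum>p<n. cscale (u (b p)) (b p))"
      then show "x \<in> range (\<lambda>u. \<Sum>p<n. cscale (u p) (b p))" by (intro range_eqI[of _ _ "u \<circ> b"]) simp
    next
      fix x u assume "x = (\<Sum>p<n. cscale (u p) (b p))"
      also have "\<dots> = (\<Sum>p<n. cscale (u (inv_into {..<n} b (b p))) (b p))"
        by (intro sum.cong refl) (simp add: inv_into_f_f[OF inj])
      finally show "x \<in> range (\<lambda>u. \<Sum>p<n. cscale (u (b p)) (b p))"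
        by (intro range_eqI[of _ _ "u \<circ> inv_into {..<n} b"]) simp
    qed
    also have "\<dots> = {\<phi>. \<exists>u. \<forall>x. \<phi> x = (\<Sum>p<n. u p * b p x)}"
      by (auto simp: fun_eq_iff sum_cscale)
    finally show ?thesis .
  qed
  have ind: "\<not> cfun.dependent (b ` {..<n}) \<longleftrightarrow> (\<forall>u. (\<forall>x. (\<Sum>p<n. u p * b p x) = 0) \<longrightarrow> (\<forall>p<n. u p = 0))"
    if inj: "inj_on b {..<n}"
  proof -
    have "cfun.dependent (b ` {..<n}) \<longleftrightarrow> (\<exists>u. (\<exists>v\<in>b ` {..<n}. u v \<noteq> 0) \<and> (\<Sum>v\<in>b ` {..<n}. cscale (u v) v) = 0)"
      by (rule cfun.dependent_finite) simp
    also have "\<dots> \<longleftrightarrow> (\<exists>u. (\<exists>p<n. u (b p) \<noteq> 0) \<and> (\<forall>x. (\<Sum>p<n. u (b p) * b p x) = 0))"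
      by (auto simp: sum.reindex[OF inj] o_def fun_eq_iff sum_cscale)
    also have "\<dots> \<longleftrightarrow> (\<exists>u. (\<exists>p<n. u p \<noteq> 0) \<and> (\<forall>x. (\<Sum>p<n. u p * b p x) = 0))"
    proof (intro iffI; elim exE conjE)
      fix u p assume *: "p < n" "u (b p) \<noteq> 0" "\<forall>x. (\<Sum>p<n. u (b p) * b p x) = 0"
      then show "\<exists>u. (\<exists>p<n. u p \<noteq> 0) \<and> (\<forall>x. (\<Sum>p<n. u p * b p x) = 0)"
        by (intro exI[of _ "u \<circ> b"]) auto
    next
      fix u p assume *: "p < n" "u p \<noteq> 0" "\<forall>x. (\<Sum>p<n. u p * b p x) = 0"
      have "(\<Sum>p<n. u (inv_into {..<n} b (b p)) * b p x) = (\<Sum>p<n. u p * b p x)" for x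
        by (intro sum.cong refl) (simp add: inv_into_f_f[OF inj])
      moreover have "u (inv_into {..<n} b (b p)) \<noteq> 0" using * by (simp add: inv_into_f_f[OF inj])
      ultimately show "\<exists>u. (\<exists>p<n. u (b p) \<noteq> 0) \<and> (\<forall>x. (\<Sum>p<n. u (b p) * b p x) = 0)"
        using * by (intro exI[of _ "u \<circ> inv_into {..<n} b"]) auto
    qed
    finally show ?thesis by blast
  qed
  have inj: "inj_on b {..<n}" if *: "\<forall>u. (\<forall>x. (\<Sum>p<n. u p * b p x) = 0) \<longrightarrow> (\<forall>p<n. u p = 0)"
  proof (rule inj_onI, rule ccontr)
    fix p q assume pq: "p \<in> {..<n}" "q \<in> {..<n}" "b p = b q" "p \<noteq> q"
    define u :: "nat \<Rightarrow> complex" where "u = (\<lambda>m. if m = p then 1 else if m = q then -1 else 0)"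
    have "(\<Sum>m<n. u m * b m x) = (\<Sum>m\<in>{p, q}. u m * b m x)" for x
      by (intro sum.mono_neutral_right) (use pq in \<open>auto simp: u_def\<close>)
    then have "(\<Sum>m<n. u m * b m x) = 0" for x using pq by (simp add: u_def)
    then have "u p = 0" using * pq by auto
    then show False by (simp add: u_def)
  qed
  show ?thesis unfolding ordered_basis_def using span ind inj by blast
qed

section \<open>Linear maps between function spaces\<close>

definition clin :: "(('a \<Rightarrow> complex) \<Rightarrow> 'b \<Rightarrow> complex) \<Rightarrow> bool" where
  "clin f \<longleftrightarrow> (\<forall>u v. f (u + v) = f u + f v) \<and> (\<forall>a u. f (cscale a u) = cscale a (f u))"

lemma clin_add: "clin f \<Longrightarrow> f (u + v) = f u + f v"
  and clin_scale: "clin f \<Longrightarrow> f (cscale a u) = cscale a (f u)"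
  by (simp_all only: clin_def)

lemma cscale_0 [simp]: "cscale 0 u = 0" "cscale a 0 = 0"
  by (auto simp: cscale_def fun_eq_iff)

lemma cscale_1 [simp]: "cscale 1 u = u"
  by (auto simp: cscale_def fun_eq_iff)

lemma cscale_cscale [simp]: "cscale a (cscale b u) = cscale (a * b) u"
  by (auto simp: cscale_def fun_eq_iff)

lemma clin_0: "clin f \<Longrightarrow> f 0 = 0"
  using clin_scale[of f 0 0] by simp

lemma clin_sum: "clin f \<Longrightarrow> f (sum F A) = (\<Sum>x\<in>A. f (F x))"
  by (induction A rule: infinite_finite_induct)
    (simp_all only: sum.insert sum.infinite sum.empty clin_0 clin_add not_False_eq_True)

lemma clin_diff: "clin f \<Longrightarrow> f (u - v) = f u - f v"
proof -
  assume f: "clin f"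
  have "f (u - v + v) = f (u - v) + f v" by (rule clin_add[OF f])
  then show ?thesis by (simp only: diff_add_cancel add_diff_cancel_right')
qed

lemma clin_comp: "clin f \<Longrightarrow> clin g \<Longrightarrow> clin (\<lambda>u. f (g u))"
  by (simp add: clin_def)

lemma clin_id: "clin (\<lambda>u. u)"
  by (simp add: clin_def)

lemma clin_vimage: "clin f \<Longrightarrow> cfun.subspace S \<Longrightarrow> cfun.subspace {u. f u \<in> S}"
  by (rule cfun.subspaceI) (auto simp only: mem_Collect_eq clin_0 clin_add clin_scale
      intro: cfun.subspace_0 cfun.subspace_add cfun.subspace_scale)

lemma clin_image: "clin f \<Longrightarrow> cfun.subspace S \<Longrightarrow> cfun.subspace (f ` S)"
proof (rule cfun.subspaceI)
  assume f: "clin f" and S: "cfun.subspace S"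
  show "0 \<in> f ` S" using clin_0[OF f] cfun.subspace_0[OF S] by (metis image_eqI)
  show "x + y \<in> f ` S" if "x \<in> f ` S" "y \<in> f ` S" for x y
    using that clin_add[OF f, symmetric] cfun.subspace_add[OF S] by (auto simp del: plus_fun_apply)
  show "cscale a x \<in> f ` S" if "x \<in> f ` S" for x a
    using that clin_scale[OF f, symmetric] cfun.subspace_scale[OF S] by auto
qed

lemma span_mem_sum:
  "(\<And>x. x \<in> A \<Longrightarrow> F x \<in> cfun.span B) \<Longrightarrow> (\<Sum>x\<in>A. cscale (a x) (F x)) \<in> cfun.span B"
  by (intro cfun.span_sum cfun.span_scale)

lemma indep_card_le:
  assumes "\<not> cfun.dependent B" "B \<subseteq> cfun.span C" "finite C"
  shows "finite B \<and> card B \<le> card C"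
  using cfun.independent_span_bound[OF assms(3,1,2)] .

lemma cdim_le:
  assumes "T \<subseteq> cfun.span C" "finite C" shows "cfun.dim T \<le> card C"
proof -
  obtain B where "B \<subseteq> T" "\<not> cfun.dependent B" "T \<subseteq> cfun.span B" "card B = cfun.dim T"
    using cfun.basis_exists[of T] by blast
  then show ?thesis using indep_card_le[of B C] assms by auto
qed

lemma cdim_mono:
  assumes "S \<subseteq> T" "T \<subseteq> cfun.span C" "finite C" shows "cfun.dim S \<le> cfun.dim T"
proof -
  obtain B where B: "B \<subseteq> T" "\<not> cfun.dependent B" "T \<subseteq> cfun.span B" "card B = cfun.dim T"
    using cfun.basis_exists[of T] by blast
  then have "finite B" using indep_card_le[of B C] assms by auto
  then show ?thesis using cdim_le[of S B] B assms by auto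
qed

text \<open>\<open>cfun.dim\<close> does not see infinite dimension, hence the finite spanning set
  C. A vector of T outside S would extend a basis of S to an independent set larger than the
  dimension of T.\<close>

lemma cdim_eq:
  assumes S: "cfun.subspace S" and "S \<subseteq> T" "T \<subseteq> cfun.span C" "finite C" "cfun.dim T \<le> cfun.dim S"
  shows "S = T"
proof (rule ccontr)
  assume "S \<noteq> T"
  then obtain x where x: "x \<in> T" "x \<notin> S" using assms by auto
  obtain B where B: "B \<subseteq> T" "\<not> cfun.dependent B" "T \<subseteq> cfun.span B" "card B = cfun.dim T"
    using cfun.basis_exists[of T] by blast
  then have fB: "finite B" using indep_card_le[of B C] assms by auto
  obtain B' where B': "B' \<subseteq> S" "\<not> cfun.dependent B'" "S \<subseteq> cfun.span B'" "card B' = cfun.dim S"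
    using cfun.basis_exists[of S] by blast
  have "cfun.span B' \<subseteq> S" using B'(1) S by (rule cfun.span_minimal)
  then have "x \<notin> cfun.span B'" using x by auto
  then have "\<not> cfun.dependent (insert x B')" "x \<notin> B'"
    using B'(2) cfun.independent_insertI cfun.span_base by blast+
  moreover have "insert x B' \<subseteq> cfun.span B" using x B B' assms by auto
  moreover have "finite B'" using indep_card_le[of B' B] B B' fB assms by auto
  ultimately have "Suc (card B') \<le> card B" using indep_card_le[of "insert x B'" B] fB by auto
  then show False using B B' assms by auto
qed

text \<open>Counting a family instead of its range matters: the family in
  \<open>dimension_inequality\<close> has two members for each basis vector, and their distinctness
  is part of what independence gives.\<close>

lemma family_card_le:
  assumes I: "finite I" and ind: "\<And>u. (\<Sum>i\<in>I. cscale (u i) (v i)) = 0 \<Longrightarrow> (\<forall>i\<in>I. u i = 0)"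
    and sp: "v ` I \<subseteq> cfun.span C" "finite C"
  shows "card I \<le> card C"
proof -
  have inj: "inj_on v I"
  proof (rule inj_onI, rule ccontr)
    fix p q assume pq: "p \<in> I" "q \<in> I" "v p = v q" "p \<noteq> q"
    define w :: "'a \<Rightarrow> complex" where "w = (\<lambda>m. if m = p then 1 else if m = q then -1 else 0)"
    have "(\<Sum>m\<in>I. cscale (w m) (v m)) = (\<Sum>m\<in>{p, q}. cscale (w m) (v m))"
      by (rule sum.mono_neutral_right[OF I]) (use pq in \<open>auto simp: w_def\<close>)
    also have "\<dots> = 0" using pq by (auto simp: cscale_def fun_eq_iff w_def)
    finally have "w p = 0" using ind[of w] pq by blast
    then show False by (simp add: w_def)
  qed
  have "\<not> cfun.dependent (v ` I)"
  proof
    assume "cfun.dependent (v ` I)"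
    then obtain u where u: "\<exists>w\<in>v ` I. u w \<noteq> 0" "(\<Sum>w\<in>v ` I. cscale (u w) w) = 0"
      using cfun.dependent_finite[of "v ` I"] I by auto
    have "(\<Sum>i\<in>I. cscale (u (v i)) (v i)) = 0" using u(2) by (simp add: sum.reindex[OF inj] o_def)
    then have "\<forall>i\<in>I. u (v i) = 0" by (rule ind)
    then show False using u(1) by blast
  qed
  then have "card (v ` I) \<le> card C" using indep_card_le sp by blast
  then show ?thesis by (simp add: card_image[OF inj])
qed

section \<open>Representations of the quiver\<close>

text \<open>One notation for the entries of \<alpha> and of \<epsilon>, so that operators of words,
  degrees and supports are handled for both kinds of arrows at once.\<close>

definition xe :: "'i rep \<Rightarrow> 'i arrow \<Rightarrow> nat \<Rightarrow> nat \<Rightarrow> complex" where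
  "xe x a p q = (case a of Al i j \<Rightarrow> x (CAlpha i j p q) | Ep i \<Rightarrow> x (CEps i p q))"

definition aop :: "('i \<Rightarrow> nat) \<Rightarrow> 'i rep \<Rightarrow> 'i arrow \<Rightarrow> (nat \<Rightarrow> complex) \<Rightarrow> nat \<Rightarrow> complex" where
  "aop n x a u = (\<lambda>p. \<Sum>q<n (asource a). xe x a p q * u q)"

definition opw :: "('i \<Rightarrow> nat) \<Rightarrow> 'i rep \<Rightarrow> 'i arrow list \<Rightarrow> (nat \<Rightarrow> complex) \<Rightarrow> nat \<Rightarrow> complex" where
  "opw n x w u = foldr (aop n x) w u"

text \<open>Vectors of V_i as functions supported below n i: operators of words then compose without
  carrying dimensions, and the vector space \<open>cfun\<close> is available.\<close>

definition VV :: "('i \<Rightarrow> nat) \<Rightarrow> 'i \<Rightarrow> (nat \<Rightarrow> complex) set" where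
  "VV n i = {u. \<forall>p. n i \<le> p \<longrightarrow> u p = 0}"

definition ev :: "nat \<Rightarrow> nat \<Rightarrow> complex" where "ev p = (\<lambda>q. if q = p then 1 else 0)"

lemma opw_simps [simp]: "opw n x [] u = u" "opw n x (a # w) u = aop n x a (opw n x w u)"
  "opw n x (w @ w') u = opw n x w (opw n x w' u)"
  by (simp_all add: opw_def)

lemma clin_aop: "clin (aop n x a)"
  by (auto simp: clin_def aop_def cscale_def fun_eq_iff distrib_left sum.distrib sum_distrib_left mult.left_commute)

lemma clin_opw: "clin (opw n x w)"
  by (induction w) (auto simp: clin_comp[OF clin_aop] simp del: plus_fun_apply intro: clin_id)

lemma subspace_VV [simp]: "cfun.subspace (VV n i)"
  by (rule cfun.subspaceI) (auto simp: VV_def cscale_def)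

lemma VV_expand: "u \<in> VV n i \<Longrightarrow> u = (\<Sum>p<n i. cscale (u p) (ev p))"
proof
  fix y assume u: "u \<in> VV n i"
  have "(\<Sum>p<n i. u p * ev p y) = (\<Sum>p<n i. if p = y then u y else 0)"
    by (intro sum.cong) (auto simp: ev_def)
  then show "u y = (\<Sum>p<n i. cscale (u p) (ev p)) y" using u by (simp add: sum_cscale VV_def)
qed

lemma VV_span: "VV n i \<subseteq> cfun.span (ev ` {..<n i})"
proof
  fix u assume "u \<in> VV n i"
  then have "u = (\<Sum>p<n i. cscale (u p) (ev p))" by (rule VV_expand)
  also have "\<dots> \<in> cfun.span (ev ` {..<n i})" by (rule span_mem_sum) (auto intro: cfun.span_base)
  finally show "u \<in> cfun.span (ev ` {..<n i})" .
qed

lemma ev_VV: "p < n i \<Longrightarrow> ev p \<in> VV n i"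
  by (auto simp: ev_def VV_def)

lemma aop_VV:
  assumes "\<And>p q. xe x a p q \<noteq> 0 \<Longrightarrow> p < n (atarget a)"
  shows "aop n x a u \<in> VV n (atarget a)"
proof -
  have "xe x a p q = 0" if "n (atarget a) \<le> p" for p q using assms[of p q] that by auto
  then show ?thesis by (auto simp: aop_def VV_def)
qed

text \<open>A finite dimensional module over the preprojective algebra of finite type with nilpotent
  loops. The framing is forgotten here; it serves to verify \<open>eps_nil\<close>.\<close>

locale qrep = preproj c d Or for c :: "'i::finite \<Rightarrow> 'i \<Rightarrow> int" and d Or +
  fixes n :: "'i \<Rightarrow> nat" and x :: "'i rep"
  assumes c_diag: "\<And>i. c i i = 2" and c_off: "\<And>i j. i \<noteq> j \<Longrightarrow> c i j \<le> 0"
    and posdef: "\<exists>d. symmetrizer c d \<and> (\<forall>x :: 'i \<Rightarrow> real. (\<exists>i. x i \<noteq> 0) \<longrightarrow>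
           0 < (\<Sum>i\<in>UNIV. \<Sum>j\<in>UNIV. real_of_int (d i * c i j) * x i * x j))"
    and osign_sq: "\<And>i j. c i j < 0 \<Longrightarrow> osign Or i j * osign Or i j = 1"
    and supp: "\<And>a p q. xe x a p q \<noteq> 0 \<Longrightarrow> p < n (atarget a)"
    and comm: "\<And>i j u. c i j < 0 \<Longrightarrow> u \<in> VV n j \<Longrightarrow>
        opw n x (replicate (nat (- c i j)) (Ep i)) (aop n x (Al i j) u)
          = aop n x (Al i j) (opw n x (replicate (nat (- c j i)) (Ep j)) u)"
    and mesh: "\<And>i u. u \<in> VV n i \<Longrightarrow> (\<Sum>j\<in>UNIV. \<Sum>k<nat (- c i j). cscale (osign Or i j)
        (opw n x (replicate k (Ep i)) (aop n x (Al i j) (aop n x (Al j i)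
          (opw n x (replicate (nat (- c i j) - 1 - k) (Ep i)) u))))) = 0"
    and eps_nil: "\<exists>N. \<forall>i. \<forall>u\<in>VV n i. opw n x (replicate N (Ep i)) u = 0"
begin

abbreviation "V \<equiv> VV n"
abbreviation "A \<equiv> aop n x"
abbreviation "W \<equiv> opw n x"
abbreviation "E i k \<equiv> opw n x (replicate k (Ep i))"

lemma A_V: "A a u \<in> V (atarget a)" by (intro aop_VV supp)

lemma W_V: "is_path c (t, w) \<Longrightarrow> psource (t, w) = i \<Longrightarrow> u \<in> V i \<Longrightarrow> W w u \<in> V t"
proof (cases w)
  case (Cons a w')
  moreover assume "is_path c (t, w)"
  ultimately have "atarget a = t" by simp
  then show ?thesis using A_V[of a] Cons by simp
qed auto

lemma E_V: "u \<in> V i \<Longrightarrow> E i k u \<in> V i"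
  by (rule W_V) auto

definition subrep :: "('i \<Rightarrow> (nat \<Rightarrow> complex) set) \<Rightarrow> bool" where
  "subrep S \<longleftrightarrow> (\<forall>i. cfun.subspace (S i) \<and> S i \<subseteq> V i) \<and>
     (\<forall>a. arrow_ok c a \<longrightarrow> A a ` S (asource a) \<subseteq> S (atarget a))"

lemma subrep_A: "subrep S \<Longrightarrow> arrow_ok c a \<Longrightarrow> u \<in> S (asource a) \<Longrightarrow> A a u \<in> S (atarget a)"
  by (auto simp: subrep_def image_subset_iff)

lemma subrep_E: "subrep S \<Longrightarrow> u \<in> S i \<Longrightarrow> E i k u \<in> S i"
  by (induction k) (use subrep_A[of S "Ep i"] in auto)

lemma subrep_sub: "subrep S \<Longrightarrow> cfun.subspace (S i)" "subrep S \<Longrightarrow> u \<in> S i \<Longrightarrow> u \<in> V i"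
  by (auto simp: subrep_def)

text \<open>An ascending filtration: by \<open>FF_Suc\<close> the next step consists of the vectors
  that every arrow sends into the present one, an iterated socle.\<close>

definition FF :: "nat \<Rightarrow> 'i \<Rightarrow> (nat \<Rightarrow> complex) set" where
  "FF k i = {u \<in> V i. \<forall>t w. is_path c (t, w) \<and> psource (t, w) = i \<and> length w = k \<longrightarrow> W w u = 0}"

lemma FF_D: "u \<in> FF k i \<Longrightarrow> is_path c (t, w) \<Longrightarrow> psource (t, w) = i \<Longrightarrow> length w = k \<Longrightarrow> W w u = 0"
  by (auto simp: FF_def)

lemma FF_V: "u \<in> FF k i \<Longrightarrow> u \<in> V i" by (auto simp: FF_def)

lemma FF_0: "FF 0 i = {0}"
proof -
  have "u = 0" if "u \<in> FF 0 i" for u using FF_D[OF that, of i "[]"] by simp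
  moreover have "0 \<in> FF 0 i" using cfun.subspace_0[OF subspace_VV] by (simp add: FF_def clin_0[OF clin_opw])
  ultimately show ?thesis by blast
qed

lemma subspace_FF: "cfun.subspace (FF k i)"
proof (rule cfun.subspaceI)
  show "0 \<in> FF k i" using cfun.subspace_0[OF subspace_VV] unfolding FF_def mem_Collect_eq
    by (simp add: clin_0[OF clin_opw])
  fix u v assume uv: "u \<in> FF k i" "v \<in> FF k i"
  then have "u + v \<in> V i" by (intro cfun.subspace_add[OF subspace_VV]) (auto dest: FF_V)
  then show "u + v \<in> FF k i" using uv unfolding FF_def mem_Collect_eq clin_add[OF clin_opw]
    by auto
next
  fix a u assume u: "u \<in> FF k i"
  then have "cscale a u \<in> V i" by (intro cfun.subspace_scale[OF subspace_VV]) (auto dest: FF_V)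
  then show "cscale a u \<in> FF k i" using u unfolding FF_def mem_Collect_eq clin_scale[OF clin_opw]
    by auto
qed

lemma FF_Suc:
  "u \<in> FF (Suc k) i \<longleftrightarrow> u \<in> V i \<and> (\<forall>a. arrow_ok c a \<and> asource a = i \<longrightarrow> A a u \<in> FF k (atarget a))"
proof (intro iffI conjI allI impI; (elim conjE)?)
  assume u: "u \<in> FF (Suc k) i"
  then show "u \<in> V i" by (rule FF_V)
  fix a assume a: "arrow_ok c a" "asource a = i"
  have "W w (A a u) = 0" if "is_path c (t, w)" "psource (t, w) = atarget a" "length w = k" for t w
    using FF_D[OF u, of t "w @ [a]"] that a by (simp add: is_path_append psource_append is_path_Cons del: is_path.simps(2))
  then show "A a u \<in> FF k (atarget a)" unfolding FF_def using A_V by blast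
next
  assume u: "u \<in> V i" and a: "\<forall>a. arrow_ok c a \<and> asource a = i \<longrightarrow> A a u \<in> FF k (atarget a)"
  have "W w u = 0" if w: "is_path c (t, w)" "psource (t, w) = i" "length w = Suc k" for t w
  proof -
    obtain w' b where "w = w' @ [b]" using w(3) by (metis length_Suc_conv_rev)
    then have b: "is_path c (t, w')" "psource (t, w') = atarget b" "arrow_ok c b" "asource b = i" "length w' = k"
      using w by (auto simp: is_path_append psource_append is_path_Cons simp del: is_path.simps(2))
    then show ?thesis using FF_D[of "A b u" k] a \<open>w = w' @ [b]\<close> by auto
  qed
  then show "u \<in> FF (Suc k) i" unfolding FF_def using u by blast
qed

text \<open>Here the letter applied last is removed, in \<open>FF_Suc\<close> the letter applied
  first; together they make each step a subrepresentation.\<close>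

lemma FF_mono: "FF k i \<subseteq> FF (Suc k) i"
proof
  fix u assume u: "u \<in> FF k i"
  have "W w u = 0" if w: "is_path c (t, w)" "psource (t, w) = i" "length w = Suc k" for t w
  proof -
    obtain b w' where bw: "w = b # w'" using w(3) by (cases w) auto
    then have "W w' u = 0" using w by (intro FF_D[OF u]) (auto simp: is_path_Cons simp del: is_path.simps(2))
    then show ?thesis by (simp add: bw clin_0[OF clin_aop])
  qed
  then show "u \<in> FF (Suc k) i" unfolding FF_def using FF_V[OF u] by blast
qed

lemma subrep_FF: "subrep (FF k)"
  unfolding subrep_def
proof (intro conjI allI impI)
  fix a assume "arrow_ok c a"
  then show "A a ` FF k (asource a) \<subseteq> FF k (atarget a)"
    using FF_mono[of k "asource a"] FF_Suc by auto
qed (auto simp: subspace_FF FF_V)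

text \<open>The total dimension is bounded by the sum of the n i, so it has a maximum at some N; the
  step after N cannot be larger.\<close>

lemma FF_stable: obtains N where "\<And>i. FF (Suc N) i = FF N i"
proof -
  have bd: "cfun.dim (FF k i) \<le> n i" for k i
  proof -
    have "FF k i \<subseteq> cfun.span (ev ` {..<n i})" using FF_V VV_span[of n i] by blast
    then have "cfun.dim (FF k i) \<le> card (ev ` {..<n i})" by (rule cdim_le) simp
    also have "\<dots> \<le> n i" using card_image_le[of "{..<n i}" ev] by simp
    finally show ?thesis .
  qed
  let ?s = "\<lambda>k. \<Sum>i\<in>UNIV. cfun.dim (FF k i)"
  have "\<exists>N. True \<and> (\<forall>k. True \<longrightarrow> ?s k \<le> ?s N)"
    by (rule ex_has_greatest_nat[of "\<lambda>_. True" 0 ?s "Suc (\<Sum>i\<in>UNIV. n i)"])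
      (auto simp: le_imp_less_Suc sum_mono bd intro!: le_SucI sum_mono bd)
  then obtain N where N: "\<And>k. ?s k \<le> ?s N" by blast
  have sp: "FF k i \<subseteq> cfun.span (ev ` {..<n i})" for k i using FF_V VV_span[of n i] by blast
  have mono: "cfun.dim (FF N i) \<le> cfun.dim (FF (Suc N) i)" for i
    by (rule cdim_mono[OF FF_mono sp]) simp
  then have "?s N \<le> ?s (Suc N)" by (intro sum_mono)
  then have eq: "?s N = ?s (Suc N)" using N[of "Suc N"] by simp
  have "cfun.dim (FF N i) = cfun.dim (FF (Suc N) i)" for i
    by (rule sum_mono_inv[OF eq]) (auto simp: mono)
  then have "FF N i = FF (Suc N) i" for i
    by (intro cdim_eq[OF subspace_FF FF_mono sp]) auto
  then show ?thesis using that by metis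
qed

end

section \<open>The complex from S_i to the sum of the S_j^f to S_i, modulo a stable step of the
  filtration\<close>

context qrep
begin

lemma E_Suc: "E i (Suc k) u = A (Ep i) (E i k u)" by simp

lemma E_add: "E i (k + l) u = E i k (E i l u)"
  by (simp add: replicate_add)

lemma E_snoc: "E i (Suc k) u = E i k (A (Ep i) u)"
  using E_add[where i = i and k = k and l = 1 and u = u] by simp

text \<open>Equal to - c_ij off the diagonal and to 0 on it, since c_ii = 2; sums over all j
  therefore skip j = i.\<close>

definition ffm :: "'i \<Rightarrow> 'i \<Rightarrow> nat" where "ffm i j = nat (- c i j)"

lemma ffm_pos: "0 < ffm i j \<longleftrightarrow> c i j < 0" by (simp add: ffm_def)

lemma comm': "c i j < 0 \<Longrightarrow> u \<in> V j \<Longrightarrow> E i (ffm i j) (A (Al i j) u) = A (Al i j) (E j (ffm j i) u)"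
  unfolding ffm_def by (rule comm)

lemma mesh': "u \<in> V i \<Longrightarrow> (\<Sum>j\<in>UNIV. \<Sum>k<ffm i j. cscale (osign Or i j)
        (E i k (A (Al i j) (A (Al j i) (E i (ffm i j - 1 - k) u))))) = 0"
  unfolding ffm_def by (rule mesh)

text \<open>Take S of least total dimension. F plus all images of arrows from S is again a
  subrepresentation above F. It is not F, as otherwise every arrow would send S into F and
  \<open>soc\<close> would give S = F; so by minimality it is S.\<close>

lemma minimal_subrep:
  assumes F: "subrep F" and soc: "\<And>i u. u \<in> V i \<Longrightarrow>
      (\<And>a. arrow_ok c a \<Longrightarrow> asource a = i \<Longrightarrow> A a u \<in> F (atarget a)) \<Longrightarrow> u \<in> F i"
    and ne: "F \<noteq> V"
  obtains S where "subrep S" "\<And>i. F i \<subseteq> S i" "S \<noteq> F"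
    "\<And>i. S i \<subseteq> cfun.span (F i \<union> (\<Union>a\<in>{a. arrow_ok c a \<and> atarget a = i}. A a ` S (asource a)))"
proof -
  let ?P = "\<lambda>S. subrep S \<and> (\<forall>i. F i \<subseteq> S i) \<and> S \<noteq> F"
  have "subrep V" unfolding subrep_def using A_V by auto
  moreover have "F i \<subseteq> V i" for i using F by (auto simp: subrep_def)
  ultimately have "?P V" using ne by auto
  then obtain S where S: "?P S"
    and min: "\<And>S'. ?P S' \<Longrightarrow> (\<Sum>i\<in>UNIV. cfun.dim (S i)) \<le> (\<Sum>i\<in>UNIV. cfun.dim (S' i))"
    using ex_has_least_nat[of ?P V "\<lambda>S. \<Sum>i\<in>UNIV. cfun.dim (S i)"] by blast
  define S' where "S' i = cfun.span (F i \<union> (\<Union>a\<in>{a. arrow_ok c a \<and> atarget a = i}. A a ` S (asource a)))" for i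
  have sub: "S' i \<subseteq> S i" for i
    unfolding S'_def using S by (intro cfun.span_minimal) (auto simp: subrep_sub intro: subrep_A)
  have FS': "F i \<subseteq> S' i" for i unfolding S'_def by (auto intro: cfun.span_base)
  have AS: "A a u \<in> S' (atarget a)" if "arrow_ok c a" "u \<in> S (asource a)" for a u
    unfolding S'_def using that by (intro cfun.span_base) auto
  have "subrep S'" unfolding subrep_def
  proof (intro conjI allI impI)
    show "cfun.subspace (S' i)" for i unfolding S'_def by (rule cfun.subspace_span)
    show "S' i \<subseteq> V i" for i using sub[of i] S by (auto simp: subrep_def)
    show "A a ` S' (asource a) \<subseteq> S' (atarget a)" if "arrow_ok c a" for a
      using AS[OF that] sub by blast
  qed
  moreover have "S' \<noteq> F"
  proof
    assume "S' = F"
    then have AF: "A a u \<in> F (atarget a)" if "arrow_ok c a" "u \<in> S (asource a)" for a u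
      using AS[OF that] by simp
    have "S i \<subseteq> F i" for i
    proof
      fix u assume u: "u \<in> S i"
      show "u \<in> F i"
      proof (rule soc)
        show "u \<in> V i" using u S subrep_sub(2) by blast
      qed (use AF u in auto)
    qed
    then have "S = F" using S by (intro ext) blast
    then show False using S by simp
  qed
  ultimately have "?P S'" using FS' by auto
  then have le: "(\<Sum>i\<in>UNIV. cfun.dim (S i)) \<le> (\<Sum>i\<in>UNIV. cfun.dim (S' i))" by (rule min)
  have sp: "S i \<subseteq> cfun.span (ev ` {..<n i})" for i using S VV_span[of n i] subrep_sub(2)[of S] by blast
  have mono: "cfun.dim (S' i) \<le> cfun.dim (S i)" for i
    by (rule cdim_mono[OF sub sp]) simp
  then have "(\<Sum>i\<in>UNIV. cfun.dim (S' i)) \<le> (\<Sum>i\<in>UNIV. cfun.dim (S i))" by (intro sum_mono)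
  then have eq: "(\<Sum>i\<in>UNIV. cfun.dim (S' i)) = (\<Sum>i\<in>UNIV. cfun.dim (S i))" using le by simp
  have "cfun.dim (S' i) = cfun.dim (S i)" for i
    by (rule sum_mono_inv[OF eq]) (auto simp: mono)
  moreover have "cfun.subspace (S' i)" for i unfolding S'_def by (rule cfun.subspace_span)
  ultimately have "S' i = S i" for i
    by (intro cdim_eq[OF _ sub sp]) auto
  then have "S i \<subseteq> cfun.span (F i \<union> (\<Union>a\<in>{a. arrow_ok c a \<and> atarget a = i}. A a ` S (asource a)))" for i
    using S'_def by (metis order_refl)
  then show ?thesis using that S by blast
qed

text \<open>Nakayama's lemma for the loop at i. The space T of the claimed sums is stable under
  \<epsilon>, and \<open>rad\<close> gives S_i = T + \<epsilon> S_i. Iterating, S_i = T +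
  \<epsilon>^k S_i for all k, and \<epsilon> is nilpotent.\<close>

lemma decompose:
  assumes F: "subrep F" and S: "subrep S" and FS: "\<And>i. F i \<subseteq> S i"
    and rad: "\<And>i. S i \<subseteq> cfun.span (F i \<union> (\<Union>a\<in>{a. arrow_ok c a \<and> atarget a = i}. A a ` S (asource a)))"
    and s: "s \<in> S i"
  shows "\<exists>f\<in>F i. \<exists>g. (\<forall>j k. g j k \<in> S j) \<and>
    s = f + (\<Sum>j\<in>UNIV. \<Sum>k<ffm i j. E i k (A (Al i j) (g j k)))"
proof -
  define G where "G g = (\<Sum>j\<in>UNIV. \<Sum>k<ffm i j. E i k (A (Al i j) (g j k)))" for g
  define T where "T = {f + G g | f g. f \<in> F i \<and> (\<forall>j k. g j k \<in> S j)}"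
  have 0: "0 \<in> S j" "0 \<in> F j" for j using S F cfun.subspace_0 subrep_sub(1) by blast+
  have Gadd: "G (\<lambda>j k. g j k + h j k) = G g + G h" for g h
    unfolding G_def by (simp only: clin_add[OF clin_aop] clin_add[OF clin_opw] sum.distrib)
  have Gscale: "G (\<lambda>j k. cscale a (g j k)) = cscale a (G g)" for a g
    unfolding G_def by (simp only: clin_scale[OF clin_aop] clin_scale[OF clin_opw] cfun.scale_sum_right)
  have G0: "G (\<lambda>j k. 0) = 0"
    unfolding G_def by (simp only: clin_0[OF clin_aop] clin_0[OF clin_opw] sum.neutral_const)
  have single: "E i k (A (Al i j) u) \<in> T" if k: "k < ffm i j" and u: "u \<in> S j" for k j u
  proof -
    let ?g = "\<lambda>j' k'. if j' = j \<and> k' = k then u else 0"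
    have "G ?g = (\<Sum>k'<ffm i j. E i k' (A (Al i j) (?g j k')))"
      unfolding G_def
    proof (rule sum.remove[of UNIV j, THEN trans, OF _ _ ])
      have "(\<Sum>j'\<in>UNIV - {j}. \<Sum>k<ffm i j'. E i k (A (Al i j') (?g j' k))) = 0"
        by (intro sum.neutral ballI) (auto simp: clin_0[OF clin_aop] clin_0[OF clin_opw])
      then show "(\<Sum>k<ffm i j. E i k (A (Al i j) (?g j k))) +
          (\<Sum>j'\<in>UNIV - {j}. \<Sum>k<ffm i j'. E i k (A (Al i j') (?g j' k)))
          = (\<Sum>k'<ffm i j. E i k' (A (Al i j) (?g j k')))" by (simp only: add_0_right)
    qed auto
    also have "\<dots> = (\<Sum>k'\<in>{k}. E i k' (A (Al i j) (?g j k')))"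
      using k by (intro sum.mono_neutral_right) (auto simp: clin_0[OF clin_aop] clin_0[OF clin_opw])
    finally have G: "G ?g = E i k (A (Al i j) u)" by simp
    have "0 + G ?g \<in> T" unfolding T_def using u 0 by fastforce
    then show ?thesis by (simp only: G add_0)
  qed
  have subT: "cfun.subspace T"
  proof (rule cfun.subspaceI)
    have "0 + G (\<lambda>j k. 0) \<in> T" unfolding T_def using 0 by blast
    then show "0 \<in> T" by (simp only: G0 add_0)
    fix x y assume "x \<in> T" "y \<in> T"
    then obtain f g f' g' where x: "x = f + G g" "f \<in> F i" "\<forall>j k. g j k \<in> S j"
      and y: "y = f' + G g'" "f' \<in> F i" "\<forall>j k. g' j k \<in> S j" unfolding T_def by blast
    have "x + y = (f + f') + G (\<lambda>j k. g j k + g' j k)" unfolding x y Gadd by (simp only: ac_simps)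
    moreover have "f + f' \<in> F i" "\<forall>j k. g j k + g' j k \<in> S j"
      using x y F S by (auto intro!: cfun.subspace_add subrep_sub(1) simp del: plus_fun_apply)
    ultimately show "x + y \<in> T" unfolding T_def mem_Collect_eq by (intro exI conjI)
  next
    fix a x assume "x \<in> T"
    then obtain f g where x: "x = f + G g" "f \<in> F i" "\<forall>j k. g j k \<in> S j" unfolding T_def by blast
    have "cscale a x = cscale a f + G (\<lambda>j k. cscale a (g j k))"
      unfolding x Gscale by (rule cfun.scale_right_distrib)
    moreover have "cscale a f \<in> F i" "\<forall>j k. cscale a (g j k) \<in> S j"
      using x F S by (auto intro!: cfun.subspace_scale subrep_sub(1))
    ultimately show "cscale a x \<in> T" unfolding T_def mem_Collect_eq by (intro exI conjI)
  qed
  have FT: "F i \<subseteq> T"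
  proof
    fix f assume "f \<in> F i"
    then have "f + G (\<lambda>j k. 0) \<in> T" unfolding T_def using 0 by blast
    then show "f \<in> T" by (simp only: G0 add_0_right)
  qed
  have ET: "A (Ep i) t \<in> T" if "t \<in> T" for t
  proof -
    obtain f g where t: "t = f + G g" "f \<in> F i" "\<forall>j k. g j k \<in> S j" using \<open>t \<in> T\<close> unfolding T_def by blast
    have *: "E i (Suc k) (A (Al i j) (g j k)) \<in> T" if k: "k < ffm i j" for j k
    proof (cases "Suc k < ffm i j")
      case True
      then show ?thesis using t by (intro single) auto
    next
      \<comment> \<open>The exponent has reached f_ij: the commutation relation moves \<epsilon>^f
        to the other side of \<alpha>_ij, where S_j absorbs it, and the exponent drops to 0.\<close>
      case False
      then have eq: "Suc k = ffm i j" using k by simp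
      have cij: "c i j < 0" using k ffm_pos by (metis gr_zeroI not_less0)
      have g: "g j k \<in> S j" using t by blast
      have "E i (Suc k) (A (Al i j) (g j k)) = E i 0 (A (Al i j) (E j (ffm j i) (g j k)))"
        unfolding eq using comm'[OF cij subrep_sub(2)[OF S g]] by simp
      also have "\<dots> \<in> T" using k subrep_E[OF S g] by (intro single) auto
      finally show ?thesis .
    qed
    have "A (Ep i) t = A (Ep i) f + (\<Sum>j\<in>UNIV. \<Sum>k<ffm i j. E i (Suc k) (A (Al i j) (g j k)))"
      unfolding t(1) G_def clin_add[OF clin_aop] clin_sum[OF clin_aop] E_Suc ..
    moreover have "A (Ep i) f \<in> T" using subrep_A[OF F, of "Ep i" f] t FT by auto
    moreover have "(\<Sum>j\<in>UNIV. \<Sum>k<ffm i j. E i (Suc k) (A (Al i j) (g j k))) \<in> T"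
      using * by (intro cfun.subspace_sum[OF subT]) auto
    ultimately show ?thesis using cfun.subspace_add[OF subT] by simp
  qed
  have step: "\<exists>t\<in>T. \<exists>s'\<in>S i. s = t + A (Ep i) s'" if "s \<in> S i" for s
  proof -
    let ?R = "{t + A (Ep i) s' | t s'. t \<in> T \<and> s' \<in> S i}"
    have "cfun.subspace ?R"
      using cfun.subspace_sums[OF subT clin_image[OF clin_aop subrep_sub(1)[OF S, of i], of n x "Ep i"]]
      by (rule back_subst[of cfun.subspace]) blast
    moreover have "F i \<union> (\<Union>a\<in>{a. arrow_ok c a \<and> atarget a = i}. A a ` S (asource a)) \<subseteq> ?R"
    proof (intro Un_least UN_least)
      have zz: "t + A (Ep i) 0 = t" for t by (simp only: clin_0[OF clin_aop] add_0_right)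
      show "F i \<subseteq> ?R"
      proof
        fix t assume "t \<in> F i"
        then have "t + A (Ep i) 0 \<in> ?R" using FT 0 by blast
        then show "t \<in> ?R" by (simp only: zz)
      qed
      fix a assume a: "a \<in> {a. arrow_ok c a \<and> atarget a = i}"
      show "A a ` S (asource a) \<subseteq> ?R"
      proof
        fix t assume "t \<in> A a ` S (asource a)"
        then obtain u where u: "u \<in> S (asource a)" "t = A a u" by blast
        show "t \<in> ?R"
        proof (cases a)
          case (Al i' j)
          then have "E i 0 (A (Al i j) u) \<in> T" using a u ffm_pos[of i j] by (intro single) auto
          then have "t + A (Ep i) 0 \<in> ?R" using 0 u Al a by auto
          then show ?thesis by (simp only: zz)
        next
          case (Ep i')
          then have "u \<in> S i" using a u by simp
          then have "0 + A (Ep i) u \<in> ?R" using cfun.subspace_0[OF subT] by blast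
          then show ?thesis using u a Ep by (simp only: add_0) simp
        qed
      qed
    qed
    ultimately have "cfun.span (F i \<union> (\<Union>a\<in>{a. arrow_ok c a \<and> atarget a = i}. A a ` S (asource a))) \<subseteq> ?R"
      by (intro cfun.span_minimal)
    then show ?thesis using rad[of i] that by blast
  qed
  \<comment> \<open>Iteration of \<open>step\<close>; the part already in T stays there under powers
    of \<epsilon> by \<open>ET\<close>.\<close>
  have "\<exists>t\<in>T. \<exists>s'\<in>S i. s = t + E i k s'" for k
  proof (induction k)
    case 0
    have "s = 0 + E i 0 s" by (simp only: add_0 opw_simps replicate.simps)
    then show ?case using cfun.subspace_0[OF subT] s by blast
  next
    case (Suc k)
    then obtain t s' where t: "t \<in> T" "s' \<in> S i" "s = t + E i k s'" by blast
    obtain t' s'' where t': "t' \<in> T" "s'' \<in> S i" "s' = t' + A (Ep i) s''" using step[OF t(2)] by blast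
    have "s = (t + E i k t') + E i (Suc k) s''"
      unfolding t(3) t'(3) E_snoc clin_add[OF clin_opw] by (simp only: add.assoc)
    moreover have "E i k t' \<in> T" using t'(1) by (induction k) (auto simp: ET)
    ultimately show ?case using t(1) t'(2) cfun.subspace_add[OF subT] by blast
  qed
  moreover obtain N where "\<And>i u. u \<in> V i \<Longrightarrow> E i N u = 0" using eps_nil by blast
  ultimately obtain t where "t \<in> T" "s = t + 0" using subrep_sub(2)[OF S] by metis
  then have "s \<in> T" by (simp only: add_0_right)
  then show ?thesis unfolding T_def G_def by blast
qed

text \<open>The commutation relation extends the hypothesis from exponents below f to all powers of
  \<epsilon>. Then the last \<epsilon>^k s before the powers enter F would be sent into F by every
  arrow, contradicting \<open>soc\<close>.\<close>

lemma inj_mod: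
  assumes F: "subrep F" and soc: "\<And>i u. u \<in> V i \<Longrightarrow>
      (\<And>a. arrow_ok c a \<Longrightarrow> asource a = i \<Longrightarrow> A a u \<in> F (atarget a)) \<Longrightarrow> u \<in> F i"
    and s: "s \<in> V i" and k: "\<And>j k. k < ffm i j \<Longrightarrow> A (Al j i) (E i (ffm i j - 1 - k) s) \<in> F j"
  shows "s \<in> F i"
proof (rule ccontr)
  assume sF: "s \<notin> F i"
  obtain N where N: "E i N s = 0" using eps_nil s by blast
  have 0: "0 \<in> F j" for j using F cfun.subspace_0 subrep_sub(1) by blast
  have all: "A (Al j i) (E i k s) \<in> F j" if cij: "c i j < 0" for j k
  proof (induction k rule: less_induct)
    case (less k')
    show ?case
    proof (cases "k' < ffm i j")
      case True
      then show ?thesis using k[of "ffm i j - 1 - k'" j] by simp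
    next
      case False
      then obtain m where m: "k' = ffm i j + m" by (metis add.commute less_imp_add_positive not_less le_Suc_ex)
      have mk: "m < k'" using m ffm_pos[of i j] cij by simp
      have "A (Al j i) (E i k' s) = E j (ffm j i) (A (Al j i) (E i m s))"
        unfolding m E_add using comm'[OF c_sym[OF cij] E_V[OF s]] by simp
      then show ?thesis using subrep_E[OF F less[OF mk]] by simp
    qed
  qed
  let ?k = "LEAST k. E i k s \<in> F i"
  have "E i N s \<in> F i" using N 0 by simp
  then have k1: "E i ?k s \<in> F i" by (rule LeastI)
  then have "?k \<noteq> 0" using sF by (metis opw_simps(1) replicate_0)
  then obtain k' where k': "?k = Suc k'" by (metis not0_implies_Suc)
  have nk: "E i k' s \<notin> F i" using not_less_Least[of k' "\<lambda>k. E i k s \<in> F i"] k' by auto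
  have "E i k' s \<in> F i"
  proof (rule soc[OF E_V[OF s]])
    fix a assume a: "arrow_ok c a" "asource a = i"
    show "A a (E i k' s) \<in> F (atarget a)"
    proof (cases a)
      case (Al j i')
      then have "c i j < 0" using a c_sym by auto
      then show ?thesis using all[of j k'] Al a by auto
    next
      case (Ep i')
      then show ?thesis using k1 k' a by simp
    qed
  qed
  then show False using nk by simp
qed

end

lemma clin_span:
  assumes f: "clin f" and u: "u \<in> cfun.span B" shows "f u \<in> cfun.span (f ` B)"
proof -
  have "cfun.span B \<subseteq> {u. f u \<in> cfun.span (f ` B)}"
    by (intro cfun.span_minimal clin_vimage f cfun.subspace_span) (auto intro: cfun.span_base)
  then show ?thesis using u by blast
qed

lemma sum_apply: "sum f A t = (\<Sum>x\<in>A. f x t)"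
  by (induction A rule: infinite_finite_induct) auto

lemma indep_zero:
  assumes "finite B" "\<not> cfun.dependent B" "(\<Sum>b\<in>B. cscale (u b) b) = 0" "b \<in> B"
  shows "u b = 0"
  using assms cfun.dependent_finite[of B] by blast

lemma clin_pad: "clin (\<lambda>g. \<lambda>(j, k, y). if j = j0 \<and> k = k0 then g y else 0)"
  by (auto simp: clin_def cscale_def fun_eq_iff)

context qrep
begin

text \<open>Lifts of a basis of S_i / F_i have images under the first map of the complex and, by
  \<open>decompose\<close>, preimages under the second one. These 2 m_i vectors of the middle term
  are independent: the second map kills the images by the mesh relation, which isolates the
  preimages, and the first map is injective modulo F by \<open>inj_mod\<close>. The maps
  \<open>pi\<close> have kernel F and so realize the quotients as spaces of functions.\<close>

lemma dimension_inequality: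
  fixes pi :: "'i \<Rightarrow> (nat \<Rightarrow> complex) \<Rightarrow> 'y \<Rightarrow> complex"
  assumes F: "subrep F" and soc: "\<And>i u. u \<in> V i \<Longrightarrow>
      (\<And>a. arrow_ok c a \<Longrightarrow> asource a = i \<Longrightarrow> A a u \<in> F (atarget a)) \<Longrightarrow> u \<in> F i"
    and S: "subrep S" and FS: "\<And>i. F i \<subseteq> S i"
    and rad: "\<And>i. S i \<subseteq> cfun.span (F i \<union> (\<Union>a\<in>{a. arrow_ok c a \<and> atarget a = i}. A a ` S (asource a)))"
    and pi: "\<And>i. clin (pi i)" "\<And>i u. u \<in> V i \<Longrightarrow> pi i u = 0 \<longleftrightarrow> u \<in> F i"
    and B: "\<And>i. finite (B i)" "\<And>i. \<not> cfun.dependent (B i)" "\<And>i. B i \<subseteq> pi i ` S i"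
      "\<And>i. pi i ` S i \<subseteq> cfun.span (B i)"
  shows "2 * card (B i) \<le> (\<Sum>j\<in>UNIV. ffm i j * card (B j))"
proof -
  have SV: "u \<in> V j" if "u \<in> S j" for u j using subrep_sub(2)[OF S that] .
  have "\<forall>b\<in>B i. \<exists>s. s \<in> S i \<and> pi i s = b" using B(3)[of i] by blast
  then obtain sv where sv: "\<And>b. b \<in> B i \<Longrightarrow> sv b \<in> S i" "\<And>b. b \<in> B i \<Longrightarrow> pi i (sv b) = b"
    by metis
  have "\<forall>b\<in>B i. \<exists>fg. fst fg \<in> F i \<and> (\<forall>j k. snd fg j k \<in> S j) \<and>
    sv b = fst fg + (\<Sum>j\<in>UNIV. \<Sum>k<ffm i j. E i k (A (Al i j) (snd fg j k)))"
  proof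
    fix b assume "b \<in> B i"
    then obtain f g where "f \<in> F i" "\<forall>j k. g j k \<in> S j"
      "sv b = f + (\<Sum>j\<in>UNIV. \<Sum>k<ffm i j. E i k (A (Al i j) (g j k)))"
      using decompose[OF F S FS rad sv(1)] by blast
    then show "\<exists>fg. fst fg \<in> F i \<and> (\<forall>j k. snd fg j k \<in> S j) \<and>
      sv b = fst fg + (\<Sum>j\<in>UNIV. \<Sum>k<ffm i j. E i k (A (Al i j) (snd fg j k)))"
      by (intro exI[of _ "(f, g)"]) simp
  qed
  then obtain fg where fg: "\<And>b. b \<in> B i \<Longrightarrow> fst (fg b) \<in> F i" "\<And>b j k. b \<in> B i \<Longrightarrow> snd (fg b) j k \<in> S j"
    "\<And>b. b \<in> B i \<Longrightarrow> sv b = fst (fg b) + (\<Sum>j\<in>UNIV. \<Sum>k<ffm i j. E i k (A (Al i j) (snd (fg b) j k)))"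
    unfolding bchoice_iff by blast
  define eA where "eA b j k = A (Al j i) (E i (ffm i j - 1 - k) (sv b))" for b j k
  \<comment> \<open>On edges the sign is its own inverse, so this factor cancels the one in
    \<open>Bop\<close>.\<close>
  define eP where "eP b j k = cscale (osign Or i j) (snd (fg b) j k)" for b j k
  define el where "el z = (case z of Inl b \<Rightarrow> eA b | Inr b \<Rightarrow> eP b)" for z
  define v where "v z = (\<lambda>(j, k, y). if k < ffm i j then pi j (el z j k) y else 0)" for z
  \<comment> \<open>Places a copy of S_j / F_j at the index (j, k), one for each k < f_ij; C then
    spans the middle term of the complex.\<close>
  define emb :: "'i \<Rightarrow> nat \<Rightarrow> ('y \<Rightarrow> complex) \<Rightarrow> 'i \<times> nat \<times> 'y \<Rightarrow> complex" where
    "emb j0 k0 = (\<lambda>g. \<lambda>(j, k, y). if j = j0 \<and> k = k0 then g y else 0)" for j0 k0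
  define C where "C = (\<Union>j\<in>UNIV. \<Union>k\<in>{..<ffm i j}. emb j k ` B j)"
  let ?I = "B i <+> B i"
  have cE: "clin (emb j k)" for j k unfolding emb_def by (rule clin_pad)
  have elS: "el z j k \<in> S j" if z: "z \<in> ?I" and k: "k < ffm i j" for z j k
  proof -
    have cij: "c i j < 0" using k ffm_pos[of i j] by linarith
    show ?thesis
    proof (cases z)
      case (Inl b)
      then have "sv b \<in> S i" using z sv by auto
      then show ?thesis using subrep_A[OF S, of "Al j i"] c_sym[OF cij] subrep_E[OF S]
        by (simp add: Inl el_def eA_def)
    next
      case (Inr b)
      then show ?thesis using z fg(2) by (auto simp: el_def eP_def intro!: cfun.subspace_scale[OF subrep_sub(1)[OF S]])
    qed
  qed
  have "card ?I \<le> card C"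
  proof (rule family_card_le)
    show "finite ?I" using B by simp
    show "finite C" unfolding C_def by (intro finite_UN_I finite_imageI B(1)) auto
    show "v ` ?I \<subseteq> cfun.span C"
    proof
      fix g assume "g \<in> v ` ?I"
      then obtain z where z: "z \<in> ?I" "g = v z" by blast
      have "v z = (\<Sum>j\<in>UNIV. \<Sum>k<ffm i j. emb j k (pi j (el z j k)))"
      proof
        fix t :: "'i \<times> nat \<times> 'y"
        obtain j0 k0 y where t: "t = (j0, k0, y)" by (cases t) auto
        have "(\<Sum>j\<in>UNIV. \<Sum>k<ffm i j. emb j k (pi j (el z j k))) t
          = (\<Sum>j\<in>UNIV. \<Sum>k<ffm i j. emb j k (pi j (el z j k)) t)"
          by (simp only: sum_apply)
        also have "\<dots> = (\<Sum>j\<in>UNIV. if j = j0 then (\<Sum>k<ffm i j. if k = k0 then pi j (el z j k) y else 0) else 0)"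
        proof (intro sum.cong refl)
          fix j
          show "(\<Sum>k<ffm i j. emb j k (pi j (el z j k)) t)
            = (if j = j0 then (\<Sum>k<ffm i j. if k = k0 then pi j (el z j k) y else 0) else 0)"
            by (cases "j = j0") (simp_all add: t emb_def eq_commute[of k0])
        qed
        also have "\<dots> = v z t" by (simp add: t v_def)
        finally show "v z t = (\<Sum>j\<in>UNIV. \<Sum>k<ffm i j. emb j k (pi j (el z j k))) t" by simp
      qed
      also have "\<dots> \<in> cfun.span C"
      proof (intro cfun.span_sum)
        fix j k assume "k \<in> {..<ffm i j}"
        then have k: "k < ffm i j" by simp
        have "pi j (el z j k) \<in> cfun.span (B j)" using elS[OF z(1) k] B(4) by blast
        then have "emb j k (pi j (el z j k)) \<in> cfun.span (emb j k ` B j)" by (rule clin_span[OF cE])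
        also have "\<dots> \<subseteq> cfun.span C" unfolding C_def using k by (intro cfun.span_mono) blast
        finally show "emb j k (pi j (el z j k)) \<in> cfun.span C" .
      qed
      finally show "g \<in> cfun.span C" using z by simp
    qed
    fix u assume u: "(\<Sum>z\<in>?I. cscale (u z) (v z)) = 0"
    define e where "e j k = (\<Sum>z\<in>?I. cscale (u z) (el z j k))" for j k
    have eF: "e j k \<in> F j" if k: "k < ffm i j" for j k
    proof -
      have "e j k \<in> S j" unfolding e_def
        by (intro cfun.subspace_sum cfun.subspace_scale subrep_sub(1)[OF S] elS k)
      moreover have "pi j (e j k) = 0"
      proof
        fix y
        have "pi j (e j k) y = (\<Sum>z\<in>?I. u z * pi j (el z j k) y)"
          unfolding e_def clin_sum[OF pi(1)] clin_scale[OF pi(1)] sum_cscale ..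
        also have "\<dots> = (\<Sum>z\<in>?I. cscale (u z) (v z)) (j, k, y)" unfolding sum_cscale using k by (simp add: v_def)
        finally show "pi j (e j k) y = 0 y" unfolding u by simp
      qed
      ultimately show ?thesis using pi(2) SV by blast
    qed
    \<comment> \<open>The second map of the complex, with the signs of the mesh relation.\<close>
    define Bop where "Bop e = (\<Sum>j\<in>UNIV. \<Sum>k<ffm i j. cscale (osign Or i j) (E i k (A (Al i j) (e j k))))"
      for e :: "'i \<Rightarrow> nat \<Rightarrow> nat \<Rightarrow> complex"
    have "Bop e \<in> F i" unfolding Bop_def
    proof (intro cfun.subspace_sum cfun.subspace_scale subrep_sub(1)[OF F])
      fix j k assume "k \<in> {..<ffm i j}"
      then have k: "k < ffm i j" by simp
      then have cij: "c i j < 0" using ffm_pos[of i j] by linarith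
      then have "A (Al i j) (e j k) \<in> F i" using subrep_A[OF F, of "Al i j"] eF[OF k] by simp
      then show "E i k (A (Al i j) (e j k)) \<in> F i" by (rule subrep_E[OF F])
    qed
    moreover have "Bop e = (\<Sum>z\<in>?I. cscale (u z) (Bop (el z)))"
    proof -
      have "Bop e = (\<Sum>j\<in>UNIV. \<Sum>k<ffm i j. \<Sum>z\<in>?I. cscale (u z) (cscale (osign Or i j) (E i k (A (Al i j) (el z j k)))))"
        unfolding Bop_def e_def clin_sum[OF clin_aop] clin_sum[OF clin_opw] clin_scale[OF clin_aop]
          clin_scale[OF clin_opw] cfun.scale_sum_right cscale_cscale by (simp only: mult.commute)
      also have "\<dots> = (\<Sum>j\<in>UNIV. \<Sum>z\<in>?I. \<Sum>k<ffm i j. cscale (u z) (cscale (osign Or i j) (E i k (A (Al i j) (el z j k)))))"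
        by (intro sum.cong refl sum.swap)
      also have "\<dots> = (\<Sum>z\<in>?I. \<Sum>j\<in>UNIV. \<Sum>k<ffm i j. cscale (u z) (cscale (osign Or i j) (E i k (A (Al i j) (el z j k)))))"
        by (rule sum.swap)
      finally show ?thesis unfolding Bop_def cfun.scale_sum_right .
    qed
    moreover have "Bop (eA b) = 0" if "b \<in> B i" for b
      unfolding Bop_def eA_def using mesh'[OF SV[OF sv(1)[OF that]]] .
    moreover have BP: "Bop (eP b) = sv b - fst (fg b)" if b: "b \<in> B i" for b
    proof -
      have "Bop (eP b) = (\<Sum>j\<in>UNIV. \<Sum>k<ffm i j. E i k (A (Al i j) (snd (fg b) j k)))"
        unfolding Bop_def eP_def clin_scale[OF clin_aop] clin_scale[OF clin_opw] cscale_cscale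
      proof (intro sum.cong refl)
        fix j k assume "k \<in> {..<ffm i j}"
        then have "c i j < 0" using ffm_pos[of i j] by fastforce
        then show "cscale (osign Or i j * osign Or i j) (E i k (A (Al i j) (snd (fg b) j k)))
            = E i k (A (Al i j) (snd (fg b) j k))" by (simp only: osign_sq cscale_1)
      qed
      then show ?thesis using fg(3)[OF b] by (simp only: add_diff_cancel_left')
    qed
    ultimately have "(\<Sum>b\<in>B i. cscale (u (Inr b)) (sv b - fst (fg b))) \<in> F i"
      by (simp add: sum.Plus B el_def)
    then have "pi i (\<Sum>b\<in>B i. cscale (u (Inr b)) (sv b - fst (fg b))) = 0"
      using pi(2) subrep_sub(2)[OF F] by blast
    moreover have "pi i (sv b - fst (fg b)) = b" if b: "b \<in> B i" for b
    proof -
      have "pi i (fst (fg b)) = 0" using pi(2) subrep_sub(2)[OF F] fg(1)[OF b] by blast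
      then show ?thesis unfolding clin_diff[OF pi(1)] sv(2)[OF b] by (simp only: diff_zero)
    qed
    ultimately have "(\<Sum>b\<in>B i. cscale (u (Inr b)) b) = 0"
      unfolding clin_sum[OF pi(1)] clin_scale[OF pi(1)] by simp
    then have r0: "u (Inr b) = 0" if "b \<in> B i" for b
      using indep_zero[OF B(1,2), of "\<lambda>b. u (Inr b)"] that by blast
    define s where "s = (\<Sum>b\<in>B i. cscale (u (Inl b)) (sv b))"
    have sS: "s \<in> S i" unfolding s_def
      by (intro cfun.subspace_sum cfun.subspace_scale subrep_sub(1)[OF S] sv)
    have "A (Al j i) (E i (ffm i j - 1 - k) s) \<in> F j" if k: "k < ffm i j" for j k
    proof -
      have "e j k = (\<Sum>b\<in>B i. cscale (u (Inl b)) (eA b j k))"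
        by (simp add: e_def sum.Plus B el_def r0)
      also have "\<dots> = A (Al j i) (E i (ffm i j - 1 - k) s)"
        unfolding s_def eA_def clin_sum[OF clin_aop] clin_sum[OF clin_opw] clin_scale[OF clin_aop]
          clin_scale[OF clin_opw] ..
      finally show ?thesis using eF[OF k] by simp
    qed
    then have "s \<in> F i" using inj_mod[OF F soc SV[OF sS]] by blast
    then have "pi i s = 0" using pi(2) SV[OF sS] by blast
    then have "(\<Sum>b\<in>B i. cscale (u (Inl b)) b) = 0"
      unfolding s_def clin_sum[OF pi(1)] clin_scale[OF pi(1)] using sv(2) by simp
    then have "u (Inl b) = 0" if "b \<in> B i" for b
      using indep_zero[OF B(1,2), of "\<lambda>b. u (Inl b)"] that by blast
    with r0 show "\<forall>z\<in>?I. u z = 0" by auto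
  qed
  also have "card C \<le> (\<Sum>j\<in>UNIV. card (\<Union>k\<in>{..<ffm i j}. emb j k ` B j))"
    unfolding C_def by (rule card_UN_le) simp
  also have "\<dots> \<le> (\<Sum>j\<in>UNIV. \<Sum>k<ffm i j. card (emb j k ` B j))"
    by (intro sum_mono card_UN_le) simp
  also have "\<dots> \<le> (\<Sum>j\<in>UNIV. \<Sum>k<ffm i j. card (B j))"
    by (intro sum_mono card_image_le B)
  finally show ?thesis by (simp add: card_Plus B)
qed

text \<open>Weighting the i-th inequality with d_i m_i, which is nonnegative, and summing makes the
  quadratic form at m at most 0.\<close>

lemma cartan_inequality_trivial:
  fixes m :: "'i \<Rightarrow> nat"
  assumes "\<And>i. 2 * m i \<le> (\<Sum>j\<in>UNIV. ffm i j * m j)"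
  shows "m i = 0"
proof (rule ccontr)
  assume mi: "m i \<noteq> 0"
  obtain d where d: "symmetrizer c d" and pos: "\<And>x :: 'i \<Rightarrow> real. (\<exists>i. x i \<noteq> 0) \<Longrightarrow>
      0 < (\<Sum>i\<in>UNIV. \<Sum>j\<in>UNIV. real_of_int (d i * c i j) * x i * x j)" using posdef by blast
  have le: "(\<Sum>j\<in>UNIV. real_of_int (c i j) * real (m j)) \<le> 0" for i
  proof -
    have "(\<Sum>j\<in>UNIV. real_of_int (c i j) * real (m j))
      = (\<Sum>j\<in>UNIV. (if j = i then 2 * real (m i) else 0) - real (ffm i j * m j))"
      using c_off c_diag by (intro sum.cong refl) (auto simp: ffm_def)
    also have "\<dots> = 2 * real (m i) - real (\<Sum>j\<in>UNIV. ffm i j * m j)" by (simp add: sum_subtractf)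
    also have "\<dots> \<le> 0" using assms[of i] by linarith
    finally show ?thesis .
  qed
  have "(\<Sum>i\<in>UNIV. \<Sum>j\<in>UNIV. real_of_int (d i * c i j) * real (m i) * real (m j))
     = (\<Sum>i\<in>UNIV. real_of_int (d i) * real (m i) * (\<Sum>j\<in>UNIV. real_of_int (c i j) * real (m j)))"
    by (simp add: sum_distrib_left mult_ac)
  also have "\<dots> \<le> 0"
  proof (rule sum_nonpos, rule mult_nonneg_nonpos[OF _ le])
    fix i have "0 < d i" using d by (simp add: symmetrizer_def)
    then show "0 \<le> real_of_int (d i) * real (m i)" by simp
  qed
  finally show False using pos[of "\<lambda>i. real (m i)"] mi by auto
qed

theorem nilpotent: "\<exists>N. \<forall>i. FF N i = V i"
proof -
  obtain N where N: "\<And>i. FF (Suc N) i = FF N i" using FF_stable by blast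
  have "FF N = V"
  proof (rule ccontr)
    assume ne: "FF N \<noteq> V"
    have soc: "u \<in> FF N i" if "u \<in> V i" "\<And>a. arrow_ok c a \<Longrightarrow> asource a = i \<Longrightarrow> A a u \<in> FF N (atarget a)" for i u
    proof -
      have "u \<in> FF (Suc N) i" unfolding FF_Suc using that by blast
      then show ?thesis by (simp only: N)
    qed
    obtain S where S: "subrep S" "\<And>i. FF N i \<subseteq> S i" "S \<noteq> FF N"
      "\<And>i. S i \<subseteq> cfun.span (FF N i \<union> (\<Union>a\<in>{a. arrow_ok c a \<and> atarget a = i}. A a ` S (asource a)))"
      using minimal_subrep[OF subrep_FF[of N] soc ne] by blast
    \<comment> \<open>Recording the values of all paths of length N gives a linear map whose kernel
      on \<open>V i\<close> is \<open>FF N i\<close>.\<close>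
    define pi where "pi i u = (\<lambda>(t, w, p). if is_path c (t, w) \<and> psource (t, w) = i \<and> length w = N then W w u p else 0)" for i u
    have cpi: "clin (pi i)" for i
      unfolding clin_def pi_def clin_add[OF clin_opw] clin_scale[OF clin_opw]
      by (auto simp: fun_eq_iff cscale_def)
    have pi0: "pi i u = 0 \<longleftrightarrow> u \<in> FF N i" if "u \<in> V i" for i u
    proof
      assume 0: "pi i u = 0"
      have "W w u = 0" if w: "is_path c (t, w)" "psource (t, w) = i" "length w = N" for t w
      proof
        fix p
        have "pi i u (t, w, p) = W w u p" unfolding pi_def using w by simp
        then show "W w u p = 0 p" unfolding 0 by simp
      qed
      then show "u \<in> FF N i" unfolding FF_def using \<open>u \<in> V i\<close> by blast
    next
      assume u: "u \<in> FF N i"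
      show "pi i u = 0"
      proof
        fix z :: "'i \<times> 'i arrow list \<times> nat"
        obtain t w p where z: "z = (t, w, p)" by (cases z) auto
        show "pi i u z = 0 z" unfolding z pi_def using FF_D[OF u, of t w] by simp
      qed
    qed
    have ex: "\<exists>B. B \<subseteq> pi i ` S i \<and> \<not> cfun.dependent B \<and> pi i ` S i \<subseteq> cfun.span B" for i
      by (rule cfun.basis_exists[of "pi i ` S i"]) (intro exI conjI)
    define B where "B i = (SOME B. B \<subseteq> pi i ` S i \<and> \<not> cfun.dependent B \<and> pi i ` S i \<subseteq> cfun.span B)" for i
    have B: "B i \<subseteq> pi i ` S i" "\<not> cfun.dependent (B i)" "pi i ` S i \<subseteq> cfun.span (B i)" for i
      using someI_ex[OF ex, of i] unfolding B_def by simp_all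
    have fin: "finite (B i)" for i
    proof -
      have "pi i ` S i \<subseteq> cfun.span (pi i ` ev ` {..<n i})"
        using clin_span[OF cpi] VV_span[of n i] subrep_sub(2)[OF S(1)] by blast
      then show ?thesis using indep_card_le[OF B(2), of i "pi i ` ev ` {..<n i}"] B(1)[of i] by blast
    qed
    have "card (B i) = 0" for i
      by (rule cartan_inequality_trivial[of "\<lambda>i. card (B i)"],
          rule dimension_inequality[OF subrep_FF[of N] soc S(1,2,4) cpi pi0 fin B(2,1,3)])
    then have B0: "B i = {}" for i using fin by simp
    have "S i \<subseteq> FF N i" for i
    proof
      fix u assume u: "u \<in> S i"
      then have "pi i u \<in> cfun.span {}" using B(3)[of i] B0 by auto
      then show "u \<in> FF N i" using pi0 subrep_sub(2)[OF S(1) u] by simp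
    qed
    then have "S = FF N" using S(2) by (intro ext) blast
    then show False using S(3) by simp
  qed
  then show ?thesis by (intro exI[of _ N]) simp
qed

end

section \<open>Polynomial functions and continuity\<close>

lemma polyfun_sum: "(\<And>i. i \<in> A \<Longrightarrow> polyfun (f i)) \<Longrightarrow> polyfun (\<lambda>x. \<Sum>i\<in>A. f i x)"
  by (induction A rule: infinite_finite_induct) (auto intro: polyfun_const polyfun_add)

lemma polyfun_prod: "(\<And>i. i \<in> A \<Longrightarrow> polyfun (f i)) \<Longrightarrow> polyfun (\<lambda>x. \<Prod>i\<in>A. f i x)"
  by (induction A rule: infinite_finite_induct) (auto intro: polyfun_const polyfun_mult)

lemma polyfun_power: "polyfun f \<Longrightarrow> polyfun (\<lambda>x. f x ^ k)"
  by (induction k) (auto intro: polyfun_const polyfun_mult)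

lemma polyfun_cmult: "polyfun f \<Longrightarrow> polyfun (\<lambda>x. a * f x)"
  by (intro polyfun_mult polyfun_const)

lemma polyfun_diff: "polyfun f \<Longrightarrow> polyfun g \<Longrightarrow> polyfun (\<lambda>x. f x - g x)"
  using polyfun_add[of f "\<lambda>x. (-1) * g x"] polyfun_cmult[of g "-1"] by simp

lemma polyfun_if: "(b \<Longrightarrow> polyfun f) \<Longrightarrow> (\<not> b \<Longrightarrow> polyfun g) \<Longrightarrow> polyfun (\<lambda>x. if b then f x else g x)"
  by (cases b) auto

lemma polyfun_det:
  assumes "\<And>p q. p < k \<Longrightarrow> q < k \<Longrightarrow> polyfun (\<lambda>x. M x p q)"
  shows "polyfun (\<lambda>x. det (mat k k (\<lambda>(p, q). M x p q)))"
proof -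
  have "det (mat k k (\<lambda>(p, q). M x p q)) = (\<Sum>\<sigma> | \<sigma> permutes {0..<k}. signof \<sigma> * (\<Prod>i = 0..<k. M x i (\<sigma> i)))" for x
  proof -
    have "det (mat k k (\<lambda>(p, q). M x p q)) = (\<Sum>\<sigma> | \<sigma> permutes {0..<k}. signof \<sigma> *
        (\<Prod>i = 0..<k. mat k k (\<lambda>(p, q). M x p q) $$ (i, \<sigma> i)))"
      by (subst det_def'[of _ k]) auto
    also have "\<dots> = (\<Sum>\<sigma> | \<sigma> permutes {0..<k}. signof \<sigma> * (\<Prod>i = 0..<k. M x i (\<sigma> i)))"
    proof (intro sum.cong refl arg_cong2[of _ _ _ _ "(*)"] prod.cong)
      fix \<sigma> i assume "\<sigma> \<in> {\<sigma>. \<sigma> permutes {0..<k}}" "i \<in> {0..<k}"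
      then have "\<sigma> i < k" "i < k" using permutes_in_image[of \<sigma> "{0..<k}" i] by auto
      then show "mat k k (\<lambda>(p, q). M x p q) $$ (i, \<sigma> i) = M x i (\<sigma> i)" by simp
    qed
    finally show ?thesis .
  qed
  moreover have "polyfun (\<lambda>x. \<Sum>\<sigma> | \<sigma> permutes {0..<k}. signof \<sigma> * (\<Prod>i = 0..<k. M x i (\<sigma> i)))"
  proof (intro polyfun_sum polyfun_cmult polyfun_prod assms)
    fix \<sigma> i assume "\<sigma> \<in> {\<sigma>. \<sigma> permutes {0..<k}}" "i \<in> {0..<k}"
    then show "\<sigma> i < k" "i < k" using permutes_in_image[of \<sigma> "{0..<k}" i] by auto
  qed
  ultimately show ?thesis by presburger
qed

lemma polyfun_adj:
  assumes M: "\<And>p q. p < k \<Longrightarrow> q < k \<Longrightarrow> polyfun (\<lambda>x. M x p q)" and pq: "p < k" "q < k"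
  shows "polyfun (\<lambda>x. adj_mat (mat k k (\<lambda>(p, q). M x p q)) $$ (p, q))"
proof -
  have "adj_mat (mat k k (\<lambda>(p, q). M x p q)) $$ (p, q)
    = (-1) ^ (q + p) * det (mat (k - 1) (k - 1) (\<lambda>(i, j). M x (insert_index q i) (insert_index p j)))" for x
  proof -
    have "mat_delete (mat k k (\<lambda>(p, q). M x p q)) q p
      = mat (k - 1) (k - 1) (\<lambda>(i, j). M x (insert_index q i) (insert_index p j))"
      using pq by (intro eq_matI) (auto simp: mat_delete_def insert_index_def)
    then show ?thesis using pq by (simp add: adj_mat_def cofactor_def)
  qed
  moreover have "polyfun (\<lambda>x. (-1) ^ (q + p) *
      det (mat (k - 1) (k - 1) (\<lambda>(i, j). M x (insert_index q i) (insert_index p j))))"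
    using pq by (intro polyfun_cmult polyfun_det M) (auto simp: insert_index_def)
  ultimately show ?thesis by presburger
qed

text \<open>Multiplication by the adjugate; no division occurs, so both sides stay polynomial in the
  entries.\<close>

lemma cramer:
  assumes "\<And>m. m < k \<Longrightarrow> (\<Sum>p<k. M m p * y p) = t m" "p < k"
  shows "det (mat k k (\<lambda>(m, p). M m p)) * y p
    = (\<Sum>m<k. adj_mat (mat k k (\<lambda>(m, p). M m p)) $$ (p, m) * t m)"
proof -
  let ?M = "mat k k (\<lambda>(m, p). M m p)"
  have A: "adj_mat ?M \<in> carrier_mat k k" "adj_mat ?M * ?M = det ?M \<cdot>\<^sub>m 1\<^sub>m k"
    using adj_mat[of ?M k] by auto
  have e: "(\<Sum>m<k. adj_mat ?M $$ (p, m) * M m q) = (if p = q then det ?M else 0)" if "q < k" for q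
  proof -
    have "(adj_mat ?M * ?M) $$ (p, q) = (\<Sum>m<k. adj_mat ?M $$ (p, m) * M m q)"
      using A(1) that assms(2) by (auto simp: scalar_prod_def atLeast0LessThan intro!: sum.cong)
    then show ?thesis using A(2) that assms(2) by auto
  qed
  have "(\<Sum>m<k. adj_mat ?M $$ (p, m) * t m) = (\<Sum>m<k. \<Sum>q<k. adj_mat ?M $$ (p, m) * M m q * y q)"
    using assms(1) by (intro sum.cong refl) (simp add: sum_distrib_left[symmetric] mult.assoc)
  also have "\<dots> = (\<Sum>q<k. (\<Sum>m<k. adj_mat ?M $$ (p, m) * M m q) * y q)"
    by (subst sum.swap) (simp add: sum_distrib_right)
  also have "\<dots> = (\<Sum>q<k. if p = q then det ?M * y q else 0)"
    by (intro sum.cong refl) (simp add: e)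
  finally show ?thesis using assms(2) by simp
qed

text \<open>Induction on k. Given points with a nonzero k by k minor, let one more point y vary: if
  all larger determinants vanished, expansion along the last row would be a linear relation among
  the b p whose last coefficient is that minor.\<close>

lemma independent_minor:
  fixes b :: "nat \<Rightarrow> 'c \<Rightarrow> complex"
  assumes "\<And>u. (\<And>y. (\<Sum>p<k. u p * b p y) = 0) \<Longrightarrow> (\<forall>p<k. u p = 0)"
  shows "\<exists>z. det (mat k k (\<lambda>(m, p). b p (z m))) \<noteq> 0"
  using assms
proof (induction k)
  case (Suc k)
  have "\<exists>z. det (mat k k (\<lambda>(m, p). b p (z m))) \<noteq> 0"
  proof (rule Suc.IH)
    fix u assume u: "\<And>y. (\<Sum>p<k. u p * b p y) = 0"
    have "\<forall>p<Suc k. (u(k := 0)) p = 0"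
    proof (rule Suc.prems)
      fix y
      have "(\<Sum>p<k. (u(k := 0)) p * b p y) = (\<Sum>p<k. u p * b p y)" by (intro sum.cong) auto
      then show "(\<Sum>p<Suc k. (u(k := 0)) p * b p y) = 0" using u by simp
    qed
    then show "\<forall>p<k. u p = 0" by (metis fun_upd_apply less_SucI less_irrefl)
  qed
  then obtain z where z: "det (mat k k (\<lambda>(m, p). b p (z m))) \<noteq> 0" by blast
  let ?M = "\<lambda>y. mat (Suc k) (Suc k) (\<lambda>(m, p). b p (if m < k then z m else y))"
  have cof: "cofactor (?M y) k j = cofactor (?M undefined) k j" if "j < Suc k" for y j
  proof -
    have "mat_delete (?M y) k j = mat_delete (?M undefined) k j"
      using that by (intro eq_matI) (auto simp: mat_delete_def)
    then show ?thesis by (simp add: cofactor_def)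
  qed
  show ?case
  proof (rule ccontr)
    assume no: "\<not> ?thesis"
    \<comment> \<open>The cofactors of the last row do not involve y, so a single relation holds for
      all y.\<close>
    have "(\<Sum>p<Suc k. cofactor (?M undefined) k p * b p y) = 0" for y
    proof -
      have "det (?M y) = 0" using no by auto
      moreover have "det (?M y) = (\<Sum>j<Suc k. ?M y $$ (k, j) * cofactor (?M y) k j)"
        by (rule laplace_expansion_row) auto
      moreover have "(\<Sum>j<Suc k. ?M y $$ (k, j) * cofactor (?M y) k j)
          = (\<Sum>j<Suc k. cofactor (?M undefined) k j * b j y)"
      proof (rule sum.cong[OF refl])
        fix j assume "j \<in> {..<Suc k}"
        then have j: "j < Suc k" by simp
        then have "?M y $$ (k, j) = b j y" by simp
        then show "?M y $$ (k, j) * cofactor (?M y) k j = cofactor (?M undefined) k j * b j y"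
          unfolding cof[OF j, of y] by (simp only: mult.commute)
      qed
      ultimately show ?thesis by (simp only:)
    qed
    then have "\<forall>p<Suc k. cofactor (?M undefined) k p = 0" by (rule Suc.prems)
    then have "cofactor (?M undefined) k k = 0" by (rule allE[of _ k]) simp
    moreover have "mat_delete (?M undefined) k k = mat k k (\<lambda>(m, p). b p (z m))"
      by (intro eq_matI) (auto simp: mat_delete_def)
    ultimately show False using z by (simp add: cofactor_def)
  qed
qed auto

text \<open>The exponents of D add both for products and for sums; in a sum each numerator takes the
  power of D that belongs to the other summand.\<close>

lemma polyfun_clear_denominators:
  assumes "polyfun q" "\<And>z. polyfun (N z)" "polyfun D"
  shows "\<exists>k q'. polyfun q' \<and> (\<forall>x. D x \<noteq> 0 \<longrightarrow> q (\<lambda>z. N z x / D x) * D x ^ k = q' x)"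
  using assms(1)
proof induction
  case (polyfun_const a)
  show ?case by (intro exI[of _ 0] exI[of _ "\<lambda>_. a"]) (auto intro: polyfun.polyfun_const)
next
  case (polyfun_coord z)
  show ?case by (intro exI[of _ 1] exI[of _ "N z"]) (auto intro: assms)
next
  case (polyfun_add f g)
  then obtain k f' l g' where *: "polyfun f'" "\<And>x. D x \<noteq> 0 \<Longrightarrow> f (\<lambda>z. N z x / D x) * D x ^ k = f' x"
    "polyfun g'" "\<And>x. D x \<noteq> 0 \<Longrightarrow> g (\<lambda>z. N z x / D x) * D x ^ l = g' x" by blast
  show ?case
  proof (intro exI[of _ "k + l"] exI[of _ "\<lambda>x. f' x * D x ^ l + g' x * D x ^ k"] conjI allI impI)
    show "polyfun (\<lambda>x. f' x * D x ^ l + g' x * D x ^ k)"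
      by (intro polyfun.polyfun_add polyfun.polyfun_mult polyfun_power * assms)
    fix x assume D: "D x \<noteq> 0"
    show "(f (\<lambda>z. N z x / D x) + g (\<lambda>z. N z x / D x)) * D x ^ (k + l) = f' x * D x ^ l + g' x * D x ^ k"
      by (simp only: *(2)[OF D, symmetric] *(4)[OF D, symmetric] power_add) (simp add: algebra_simps)
  qed
next
  case (polyfun_mult f g)
  then obtain k f' l g' where *: "polyfun f'" "\<And>x. D x \<noteq> 0 \<Longrightarrow> f (\<lambda>z. N z x / D x) * D x ^ k = f' x"
    "polyfun g'" "\<And>x. D x \<noteq> 0 \<Longrightarrow> g (\<lambda>z. N z x / D x) * D x ^ l = g' x" by blast
  show ?case
  proof (intro exI[of _ "k + l"] exI[of _ "\<lambda>x. f' x * g' x"] conjI allI impI)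
    show "polyfun (\<lambda>x. f' x * g' x)" by (intro polyfun.polyfun_mult *)
    fix x assume D: "D x \<noteq> 0"
    show "f (\<lambda>z. N z x / D x) * g (\<lambda>z. N z x / D x) * D x ^ (k + l) = f' x * g' x"
      by (simp only: *(2)[OF D, symmetric] *(4)[OF D, symmetric] power_add) (simp add: algebra_simps)
  qed
qed

lemma openin_zariski: "openin zariski U \<longleftrightarrow> (\<exists>F. (\<forall>f\<in>F. polyfun f) \<and> U = {x. \<exists>f\<in>F. f x \<noteq> 0})"
  unfolding zariski_def by (subst topology_inverse'[OF istopology_zariski]) (rule refl)

lemma topspace_zariski [simp]: "topspace zariski = UNIV"
proof -
  have "openin zariski UNIV" unfolding openin_zariski
    by (intro exI[of _ "{\<lambda>_. 1}"]) (auto intro: polyfun_const)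
  then show ?thesis using openin_subset by blast
qed

lemma continuous_on_polyfun: "polyfun f \<Longrightarrow> continuous_on UNIV f"
  by (induction rule: polyfun.induct) (auto intro!: continuous_intros)

text \<open>Near each point one denominator serves all coordinates, so substitution into a
  polynomial costs one power of D. This gives continuity in the Zariski as well as in the classical
  topology.\<close>

definition locally_rational ::
  "('a \<Rightarrow> complex) set \<Rightarrow> (('a \<Rightarrow> complex) \<Rightarrow> 'b \<Rightarrow> complex) \<Rightarrow> bool" where
  "locally_rational S f \<longleftrightarrow> (\<forall>x0\<in>S. \<exists>D N. polyfun D \<and> (\<forall>z. polyfun (N z)) \<and> D x0 \<noteq> 0 \<and>
     (\<forall>x\<in>S. D x \<noteq> 0 \<longrightarrow> (\<forall>z. f x z = N z x / D x)))"

lemma locally_rational_polynomial: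
  assumes "\<And>z. polyfun (\<lambda>x. f x z)" shows "locally_rational S f"
  unfolding locally_rational_def
  by (intro ballI exI[of _ "\<lambda>_. 1"] exI[of _ "\<lambda>z x. f x z"]) (auto intro: polyfun_const assms)

lemma continuous_map_zariski:
  assumes f: "locally_rational S f" and ST: "f ` S \<subseteq> T"
  shows "continuous_map (subtopology zariski S) (subtopology zariski T) f"
proof -
  have "openin (subtopology zariski S) {x \<in> S. f x \<in> U}" if U: "openin zariski U" for U
  proof -
    obtain F where F: "\<forall>q\<in>F. polyfun q" "U = {x. \<exists>q\<in>F. q x \<noteq> 0}" using U unfolding openin_zariski by blast
    show ?thesis
    proof (subst openin_subopen, intro ballI)
      fix x0 assume "x0 \<in> {x \<in> S. f x \<in> U}"
      then obtain q where x0: "x0 \<in> S" and q: "q \<in> F" "q (f x0) \<noteq> 0" using F(2) by blast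
      obtain D N where D: "polyfun D" "\<And>z. polyfun (N z)" "D x0 \<noteq> 0"
        and eq: "\<And>x z. x \<in> S \<Longrightarrow> D x \<noteq> 0 \<Longrightarrow> f x z = N z x / D x"
        using f x0 unfolding locally_rational_def by blast
      obtain k q' where q': "polyfun q'" "\<And>x. D x \<noteq> 0 \<Longrightarrow> q (\<lambda>z. N z x / D x) * D x ^ k = q' x"
        using polyfun_clear_denominators[of q N D] F(1) q(1) D by blast
      have fx: "f x = (\<lambda>z. N z x / D x)" if "x \<in> S" "D x \<noteq> 0" for x using eq[OF that] by auto
      have q'x: "q' x = q (f x) * D x ^ k" if "x \<in> S" "D x \<noteq> 0" for x
        using q'(2)[OF that(2)] fx[OF that] by simp
      \<comment> \<open>Where D and q' do not vanish, q (f x) does not vanish either, being q' x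
        divided by a power of D.\<close>
      let ?O = "S \<inter> {x. \<exists>g\<in>{\<lambda>x. D x * q' x}. g x \<noteq> 0}"
      have "openin zariski {x. \<exists>g\<in>{\<lambda>x. D x * q' x}. g x \<noteq> 0}"
        unfolding openin_zariski using D q' by (intro exI[of _ "{\<lambda>x. D x * q' x}"]) (auto intro: polyfun_mult)
      then have "openin (subtopology zariski S) ?O" unfolding openin_subtopology by blast
      moreover have "x0 \<in> ?O" using x0 D q q'x[OF x0 D(3)] by simp
      moreover have "?O \<subseteq> {x \<in> S. f x \<in> U}" using q'x q(1) F(2) by auto
      ultimately show "\<exists>V. openin (subtopology zariski S) V \<and> x0 \<in> V \<and> V \<subseteq> {x \<in> S. f x \<in> U}"
        by (intro exI[of _ ?O] conjI)
    qed
  qed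
  then have "continuous_map (subtopology zariski S) zariski f" unfolding continuous_map_def by auto
  then show ?thesis using ST by (auto simp: continuous_map_in_subtopology)
qed

lemma continuous_map_euclidean_rational:
  assumes f: "locally_rational S f" and ST: "f ` S \<subseteq> T"
  shows "continuous_map (subtopology euclidean S) (subtopology euclidean T) f"
proof -
  have "continuous_on S f"
  proof (rule continuous_on_coordinatewise_then_product)
    fix z
    show "continuous_on S (\<lambda>x. f x z)"
      unfolding continuous_on_def
    proof
      fix x0 assume x0: "x0 \<in> S"
      obtain D N where D: "polyfun D" "\<And>z. polyfun (N z)" "D x0 \<noteq> 0"
        and eq: "\<And>x z. x \<in> S \<Longrightarrow> D x \<noteq> 0 \<Longrightarrow> f x z = N z x / D x"
        using f x0 unfolding locally_rational_def by blast
      have t: "(g \<longlongrightarrow> g x0) (at x0 within S)" if "polyfun g" for g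
        using continuous_on_subset[OF continuous_on_polyfun[OF that], of S] x0
        unfolding continuous_on_def by simp
      have "((\<lambda>x. N z x / D x) \<longlongrightarrow> N z x0 / D x0) (at x0 within S)"
        by (intro tendsto_divide t D)
      moreover have "\<forall>\<^sub>F x in at x0 within S. N z x / D x = f x z"
      proof -
        have "open {x. D x \<noteq> 0}"
          using open_vimage[OF open_delete[OF open_UNIV] continuous_on_polyfun[OF D(1)], of 0]
          by (simp add: vimage_def)
        then show ?thesis unfolding eventually_at_topological
          using eq D(3) by (intro exI[of _ "{x. D x \<noteq> 0}"] conjI ballI impI) simp_all
      qed
      ultimately have "((\<lambda>x. f x z) \<longlongrightarrow> N z x0 / D x0) (at x0 within S)"
        by (rule Lim_transform_eventually)
      then show "((\<lambda>x. f x z) \<longlongrightarrow> f x0 z) (at x0 within S)" using eq[OF x0 D(3)] by simp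
    qed
  qed
  then show ?thesis using ST by (auto simp: continuous_map_in_subtopology continuous_map_iff_continuous)
qed

lemma closedin_polynomial_zeros:
  fixes S :: "('c \<Rightarrow> complex) set"
  assumes "\<forall>f\<in>F. polyfun f"
  shows "closedin (subtopology zariski S) {x \<in> S. \<forall>f\<in>F. f x = 0}"
    "closedin (subtopology euclidean S) {x \<in> S. \<forall>f\<in>F. f x = 0}"
proof -
  have "openin zariski {x. \<exists>f\<in>F. f x \<noteq> 0}" unfolding openin_zariski using assms by blast
  then have "openin (subtopology zariski S) (S \<inter> {x. \<exists>f\<in>F. f x \<noteq> 0})" unfolding openin_subtopology by blast
  moreover have "S - {x \<in> S. \<forall>f\<in>F. f x = 0} = S \<inter> {x. \<exists>f\<in>F. f x \<noteq> 0}" by blast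
  ultimately show "closedin (subtopology zariski S) {x \<in> S. \<forall>f\<in>F. f x = 0}" by (simp add: closedin_def)
  have "closed (\<Inter>f\<in>F. {x. f x = 0})"
  proof (intro closed_INT ballI)
    fix f assume "f \<in> F"
    then have "continuous_on UNIV f" using assms continuous_on_polyfun by blast
    then show "closed {x. f x = 0}"
      using closed_vimage[of "{0}" f] by (simp add: vimage_def)
  qed
  moreover have "{x \<in> S. \<forall>f\<in>F. f x = 0} = S \<inter> (\<Inter>f\<in>F. {x. f x = 0})" by blast
  ultimately show "closedin (subtopology euclidean S) {x \<in> S. \<forall>f\<in>F. f x = 0}"
    by (auto simp: closedin_subtopology)
qed

section \<open>Quotient topologies\<close>

lemma openin_quotient_top:
  "openin (quotient_top T p) U \<longleftrightarrow> U \<subseteq> p ` topspace T \<and> openin T {x \<in> topspace T. p x \<in> U}"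
  unfolding quotient_top_def by (subst topology_inverse'[OF istopology_quotient_top]) (rule refl)

lemma topspace_quotient_top: "topspace (quotient_top T p) = p ` topspace T"
proof -
  have "openin (quotient_top T p) (p ` topspace T)"
  proof -
    have "{x \<in> topspace T. p x \<in> p ` topspace T} = topspace T" by blast
    then show ?thesis unfolding openin_quotient_top by simp
  qed
  then show ?thesis using openin_subset[of "quotient_top T p"] openin_quotient_top[of T p "topspace (quotient_top T p)"]
    openin_topspace[of "quotient_top T p"] by blast
qed

lemma quotient_map_quotient_top: "quotient_map T (quotient_top T p) p"
  unfolding quotient_map_def topspace_quotient_top openin_quotient_top by auto

text \<open>A quotient map restricts to a quotient map on a closed saturated set, so Z carries the
  quotient topology of P. Through the homeomorphism \<Psi> the other side is a quotient of P as
  well, and the two quotient maps have the same fibres: \<open>h\<close> gives one inclusion,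
  \<open>inj\<close> the other.\<close>

lemma homeomorphic_quotients:
  assumes clo: "closedin (subtopology T S) P"
    and sat: "\<And>x. x \<in> S \<Longrightarrow> p x \<in> Z \<longleftrightarrow> x \<in> P" and Z: "Z = p ` P"
    and \<Psi>: "continuous_map (subtopology T P) (subtopology T' F) \<Psi>"
      "continuous_map (subtopology T' F) (subtopology T P) \<Theta>"
      "\<And>x. x \<in> P \<Longrightarrow> \<Theta> (\<Psi> x) = x" "\<And>y. y \<in> F \<Longrightarrow> \<Psi> (\<Theta> y) = y"
    and top: "topspace T = UNIV" "topspace T' = UNIV"
    and h: "\<And>x. x \<in> P \<Longrightarrow> h (p x) = q (\<Psi> x)"
    and inj: "\<And>x y. x \<in> P \<Longrightarrow> y \<in> P \<Longrightarrow> q (\<Psi> x) = q (\<Psi> y) \<Longrightarrow> p x = p y"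
  shows "homeomorphic_map (subtopology (quotient_top (subtopology T S) p) Z)
     (quotient_top (subtopology T' F) q) h"
proof -
  have PS: "P \<subseteq> S" using closedin_subset[OF clo] top by auto
  have sub: "subtopology (subtopology T S) P = subtopology T P"
    using PS by (simp add: subtopology_subtopology inf.absorb2)
  let ?Q = "quotient_top (subtopology T S) p"
  let ?R = "subtopology ?Q Z"
  let ?G = "quotient_top (subtopology T' F) q"
  have tQ: "topspace ?Q = p ` S" by (simp add: topspace_quotient_top top)
  have ZQ: "Z \<subseteq> p ` S" unfolding Z using PS by blast
  have pre: "{x \<in> topspace (subtopology T S). p x \<in> Z} = P" using sat PS top by auto
  have qm: "quotient_map (subtopology T S) ?Q p" by (rule quotient_map_quotient_top)
  have "closedin ?Q Z"
    unfolding closedin_def tQ openin_quotient_top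
  proof (intro conjI ZQ)
    have "{x \<in> topspace (subtopology T S). p x \<in> p ` S - Z} = topspace (subtopology T S) - P"
      using sat top PS by auto
    then show "openin (subtopology T S) {x \<in> topspace (subtopology T S). p x \<in> p ` S - Z}"
      using clo by (simp add: closedin_def)
  qed (auto simp: top)
  then have qP: "quotient_map (subtopology T P) ?R p"
    using quotient_map_restriction[OF qm pre] sub by simp
  have hm: "homeomorphic_map (subtopology T P) (subtopology T' F) \<Psi>"
    using \<Psi> top by (intro homeomorphic_maps_imp_map[of _ _ _ \<Theta>]) (auto simp: homeomorphic_maps_def)
  have q\<Psi>: "quotient_map (subtopology T P) ?G (q \<circ> \<Psi>)"
    by (rule quotient_map_compose[OF _ quotient_map_quotient_top])
      (use hm in \<open>simp add: homeomorphic_map_def\<close>)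
  have hp: "quotient_map (subtopology T P) ?G (h \<circ> p)"
    by (rule quotient_map_eq[OF q\<Psi>]) (use h top in auto)
  then have "continuous_map (subtopology T P) ?G (h \<circ> p)" by (rule quotient_imp_continuous_map)
  then have ch: "continuous_map ?R ?G h" by (rule continuous_compose_quotient_map[OF qP])
  have "quotient_map ?R ?G h"
    by (rule quotient_map_from_composition[OF quotient_imp_continuous_map[OF qP] ch hp])
  moreover have "inj_on h (topspace ?R)"
  proof (rule inj_onI)
    fix a b assume "a \<in> topspace ?R" "b \<in> topspace ?R" and eq: "h a = h b"
    then obtain x y where "x \<in> P" "y \<in> P" "a = p x" "b = p y" unfolding Z by auto
    then show "a = b" using eq h inj by metis
  qed
  ultimately show ?thesis by (simp add: homeomorphic_map_def)
qed

section \<open>Block decompositions\<close>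

text \<open>The offset at which the block of r begins when blocks of lengths l are concatenated in
  the order of the list.\<close>

fun boff :: "('r \<Rightarrow> nat) \<Rightarrow> 'r list \<Rightarrow> 'r \<Rightarrow> nat" where
  "boff l [] r = 0"
| "boff l (r' # rs) r = (if r = r' then 0 else l r' + boff l rs r)"

lemma boff_less: "r \<in> set rs \<Longrightarrow> m < l r \<Longrightarrow> boff l rs r + m < sum_list (map l rs)"
  by (induction rs) auto

lemma boff_inj:
  "r \<in> set rs \<Longrightarrow> r' \<in> set rs \<Longrightarrow> m < l r \<Longrightarrow> m' < l r' \<Longrightarrow> boff l rs r + m = boff l rs r' + m' \<Longrightarrow>
    r = r' \<and> m = m'"
  by (induction rs) (auto split: if_splits)

lemma boff_surj:
  "distinct rs \<Longrightarrow> p < sum_list (map l rs) \<Longrightarrow> \<exists>r\<in>set rs. \<exists>m<l r. p = boff l rs r + m"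
proof (induction rs arbitrary: p)
  case (Cons r' rs)
  show ?case
  proof (cases "p < l r'")
    case True
    then show ?thesis by (intro bexI[of _ r'] exI[of _ p]) auto
  next
    case False
    then have "p - l r' < sum_list (map l rs)" using Cons.prems by auto
    moreover have "distinct rs" using Cons.prems by simp
    ultimately obtain r m where "r \<in> set rs" "m < l r" "p - l r' = boff l rs r + m"
      using Cons.IH by blast
    then show ?thesis using False Cons.prems by (intro bexI[of _ r] exI[of _ m]) auto
  qed
qed simp

lemma length_concat_blocks:
  "(\<And>r. r \<in> set rs \<Longrightarrow> length (B r) = l r) \<Longrightarrow> length (concat (map B rs)) = sum_list (map l rs)"
  by (induction rs) auto

lemma concat_blocks_nth:
  assumes "\<And>r. r \<in> set rs \<Longrightarrow> length (B r) = l r" "r \<in> set rs" "m < l r"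
  shows "concat (map B rs) ! (boff l rs r + m) = B r ! m"
  using assms by (induction rs) (auto simp: nth_append)

lemma dim_diag_blocks:
  assumes "\<And>r. r \<in> set rs \<Longrightarrow> A r \<in> carrier_mat (l r) (l r)"
  shows "diag_block_mat (map A rs) \<in> carrier_mat (sum_list (map l rs)) (sum_list (map l rs))"
proof -
  have "map dim_row (map A rs) = map l rs" "map dim_col (map A rs) = map l rs" using assms by auto
  then show ?thesis using dim_diag_block_mat[of "map A rs"] by (metis carrier_matI)
qed

lemma diag_blocks_index:
  assumes "\<And>r. r \<in> set rs \<Longrightarrow> A r \<in> carrier_mat (l r) (l r)" "r \<in> set rs" "m < l r" "r' \<in> set rs" "m' < l r'"
  shows "diag_block_mat (map A rs) $$ (boff l rs r + m, boff l rs r' + m')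
    = (if r = r' then A r $$ (m, m') else (0::complex))"
  using assms
proof (induction rs)
  case (Cons r0 rs)
  have c: "diag_block_mat (map A rs) \<in> carrier_mat (sum_list (map l rs)) (sum_list (map l rs))"
    using Cons.prems by (intro dim_diag_blocks) auto
  have A0: "A r0 \<in> carrier_mat (l r0) (l r0)" using Cons.prems by auto
  have eq: "diag_block_mat (map A (r0 # rs)) = four_block_mat (A r0)
     (0\<^sub>m (l r0) (sum_list (map l rs))) (0\<^sub>m (sum_list (map l rs)) (l r0)) (diag_block_mat (map A rs))"
    using c A0 by (simp add: Let_def)
  consider "r = r0" "r' = r0" | "r = r0" "r' \<noteq> r0" | "r \<noteq> r0" "r' = r0" | "r \<noteq> r0" "r' \<noteq> r0" by blast
  then show ?case
  proof cases
    case 1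
    then show ?thesis unfolding eq using Cons.prems(3,5) A0 c by simp
  next
    case 2
    then have "boff l rs r' + m' < sum_list (map l rs)" using Cons.prems by (intro boff_less) auto
    then show ?thesis unfolding eq using Cons.prems(3,5) A0 c 2 by simp
  next
    case 3
    then have "boff l rs r + m < sum_list (map l rs)" using Cons.prems by (intro boff_less) auto
    then show ?thesis unfolding eq using Cons.prems(3,5) A0 c 3 by simp
  next
    case 4
    then have "boff l rs r' + m' < sum_list (map l rs)" "boff l rs r + m < sum_list (map l rs)"
      using Cons.prems by (auto intro!: boff_less)
    moreover have "diag_block_mat (map A rs) $$ (boff l rs r + m, boff l rs r' + m')
        = (if r = r' then A r $$ (m, m') else 0)"
      using Cons.prems 4 by (intro Cons.IH) auto
    ultimately show ?thesis unfolding eq using Cons.prems(3,5) A0 c 4 by simp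
  qed
qed simp

text \<open>Homogeneity of degree 2 d confines A to the subdiagonal, since the degrees of the basis
  grow in steps of 2 d. The only entry of the power l - 1 of A that can be nonzero is then the
  product of the subdiagonal, and this power is not 0 because A is similar to a single Jordan block
  of size l.\<close>

lemma regular_nilpotent_subdiagonal:
  assumes rn: "regular_nilpotent l A" and d: "0 < d"
    and hom: "homogeneous_mat (2 * d) (block_degs d k l) (block_degs d k l) A"
  shows "p < l \<Longrightarrow> q < l \<Longrightarrow> p \<noteq> Suc q \<Longrightarrow> A $$ (p, q) = 0" "Suc q < l \<Longrightarrow> A $$ (Suc q, q) \<noteq> 0"
proof -
  have A: "A \<in> carrier_mat l l" using rn by (simp add: regular_nilpotent_def)
  show off: "A $$ (p, q) = 0" if "p < l" "q < l" "p \<noteq> Suc q" for p q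
  proof (rule ccontr)
    assume "A $$ (p, q) \<noteq> 0"
    then have "block_degs d k l ! p = block_degs d k l ! q + 2 * d"
      using hom that by (auto simp: homogeneous_mat_def block_degs_def)
    then have "2 * int p * d = 2 * (int q + 1) * d" using that by (simp add: block_degs_def algebra_simps)
    then have "int p = int q + 1" using d by simp
    then show False using that by simp
  qed
  show "A $$ (Suc q, q) \<noteq> 0" if q: "Suc q < l"
  proof
    assume 0: "A $$ (Suc q, q) = 0"
    have pw: "(A ^\<^sub>m t) $$ (a, b) = (if a = b + t then \<Prod>i\<in>{b..<b + t}. A $$ (Suc i, i) else 0)"
      if "a < l" "b < l" for a b t
      using that
    proof (induction t arbitrary: b)
      case 0
      then show ?case using A by auto
    next
      case (Suc t)
      have "(A ^\<^sub>m Suc t) $$ (a, b) = (\<Sum>m<l. (A ^\<^sub>m t) $$ (a, m) * A $$ (m, b))"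
        using A Suc.prems pow_carrier_mat[OF A, of t]
        by (auto simp: scalar_prod_def atLeast0LessThan intro!: sum.cong)
      also have "\<dots> = (\<Sum>m<l. if m = Suc b then (A ^\<^sub>m t) $$ (a, Suc b) * A $$ (Suc b, b) else 0)"
        using off Suc.prems by (intro sum.cong refl) auto
      also have "\<dots> = (if Suc b < l then (A ^\<^sub>m t) $$ (a, Suc b) * A $$ (Suc b, b) else 0)" by simp
      also have "\<dots> = (if a = b + Suc t then \<Prod>i\<in>{b..<b + Suc t}. A $$ (Suc i, i) else 0)"
        using Suc.IH[of "Suc b"] Suc.prems
        by (auto simp: prod.atLeast_Suc_lessThan mult.commute)
      finally show ?case .
    qed
    have "A ^\<^sub>m (l - 1) = 0\<^sub>m l l"
    proof (rule eq_matI)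
      fix a b assume "a < dim_row (0\<^sub>m l l :: complex mat)" "b < dim_col (0\<^sub>m l l :: complex mat)"
      then have ab: "a < l" "b < l" by auto
      have "(\<Prod>i\<in>{b..<b + (l - 1)}. A $$ (Suc i, i)) = 0" if "a = b + (l - 1)"
      proof -
        have "q \<in> {b..<b + (l - 1)}" using that ab q by auto
        then show ?thesis using 0 by (intro prod_zero) auto
      qed
      then show "(A ^\<^sub>m (l - 1)) $$ (a, b) = 0\<^sub>m l l $$ (a, b)" using pw[OF ab] ab by simp
    qed (use A in auto)
    moreover obtain P Q where PQ: "similar_mat_wit A (jordan_block l 0) P Q"
      using rn by (auto simp: regular_nilpotent_def similar_mat_def)
    have P: "P \<in> carrier_mat l l" "Q \<in> carrier_mat l l" "Q * P = 1\<^sub>m l"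
      using similar_mat_witD2[OF A PQ] by auto
    have "A ^\<^sub>m (l - 1) = P * jordan_block l 0 ^\<^sub>m (l - 1) * Q" by (rule similar_mat_wit_pow_id[OF PQ])
    moreover define J where "J = (jordan_block l 0 :: complex mat) ^\<^sub>m (l - 1)"
    moreover have J: "J \<in> carrier_mat l l" unfolding J_def by simp
    ultimately have "P * J * Q = 0\<^sub>m l l" by simp
    then have "Q * (P * J * Q) * P = 0\<^sub>m l l" using P by simp
    moreover have "Q * (P * J * Q) * P = (Q * P) * J * (Q * P)"
      using P(1,2) J by (simp add: assoc_mult_mat[where ?n\<^sub>1 = l and ?n\<^sub>2 = l and ?n\<^sub>3 = l and ?n\<^sub>4 = l])
    ultimately have "J = 0\<^sub>m l l" using P J by simp
    moreover have "J $$ (0, l - 1) = 1" unfolding J_def jordan_block_zero_pow using q by simp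
    ultimately show False using q by simp
  qed
qed

section \<open>The setting\<close>

text \<open>Both parts of the theorem are treated together: \<open>grd\<close> tells whether degrees are taken into account.
  The pieces of a submodule are indexed by labels \<open>j\<close>, a label having a vertex \<open>vt j\<close> and a degree
  \<open>dg j\<close>; \<open>pos j q\<close> is the position in the basis of \<open>V\<close> at \<open>vt j\<close> of the \<open>q\<close>-th vector with label
  \<open>j\<close>.\<close>

locale setting = preproj_dual c d Or s ii kk ll
  for c :: "'i::finite \<Rightarrow> 'i \<Rightarrow> int" and d Or s ii kk ll +
  fixes \<gamma> :: "nat \<Rightarrow> complex mat" and grd :: bool and n :: "'i \<Rightarrow> nat" and vdeg :: "'i \<Rightarrow> nat \<Rightarrow> int"
    and vt :: "'j \<Rightarrow> 'i" and dg :: "'j \<Rightarrow> int" and vj :: "'j \<Rightarrow> nat" and pos :: "'j \<Rightarrow> nat \<Rightarrow> nat"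
    and jl :: "'i \<Rightarrow> nat \<Rightarrow> 'j" and rk :: "'i \<Rightarrow> nat \<Rightarrow> nat"
  assumes cartan: "simple_cartan_matrix c" and symm: "minimal_symmetrizer c d" and ori: "orientation c Or"
    and gam: "\<And>r. r \<in> {1..s} \<Longrightarrow> regular_nilpotent (ll r) (\<gamma> r) \<and>
           homogeneous_mat (2 * d (ii r)) (block_degs (d (ii r)) (kk r) (ll r))
             (block_degs (d (ii r)) (kk r) (ll r)) (\<gamma> r)"
    and idx1: "\<And>i p. p < n i \<Longrightarrow> vt (jl i p) = i \<and> rk i p < vj (jl i p) \<and> pos (jl i p) (rk i p) = p"
    and idx2: "\<And>j q. q < vj j \<Longrightarrow> pos j q < n (vt j) \<and> jl (vt j) (pos j q) = j \<and> rk (vt j) (pos j q) = q"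
    and dg_jl: "\<And>i p. grd \<Longrightarrow> p < n i \<Longrightarrow> dg (jl i p) = vdeg i p"
    and lab_inj: "\<And>j j'. vt j = vt j' \<Longrightarrow> (grd \<Longrightarrow> dg j = dg j') \<Longrightarrow> j = j'"
    and lab_ex: "\<And>i e. \<exists>j. vt j = i \<and> (grd \<longrightarrow> dg j = e)"
begin

lemma d_pos: "0 < d i" and d_sym: "d i * c i j = d j * c j i"
  using symm by (auto simp: minimal_symmetrizer_def symmetrizer_def)

lemma c_diag: "c i i = 2" and c_off: "i \<noteq> j \<Longrightarrow> c i j \<le> 0"
  and posdef: "\<exists>d. symmetrizer c d \<and> (\<forall>x :: 'i \<Rightarrow> real. (\<exists>i. x i \<noteq> 0) \<longrightarrow>
           0 < (\<Sum>i\<in>UNIV. \<Sum>j\<in>UNIV. real_of_int (d i * c i j) * x i * x j))"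
  using cartan by (auto simp: simple_cartan_matrix_def)

lemma c_neg_ne: "c i j < 0 \<Longrightarrow> i \<noteq> j" using c_diag[of i] by auto

lemma or_D: "(i, j) \<in> Or \<Longrightarrow> (j, i) \<notin> Or" "c i j < 0 \<Longrightarrow> (i, j) \<in> Or \<or> (j, i) \<in> Or"
proof -
  have 1: "\<And>i j. i \<noteq> j \<Longrightarrow> c i j < 0 \<Longrightarrow> ((i, j) \<in> Or) \<noteq> ((j, i) \<in> Or)"
    and 2: "\<And>i j. (i, j) \<in> Or \<Longrightarrow> i \<noteq> j \<and> c i j < 0"
    using ori unfolding orientation_def by blast+
  show "(i, j) \<in> Or \<Longrightarrow> (j, i) \<notin> Or" using 2[of i j] 1[of i j] by simp
  show "c i j < 0 \<Longrightarrow> (i, j) \<in> Or \<or> (j, i) \<in> Or" using 1[of i j] c_neg_ne[of i j] by blast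
qed

lemma osign_sq: "c i j < 0 \<Longrightarrow> osign Or i j * osign Or i j = 1"
  using or_D(2)[of i j] by (auto simp: osign_def)

lemma osign_swap: "osign Or j i = - osign Or i j"
  using or_D(1)[of i j] by (auto simp: osign_def)

definition wd :: "'i \<Rightarrow> nat" where "wd = dims (W_degs d s ii kk ll)"
definition wpos :: "nat \<Rightarrow> nat \<Rightarrow> nat" where "wpos r m = boff ll (block_indices s ii (ii r)) r + m"
definition wdeg :: "'i \<Rightarrow> nat \<Rightarrow> int" where "wdeg i q = W_degs d s ii kk ll i ! q"

lemma set_block_indices: "set (block_indices s ii i) = {r \<in> RS. ii r = i}"
  by (auto simp: block_indices_def)

lemma distinct_block_indices: "distinct (block_indices s ii i)"
  by (simp add: block_indices_def)

lemma length_block_degs [simp]: "length (block_degs a b l) = l"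
  by (simp add: block_degs_def)

lemma wd_eq: "wd i = sum_list (map ll (block_indices s ii i))"
  unfolding wd_def dims_def W_degs_def by (rule length_concat_blocks) simp

lemma wpos_less: "r \<in> RS \<Longrightarrow> m < ll r \<Longrightarrow> wpos r m < wd (ii r)"
  unfolding wpos_def wd_eq by (rule boff_less) (auto simp: set_block_indices)

lemma wpos_surj:
  assumes "q < wd i"
  obtains r m where "r \<in> RS" "ii r = i" "m < ll r" "q = wpos r m"
  using boff_surj[OF distinct_block_indices[of i], of q ll] assms
  by (auto simp: wd_eq wpos_def set_block_indices)

lemma wpos_inj:
  "r \<in> RS \<Longrightarrow> r' \<in> RS \<Longrightarrow> ii r = ii r' \<Longrightarrow> m < ll r \<Longrightarrow> m' < ll r' \<Longrightarrow> wpos r m = wpos r' m' \<Longrightarrow> r = r' \<and> m = m'"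
  unfolding wpos_def by (rule boff_inj[of r "block_indices s ii (ii r)"]) (auto simp: set_block_indices)

lemma wdeg_wpos:
  assumes "r \<in> RS" "m < ll r"
  shows "wdeg (ii r) (wpos r m) = kk r - (int (ll r) - 1) * d (ii r) + 2 * int m * d (ii r)"
proof -
  have "wdeg (ii r) (wpos r m) = block_degs (d (ii r)) (kk r) (ll r) ! m"
    unfolding wdeg_def wpos_def W_degs_def
    by (rule concat_blocks_nth) (use assms in \<open>auto simp: set_block_indices\<close>)
  then show ?thesis using assms by (simp add: block_degs_def)
qed

lemma gamma_carrier: "r \<in> RS \<Longrightarrow> \<gamma> r \<in> carrier_mat (ll r) (ll r)"
  using gam[of r] by (simp add: regular_nilpotent_def)

lemma gamma_sum_carrier: "gamma_sum s ii \<gamma> i \<in> carrier_mat (wd i) (wd i)"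
  unfolding gamma_sum_def wd_eq
  by (rule dim_diag_blocks) (auto simp: set_block_indices intro: gamma_carrier)

lemma gamma_sum_wpos:
  assumes "r \<in> RS" "r' \<in> RS" "ii r = ii r'" "m < ll r" "m' < ll r'"
  shows "gamma_sum s ii \<gamma> (ii r) $$ (wpos r m, wpos r' m') = (if r = r' then \<gamma> r $$ (m, m') else 0)"
  unfolding gamma_sum_def wpos_def assms(3)
  by (rule diag_blocks_index) (use assms in \<open>auto simp: set_block_indices intro: gamma_carrier\<close>)

lemma gamma_off: "r \<in> RS \<Longrightarrow> p < ll r \<Longrightarrow> q < ll r \<Longrightarrow> p \<noteq> Suc q \<Longrightarrow> \<gamma> r $$ (p, q) = 0"
  using regular_nilpotent_subdiagonal(1)[of "ll r" "\<gamma> r" "d (ii r)"] gam d_pos by blast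

definition gs :: "nat \<Rightarrow> nat \<Rightarrow> complex" where "gs r m = \<gamma> r $$ (Suc m, m)"

lemma gs_nz: "r \<in> RS \<Longrightarrow> Suc m < ll r \<Longrightarrow> gs r m \<noteq> 0"
  unfolding gs_def using regular_nilpotent_subdiagonal(2)[of "ll r" "\<gamma> r" "d (ii r)"] gam d_pos by blast

text \<open>As \<gamma> is block diagonal with subdiagonal blocks, a row meets at most one nonzero
  entry.\<close>

lemma gamma_row:
  assumes r: "r \<in> RS" "m < ll r"
  shows "(\<Sum>q<wd (ii r). gamma_sum s ii \<gamma> (ii r) $$ (wpos r m, q) * f q)
    = (case m of 0 \<Rightarrow> 0 | Suc m' \<Rightarrow> gs r m' * f (wpos r m'))"
proof -
  let ?g = "gamma_sum s ii \<gamma> (ii r)"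
  have z: "?g $$ (wpos r m, q) = 0" if q: "q < wd (ii r)" "\<forall>m'. m = Suc m' \<longrightarrow> q \<noteq> wpos r m'" for q
  proof -
    obtain r' m' where r': "r' \<in> RS" "ii r' = ii r" "m' < ll r'" "q = wpos r' m'" using wpos_surj[OF q(1)] by blast
    show ?thesis using gamma_sum_wpos[of r r' m m'] r r' q(2) gamma_off[of r m m'] by auto
  qed
  show ?thesis
  proof (cases m)
    case 0
    then show ?thesis using z by (simp add: sum.neutral)
  next
    case (Suc m')
    have "(\<Sum>q<wd (ii r). ?g $$ (wpos r m, q) * f q) = (\<Sum>q\<in>{wpos r m'}. ?g $$ (wpos r m, q) * f q)"
      using wpos_less[of r m'] r Suc z by (intro sum.mono_neutral_right) auto
    also have "\<dots> = gs r m' * f (wpos r m')"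
      using gamma_sum_wpos[of r r m m'] r Suc by (simp add: gs_def)
    finally show ?thesis using Suc by simp
  qed
qed

fun okc :: "'i coord \<Rightarrow> bool" where
  "okc (CAlpha i j p q) \<longleftrightarrow> (grd \<longrightarrow> vdeg i p = vdeg j q + bform c d i j)"
| "okc (CA i p q) \<longleftrightarrow> (grd \<longrightarrow> wdeg i p = vdeg i q - d i)"
| "okc (CAs i p q) \<longleftrightarrow> (grd \<longrightarrow> vdeg i p = wdeg i q - d i)"
| "okc (CEps i p q) \<longleftrightarrow> (grd \<longrightarrow> vdeg i p = vdeg i q + 2 * d i)"

text \<open>With \<open>grd\<close> false this is \<open>Xrep\<close>, with \<open>grd\<close> true
  it is \<open>Xrep_gr\<close>; \<open>GG\<close> is in the same way \<open>GLrep\<close> or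
  \<open>GLrep_gr\<close>. Degrees become a condition on coordinates.\<close>

definition XX :: "'i rep set" where
  "XX = {x. \<forall>z. x z \<noteq> 0 \<longrightarrow> z \<in> coords c n wd \<and> okc z}"

definition GG :: "('i \<Rightarrow> complex mat) set" where
  "GG = {g. \<forall>i. g i \<in> carrier_mat (n i) (n i) \<and> invertible_mat (g i) \<and>
     (grd \<longrightarrow> (\<forall>p<n i. \<forall>q<n i. g i $$ (p, q) \<noteq> 0 \<longrightarrow> vdeg i p = vdeg i q))}"

abbreviation "V \<equiv> VV n"

lemma XX_D: "x \<in> XX \<Longrightarrow> x z \<noteq> 0 \<Longrightarrow> z \<in> coords c n wd \<and> okc z"
  unfolding XX_def by blast

lemma XX_supp:
  assumes "x \<in> XX" "xe x a p q \<noteq> 0"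
  shows "p < n (atarget a)" "q < n (asource a)" "arrow_ok c a"
    "grd \<Longrightarrow> vdeg (atarget a) p = vdeg (asource a) q + adeg c d a"
proof -
  have "p < n (atarget a) \<and> q < n (asource a) \<and> arrow_ok c a \<and>
    (grd \<longrightarrow> vdeg (atarget a) p = vdeg (asource a) q + adeg c d a)"
  proof (cases a)
    case (Al i j)
    then show ?thesis using XX_D[OF assms(1), of "CAlpha i j p q"] assms(2)
      by (auto simp: xe_def coords_def)
  next
    case (Ep i)
    then show ?thesis using XX_D[OF assms(1), of "CEps i p q"] assms(2)
      by (auto simp: xe_def coords_def)
  qed
  then show "p < n (atarget a)" "q < n (asource a)" "arrow_ok c a"
    "grd \<Longrightarrow> vdeg (atarget a) p = vdeg (asource a) q + adeg c d a" by auto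
qed

lemma XX_CA: "x \<in> XX \<Longrightarrow> x (CA i p q) \<noteq> 0 \<Longrightarrow> p < wd i \<and> q < n i \<and> (grd \<longrightarrow> wdeg i p = vdeg i q - d i)"
  using XX_D[of x "CA i p q"] by (auto simp: coords_def)

lemma XX_CAs: "x \<in> XX \<Longrightarrow> x (CAs i p q) \<noteq> 0 \<Longrightarrow> p < n i \<and> q < wd i \<and> (grd \<longrightarrow> vdeg i p = wdeg i q - d i)"
  using XX_D[of x "CAs i p q"] by (auto simp: coords_def)

definition row :: "'i rep \<Rightarrow> 'i \<Rightarrow> nat \<Rightarrow> (nat \<Rightarrow> complex) \<Rightarrow> complex" where
  "row x i m u = (\<Sum>p<n i. x (CA i m p) * u p)"

lemma row_sum: "row x i m (\<Sum>a\<in>A. cscale (k a) (f a)) = (\<Sum>a\<in>A. k a * row x i m (f a))"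
  unfolding row_def sum_cscale sum_distrib_left by (subst sum.swap) (simp add: mult_ac)

lemma row_0 [simp]: "row x i m 0 = 0" by (simp add: row_def)

definition sep :: "'i rep \<Rightarrow> bool" where
  "sep x \<longleftrightarrow> (\<forall>i. \<forall>u\<in>V i. (\<forall>i0 m w. m < wd i0 \<and> is_path c (i0, w) \<and> psource (i0, w) = i
     \<longrightarrow> row x i0 m (opw n x w u) = 0) \<longrightarrow> u = 0)"

text \<open>Translates the vectors that occur in \<open>stable\<close> into functions extended by
  0.\<close>

definition fnv :: "nat \<Rightarrow> complex vec \<Rightarrow> nat \<Rightarrow> complex" where
  "fnv k v = (\<lambda>p. if p < k then v $ p else 0)"

lemma fnv_V: "fnv (n i) v \<in> V i" by (simp add: fnv_def VV_def)

lemma fnv_alpha: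
  assumes x: "x \<in> XX" and v: "v \<in> carrier_vec (n j)"
  shows "fnv (n i) (alphaM n x i j *\<^sub>v v) = aop n x (Al i j) (fnv (n j) v)"
proof
  fix p
  show "fnv (n i) (alphaM n x i j *\<^sub>v v) p = aop n x (Al i j) (fnv (n j) v) p"
  proof (cases "p < n i")
    case True
    then show ?thesis using v
      by (auto simp: fnv_def aop_def xe_def alphaM_def scalar_prod_def atLeast0LessThan intro!: sum.cong)
  next
    case False
    then have "xe x (Al i j) p q = 0" for q using XX_supp(1)[OF x, of "Al i j" p q] by auto
    then show ?thesis using False by (simp add: fnv_def aop_def)
  qed
qed

lemma fnv_eps:
  assumes x: "x \<in> XX" and v: "v \<in> carrier_vec (n i)"
  shows "fnv (n i) (epsM n x i *\<^sub>v v) = aop n x (Ep i) (fnv (n i) v)"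
proof
  fix p
  show "fnv (n i) (epsM n x i *\<^sub>v v) p = aop n x (Ep i) (fnv (n i) v) p"
  proof (cases "p < n i")
    case True
    then show ?thesis using v
      by (auto simp: fnv_def aop_def xe_def epsM_def scalar_prod_def atLeast0LessThan intro!: sum.cong)
  next
    case False
    then have "xe x (Ep i) p q = 0" for q using XX_supp(1)[OF x, of "Ep i" p q] by auto
    then show ?thesis using False by (simp add: fnv_def aop_def)
  qed
qed

lemma aM_row:
  assumes v: "v \<in> carrier_vec (n i)" and m: "m < wd i"
  shows "(aM n wd x i *\<^sub>v v) $ m = row x i m (fnv (n i) v)"
  using v m by (auto simp: fnv_def row_def aM_def scalar_prod_def atLeast0LessThan intro!: sum.cong)

lemma fnv_add: "u \<in> carrier_vec k \<Longrightarrow> v \<in> carrier_vec k \<Longrightarrow> fnv k (u + v) = fnv k u + fnv k v"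
  by (auto simp: fnv_def fun_eq_iff)

lemma fnv_smult: "u \<in> carrier_vec k \<Longrightarrow> fnv k (a \<cdot>\<^sub>v u) = cscale a (fnv k u)"
  by (auto simp: fnv_def fun_eq_iff cscale_def)

lemma row_add: "row x i m (u + v) = row x i m u + row x i m v"
  by (simp add: row_def distrib_left sum.distrib)

lemma row_scale: "row x i m (cscale a u) = a * row x i m u"
  by (simp add: row_def cscale_def sum_distrib_left mult.left_commute)

text \<open>The common kernel T of all rows of a w, w a path, is the largest graded subspace that is
  preserved by the arrows and killed by a; stability says that it is 0.\<close>

lemma stable_iff_sep:
  assumes x: "x \<in> XX" shows "stable c n wd x \<longleftrightarrow> sep x"
proof
  assume st: "stable c n wd x"
  define T where "T i = {v \<in> carrier_vec (n i). \<forall>i0 m w. m < wd i0 \<and> is_path c (i0, w) \<and> psource (i0, w) = i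
     \<longrightarrow> row x i0 m (opw n x w (fnv (n i) v)) = 0}" for i
  have TD: "row x i0 m (opw n x w (fnv (n i) v)) = 0"
    if "v \<in> T i" "m < wd i0" "is_path c (i0, w)" "psource (i0, w) = i" for v i i0 m w
    using that unfolding T_def by blast
  have "\<forall>i. T i = {0\<^sub>v (n i)}"
  proof (rule st[unfolded stable_def, THEN spec, THEN mp], intro conjI allI impI ballI)
    fix i
    show "linear_subspace (n i) (T i)" unfolding linear_subspace_def
    proof (intro conjI ballI allI)
      have "fnv (n i) (0\<^sub>v (n i)) = 0" by (auto simp: fnv_def fun_eq_iff)
      then show "0\<^sub>v (n i) \<in> T i" by (auto simp: T_def clin_0[OF clin_opw])
      fix u assume u: "u \<in> T i"
      show "u + v \<in> T i" if v: "v \<in> T i" for v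
        using u v unfolding T_def by (auto simp: fnv_add clin_add[OF clin_opw] row_add simp del: plus_fun_apply)
      show "a \<cdot>\<^sub>v u \<in> T i" for a
        using u unfolding T_def by (auto simp: fnv_smult clin_scale[OF clin_opw] row_scale)
    qed (auto simp: T_def)
  next
    fix i j v assume ij: "c i j < 0" and v: "v \<in> T j"
    then have vc: "v \<in> carrier_vec (n j)" by (simp add: T_def)
    show "alphaM n x i j *\<^sub>v v \<in> T i" unfolding T_def
    proof (intro CollectI conjI allI impI)
      show "alphaM n x i j *\<^sub>v v \<in> carrier_vec (n i)" by (simp add: alphaM_def carrier_vecI)
      fix i0 m w assume a: "m < wd i0 \<and> is_path c (i0, w) \<and> psource (i0, w) = i"
      have "row x i0 m (opw n x (w @ [Al i j]) (fnv (n j) v)) = 0"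
        using a ij by (intro TD[OF v]) (auto simp: is_path_append psource_append)
      then show "row x i0 m (opw n x w (fnv (n i) (alphaM n x i j *\<^sub>v v))) = 0"
        by (simp add: fnv_alpha[OF x vc])
    qed
  next
    fix i v assume v: "v \<in> T i"
    then have vc: "v \<in> carrier_vec (n i)" by (simp add: T_def)
    show "epsM n x i *\<^sub>v v \<in> T i" unfolding T_def
    proof (intro CollectI conjI allI impI)
      show "epsM n x i *\<^sub>v v \<in> carrier_vec (n i)" by (simp add: epsM_def carrier_vecI)
      fix i0 m w assume a: "m < wd i0 \<and> is_path c (i0, w) \<and> psource (i0, w) = i"
      have "row x i0 m (opw n x (w @ [Ep i]) (fnv (n i) v)) = 0"
        using a by (intro TD[OF v]) (auto simp: is_path_append psource_append)
      then show "row x i0 m (opw n x w (fnv (n i) (epsM n x i *\<^sub>v v))) = 0"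
        by (simp add: fnv_eps[OF x vc])
    qed
    show "aM n wd x i *\<^sub>v v = 0\<^sub>v (wd i)"
    proof (rule eq_vecI)
      fix m assume "m < dim_vec (0\<^sub>v (wd i) :: complex vec)"
      then have m: "m < wd i" by simp
      then show "(aM n wd x i *\<^sub>v v) $ m = 0\<^sub>v (wd i) $ m"
        using TD[OF v m, of "[]"] aM_row[OF vc m] by simp
    qed (simp add: aM_def)
  qed
  then have T0: "T i = {0\<^sub>v (n i)}" for i by blast
  show "sep x" unfolding sep_def
  proof (intro allI ballI impI)
    fix i u assume u: "u \<in> V i" and 0: "\<forall>i0 m w. m < wd i0 \<and> is_path c (i0, w) \<and> psource (i0, w) = i
     \<longrightarrow> row x i0 m (opw n x w u) = 0"
    have eq: "fnv (n i) (vec (n i) u) = u" using u by (auto simp: fnv_def VV_def fun_eq_iff)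
    have "vec (n i) u \<in> T i" unfolding T_def using 0 by (simp add: eq)
    then have "vec (n i) u = 0\<^sub>v (n i)" using T0 by blast
    then have "fnv (n i) (0\<^sub>v (n i)) = u" using eq by simp
    moreover have "fnv (n i) (0\<^sub>v (n i)) = 0" by (auto simp: fnv_def fun_eq_iff)
    ultimately show "u = 0" by simp
  qed
next
  assume sp: "sep x"
  show "stable c n wd x" unfolding stable_def
  proof (intro allI impI; elim conjE)
    fix T i
    assume T: "\<forall>i. linear_subspace (n i) (T i)" "\<forall>i j. c i j < 0 \<longrightarrow> (\<forall>u\<in>T j. alphaM n x i j *\<^sub>v u \<in> T i)"
      "\<forall>i. \<forall>u\<in>T i. epsM n x i *\<^sub>v u \<in> T i" "\<forall>i. \<forall>u\<in>T i. aM n wd x i *\<^sub>v u = 0\<^sub>v (wd i)"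
    have Tc: "v \<in> carrier_vec (n i)" if "v \<in> T i" for v i using T(1) that by (auto simp: linear_subspace_def)
    have path: "\<exists>v'\<in>T i0. opw n x w (fnv (n i) v) = fnv (n i0) v'"
      if "v \<in> T i" "is_path c (i0, w)" "psource (i0, w) = i" for v i i0 w
      using that(2,3)
    proof (induction w arbitrary: i0)
      case Nil
      then show ?case using that(1) by auto
    next
      case (Cons a w)
      then obtain v' where v': "v' \<in> T (asource a)" "opw n x w (fnv (n i) v) = fnv (n (asource a)) v'"
        unfolding is_path_Cons by auto
      show ?case
      proof (cases a)
        case (Al i' j)
        then show ?thesis using Cons.prems v' T(2) fnv_alpha[OF x, of v' j i'] Tc[OF v'(1)]
          by (intro bexI[of _ "alphaM n x i' j *\<^sub>v v'"]) auto
      next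
        case (Ep i')
        then show ?thesis using Cons.prems v' T(3) fnv_eps[OF x, of v' i'] Tc[OF v'(1)]
          by (intro bexI[of _ "epsM n x i' *\<^sub>v v'"]) auto
      qed
    qed
    have "v = 0\<^sub>v (n i)" if v: "v \<in> T i" for v
    proof -
      have "fnv (n i) v = 0"
      proof (rule sp[unfolded sep_def, rule_format, OF fnv_V])
        fix i0 m w assume a: "m < wd i0 \<and> is_path c (i0, w) \<and> psource (i0, w) = i"
        then obtain v' where v': "v' \<in> T i0" "opw n x w (fnv (n i) v) = fnv (n i0) v'"
          using path[OF v] by blast
        then show "row x i0 m (opw n x w (fnv (n i) v)) = 0"
          using aM_row[OF Tc[OF v'(1)], of m x] T(4) a by auto
      qed
      then have "fnv (n i) v p = 0" for p by simp
      then have "v $ p = 0" if "p < n i" for p using that unfolding fnv_def by metis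
      then show ?thesis using Tc[OF v] by (intro eq_vecI) auto
    qed
    moreover have "0\<^sub>v (n i) \<in> T i" using T(1) by (simp add: linear_subspace_def)
    ultimately show "T i = {0\<^sub>v (n i)}" by blast
  qed
qed

end

section \<open>The equations of critical points with \<open>a\<^sup>* = 0\<close>\<close>

context setting
begin

lemma clin_ext:
  assumes "clin f" "clin g" "\<And>q. q < n i \<Longrightarrow> f (ev q) = g (ev q)" "u \<in> V i"
  shows "f u = g u"
proof -
  have u: "u = (\<Sum>p<n i. cscale (u p) (ev p))" using assms(4) by (rule VV_expand)
  have "f u = (\<Sum>p<n i. cscale (u p) (f (ev p)))" by (subst u) (simp only: clin_sum[OF assms(1)] clin_scale[OF assms(1)])
  also have "\<dots> = (\<Sum>p<n i. cscale (u p) (g (ev p)))" using assms(3) by (intro sum.cong) auto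
  also have "\<dots> = g (\<Sum>p<n i. cscale (u p) (ev p))" by (simp only: clin_sum[OF assms(2)] clin_scale[OF assms(2)])
  finally show ?thesis unfolding u[symmetric] .
qed

abbreviation "ff i j \<equiv> nat (- c i j)"

text \<open>Written for entries at basis vectors, the relations are polynomial equations in x, as
  \<open>PS_closed\<close> requires; \<open>EQc_D\<close>, \<open>EQm_D\<close> and
  \<open>EQa_D\<close> return to arbitrary vectors.\<close>

definition EQc :: "'i rep \<Rightarrow> bool" where
  "EQc x \<longleftrightarrow> (\<forall>i j p q. c i j < 0 \<and> q < n j \<longrightarrow>
     opw n x (replicate (ff i j) (Ep i)) (aop n x (Al i j) (ev q)) p
       = aop n x (Al i j) (opw n x (replicate (ff j i) (Ep j)) (ev q)) p)"

definition EQm :: "'i rep \<Rightarrow> bool" where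
  "EQm x \<longleftrightarrow> (\<forall>i p q. q < n i \<longrightarrow> (\<Sum>j\<in>UNIV. \<Sum>k<ff i j. osign Or i j *
        opw n x (replicate k (Ep i)) (aop n x (Al i j) (aop n x (Al j i)
          (opw n x (replicate (ff i j - 1 - k) (Ep i)) (ev q)))) p) = 0)"

text \<open>The identity a \<epsilon> = \<gamma> a: in the homogeneous basis \<gamma> is a weighted
  shift, so its first row in each block is 0.\<close>

definition EQa :: "'i rep \<Rightarrow> bool" where
  "EQa x \<longleftrightarrow> (\<forall>r m q. r \<in> RS \<and> m < ll r \<and> q < n (ii r) \<longrightarrow>
     row x (ii r) (wpos r m) (aop n x (Ep (ii r)) (ev q))
       = (case m of 0 \<Rightarrow> 0 | Suc m' \<Rightarrow> gs r m' * row x (ii r) (wpos r m') (ev q)))"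

definition as0 :: "'i rep \<Rightarrow> bool" where
  "as0 x \<longleftrightarrow> (\<forall>i p m. x (CAs i p m) = 0)"

text \<open>By \<open>orb_CF\<close> these are the stable points whose orbit lies in the critical
  locus and in the nilpotent fibre.\<close>

definition PS :: "'i rep set" where
  "PS = {x \<in> XX. stable c n wd x \<and> EQc x \<and> EQm x \<and> EQa x \<and> as0 x}"

lemma EQc_D:
  assumes "EQc x" "c i j < 0" "u \<in> V j"
  shows "opw n x (replicate (ff i j) (Ep i)) (aop n x (Al i j) u)
          = aop n x (Al i j) (opw n x (replicate (ff j i) (Ep j)) u)"
  using assms(3)
  by (rule clin_ext[rotated 3])
    (use assms(1,2) in \<open>auto simp: EQc_def intro: clin_comp[OF clin_opw clin_aop] clin_comp[OF clin_aop clin_opw]\<close>)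

lemma EQm_D:
  assumes "EQm x" "u \<in> V i"
  shows "(\<Sum>j\<in>UNIV. \<Sum>k<ff i j. cscale (osign Or i j)
        (opw n x (replicate k (Ep i)) (aop n x (Al i j) (aop n x (Al j i)
          (opw n x (replicate (ff i j - 1 - k) (Ep i)) u))))) = 0" (is "?f u = 0")
proof -
  have "clin ?f" unfolding clin_def
    by (simp only: clin_add[OF clin_opw] clin_add[OF clin_aop] clin_scale[OF clin_opw] clin_scale[OF clin_aop]
      cfun.scale_right_distrib sum.distrib cscale_cscale cfun.scale_sum_right mult.commute simp_thms)
  moreover have "clin (\<lambda>u. 0)" by (auto simp: clin_def)
  moreover have "?f (ev q) = 0" if "q < n i" for q
  proof
    fix p
    show "?f (ev q) p = 0 p" using assms(1) that unfolding EQm_def sum_apply cscale_def by simp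
  qed
  ultimately show ?thesis using clin_ext[of ?f "\<lambda>u. 0" i u] assms(2) by blast
qed

lemma row_ext:
  assumes "u \<in> V i" "clin f" "clin g"
    "\<And>q. q < n i \<Longrightarrow> row x i1 m1 (f (ev q)) = a * row x i2 m2 (g (ev q))"
  shows "row x i1 m1 (f u) = a * row x i2 m2 (g u)"
proof -
  have u: "u = (\<Sum>p<n i. cscale (u p) (ev p))" using assms(1) by (rule VV_expand)
  have "row x i1 m1 (f (\<Sum>p<n i. cscale (u p) (ev p))) = (\<Sum>p<n i. u p * row x i1 m1 (f (ev p)))"
    by (simp only: clin_sum[OF assms(2)] clin_scale[OF assms(2)] row_sum)
  also have "\<dots> = (\<Sum>p<n i. a * (u p * row x i2 m2 (g (ev p))))"
    using assms(4) by (intro sum.cong refl) (simp add: mult.left_commute)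
  also have "\<dots> = a * (\<Sum>p<n i. u p * row x i2 m2 (g (ev p)))" by (simp add: sum_distrib_left)
  also have "(\<Sum>p<n i. u p * row x i2 m2 (g (ev p))) = row x i2 m2 (g (\<Sum>p<n i. cscale (u p) (ev p)))"
    by (simp only: clin_sum[OF assms(3)] clin_scale[OF assms(3)] row_sum)
  finally show ?thesis unfolding u[symmetric] .
qed

lemma EQa_D:
  assumes "EQa x" "r \<in> RS" "u \<in> V (ii r)"
  shows "0 < ll r \<Longrightarrow> row x (ii r) (wpos r 0) (aop n x (Ep (ii r)) u) = 0"
    "Suc m < ll r \<Longrightarrow> row x (ii r) (wpos r (Suc m)) (aop n x (Ep (ii r)) u) = gs r m * row x (ii r) (wpos r m) u"
proof -
  assume "0 < ll r"
  then have "row x (ii r) (wpos r 0) (aop n x (Ep (ii r)) u) = 0 * row x (ii r) (wpos r 0) u"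
    using assms by (intro row_ext[OF assms(3) clin_aop clin_id]) (auto simp: EQa_def)
  then show "row x (ii r) (wpos r 0) (aop n x (Ep (ii r)) u) = 0" by simp
next
  assume "Suc m < ll r"
  then show "row x (ii r) (wpos r (Suc m)) (aop n x (Ep (ii r)) u) = gs r m * row x (ii r) (wpos r m) u"
    using assms by (intro row_ext[OF assms(3) clin_aop clin_id]) (force simp: EQa_def)
qed

lemma aop_V: "x \<in> XX \<Longrightarrow> aop n x a u \<in> V (atarget a)"
  by (intro aop_VV XX_supp(1)) auto

lemma opw_V: "x \<in> XX \<Longrightarrow> is_path c (t, w) \<Longrightarrow> psource (t, w) = i \<Longrightarrow> u \<in> V i \<Longrightarrow> opw n x w u \<in> V t"
proof (cases w)
  case (Cons a w')
  moreover assume "is_path c (t, w)" "x \<in> XX"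
  ultimately show ?thesis using aop_V[of x a] by simp
qed auto

lemma E_V: "x \<in> XX \<Longrightarrow> u \<in> V i \<Longrightarrow> opw n x (replicate k (Ep i)) u \<in> V i"
  by (rule opw_V) auto

lemma eps_add: "opw n x (replicate (k + k') (Ep i)) u = opw n x (replicate k (Ep i)) (opw n x (replicate k' (Ep i)) u)"
  by (simp add: replicate_add)

lemma row_eps_0:
  assumes x: "x \<in> XX" "EQa x" and r: "r \<in> RS" and m: "m < ll r" "m < k" and u: "u \<in> V (ii r)"
  shows "row x (ii r) (wpos r m) (opw n x (replicate k (Ep (ii r))) u) = 0"
  using m
proof (induction m arbitrary: k)
  case 0
  then obtain k' where "k = Suc k'" by (cases k) auto
  then show ?case using EQa_D(1)[OF x(2) r E_V[OF x(1) u]] 0 by simp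
next
  case (Suc m)
  then obtain k' where k: "k = Suc k'" by (cases k) auto
  then show ?case using EQa_D(2)[OF x(2) r E_V[OF x(1) u] Suc.prems(1)] Suc.IH[of k'] Suc.prems by simp
qed

text \<open>Up to the nonzero factor \<open>gs r m\<close>, row m of a u is row m + 1 of a
  \<epsilon> u; descending from the last row, everything is expressed by last rows of a \<epsilon>^k
  u.\<close>

lemma rows_from_last:
  assumes x: "x \<in> XX" "EQa x" and r: "r \<in> RS" and u: "u \<in> V (ii r)"
    and 0: "\<And>k. row x (ii r) (wpos r (ll r - 1)) (opw n x (replicate k (Ep (ii r))) u) = 0"
    and m: "m < ll r"
  shows "row x (ii r) (wpos r m) u = 0"
proof -
  have "row x (ii r) (wpos r (ll r - 1 - t)) (opw n x (replicate k (Ep (ii r))) u) = 0" if "t < ll r" for t k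
    using that
  proof (induction t arbitrary: k)
    case (Suc t)
    have e: "ll r - 1 - t = Suc (ll r - 1 - Suc t)" using Suc.prems by simp
    have "gs r (ll r - 1 - Suc t) * row x (ii r) (wpos r (ll r - 1 - Suc t)) (opw n x (replicate k (Ep (ii r))) u)
      = row x (ii r) (wpos r (ll r - 1 - t)) (opw n x (replicate (Suc k) (Ep (ii r))) u)"
      using EQa_D(2)[OF x(2) r E_V[OF x(1) u], of "ll r - 1 - Suc t" k] Suc.prems e by simp
    also have "\<dots> = 0" using Suc.IH[of "Suc k"] Suc.prems by simp
    finally show ?case using gs_nz[OF r, of "ll r - 1 - Suc t"] Suc.prems by simp
  qed (use 0 in simp)
  from this[of "ll r - 1 - m" 0] show ?thesis using m by simp
qed

text \<open>Nilpotency of the \<open>\<epsilon>\<^sub>i\<close>: the elements \<open>\<epsilon>\<^sub>i\<^bsup>zz i\<^esup>\<close> form a central element, and its powers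
  are moved to the framing, where \<open>\<gamma>\<close> is nilpotent.\<close>

definition ZZ :: nat where
  "ZZ = (\<Prod>(a, b)\<in>UNIV \<times> UNIV. nat (d a) * (if c a b < 0 then ff a b else 1))"

definition zz :: "'i \<Rightarrow> nat" where "zz i = ZZ div nat (d i)"

text \<open>Symmetry of d_i c_ij says that d_i f_ij = d_j f_ji, so division of the common multiple
  \<open>ZZ\<close> by d_i and by d_j leaves the same cofactor m.\<close>

lemma zz_edge:
  assumes "c i j < 0" obtains m where "zz i = ff i j * m" "zz j = ff j i * m"
proof -
  have "nat (d i) * ff i j dvd ZZ" unfolding ZZ_def
    using dvd_prodI[of "UNIV \<times> UNIV" "(i, j)" "\<lambda>(a, b). nat (d a) * (if c a b < 0 then ff a b else 1)"] assms
    by simp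
  then obtain m where m: "ZZ = nat (d i) * ff i j * m" by blast
  have "int (nat (d i) * ff i j) = int (nat (d j) * ff j i)"
    using d_sym[of i j] d_pos[of i] d_pos[of j] assms c_sym[OF assms] by simp
  then have m': "ZZ = nat (d j) * ff j i * m" using m by (simp only: of_nat_eq_iff)
  have "zz i = ff i j * m" unfolding zz_def m using d_pos[of i] by (simp add: mult.assoc)
  moreover have "zz j = ff j i * m" unfolding zz_def m' using d_pos[of j] by (simp add: mult.assoc)
  ultimately show ?thesis by (rule that)
qed

lemma zz_pos: "0 < zz i"
proof -
  have "nat (d i) * (if c i i < 0 then ff i i else 1) dvd ZZ" unfolding ZZ_def
    using dvd_prodI[of "UNIV \<times> UNIV" "(i, i)" "\<lambda>(a, b). nat (d a) * (if c a b < 0 then ff a b else 1)"] by simp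
  then have "nat (d i) dvd ZZ" by (rule dvd_mult_left)
  moreover have "ZZ > 0" unfolding ZZ_def using d_pos by (intro prod_pos) auto
  ultimately show ?thesis using d_pos[of i] unfolding zz_def by (auto intro: dvd_imp_le simp: div_greater_zero_iff)
qed

text \<open>For an edge the commutation relation is applied m N times, m being the cofactor from
  \<open>zz_edge\<close>; a loop commutes with its own powers.\<close>

lemma zz_central:
  assumes x: "x \<in> XX" "EQc x" and u: "u \<in> V (asource a)" and a: "arrow_ok c a"
  shows "opw n x (replicate (zz (atarget a) * N) (Ep (atarget a))) (aop n x a u)
    = aop n x a (opw n x (replicate (zz (asource a) * N) (Ep (asource a))) u)"
proof (cases a)
  case (Al i j)
  then have cij: "c i j < 0" using a by simp
  obtain m where m: "zz i = ff i j * m" "zz j = ff j i * m" using zz_edge[OF cij] by blast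
  have *: "opw n x (replicate (ff i j * k) (Ep i)) (aop n x (Al i j) u)
     = aop n x (Al i j) (opw n x (replicate (ff j i * k) (Ep j)) u)" for k
  proof (induction k)
    case (Suc k)
    have "opw n x (replicate (ff i j * Suc k) (Ep i)) (aop n x (Al i j) u)
      = opw n x (replicate (ff i j) (Ep i)) (aop n x (Al i j) (opw n x (replicate (ff j i * k) (Ep j)) u))"
      using Suc by (simp add: eps_add)
    also have "\<dots> = aop n x (Al i j) (opw n x (replicate (ff j i * Suc k) (Ep j)) u)"
      using EQc_D[OF x(2) cij E_V[OF x(1)], of u "ff j i * k"] u Al by (simp add: eps_add)
    finally show ?case .
  qed simp
  show ?thesis using *[of "m * N"] by (simp add: Al m mult.assoc)
next
  case (Ep i)
  have "opw n x (replicate k (Ep i)) (aop n x (Ep i) u) = aop n x (Ep i) (opw n x (replicate k (Ep i)) u)" for k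
    by (induction k) auto
  then show ?thesis by (simp add: Ep)
qed

lemma zz_central_path:
  assumes x: "x \<in> XX" "EQc x" and u: "u \<in> V i"
  shows "is_path c (t, w) \<Longrightarrow> psource (t, w) = i \<Longrightarrow>
    opw n x (replicate (zz t * N) (Ep t)) (opw n x w u) = opw n x w (opw n x (replicate (zz i * N) (Ep i)) u)"
proof (induction w arbitrary: t)
  case (Cons a w)
  then have a: "atarget a = t" "arrow_ok c a" "is_path c (asource a, w)" "psource (asource a, w) = i"
    unfolding is_path_Cons by auto
  show ?case using zz_central[OF x opw_V[OF x(1) a(3,4) u] a(2), of N] Cons.IH[OF a(3,4)] a(1) by simp
qed simp

text \<open>A power of \<epsilon> with exponent \<open>zz i * N\<close> can be moved through any
  path to the framing, where a \<epsilon> = \<gamma> a makes it vanish. So all rows of a w vanish on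
  its image, and \<open>sep\<close> concludes.\<close>

lemma eps_nilpotent:
  assumes x: "x \<in> PS"
  shows "\<exists>N. \<forall>i. \<forall>u\<in>V i. opw n x (replicate N (Ep i)) u = 0"
proof -
  have X: "x \<in> XX" and c: "EQc x" and a: "EQa x" and sp: "sep x"
    using x stable_iff_sep by (auto simp: PS_def)
  \<comment> \<open>At least as large as every block length; as \<open>zz\<close> is positive,
    \<open>zz i * N\<close> exceeds each row index inside a block, which is what
    \<open>row_eps_0\<close> asks for.\<close>
  define N where "N = (\<Sum>r\<in>RS. ll r)"
  have N: "ll r \<le> N" if "r \<in> RS" for r unfolding N_def by (rule member_le_sum) (use that in auto)
  have z: "opw n x (replicate (zz i * N) (Ep i)) u = 0" if u: "u \<in> V i" for i u
  proof (rule sp[unfolded sep_def, rule_format, OF E_V[OF X u]])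
    fix i0 q w assume w: "q < wd i0 \<and> is_path c (i0, w) \<and> psource (i0, w) = i"
    then obtain r m where r: "r \<in> RS" "ii r = i0" "m < ll r" "q = wpos r m" using wpos_surj by blast
    have "m < zz i0 * N" using N[OF r(1)] r(3) zz_pos[of i0]
      by (metis less_le_trans mult_le_mono1 nat_mult_1 Suc_leI One_nat_def order_trans)
    then show "row x i0 q (opw n x w (opw n x (replicate (zz i * N) (Ep i)) u)) = 0"
      using zz_central_path[OF X c u, of i0 w N] w row_eps_0[OF X a r(1,3), of "zz i0 * N" "opw n x w u"]
        opw_V[OF X, of i0 w i u] u r by auto
  qed
  \<comment> \<open>One exponent that works for every vertex.\<close>
  have "opw n x (replicate (\<Sum>i\<in>UNIV. zz i * N) (Ep i)) u = 0" if u: "u \<in> V i" for i u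
  proof -
    have "zz i * N \<le> (\<Sum>i\<in>UNIV. zz i * N)" by (rule member_le_sum) auto
    then obtain k where k: "(\<Sum>i\<in>UNIV. zz i * N) = k + zz i * N" by (metis le_Suc_ex add.commute)
    show ?thesis unfolding k eps_add z[OF u] by (simp add: clin_0[OF clin_opw])
  qed
  then show ?thesis by blast
qed

lemma qrep_PS:
  assumes x: "x \<in> PS" shows "qrep c Or n x"
proof unfold_locales
  show "\<exists>N. \<forall>i. \<forall>u\<in>V i. opw n x (replicate N (Ep i)) u = 0" by (rule eps_nilpotent[OF x])
next
  fix i j u assume "c i j < 0" "u \<in> V j"
  then show "opw n x (replicate (ff i j) (Ep i)) (aop n x (Al i j) u)
          = aop n x (Al i j) (opw n x (replicate (ff j i) (Ep j)) u)"
    using x by (intro EQc_D) (auto simp: PS_def)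
next
  fix i u assume "u \<in> V i"
  then show "(\<Sum>j\<in>UNIV. \<Sum>k<ff i j. cscale (osign Or i j)
        (opw n x (replicate k (Ep i)) (aop n x (Al i j) (aop n x (Al j i)
          (opw n x (replicate (ff i j - 1 - k) (Ep i)) u))))) = 0"
    using x by (intro EQm_D) (auto simp: PS_def)
next
  fix a p q assume "xe x a p q \<noteq> 0"
  then show "p < n (atarget a)" using XX_supp(1) x by (auto simp: PS_def)
qed (fact c_diag c_off posdef osign_sq)+

lemma long_paths_vanish:
  assumes "x \<in> PS"
  obtains N where "\<And>t w i u. is_path c (t, w) \<Longrightarrow> psource (t, w) = i \<Longrightarrow> N \<le> length w \<Longrightarrow> u \<in> V i \<Longrightarrow> opw n x w u = 0"
proof -
  have X: "x \<in> XX" using assms by (simp add: PS_def)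
  interpret q: qrep c d Or n x by (rule qrep_PS[OF assms])
  obtain N where N: "\<And>i. q.FF N i = V i" using q.nilpotent by blast
  have *: "opw n x w u = 0" if w: "is_path c (t, w)" "psource (t, w) = i" "N \<le> length w" and u: "u \<in> V i" for t w i u
  proof -
    let ?a = "take (length w - N) w" and ?b = "drop (length w - N) w"
    have p: "is_path c (t, ?a @ ?b)" "psource (t, ?a @ ?b) = i" using w by simp_all
    then have b: "is_path c (psource (t, ?a), ?b)" "psource (psource (t, ?a), ?b) = i"
      unfolding is_path_append psource_append by blast+
    have "u \<in> q.FF N i" using N u by simp
    then have "opw n x ?b u = 0" using q.FF_D[OF _ b] w(3) by simp
    then have "opw n x (?a @ ?b) u = 0" by (simp only: opw_simps(3) clin_0[OF clin_opw])
    then show ?thesis by simp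
  qed
  show ?thesis by (rule that[of N]) (rule *)
qed

end

section \<open>The frame of a point\<close>

lemma clin_unhat_like: "clin f \<Longrightarrow> f (\<Sum>a\<in>A. cscale (k a) (g a)) = (\<Sum>a\<in>A. cscale (k a) (f (g a)))"
  by (simp only: clin_sum clin_scale)

context setting
begin

lemma clin_unhat: "clin unhat"
  by (simp only: clin_def unhat_add unhat_scale simp_thms)

lemma clin_hat: "clin hat"
  by (simp only: clin_def hat_add hat_scale simp_thms)

lemma clin_opa: "clin (opa a)"
  by (auto simp: clin_def opa_def cscale_def fun_eq_iff)

lemma clin_opr: "clin (opr i)"
  by (auto simp: clin_def opr_def cscale_def fun_eq_iff)

text \<open>The word is flipped because arrows act on the dual through tau. One row for each r is
  enough, as each summand is the dual of a cyclic module.\<close>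

definition lamv :: "'i rep \<Rightarrow> 'i \<Rightarrow> (nat \<Rightarrow> complex) \<Rightarrow> nat \<times> 'i qpath \<Rightarrow> complex" where
  "lamv x i u = (\<lambda>(r, t, w). if r \<in> RS \<and> is_path c (t, w) \<and> psource (t, w) = ii r \<and> t = i
     then row x (ii r) (wpos r (ll r - 1)) (opw n x (flipw w) u) else 0)"

lemma clin_lamv: "clin (lamv x i)"
  unfolding clin_def lamv_def clin_add[OF clin_opw] clin_scale[OF clin_opw] row_add row_scale
  by (auto simp: fun_eq_iff cscale_def)

lemma flip_path: "is_path c (t, w) \<Longrightarrow> is_path c (psource (t, w), flipw w)"
  by (rule is_path_flipw[OF c_sym])

lemma flip_V:
  assumes "x \<in> XX" "is_path c (t, w)" "u \<in> V t" shows "opw n x (flipw w) u \<in> V (psource (t, w))"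
  using opw_V[OF assms(1) flip_path[OF assms(2)] psource_flipw[OF assms(2)] assms(3)] .

text \<open>A prefix of the argument acts on the vector. The conditions of \<open>KP\<close> thereby
  reduce to identities between operators on V.\<close>

lemma lamv_append:
  assumes x: "x \<in> XX" and u: "is_path c (t, u)"
  shows "lamv x t z (r, t, u @ w) = lamv x (psource (t, u)) (opw n x (flipw u) z) (r, psource (t, u), w)"
  using u by (auto simp: lamv_def is_path_append psource_append)

lemma lamv_support:
  "lamv x i u (r, p) \<noteq> 0 \<Longrightarrow> r \<in> RS \<and> is_path c p \<and> psource p = ii r \<and> fst p = i"
  by (cases p) (auto simp: lamv_def split: if_splits)

lemma finite_arrows: "finite (UNIV :: 'i arrow set)"
proof -
  have "(UNIV :: 'i arrow set) = (\<lambda>(i, j). Al i j) ` UNIV \<union> Ep ` UNIV"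
  proof (intro Set.set_eqI iffI UNIV_I)
    fix a :: "'i arrow"
    show "a \<in> (\<lambda>(i, j). Al i j) ` UNIV \<union> Ep ` UNIV" by (cases a) auto
  qed
  then show ?thesis by (metis finite_Un finite_imageI finite)
qed

text \<open>After flipping, the relation for (i, j) is the one for (j, i), applied to the vector
  produced by the prefix u. If the prefix does not fit, neither word is a path.\<close>

lemma lamv_comm:
  assumes x: "x \<in> PS" and z: "z \<in> V t" and ij: "c i j < 0"
  shows "lamv x t z (r, t, u @ replicate (ff i j) (Ep i) @ [Al i j] @ w)
    = lamv x t z (r, t, u @ [Al i j] @ replicate (ff j i) (Ep j) @ w)"
proof (cases "is_path c (t, u) \<and> psource (t, u) = i")
  case True
  have X: "x \<in> XX" "EQc x" using x by (auto simp: PS_def)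
  let ?z = "opw n x (flipw u) z"
  have zV: "?z \<in> V i" using flip_V[OF X(1), of t u z] True z by simp
  have a: "is_path c (i, replicate (ff i j) (Ep i) @ [Al i j])" "psource (i, replicate (ff i j) (Ep i) @ [Al i j]) = j"
    "is_path c (i, [Al i j] @ replicate (ff j i) (Ep j))" "psource (i, [Al i j] @ replicate (ff j i) (Ep j)) = j"
    using ij by (auto simp: is_path_append psource_append)
  have "opw n x (flipw (replicate (ff i j) (Ep i) @ [Al i j])) ?z = opw n x (flipw ([Al i j] @ replicate (ff j i) (Ep j))) ?z"
    using EQc_D[OF X(2) c_sym[OF ij] zV] by simp
  then show ?thesis
    using lamv_append[OF X(1), of t u z r] lamv_append[OF X(1) a(1), of ?z r w] lamv_append[OF X(1) a(3), of ?z r w] True a(2,4)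
    by simp
next
  case False
  then have "\<not> is_path c (t, u @ replicate (ff i j) (Ep i) @ [Al i j] @ w)"
    "\<not> is_path c (t, u @ [Al i j] @ replicate (ff j i) (Ep j) @ w)"
    using ij by (auto simp: is_path_append)
  then show ?thesis using lamv_support by metis
qed

text \<open>Flipping exchanges the exponents k and f - 1 - k around \<alpha>_ij \<alpha>_ji;
  reindexing the sum restores the mesh relation.\<close>

lemma lamv_mesh:
  assumes x: "x \<in> PS" and z: "z \<in> V t"
  shows "(\<Sum>j\<in>UNIV. \<Sum>k<ff i j. osign Or i j * lamv x t z (r, t, u @
       (replicate k (Ep i) @ [Al i j, Al j i] @ replicate (ff i j - 1 - k) (Ep i)) @ w)) = 0"
proof (cases "is_path c (t, u) \<and> psource (t, u) = i")
  case True
  have X: "x \<in> XX" "EQm x" using x by (auto simp: PS_def)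
  let ?z = "opw n x (flipw u) z"
  let ?o = "\<lambda>j k. opw n x (replicate k (Ep i)) (aop n x (Al i j) (aop n x (Al j i)
          (opw n x (replicate (ff i j - 1 - k) (Ep i)) ?z)))"
  have zV: "?z \<in> V i" using flip_V[OF X(1), of t u z] True z by simp
  have e: "lamv x t z (r, t, u @ (replicate k (Ep i) @ [Al i j, Al j i] @ replicate (ff i j - 1 - k) (Ep i)) @ w)
    = lamv x i (?o j (ff i j - 1 - k)) (r, i, w)" if k: "k < ff i j" for j k
  proof -
    let ?q = "replicate k (Ep i) @ [Al i j, Al j i] @ replicate (ff i j - 1 - k) (Ep i)"
    have cij: "c i j < 0" using k by simp
    have q: "is_path c (i, ?q)" "psource (i, ?q) = i"
      using cij c_sym[OF cij] by (auto simp: is_path_append psource_append)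
    have "opw n x (flipw ?q) ?z = ?o j (ff i j - 1 - k)" using k by simp
    then show ?thesis using lamv_append[OF X(1), of t u z r "?q @ w"] lamv_append[OF X(1) q(1), of ?z r w] True q(2)
      by simp
  qed
  have "(\<Sum>j\<in>UNIV. \<Sum>k<ff i j. osign Or i j * lamv x t z (r, t, u @
       (replicate k (Ep i) @ [Al i j, Al j i] @ replicate (ff i j - 1 - k) (Ep i)) @ w))
     = (\<Sum>j\<in>UNIV. \<Sum>k<ff i j. osign Or i j * lamv x i (?o j (ff i j - 1 - k)) (r, i, w))"
    by (intro sum.cong refl arg_cong2[of _ _ _ _ "(*)"] e) simp
  also have "\<dots> = (\<Sum>j\<in>UNIV. \<Sum>k<ff i j. osign Or i j * lamv x i (?o j k) (r, i, w))"
  proof (rule sum.cong[OF refl])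
    fix j
    show "(\<Sum>k<ff i j. osign Or i j * lamv x i (?o j (ff i j - 1 - k)) (r, i, w))
      = (\<Sum>k<ff i j. osign Or i j * lamv x i (?o j k) (r, i, w))"
      by (rule sum.reindex_bij_witness[of _ "\<lambda>k. ff i j - 1 - k" "\<lambda>k. ff i j - 1 - k"]) auto
  qed
  also have "\<dots> = lamv x i (\<Sum>j\<in>UNIV. \<Sum>k<ff i j. cscale (osign Or i j) (?o j k)) (r, i, w)"
    unfolding clin_sum[OF clin_lamv] clin_scale[OF clin_lamv] sum_apply by (simp only: cscale_def)
  also have "\<dots> = 0" using EQm_D[OF X(2) zV] by (simp add: clin_0[OF clin_lamv])
  finally show ?thesis .
next
  case False
  have "lamv x t z (r, t, u @ (replicate k (Ep i) @ [Al i j, Al j i] @ replicate (ff i j - 1 - k) (Ep i)) @ w) = 0" for j k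
  proof -
    have "\<not> is_path c (t, u @ (replicate k (Ep i) @ [Al i j, Al j i] @ replicate (ff i j - 1 - k) (Ep i)) @ w)"
      using False by (auto simp: is_path_append psource_append split: if_splits)
    then show ?thesis using lamv_support by metis
  qed
  then show ?thesis by simp
qed

lemma lamv_eps:
  assumes x: "x \<in> PS" and z: "z \<in> V t"
  shows "lamv x t z (r, t, u @ replicate (ll r) (Ep (ii r))) = 0"
proof (cases "r \<in> RS \<and> is_path c (t, u) \<and> psource (t, u) = ii r")
  case True
  have X: "x \<in> XX" "EQa x" using x by (auto simp: PS_def)
  have zV: "opw n x (flipw u) z \<in> V (ii r)" using flip_V[OF X(1), of t u z] True z by simp
  have "row x (ii r) (wpos r (ll r - 1)) (opw n x (replicate (ll r) (Ep (ii r))) (opw n x (flipw u) z)) = 0"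
    using True ll_pos[of r] by (intro row_eps_0[OF X _ _ _ zV]) auto
  then show ?thesis by (simp add: lamv_def)
next
  case False
  show ?thesis
  proof (cases "r \<in> RS")
    case True
    then have "\<not> is_path c (t, u @ replicate (ll r) (Ep (ii r)))"
      using False ll_pos[of r] by (auto simp: is_path_append)
    then show ?thesis using lamv_support by metis
  qed (use lamv_support in metis)
qed

text \<open>The last condition, membership in the graded dual, is where the vanishing of long paths
  enters: the function is nonzero only on words of bounded length, of which there are finitely
  many.\<close>

lemma lamv_KP:
  assumes x: "x \<in> PS" and z: "z \<in> V i"
  shows "lamv x i z \<in> KP"
proof (rule KP_I)
  fix r p assume "lamv x i z (r, p) \<noteq> 0"
  then show "r \<in> RS" "is_path c p" "psource p = ii r" using lamv_support[of x i z r p] by auto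
next
  fix r t u w a b assume "c a b < 0"
  then show "lamv x i z (r, t, u @ replicate (ff a b) (Ep a) @ [Al a b] @ w)
        = lamv x i z (r, t, u @ [Al a b] @ replicate (ff b a) (Ep b) @ w)"
  proof (cases "t = i")
    case True
    then show ?thesis using lamv_comm[OF x z \<open>c a b < 0\<close>] by simp
  next
    case False
    then have "lamv x i z (r, t, v) = 0" for v using lamv_support[of x i z r "(t, v)"] by auto
    then show ?thesis by simp
  qed
next
  fix r t u w a
  show "(\<Sum>j\<in>UNIV. \<Sum>k<ff a j. osign Or a j * lamv x i z (r, t, u @
       (replicate k (Ep a) @ [Al a j, Al j a] @ replicate (ff a j - 1 - k) (Ep a)) @ w)) = 0"
  proof (cases "t = i")
    case True
    then show ?thesis using lamv_mesh[OF x z, where i = a] by simp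
  next
    case False
    then have "lamv x i z (r, t, v) = 0" for v using lamv_support[of x i z r "(t, v)"] by auto
    then show ?thesis by simp
  qed
next
  fix r t u
  show "lamv x i z (r, t, u @ replicate (ll r) (Ep (ii r))) = 0"
    using lamv_eps[OF x z, of r u] lamv_support[of x i z r "(t, u @ replicate (ll r) (Ep (ii r)))"] by (cases "t = i") auto
next
  fix r
  obtain N where N: "\<And>t w i u. is_path c (t, w) \<Longrightarrow> psource (t, w) = i \<Longrightarrow> N \<le> length w \<Longrightarrow> u \<in> V i \<Longrightarrow> opw n x w u = 0"
    using long_paths_vanish[OF x] by blast
  have "{m. \<exists>p. pdeg c d p = m \<and> lamv x i z (r, p) \<noteq> 0}
    \<subseteq> (\<lambda>w. pdeg c d (i, w)) ` {w. set w \<subseteq> UNIV \<and> length w \<le> N}"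
  proof safe
    fix t w assume nz: "lamv x i z (r, t, w) \<noteq> 0"
    then have p: "is_path c (t, w)" "t = i" using lamv_support by fastforce+
    have "length w \<le> N"
    proof (rule ccontr)
      assume "\<not> length w \<le> N"
      then have "opw n x (flipw w) z = 0"
        using z p by (intro N[OF flip_path[OF p(1)]] psource_flipw) (auto simp: psource_flipw)
      then show False using nz unfolding lamv_def by (auto split: if_splits)
    qed
    then show "pdeg c d (t, w) \<in> (\<lambda>w. pdeg c d (i, w)) ` {w. set w \<subseteq> UNIV \<and> length w \<le> N}" using p by auto
  qed
  then show "finite {m. \<exists>p. pdeg c d p = m \<and> lamv x i z (r, p) \<noteq> 0}"
    using finite_lists_length_le[OF finite_arrows] finite_subset by blast
qed

lemma opa_lamv:
  assumes x: "x \<in> XX" and a: "arrow_ok c a"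
  shows "opa a (lamv x i u) = (if asource a = i then lamv x (atarget a) (aop n x a u) else 0)"
proof
  fix y :: "nat \<times> 'i qpath"
  obtain r t w where y: "y = (r, t, w)" by (cases y) auto
  have ok: "arrow_ok c (aflip a)" using a by (cases a) (auto intro: c_sym)
  show "opa a (lamv x i u) y = (if asource a = i then lamv x (atarget a) (aop n x a u) else 0) y"
    using ok unfolding y by (auto simp: opa_def lamv_def is_path_Cons simp del: is_path.simps(2))
qed

lemma opr_lamv: "opr k (lamv x i u) = (if k = i then lamv x i u else 0)"
  by (auto simp: opr_def lamv_def fun_eq_iff)

text \<open>The functional determines all rows, because \<open>\<gamma>\<close> is regular.\<close>

lemma lamv_eq_0:
  assumes x: "x \<in> XX" "EQa x" and sp: "sep x" and u: "u \<in> V i" and 0: "lamv x i u = 0"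
  shows "u = 0"
proof (rule sp[unfolded sep_def, rule_format, OF u])
  fix i0 m w assume w: "m < wd i0 \<and> is_path c (i0, w) \<and> psource (i0, w) = i"
  then obtain r m' where r: "r \<in> RS" "ii r = i0" "m' < ll r" "m = wpos r m'" using wpos_surj by blast
  have "opw n x w u \<in> V (ii r)" using opw_V[OF x(1), of i0 w i u] w u r by simp
  moreover have "row x (ii r) (wpos r (ll r - 1)) (opw n x (replicate k (Ep (ii r))) (opw n x w u)) = 0" for k
  proof -
    have p: "is_path c (i0, replicate k (Ep i0) @ w)" "psource (i0, replicate k (Ep i0) @ w) = i"
      using w by (auto simp: is_path_append psource_append)
    have "lamv x i u (r, i, flipw (replicate k (Ep i0) @ w)) = 0" by (simp add: 0)
    then show ?thesis
      using r p psource_flipw[OF p(1)] flip_path[OF p(1)] by (simp add: lamv_def)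
  qed
  ultimately show "row x i0 m (opw n x w u) = 0" using rows_from_last[OF x r(1) _ _ r(3)] r by simp
qed

lemma lamv_inj:
  assumes x: "x \<in> XX" "EQa x" "sep x" and u: "u \<in> V i" "v \<in> V i" and eq: "lamv x i u = lamv x i v"
  shows "u = v"
proof -
  have "lamv x i (u - v) = 0" using clin_diff[OF clin_lamv] eq by simp
  then have "u - v = 0" using cfun.subspace_diff[OF subspace_VV u] by (intro lamv_eq_0[OF x]) auto
  then show ?thesis by simp
qed

lemma aop_degree:
  assumes x: "x \<in> XX" and u: "\<And>p. u p \<noteq> 0 \<Longrightarrow> grd \<Longrightarrow> vdeg (asource a) p = e"
    and nz: "aop n x a u p \<noteq> 0" and g: grd
  shows "vdeg (atarget a) p = e + adeg c d a"
proof -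
  obtain q where "q < n (asource a)" "xe x a p q * u q \<noteq> 0"
    using nz unfolding aop_def by (metis (mono_tags, lifting) lessThan_iff sum.neutral)
  then show ?thesis using XX_supp(4)[OF x _ g, of a p q] u[of q] g by auto
qed

lemma opw_degree:
  assumes x: "x \<in> XX" and u: "\<And>p. u p \<noteq> 0 \<Longrightarrow> grd \<Longrightarrow> vdeg i p = e" and g: grd
  shows "is_path c (t, w) \<Longrightarrow> psource (t, w) = i \<Longrightarrow> opw n x w u p \<noteq> 0 \<Longrightarrow> vdeg t p = e + pdeg c d (t, w)"
proof (induction w arbitrary: t p)
  case (Cons a w)
  have a: "atarget a = t" "is_path c (asource a, w)" "psource (asource a, w) = i"
    using Cons.prems(1,2) by auto
  have "vdeg (asource a) q = e + pdeg c d (asource a, w)" if "opw n x w u q \<noteq> 0" for q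
    using Cons.IH[OF a(2,3) that] .
  then have "vdeg (atarget a) p = e + pdeg c d (asource a, w) + adeg c d a"
    using Cons.prems(3) by (intro aop_degree[OF x _ _ g]) auto
  then show ?case using a by (simp add: pdeg_def)
qed (auto simp: pdeg_def u g)

lemma pdeg_flipw: "pdeg c d (i, flipw w) = pdeg c d (j, w)"
proof -
  have "adeg c d (aflip a) = adeg c d a" for a by (cases a) (auto simp: bform_def d_sym)
  then have "map (adeg c d) (map aflip w) = map (adeg c d) w" by simp
  then show ?thesis by (simp only: pdeg_def flipw_def snd_conv rev_map[symmetric] sum_list_rev)
qed

text \<open>The last row of block r has degree k + (l - 1) d and a lowers degrees by d. So a path
  contributes only if it moves degree e to k + l d; this explains the shift in the definition of
  K.\<close>

lemma lamv_degree:
  assumes x: "x \<in> XX" and u: "\<And>p. u p \<noteq> 0 \<Longrightarrow> grd \<Longrightarrow> vdeg i p = e"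
    and nz: "lamv x i u (r, p) \<noteq> 0" and g: grd
  shows "pdeg c d p = kk r + int (ll r) * d (ii r) - e"
proof -
  obtain t w where p: "p = (t, w)" by (cases p) auto
  have r: "r \<in> RS" "is_path c (t, w)" "psource (t, w) = ii r" "t = i"
    and nz': "row x (ii r) (wpos r (ll r - 1)) (opw n x (flipw w) u) \<noteq> 0"
    using nz unfolding p lamv_def by (auto split: if_splits)
  obtain q where q: "x (CA (ii r) (wpos r (ll r - 1)) q) \<noteq> 0" "opw n x (flipw w) u q \<noteq> 0"
    using nz' unfolding row_def by (metis (mono_tags, lifting) mult_eq_0_iff sum.neutral)
  have 1: "wdeg (ii r) (wpos r (ll r - 1)) = vdeg (ii r) q - d (ii r)" using XX_CA[OF x q(1)] g by simp
  have 2: "wdeg (ii r) (wpos r (ll r - 1)) = kk r + (int (ll r) - 1) * d (ii r)"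
    using wdeg_wpos[OF r(1), of "ll r - 1"] ll_pos[OF r(1)] by (simp add: of_nat_diff algebra_simps)
  have 3: "vdeg (ii r) q = e + pdeg c d (t, w)"
    using opw_degree[where i = i and t = "ii r" and w = "flipw w" and p = q, OF x u g]
      flip_path[OF r(2)] psource_flipw[OF r(2)] q(2) r
      pdeg_flipw[where i = "ii r" and w = w and j = t] by simp
  show ?thesis using 1 2 3 by (simp add: p algebra_simps)
qed

end

section \<open>The submodule attached to a point\<close>

lemma sum_nonzeroE:
  assumes "(\<Sum>a\<in>A. f a) \<noteq> 0" obtains a where "a \<in> A" "f a \<noteq> 0"
  using assms by (rule sum.not_neutral_contains_not_neutral)

lemma obasis_D:
  assumes "ordered_basis k S b"
  shows "(\<And>y. (\<Sum>p<k. u p * b p y) = 0) \<Longrightarrow> p < k \<Longrightarrow> u p = 0"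
    "f \<in> S \<Longrightarrow> \<exists>u. f = (\<Sum>p<k. cscale (u p) (b p))" "(\<Sum>p<k. cscale (u p) (b p)) \<in> S" "p < k \<Longrightarrow> b p \<in> S"
proof -
  have *: "\<And>u. (\<And>x. (\<Sum>p<k. u p * b p x) = 0) \<Longrightarrow> (\<forall>p<k. u p = 0)"
    and S: "S = {\<phi>. \<exists>u. \<forall>x. \<phi> x = (\<Sum>p<k. u p * b p x)}"
    using assms unfolding ordered_basis_iff by blast+
  show "(\<And>y. (\<Sum>p<k. u p * b p y) = 0) \<Longrightarrow> p < k \<Longrightarrow> u p = 0" using * by blast
  show "f \<in> S \<Longrightarrow> \<exists>u. f = (\<Sum>p<k. cscale (u p) (b p))"
    unfolding S by (auto simp: fun_eq_iff sum_cscale)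
  show mem: "(\<Sum>p<k. cscale (u p) (b p)) \<in> S" for u unfolding S by (auto simp: sum_cscale)
  show "b p \<in> S" if p: "p < k"
  proof -
    have "b p = (\<Sum>q<k. cscale (if q = p then 1 else 0) (b q))"
    proof
      fix y
      have "(\<Sum>q<k. (if q = p then 1 else 0) * b q y) = (\<Sum>q<k. if q = p then b p y else 0)"
        by (intro sum.cong) auto
      then show "b p y = (\<Sum>q<k. cscale (if q = p then 1 else 0) (b q)) y" using p by (simp add: sum_cscale)
    qed
    then show ?thesis using mem[of "\<lambda>q. if q = p then 1 else 0"] by simp
  qed
qed

lemma obasis_I:
  assumes "\<And>u. (\<Sum>p<k. cscale (u p) (b p)) = 0 \<Longrightarrow> \<forall>p<k. u p = 0"
    "\<And>f. f \<in> S \<longleftrightarrow> (\<exists>u. f = (\<Sum>p<k. cscale (u p) (b p)))"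
  shows "ordered_basis k S b"
  unfolding ordered_basis_iff
proof (intro conjI allI impI)
  fix u p assume u: "\<forall>x. (\<Sum>p<k. u p * b p x) = 0" and p: "p < k"
  have "(\<Sum>p<k. cscale (u p) (b p)) = 0" using u by (auto simp: fun_eq_iff sum_cscale)
  then show "u p = 0" using assms(1) p by blast
next
  show "S = {\<phi>. \<exists>u. \<forall>x. \<phi> x = (\<Sum>p<k. u p * b p x)}"
  proof (intro Set.set_eqI)
    fix f
    show "f \<in> S \<longleftrightarrow> f \<in> {\<phi>. \<exists>u. \<forall>x. \<phi> x = (\<Sum>p<k. u p * b p x)}"
      unfolding assms(2) by (simp add: fun_eq_iff sum_cscale)
  qed
qed

context setting
begin

text \<open>On submodules this is \<open>piece\<close> in the ungraded and \<open>piece_gr\<close>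
  in the graded case; membership is read off the support on paths.\<close>

definition pcs :: "(nat \<times> 'i palg set set \<Rightarrow> complex) set \<Rightarrow> 'j \<Rightarrow> (nat \<times> 'i palg set set \<Rightarrow> complex) set" where
  "pcs U j = {\<phi> \<in> U. \<forall>r p. hat \<phi> (r, p) \<noteq> 0 \<longrightarrow> fst p = vt j \<and>
     (grd \<longrightarrow> pdeg c d p = kk r + int (ll r) * d (ii r) - dg j)}"

definition Gset :: "(nat \<times> 'i palg set set \<Rightarrow> complex) set set" where
  "Gset = {U. pi_submodule c Or KG U \<and> U = cfun.span (\<Union>j. pcs U j) \<and> (\<forall>j. has_dim (pcs U j) (vj j))}"

definition FS :: "('j \<times> nat \<times> nat \<times> 'i palg set set \<Rightarrow> complex) set" where
  "FS = frames pcs vj Gset"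

text \<open>The images of the basis vectors of V, sorted by label; they frame the submodule that
  corresponds to \<open>HH x\<close>.\<close>

definition Psi :: "'i rep \<Rightarrow> 'j \<times> nat \<times> nat \<times> 'i palg set set \<Rightarrow> complex" where
  "Psi x = (\<lambda>(j, q, z). if q < vj j then unhat (lamv x (vt j) (ev (pos j q))) z else 0)"

definition HH :: "'i rep \<Rightarrow> (nat \<times> 'i qpath \<Rightarrow> complex) set" where
  "HH x = {\<Sum>i\<in>UNIV. lamv x i (u i) | u. \<forall>i. u i \<in> V i}"

lemma HH_I: "(\<And>i. u i \<in> V i) \<Longrightarrow> (\<Sum>i\<in>UNIV. lamv x i (u i)) \<in> HH x"
  unfolding HH_def by blast

lemma sum_single_vertex: "(\<Sum>k\<in>UNIV. lamv x k (if k = i then u else 0)) = lamv x i u"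
proof -
  have "(\<Sum>k\<in>UNIV. lamv x k (if k = i then u else 0)) = (\<Sum>k\<in>UNIV. if k = i then lamv x i u else 0)"
    by (intro sum.cong) (auto simp: clin_0[OF clin_lamv])
  then show ?thesis by simp
qed

lemma zero_V: "0 \<in> V i" by (rule cfun.subspace_0[OF subspace_VV])

lemma lamv_HH: "u \<in> V i \<Longrightarrow> lamv x i u \<in> HH x"
  using HH_I[of "\<lambda>k. if k = i then u else 0" x] zero_V by (simp add: sum_single_vertex)

lemma subspace_HH: "cfun.subspace (HH x)"
proof (rule cfun.subspaceI)
  show "0 \<in> HH x" using HH_I[of "\<lambda>k. 0" x] zero_V by (simp add: clin_0[OF clin_lamv])
  fix f g assume "f \<in> HH x" "g \<in> HH x"
  then obtain u v where u: "f = (\<Sum>i\<in>UNIV. lamv x i (u i))" "\<And>i. u i \<in> V i"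
    and v: "g = (\<Sum>i\<in>UNIV. lamv x i (v i))" "\<And>i. v i \<in> V i" unfolding HH_def by blast
  have "f + g = (\<Sum>i\<in>UNIV. lamv x i (u i + v i))"
    unfolding u v clin_add[OF clin_lamv] sum.distrib ..
  also have "\<dots> \<in> HH x" by (intro HH_I cfun.subspace_add[OF subspace_VV] u v)
  finally show "f + g \<in> HH x" .
next
  fix a f assume "f \<in> HH x"
  then obtain u where u: "f = (\<Sum>i\<in>UNIV. lamv x i (u i))" "\<And>i. u i \<in> V i" unfolding HH_def by blast
  have "cscale a f = (\<Sum>i\<in>UNIV. lamv x i (cscale a (u i)))"
    unfolding u clin_scale[OF clin_lamv] cfun.scale_sum_right ..
  also have "\<dots> \<in> HH x" by (intro HH_I cfun.subspace_scale[OF subspace_VV] u)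
  finally show "cscale a f \<in> HH x" .
qed

lemma HH_KP: "x \<in> PS \<Longrightarrow> HH x \<subseteq> KP"
  unfolding HH_def using lamv_KP by (auto intro!: cfun.subspace_sum[OF subspace_KP])

lemma hsub_HH:
  assumes x: "x \<in> PS" shows "hsub (HH x)"
proof -
  have X: "x \<in> XX" using x by (simp add: PS_def)
  have "opa a f \<in> HH x" if a: "arrow_ok c a" and f: "f \<in> HH x" for a f
  proof -
    obtain u where u: "f = (\<Sum>i\<in>UNIV. lamv x i (u i))" "\<And>i. u i \<in> V i" using f unfolding HH_def by blast
    have "opa a f = (\<Sum>i\<in>UNIV. if asource a = i then lamv x (atarget a) (aop n x a (u i)) else 0)"
      unfolding u clin_sum[OF clin_opa] opa_lamv[OF X a] ..
    then show ?thesis using lamv_HH[OF aop_V[OF X, of a "u (asource a)"]] by simp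
  qed
  moreover have "opr k f \<in> HH x" if f: "f \<in> HH x" for k f
  proof -
    obtain u where u: "f = (\<Sum>i\<in>UNIV. lamv x i (u i))" "\<And>i. u i \<in> V i" using f unfolding HH_def by blast
    have "opr k f = (\<Sum>i\<in>UNIV. if k = i then lamv x i (u i) else 0)"
      unfolding u clin_sum[OF clin_opr] opr_lamv ..
    then show ?thesis using lamv_HH[OF u(2), of x k] by simp
  qed
  ultimately show ?thesis unfolding hsub_def using subspace_HH HH_KP[OF x] by blast
qed

lemma hat_unhat_HH: "x \<in> PS \<Longrightarrow> hat ` (unhat ` HH x) = HH x"
  using HH_KP hat_unhat by (force simp: image_image)

lemma submodule_HH: "x \<in> PS \<Longrightarrow> pi_submodule c Or KG (unhat ` HH x)"
  unfolding pi_submodule_iff hat_unhat_HH using hsub_HH HH_KP unhat_carrier by blast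

lemma PS_D: "x \<in> PS \<Longrightarrow> x \<in> XX" "x \<in> PS \<Longrightarrow> EQa x" "x \<in> PS \<Longrightarrow> sep x" "x \<in> PS \<Longrightarrow> EQc x"
  "x \<in> PS \<Longrightarrow> EQm x" "x \<in> PS \<Longrightarrow> as0 x"
  using stable_iff_sep by (auto simp: PS_def)

text \<open>The support of f fixes the vertex, so f comes from one vector u. Split u by label.
  Wherever the basis vectors with other labels contribute, the degree of the path differs from that
  of label j, so both f and the part with label j vanish there; hence the other part maps to
  0.\<close>

lemma label_part:
  assumes x: "x \<in> PS" and f: "f \<in> HH x"
    and sf: "\<And>r p. f (r, p) \<noteq> 0 \<Longrightarrow> fst p = vt j \<and> (grd \<longrightarrow> pdeg c d p = kk r + int (ll r) * d (ii r) - dg j)"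
  obtains u where "u \<in> V (vt j)" "\<And>p. u p \<noteq> 0 \<Longrightarrow> jl (vt j) p = j" "f = lamv x (vt j) u"
proof -
  note X = PS_D(1)[OF x] and E = PS_D(2)[OF x] and sp = PS_D(3)[OF x]
  let ?i = "vt j"
  obtain u where u: "f = (\<Sum>i\<in>UNIV. lamv x i (u i))" "\<And>i. u i \<in> V i" using f unfolding HH_def by blast
  have val: "f (r, i, w) = lamv x i (u i) (r, i, w)" for r i w
  proof -
    have "f (r, i, w) = (\<Sum>k\<in>UNIV. lamv x k (u k) (r, i, w))" unfolding u sum_apply ..
    also have "\<dots> = (\<Sum>k\<in>UNIV. if k = i then lamv x i (u i) (r, i, w) else 0)"
      by (intro sum.cong) (auto simp: lamv_def)
    finally show ?thesis by simp
  qed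
  have f1: "f = lamv x ?i (u ?i)"
  proof
    fix y :: "nat \<times> 'i qpath"
    obtain r t w where y: "y = (r, t, w)" by (cases y) auto
    show "f y = lamv x ?i (u ?i) y"
    proof (cases "t = ?i")
      case False
      then show ?thesis using sf[of r "(t, w)"] by (auto simp: y lamv_def)
    qed (simp add: y val)
  qed
  define v1 where "v1 = (\<lambda>p. if jl ?i p = j then u ?i p else 0)"
  define v2 where "v2 = (\<lambda>p. if jl ?i p = j then 0 else u ?i p)"
  have v: "u ?i = v1 + v2" by (auto simp: v1_def v2_def fun_eq_iff)
  have vV: "v1 \<in> V ?i" "v2 \<in> V ?i" using u(2)[of ?i] by (auto simp: v1_def v2_def VV_def)
  have np: "p < n ?i" if "u ?i p \<noteq> 0" for p using that u(2)[of ?i] by (auto simp: VV_def not_le[symmetric])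
  have lv: "f = lamv x ?i v1 + lamv x ?i v2" using f1 unfolding v clin_add[OF clin_lamv] .
  have "lamv x ?i v2 = 0"
  proof (cases grd)
    case False
    have "jl ?i p = j" if "u ?i p \<noteq> 0" for p
      using idx1[OF np[OF that]] False by (intro lab_inj) auto
    then have "v2 = 0" by (auto simp: v2_def fun_eq_iff)
    then show ?thesis by (simp add: clin_0[OF clin_lamv])
  next
    case True
    show ?thesis
    proof
      fix y :: "nat \<times> 'i qpath"
      obtain r p where y: "y = (r, p)" by (cases y) auto
      show "lamv x ?i v2 y = 0 y"
      proof (rule ccontr)
        assume nz: "lamv x ?i v2 y \<noteq> 0 y"
        have "v2 = (\<Sum>q<n ?i. cscale (v2 q) (ev q))" by (rule VV_expand[OF vV(2)])
        then have "lamv x ?i v2 = lamv x ?i (\<Sum>q<n ?i. cscale (v2 q) (ev q))" by (rule arg_cong)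
        then have "lamv x ?i v2 (r, p) = (\<Sum>q<n ?i. v2 q * lamv x ?i (ev q) (r, p))"
          by (simp only: clin_unhat_like[OF clin_lamv] sum_cscale)
        then obtain q where q: "q < n ?i" "v2 q \<noteq> 0" "lamv x ?i (ev q) (r, p) \<noteq> 0"
          using nz sum_nonzeroE[of "\<lambda>q. v2 q * lamv x ?i (ev q) (r, p)" "{..<n ?i}"] unfolding y by auto
        have p1: "pdeg c d p = kk r + int (ll r) * d (ii r) - vdeg ?i q"
          using lamv_degree[OF X _ q(3) True, of "vdeg ?i q"] by (auto simp: ev_def split: if_splits)
        have ne: "vdeg ?i q \<noteq> dg j"
        proof
          assume "vdeg ?i q = dg j"
          then have "jl ?i q = j" using idx1[OF q(1)] dg_jl[OF True q(1)] by (intro lab_inj) auto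
          then show False using q(2) by (simp add: v2_def)
        qed
        have "vdeg ?i p' = dg j" if "v1 p' \<noteq> 0" for p'
          using that np[of p'] dg_jl[OF True, of p' ?i] by (auto simp: v1_def split: if_splits)
        then have "lamv x ?i v1 (r, p) \<noteq> 0 \<Longrightarrow> pdeg c d p = kk r + int (ll r) * d (ii r) - dg j"
          by (rule lamv_degree[OF X _ _ True])
        then have "lamv x ?i v1 (r, p) = 0" using p1 ne by linarith
        then have "f (r, p) \<noteq> 0" using nz unfolding lv y by simp
        then show False using sf[of r p] p1 ne True by simp
      qed
    qed
  qed
  then have "f = lamv x ?i v1" using lv by simp
  moreover have "jl ?i p = j" if "v1 p \<noteq> 0" for p using that by (simp add: v1_def split: if_splits)
  ultimately show ?thesis using that[of v1] vV(1) by blast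
qed

lemma label_vector_expand:
  assumes "u \<in> V (vt j)" "\<And>p. u p \<noteq> 0 \<Longrightarrow> jl (vt j) p = j"
  shows "u = (\<Sum>q<vj j. cscale (u (pos j q)) (ev (pos j q)))"
proof
  fix p
  have "(\<Sum>q<vj j. u (pos j q) * ev (pos j q) p) = (if u p = 0 then 0 else u p)"
  proof (cases "u p = 0")
    case True
    then show ?thesis by (auto simp: ev_def intro!: sum.neutral)
  next
    case False
    then have p: "p < n (vt j)" "jl (vt j) p = j" using assms by (auto simp: VV_def not_le[symmetric])
    have "(\<Sum>q<vj j. u (pos j q) * ev (pos j q) p) = (\<Sum>q<vj j. if q = rk (vt j) p then u p else 0)"
      using idx1[OF p(1)] p(2) idx2[of _ j] by (intro sum.cong refl) (auto simp: ev_def)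
    then show ?thesis using idx1[OF p(1)] p(2) False by simp
  qed
  then show "u p = (\<Sum>q<vj j. cscale (u (pos j q)) (ev (pos j q))) p" by (simp add: sum_cscale)
qed

lemma label_lamv_support:
  assumes x: "x \<in> XX" and q: "q < vj j" and nz: "lamv x (vt j) (ev (pos j q)) (r, p) \<noteq> 0"
  shows "fst p = vt j \<and> (grd \<longrightarrow> pdeg c d p = kk r + int (ll r) * d (ii r) - dg j)"
proof -
  have "grd \<Longrightarrow> vdeg (vt j) (pos j q) = dg j" using idx2[OF q] dg_jl[of "pos j q" "vt j"] by simp
  then show ?thesis using lamv_support[OF nz] lamv_degree[OF x _ nz, of "dg j"]
    by (auto simp: ev_def split: if_splits)
qed

text \<open>Independence is injectivity of \<open>lamv\<close>, which rests on separation; that the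
  whole piece is reached is \<open>label_part\<close>.\<close>

lemma Psi_basis:
  assumes x: "x \<in> PS"
  shows "ordered_basis (vj j) (pcs (unhat ` HH x) j) (\<lambda>q z. Psi x (j, q, z))"
proof (rule obasis_I)
  note X = PS_D(1)[OF x]
  have P: "(\<lambda>z. Psi x (j, q, z)) = unhat (lamv x (vt j) (ev (pos j q)))" if "q < vj j" for q
    using that by (simp add: Psi_def)
  have S: "(\<Sum>q<vj j. cscale (u q) (\<lambda>z. Psi x (j, q, z)))
     = unhat (lamv x (vt j) (\<Sum>q<vj j. cscale (u q) (ev (pos j q))))" for u
    using P by (simp add: clin_unhat_like[OF clin_lamv] clin_unhat_like[OF clin_unhat])
  have eV: "ev (pos j q) \<in> V (vt j)" if "q < vj j" for q using idx2[OF that] by (intro ev_VV) simp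
  have sV: "(\<Sum>q<vj j. cscale (u q) (ev (pos j q))) \<in> V (vt j)" for u
    by (intro cfun.subspace_sum[OF subspace_VV] cfun.subspace_scale[OF subspace_VV]) (auto simp: eV)
  have K: "lamv x (vt j) (\<Sum>q<vj j. cscale (u q) (ev (pos j q))) \<in> KP" for u by (rule lamv_KP[OF x sV])
  show "\<forall>p<vj j. u p = 0" if 0: "(\<Sum>q<vj j. cscale (u q) (\<lambda>z. Psi x (j, q, z))) = 0" for u
  proof (intro allI impI)
    fix p assume p: "p < vj j"
    have "lamv x (vt j) (\<Sum>q<vj j. cscale (u q) (ev (pos j q))) = hat 0"
      using hat_unhat[OF K, of u] 0 unfolding S by simp
    then have "(\<Sum>q<vj j. cscale (u q) (ev (pos j q))) = 0"
      by (intro lamv_eq_0[OF X PS_D(2,3)[OF x] sV]) (simp add: clin_0[OF clin_hat])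
    then have "(\<Sum>q<vj j. cscale (u q) (ev (pos j q))) (pos j p) = 0" by (simp only: zero_fun_apply)
    then have "(\<Sum>q<vj j. u q * ev (pos j q) (pos j p)) = 0" unfolding sum_cscale .
    moreover have "(\<Sum>q<vj j. u q * ev (pos j q) (pos j p)) = (\<Sum>q<vj j. if q = p then u p else 0)"
    proof (intro sum.cong refl)
      fix q assume "q \<in> {..<vj j}"
      then have "pos j p = pos j q \<Longrightarrow> q = p" using idx2[of q j] idx2[OF p] by (metis lessThan_iff)
      then show "u q * ev (pos j q) (pos j p) = (if q = p then u p else 0)" by (auto simp: ev_def)
    qed
    ultimately show "u p = 0" using p by simp
  qed
  show "f \<in> pcs (unhat ` HH x) j \<longleftrightarrow> (\<exists>u. f = (\<Sum>q<vj j. cscale (u q) (\<lambda>z. Psi x (j, q, z))))" for f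
  proof
    assume f: "f \<in> pcs (unhat ` HH x) j"
    then obtain g where g: "g \<in> HH x" "f = unhat g" by (auto simp: pcs_def)
    have hf: "hat f = g" using g HH_KP[OF x] hat_unhat by auto
    obtain u where u: "u \<in> V (vt j)" "\<And>p. u p \<noteq> 0 \<Longrightarrow> jl (vt j) p = j" "g = lamv x (vt j) u"
      by (rule label_part[OF x g(1), of j]) (use f hf in \<open>auto simp: pcs_def\<close>)
    then have "f = unhat (lamv x (vt j) (\<Sum>q<vj j. cscale (u (pos j q)) (ev (pos j q))))"
      using label_vector_expand[OF u(1,2)] g by simp
    then show "\<exists>u. f = (\<Sum>q<vj j. cscale (u q) (\<lambda>z. Psi x (j, q, z)))" unfolding S[symmetric]
      by (intro exI[of _ "\<lambda>q. u (pos j q)"])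
  next
    assume "\<exists>u. f = (\<Sum>q<vj j. cscale (u q) (\<lambda>z. Psi x (j, q, z)))"
    then obtain u where f: "f = unhat (lamv x (vt j) (\<Sum>q<vj j. cscale (u q) (ev (pos j q))))" unfolding S by blast
    have h: "hat f = (\<Sum>q<vj j. cscale (u q) (lamv x (vt j) (ev (pos j q))))"
      unfolding f by (rule trans[OF hat_unhat[OF K] clin_unhat_like[OF clin_lamv]])
    have "fst p = vt j \<and> (grd \<longrightarrow> pdeg c d p = kk r + int (ll r) * d (ii r) - dg j)" if "hat f (r, p) \<noteq> 0" for r p
    proof -
      have "(\<Sum>q<vj j. u q * lamv x (vt j) (ev (pos j q)) (r, p)) \<noteq> 0" using that unfolding h sum_cscale .
      then obtain q where "q < vj j" "lamv x (vt j) (ev (pos j q)) (r, p) \<noteq> 0"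
        using sum_nonzeroE[of "\<lambda>q. u q * lamv x (vt j) (ev (pos j q)) (r, p)" "{..<vj j}"] by auto
      then show ?thesis using label_lamv_support[OF X] by blast
    qed
    moreover have "f \<in> unhat ` HH x" unfolding f using lamv_HH[OF sV] by blast
    ultimately show "f \<in> pcs (unhat ` HH x) j" unfolding pcs_def by blast
  qed
qed

lemma Gset_HH:
  assumes x: "x \<in> PS" shows "unhat ` HH x \<in> Gset"
  unfolding Gset_def
proof (intro CollectI conjI allI)
  let ?U = "unhat ` HH x"
  show U: "pi_submodule c Or KG ?U" by (rule submodule_HH[OF x])
  show "has_dim (pcs ?U j) (vj j)" for j unfolding has_dim_def using Psi_basis[OF x] by blast
  show "?U = cfun.span (\<Union>j. pcs ?U j)"
  proof
    show "cfun.span (\<Union>j. pcs ?U j) \<subseteq> ?U"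
      by (intro cfun.span_minimal subspace_submodule[OF U]) (auto simp: pcs_def)
    show "?U \<subseteq> cfun.span (\<Union>j. pcs ?U j)"
    proof
      fix f assume "f \<in> ?U"
      then obtain u where u: "f = unhat (\<Sum>i\<in>UNIV. lamv x i (u i))" "\<And>i. u i \<in> V i" unfolding HH_def by blast
      have "f = (\<Sum>i\<in>UNIV. \<Sum>p<n i. cscale (u i p) (unhat (lamv x i (ev p))))"
      proof -
        have "lamv x i (u i) = (\<Sum>p<n i. cscale (u i p) (lamv x i (ev p)))" for i
          using VV_expand[OF u(2), of i] clin_unhat_like[OF clin_lamv, of x i "u i" ev "{..<n i}"] by simp
        then show ?thesis unfolding u(1) by (simp add: clin_sum[OF clin_unhat] clin_scale[OF clin_unhat])
      qed
      also have "\<dots> \<in> cfun.span (\<Union>j. pcs ?U j)"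
      proof (intro cfun.span_sum cfun.span_scale cfun.span_base UN_I)
        fix i p assume "p \<in> {..<n i}"
        then have p: "p < n i" by simp
        have "(\<lambda>z. Psi x (jl i p, rk i p, z)) \<in> pcs ?U (jl i p)"
          using obasis_D(4)[OF Psi_basis[OF x], of "rk i p" "jl i p"] idx1[OF p] by simp
        then show "unhat (lamv x i (ev p)) \<in> pcs ?U (jl i p)" using idx1[OF p] by (simp add: Psi_def)
      qed simp
      finally show "f \<in> cfun.span (\<Union>j. pcs ?U j)" .
    qed
  qed
qed

lemma Psi_FS: "x \<in> PS \<Longrightarrow> Psi x \<in> FS"
  unfolding FS_def frames_def using Gset_HH Psi_basis by (auto simp: Psi_def)

text \<open>Elements of \<open>Gset\<close> are spanned by their pieces, so a frame determines its
  submodule; this identifies the fibres of the quotient map on frames.\<close>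

lemma frame_span_eq:
  assumes \<Phi>: "\<forall>j p z. vj j \<le> p \<longrightarrow> \<Phi> (j, p, z) = 0" and U: "U \<in> Gset"
    and b: "\<And>j. ordered_basis (vj j) (pcs U j) (\<lambda>p z. \<Phi> (j, p, z))"
  shows "frame_span \<Phi> = U"
proof
  have sub: "cfun.subspace U" using U subspace_submodule by (auto simp: Gset_def)
  have Us: "U = cfun.span (\<Union>j. pcs U j)" using U by (simp add: Gset_def)
  show "frame_span \<Phi> \<subseteq> U" unfolding frame_span_def
  proof (intro cfun.span_minimal[OF _ sub] image_subsetI)
    fix jp :: "'j \<times> nat"
    obtain j p where jp: "jp = (j, p)" by (cases jp) auto
    show "(case jp of (j, p) \<Rightarrow> \<lambda>z. \<Phi> (j, p, z)) \<in> U"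
    proof (cases "p < vj j")
      case True
      then show ?thesis using obasis_D(4)[OF b True] by (auto simp: jp pcs_def)
    next
      case False
      then have "(\<lambda>z. \<Phi> (j, p, z)) = 0" using \<Phi> by (auto simp: fun_eq_iff)
      then show ?thesis using cfun.subspace_0[OF sub] by (simp add: jp)
    qed
  qed
  have "pcs U j \<subseteq> frame_span \<Phi>" for j
  proof
    fix f assume "f \<in> pcs U j"
    then obtain u where "f = (\<Sum>p<vj j. cscale (u p) (\<lambda>z. \<Phi> (j, p, z)))" using obasis_D(2)[OF b] by blast
    moreover have "(\<lambda>z. \<Phi> (j, p, z)) \<in> range (\<lambda>(j, p) x. \<Phi> (j, p, x))" for p
      by (rule range_eqI[of _ _ "(j, p)"]) simp
    ultimately show "f \<in> frame_span \<Phi>" unfolding frame_span_def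
      by (simp only:) (intro span_mem_sum cfun.span_base)
  qed
  then show "U \<subseteq> frame_span \<Phi>" unfolding frame_span_def
    by (subst Us) (intro cfun.span_minimal cfun.subspace_span, auto)
qed

lemma frame_span_Psi: "x \<in> PS \<Longrightarrow> frame_span (Psi x) = unhat ` HH x"
  by (rule frame_span_eq[OF _ Gset_HH Psi_basis]) (auto simp: Psi_def)

end

section \<open>A point is determined by its frame\<close>

context setting
begin

lemma label_sum:
  fixes h :: "nat \<Rightarrow> complex"
  shows "(\<Sum>p<n (vt j). if jl (vt j) p = j then h p else 0) = (\<Sum>q<vj j. h (pos j q))"
proof -
  have "(\<Sum>p<n (vt j). if jl (vt j) p = j then h p else 0) = (\<Sum>p | p < n (vt j) \<and> jl (vt j) p = j. h p)"
    by (simp add: sum.If_cases) (rule sum.cong, auto)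
  also have "\<dots> = (\<Sum>q<vj j. h (pos j q))"
    by (rule sum.reindex_bij_witness[of _ "pos j" "rk (vt j)"]) (use idx1 idx2 in force)+
  finally show ?thesis .
qed

text \<open>The frame indexed by the basis vectors (i, p) of V instead of labels; for the frame of x
  in \<open>PS\<close> it is \<open>lamv x i (ev p)\<close>, by \<open>Psi_lamF\<close>.\<close>

definition lamF :: "('j \<times> nat \<times> nat \<times> 'i palg set set \<Rightarrow> complex) \<Rightarrow> 'i \<Rightarrow> nat \<Rightarrow> nat \<times> 'i qpath \<Rightarrow> complex" where
  "lamF \<Phi> i p = hat (\<lambda>z. \<Phi> (jl i p, rk i p, z))"

lemma FS_E:
  assumes "\<Phi> \<in> FS"
  shows "\<exists>U. U \<in> Gset \<and> pi_submodule c Or KG U \<and> U \<subseteq> mcarrier KG \<and> hsub (hat ` U) \<and>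
    (\<forall>j. ordered_basis (vj j) (pcs U j) (\<lambda>p z. \<Phi> (j, p, z))) \<and> (\<forall>j p z. vj j \<le> p \<longrightarrow> \<Phi> (j, p, z) = 0)"
proof -
  obtain U where U: "U \<in> Gset" "\<forall>j. ordered_basis (vj j) (pcs U j) (\<lambda>p z. \<Phi> (j, p, z))"
    "\<forall>j p z. vj j \<le> p \<longrightarrow> \<Phi> (j, p, z) = 0"
    using assms unfolding FS_def frames_def by blast
  have "pi_submodule c Or KG U" using U by (simp add: Gset_def)
  then show ?thesis using U pi_submodule_iff[of U] by (intro exI[of _ U] conjI) auto
qed

lemma lamF_KP:
  assumes \<Phi>: "\<Phi> \<in> FS" and p: "p < n i" shows "lamF \<Phi> i p \<in> KP"
proof -
  obtain U where UG: "U \<in> Gset" "pi_submodule c Or KG U" and UK: "U \<subseteq> mcarrier KG" and Uh: "hsub (hat ` U)"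
    and b: "\<And>j. ordered_basis (vj j) (pcs U j) (\<lambda>p z. \<Phi> (j, p, z))" and b0: "\<And>j p z. vj j \<le> p \<Longrightarrow> \<Phi> (j, p, z) = 0"
    using FS_E[OF \<Phi>] by blast
  have "(\<lambda>z. \<Phi> (jl i p, rk i p, z)) \<in> U" using obasis_D(4)[OF b] idx1[OF p] by (auto simp: pcs_def)
  then show ?thesis unfolding lamF_def using UK hat_KP by blast
qed

lemma lamF_support:
  assumes \<Phi>: "\<Phi> \<in> FS" and p: "p < n i" and nz: "lamF \<Phi> i p (r, y) \<noteq> 0"
  shows "fst y = i" "grd \<Longrightarrow> pdeg c d y = kk r + int (ll r) * d (ii r) - vdeg i p"
proof -
  obtain U where UG: "U \<in> Gset" "pi_submodule c Or KG U" and UK: "U \<subseteq> mcarrier KG" and Uh: "hsub (hat ` U)"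
    and b: "\<And>j. ordered_basis (vj j) (pcs U j) (\<lambda>p z. \<Phi> (j, p, z))" and b0: "\<And>j p z. vj j \<le> p \<Longrightarrow> \<Phi> (j, p, z) = 0"
    using FS_E[OF \<Phi>] by blast
  have "(\<lambda>z. \<Phi> (jl i p, rk i p, z)) \<in> pcs U (jl i p)" using obasis_D(4)[OF b] idx1[OF p] by auto
  then show "fst y = i" "grd \<Longrightarrow> pdeg c d y = kk r + int (ll r) * d (ii r) - vdeg i p"
    using nz idx1[OF p] dg_jl[OF _ p] unfolding lamF_def pcs_def mem_Collect_eq by metis+
qed

text \<open>Within a label independence is that of the ordered basis. Functions with different
  labels at the same vertex have disjoint supports, because the degrees of the paths differ, so a
  relation splits by labels.\<close>

lemma lamF_independent:
  assumes \<Phi>: "\<Phi> \<in> FS" and 0: "(\<Sum>p<n i. cscale (u p) (lamF \<Phi> i p)) = 0" and p0: "p0 < n i"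
  shows "u p0 = 0"
proof -
  obtain U where UG: "U \<in> Gset" "pi_submodule c Or KG U" and UK: "U \<subseteq> mcarrier KG" and Uh: "hsub (hat ` U)"
    and b: "\<And>j. ordered_basis (vj j) (pcs U j) (\<lambda>p z. \<Phi> (j, p, z))" and b0: "\<And>j p z. vj j \<le> p \<Longrightarrow> \<Phi> (j, p, z) = 0"
    using FS_E[OF \<Phi>] by blast
  define j where "j = jl i p0"
  have j: "vt j = i" "rk i p0 < vj j" "pos j (rk i p0) = p0" using idx1[OF p0] by (auto simp: j_def)
  have lF: "lamF \<Phi> i (pos j q) = hat (\<lambda>z. \<Phi> (j, q, z))" if "q < vj j" for q
    using idx2[OF that] j by (simp add: lamF_def)
  let ?X = "\<Sum>q<vj j. cscale (u (pos j q)) (\<lambda>z. \<Phi> (j, q, z))"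
  have XU: "?X \<in> U" using obasis_D(3)[OF b[of j], of "\<lambda>q. u (pos j q)"] by (simp add: pcs_def)
  have hX: "hat ?X = (\<Sum>q<vj j. cscale (u (pos j q)) (lamF \<Phi> i (pos j q)))"
    unfolding clin_unhat_like[OF clin_hat] by (intro sum.cong) (auto simp: lF)
  have "hat ?X = 0"
  proof
    fix z :: "nat \<times> 'i qpath"
    obtain r y where z: "z = (r, y)" by (cases z) auto
    show "hat ?X z = 0 z"
    proof (rule ccontr)
      assume nz: "hat ?X z \<noteq> 0 z"
      then have "(\<Sum>q<vj j. u (pos j q) * lamF \<Phi> i (pos j q) (r, y)) \<noteq> 0"
        unfolding hX z sum_cscale by simp
      then obtain q where q: "q < vj j" "lamF \<Phi> i (pos j q) (r, y) \<noteq> 0"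
        using sum_nonzeroE[of "\<lambda>q. u (pos j q) * lamF \<Phi> i (pos j q) (r, y)" "{..<vj j}"] by auto
      have pq: "pos j q < n i" "jl i (pos j q) = j" using idx2[OF q(1)] j by auto
      have other: "lamF \<Phi> i p (r, y) = 0" if p: "p < n i" "jl i p \<noteq> j" for p
      proof (rule ccontr)
        assume nz': "lamF \<Phi> i p (r, y) \<noteq> 0"
        have "grd \<Longrightarrow> dg (jl i p) = dg j"
          using lamF_support(2)[OF \<Phi> p(1) nz'] lamF_support(2)[OF \<Phi> pq(1) q(2)] dg_jl[OF _ p(1)] dg_jl[OF _ pq(1)] pq(2) by simp
        then have "jl i p = j" using idx1[OF p(1)] j by (intro lab_inj) auto
        then show False using p by simp
      qed
      have "hat ?X (r, y) = (\<Sum>q<vj j. u (pos j q) * lamF \<Phi> i (pos j q) (r, y))" unfolding hX sum_cscale ..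
      also have "\<dots> = (\<Sum>p<n i. if jl i p = j then u p * lamF \<Phi> i p (r, y) else 0)"
        using label_sum[of j "\<lambda>p. u p * lamF \<Phi> i p (r, y)"] j by simp
      also have "\<dots> = (\<Sum>p<n i. u p * lamF \<Phi> i p (r, y))"
        by (intro sum.cong) (auto simp: other)
      also have "\<dots> = (\<Sum>p<n i. cscale (u p) (lamF \<Phi> i p)) (r, y)" unfolding sum_cscale ..
      also have "\<dots> = 0" unfolding 0 by simp
      finally show False using nz by (simp add: z)
    qed
  qed
  then have "?X = 0" using UK XU cfun.subspace_0[OF subspace_carrier] by (intro hat_inj) (auto simp: clin_0[OF clin_hat])
  then have "?X z = 0" for z by (simp only: zero_fun_apply)
  then have "(\<Sum>q<vj j. u (pos j q) * \<Phi> (j, q, z)) = 0" for z unfolding sum_cscale .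
  then have "u (pos j (rk i p0)) = 0" using obasis_D(1)[OF b[of j], of "\<lambda>q. u (pos j q)"] j(2) by blast
  then show ?thesis using j by simp
qed

text \<open>The image of a frame vector under an arrow lies in the submodule and has a definite
  label, hence is a combination of the frame of one piece. The coefficients will be the matrix
  entries of the arrow, which are homogeneous for this reason.\<close>

lemma lamF_arrow:
  assumes \<Phi>: "\<Phi> \<in> FS" and a: "arrow_ok c a" and q: "q < n (asource a)"
  shows "\<exists>f. (\<forall>p. f p \<noteq> 0 \<longrightarrow> p < n (atarget a) \<and> (grd \<longrightarrow> vdeg (atarget a) p = vdeg (asource a) q + adeg c d a)) \<and>
    opa a (lamF \<Phi> (asource a) q) = (\<Sum>p<n (atarget a). cscale (f p) (lamF \<Phi> (atarget a) p))"
proof -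
  obtain U where UG: "U \<in> Gset" "pi_submodule c Or KG U" and UK: "U \<subseteq> mcarrier KG" and Uh: "hsub (hat ` U)"
    and b: "\<And>j. ordered_basis (vj j) (pcs U j) (\<lambda>p z. \<Phi> (j, p, z))" and b0: "\<And>j p z. vj j \<le> p \<Longrightarrow> \<Phi> (j, p, z) = 0"
    using FS_E[OF \<Phi>] by blast
  let ?i = "asource a" and ?t = "atarget a"
  \<comment> \<open>The label of the image: vertex and degree are prescribed, and such a label
    exists even if its piece is 0.\<close>
  obtain j' where j': "vt j' = ?t" "grd \<longrightarrow> dg j' = vdeg ?i q + adeg c d a" using lab_ex by blast
  have "(\<lambda>z. \<Phi> (jl ?i q, rk ?i q, z)) \<in> U" using obasis_D(4)[OF b] idx1[OF q] by (auto simp: pcs_def)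
  then have "opa a (lamF \<Phi> ?i q) \<in> hat ` U" using Uh a unfolding hsub_def lamF_def by blast
  then obtain \<psi> where \<psi>: "\<psi> \<in> U" "hat \<psi> = opa a (lamF \<Phi> ?i q)" by force
  have "\<psi> \<in> pcs U j'" unfolding pcs_def
  proof (intro CollectI conjI allI impI \<psi>(1))
    fix r p assume nz: "hat \<psi> (r, p) \<noteq> 0"
    then have *: "fst p = ?t" "lamF \<Phi> ?i q (r, ?i, aflip a # snd p) \<noteq> 0"
      unfolding \<psi>(2) opa_def by (auto split: if_splits)
    show "fst p = vt j'" using * j' by simp
    assume g: grd
    have "adeg c d (aflip a) = adeg c d a" by (cases a) (auto simp: bform_def d_sym)
    then have "adeg c d a + pdeg c d p = kk r + int (ll r) * d (ii r) - vdeg ?i q"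
      using lamF_support(2)[OF \<Phi> q *(2) g] by (simp add: pdeg_def)
    then show "pdeg c d p = kk r + int (ll r) * d (ii r) - dg j'" using j' g by simp
  qed
  then obtain g where g: "\<psi> = (\<Sum>q'<vj j'. cscale (g q') (\<lambda>z. \<Phi> (j', q', z)))" using obasis_D(2)[OF b] by blast
  define f where "f p = (if p < n ?t \<and> jl ?t p = j' then g (rk ?t p) else 0)" for p
  have "opa a (lamF \<Phi> ?i q) = (\<Sum>p<n ?t. cscale (f p) (lamF \<Phi> ?t p))"
  proof
    fix z
    have "opa a (lamF \<Phi> ?i q) z = (\<Sum>q'<vj j'. g q' * hat (\<lambda>z. \<Phi> (j', q', z)) z)"
      unfolding \<psi>(2)[symmetric] g clin_unhat_like[OF clin_hat] sum_cscale ..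
    also have "\<dots> = (\<Sum>q'<vj j'. g (rk ?t (pos j' q')) * lamF \<Phi> ?t (pos j' q') z)"
      using idx2[of _ j'] j' by (intro sum.cong) (auto simp: lamF_def)
    also have "\<dots> = (\<Sum>p<n ?t. if jl ?t p = j' then g (rk ?t p) * lamF \<Phi> ?t p z else 0)"
      using label_sum[of j' "\<lambda>p. g (rk ?t p) * lamF \<Phi> ?t p z"] j' by simp
    also have "\<dots> = (\<Sum>p<n ?t. f p * lamF \<Phi> ?t p z)" by (intro sum.cong) (auto simp: f_def)
    finally show "opa a (lamF \<Phi> ?i q) z = (\<Sum>p<n ?t. cscale (f p) (lamF \<Phi> ?t p)) z" unfolding sum_cscale .
  qed
  moreover have "p < n ?t \<and> (grd \<longrightarrow> vdeg ?t p = vdeg ?i q + adeg c d a)" if "f p \<noteq> 0" for p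
    using that dg_jl[of p ?t] j' by (auto simp: f_def split: if_splits)
  ultimately show ?thesis by blast
qed

text \<open>The factor with which the power l - 1 - m of \<gamma> sends the m-th basis vector of
  block r to the last one; it compares row m of a with the last row of a \<epsilon>^(l - 1 - m), see
  \<open>Gc_row\<close>.\<close>

definition Gc :: "nat \<Rightarrow> nat \<Rightarrow> complex" where "Gc r m = (\<Prod>t\<in>{m..<ll r - 1}. gs r t)"

lemma Gc_nz: "r \<in> RS \<Longrightarrow> Gc r m \<noteq> 0"
  unfolding Gc_def using gs_nz by (auto simp: prod_zero_iff)

lemma Gc_last [simp]: "Gc r (ll r - Suc 0) = 1" by (simp add: Gc_def)

lemma Gc_step: "Suc m < ll r \<Longrightarrow> Gc r m = gs r m * Gc r (Suc m)"
  unfolding Gc_def by (simp add: prod.atLeast_Suc_lessThan)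

lemma Gc_row:
  assumes x: "x \<in> XX" "EQa x" and r: "r \<in> RS" and m: "m < ll r" and u: "u \<in> V (ii r)"
  shows "lamv x (ii r) u (r, ii r, replicate (ll r - 1 - m) (Ep (ii r))) = Gc r m * row x (ii r) (wpos r m) u"
proof -
  have "row x (ii r) (wpos r (ll r - 1)) (opw n x (replicate k (Ep (ii r))) u) = Gc r (ll r - 1 - k) * row x (ii r) (wpos r (ll r - 1 - k)) u"
    if "k < ll r" "u \<in> V (ii r)" for k u
    using that
  proof (induction k arbitrary: u)
    case (Suc k)
    have e: "ll r - 1 - k = Suc (ll r - 1 - Suc k)" using Suc.prems by simp
    have "opw n x (replicate (Suc k) (Ep (ii r))) u = opw n x (replicate k (Ep (ii r))) (aop n x (Ep (ii r)) u)"
      using eps_add[of x k 1 "ii r" u] by simp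
    then have "row x (ii r) (wpos r (ll r - 1)) (opw n x (replicate (Suc k) (Ep (ii r))) u)
      = Gc r (ll r - 1 - k) * row x (ii r) (wpos r (ll r - 1 - k)) (aop n x (Ep (ii r)) u)"
      using Suc.IH[of "aop n x (Ep (ii r)) u"] Suc.prems aop_V[OF x(1), of "Ep (ii r)"] by simp
    also have "\<dots> = Gc r (ll r - 1 - k) * (gs r (ll r - 1 - Suc k) * row x (ii r) (wpos r (ll r - 1 - Suc k)) u)"
      using EQa_D(2)[OF x(2) r Suc.prems(2), of "ll r - 1 - Suc k"] Suc.prems e by simp
    finally show ?case using Gc_step[of "ll r - 1 - Suc k" r] Suc.prems e by (simp add: mult_ac)
  qed simp
  from this[of "ll r - 1 - m" u] show ?thesis using m u r by (simp add: lamv_def)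
qed

lemma row_ev: "p < n i \<Longrightarrow> row x i m (ev p) = x (CA i m p)"
proof -
  assume p: "p < n i"
  have "row x i m (ev p) = (\<Sum>q<n i. if q = p then x (CA i m p) else 0)"
    unfolding row_def by (intro sum.cong) (auto simp: ev_def)
  then show ?thesis using p by simp
qed

lemma aop_ev: "q < n (asource a) \<Longrightarrow> aop n x a (ev q) p = xe x a p q"
proof -
  assume p: "q < n (asource a)"
  have "aop n x a (ev q) p = (\<Sum>q'<n (asource a). if q' = q then xe x a p q else 0)"
    unfolding aop_def by (intro sum.cong) (auto simp: ev_def)
  then show ?thesis using p by simp
qed

lemma lamv_expand:
  assumes "u \<in> V i" shows "lamv x i u = (\<Sum>p<n i. cscale (u p) (lamv x i (ev p)))"
proof -
  have "lamv x i u = lamv x i (\<Sum>p<n i. cscale (u p) (ev p))" using VV_expand[OF assms] by (rule arg_cong)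
  also have "\<dots> = (\<Sum>p<n i. cscale (u p) (lamv x i (ev p)))" by (rule clin_unhat_like[OF clin_lamv])
  finally show ?thesis .
qed

lemma Psi_lamF:
  assumes x: "x \<in> PS" and p: "p < n i" shows "lamF (Psi x) i p = lamv x i (ev p)"
proof -
  have "(\<lambda>z. Psi x (jl i p, rk i p, z)) = unhat (lamv x i (ev p))" using idx1[OF p] by (simp add: Psi_def)
  then show ?thesis unfolding lamF_def using hat_unhat[OF lamv_KP[OF x ev_VV]] p by simp
qed

lemma frame_CA:
  assumes x: "x \<in> PS" and r: "r \<in> RS" "m < ll r" and p: "p < n (ii r)"
  shows "x (CA (ii r) (wpos r m) p) = lamF (Psi x) (ii r) p (r, ii r, replicate (ll r - 1 - m) (Ep (ii r))) / Gc r m"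
  using Gc_row[OF PS_D(1,2)[OF x] r ev_VV, of p] p Gc_nz[OF r(1), of m]
  by (simp add: Psi_lamF[OF x p] row_ev)

text \<open>For fixed q these are linear equations for column q of the arrow, one for each
  evaluation point z, with linearly independent coefficient functions. They give uniqueness in
  \<open>Psi_inj\<close> and, by Cramer's rule, the rational inverse.\<close>

lemma frame_arrow:
  assumes x: "x \<in> PS" and a: "arrow_ok c a" and q: "q < n (asource a)"
  shows "opa a (lamF (Psi x) (asource a) q) z = (\<Sum>p<n (atarget a). lamF (Psi x) (atarget a) p z * xe x a p q)"
proof -
  have X: "x \<in> XX" using x by (simp add: PS_def)
  have "opa a (lamF (Psi x) (asource a) q) = lamv x (atarget a) (aop n x a (ev q))"
    unfolding Psi_lamF[OF x q] opa_lamv[OF X a] by simp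
  also have "\<dots> = (\<Sum>p<n (atarget a). cscale (aop n x a (ev q) p) (lamv x (atarget a) (ev p)))"
    by (rule lamv_expand[OF aop_V[OF X]])
  finally have "opa a (lamF (Psi x) (asource a) q) z
    = (\<Sum>p<n (atarget a). aop n x a (ev q) p * lamv x (atarget a) (ev p) z)"
    by (simp only: sum_cscale)
  also have "\<dots> = (\<Sum>p<n (atarget a). lamF (Psi x) (atarget a) p z * xe x a p q)"
    by (intro sum.cong) (auto simp: Psi_lamF[OF x] aop_ev[OF q])
  finally show ?thesis .
qed

lemma XX_eqI:
  assumes "x \<in> XX" "y \<in> XX" "as0 x" "as0 y"
    and "\<And>a p q. arrow_ok c a \<Longrightarrow> p < n (atarget a) \<Longrightarrow> q < n (asource a) \<Longrightarrow> xe x a p q = xe y a p q"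
    and "\<And>r m p. r \<in> RS \<Longrightarrow> m < ll r \<Longrightarrow> p < n (ii r) \<Longrightarrow> x (CA (ii r) (wpos r m) p) = y (CA (ii r) (wpos r m) p)"
  shows "x = y"
proof
  fix z
  show "x z = y z"
  proof (cases "x z = 0 \<and> y z = 0")
    case False
    then have z: "z \<in> coords c n wd" using XX_D[OF assms(1), of z] XX_D[OF assms(2), of z] by auto
    show ?thesis
    proof (cases z)
      case (CAlpha i j p q)
      then show ?thesis using z assms(5)[of "Al i j" p q] by (auto simp: coords_def xe_def)
    next
      case (CEps i p q)
      then show ?thesis using z assms(5)[of "Ep i" p q] by (auto simp: coords_def xe_def)
    next
      case (CAs i p q)
      then show ?thesis using assms(3,4) by (simp add: as0_def)
    next
      case (CA i p q)
      then have "p < wd i" "q < n i" using z by (auto simp: coords_def)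
      then show ?thesis using assms(6) wpos_surj[of p i] CA by metis
    qed
  qed simp
qed

lemma Psi_inj:
  assumes x: "x \<in> PS" and y: "y \<in> PS" and eq: "Psi x = Psi y" shows "x = y"
proof (rule XX_eqI)
  fix a p q assume a: "arrow_ok c a" and p: "p < n (atarget a)" and q: "q < n (asource a)"
  have "(\<Sum>p<n (atarget a). cscale (xe x a p q - xe y a p q) (lamF (Psi x) (atarget a) p)) = 0"
  proof
    fix z
    show "(\<Sum>p<n (atarget a). cscale (xe x a p q - xe y a p q) (lamF (Psi x) (atarget a) p)) z = 0 z"
      using frame_arrow[OF x a q, of z] frame_arrow[OF y a q, of z] eq
      by (simp add: sum_cscale left_diff_distrib sum_subtractf mult.commute)
  qed
  then have "xe x a p q - xe y a p q = 0"
    using lamF_independent[OF Psi_FS[OF x], of "\<lambda>p. xe x a p q - xe y a p q"] p by blast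
  then show "xe x a p q = xe y a p q" by simp
next
  fix r m p assume "r \<in> RS" "m < ll r" "p < n (ii r)"
  then show "x (CA (ii r) (wpos r m) p) = y (CA (ii r) (wpos r m) p)"
    using frame_CA[OF x, of r m p] frame_CA[OF y, of r m p] eq by simp
qed (rule PS_D[OF x] PS_D[OF y])+

definition Theta :: "('j \<times> nat \<times> nat \<times> 'i palg set set \<Rightarrow> complex) \<Rightarrow> 'i rep" where
  "Theta \<Phi> = (THE x. x \<in> PS \<and> Psi x = \<Phi>)"

lemma Theta_Psi: "x \<in> PS \<Longrightarrow> Theta (Psi x) = x"
  unfolding Theta_def by (rule the_equality) (auto intro: Psi_inj)

end

section \<open>Every frame comes from a point\<close>

context setting
begin

definition rm :: "'i \<Rightarrow> nat \<Rightarrow> nat \<times> nat" where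
  "rm i p = (SOME rm. fst rm \<in> RS \<and> ii (fst rm) = i \<and> snd rm < ll (fst rm) \<and> p = wpos (fst rm) (snd rm))"

lemma rm_spec:
  assumes "p < wd i"
  shows "fst (rm i p) \<in> RS" "ii (fst (rm i p)) = i" "snd (rm i p) < ll (fst (rm i p))"
    "p = wpos (fst (rm i p)) (snd (rm i p))"
proof -
  obtain r m where "r \<in> RS" "ii r = i" "m < ll r" "p = wpos r m" using wpos_surj[OF assms] .
  then have "\<exists>rm. fst rm \<in> RS \<and> ii (fst rm) = i \<and> snd rm < ll (fst rm) \<and> p = wpos (fst rm) (snd rm)"
    by (intro exI[of _ "(r, m)"]) simp
  from someI_ex[OF this] show "fst (rm i p) \<in> RS" "ii (fst (rm i p)) = i" "snd (rm i p) < ll (fst (rm i p))"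
    "p = wpos (fst (rm i p)) (snd (rm i p))" unfolding rm_def by blast+
qed

lemma rm_wpos:
  assumes "r \<in> RS" "m < ll r" shows "rm (ii r) (wpos r m) = (r, m)"
proof -
  note s = rm_spec[OF wpos_less[OF assms]]
  have "fst (rm (ii r) (wpos r m)) = r \<and> snd (rm (ii r) (wpos r m)) = m"
    by (rule wpos_inj) (use s assms in auto)
  then show ?thesis by (cases "rm (ii r) (wpos r m)") simp
qed

text \<open>The arrows of x are the coefficients from \<open>lamF_arrow\<close>, and the entries of
  a come from the values of the frame at powers of \<epsilon>. By induction on paths the functions
  attached to this x are the given ones. As they lie in \<open>KP\<close> and are independent, every
  relation can be tested on them, where it is a condition in the definition of
  \<open>KP\<close>.\<close>

lemma Psi_surj:
  assumes \<Phi>: "\<Phi> \<in> FS" shows "\<exists>x\<in>PS. Psi x = \<Phi>"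
proof -
  let ?P = "\<lambda>a q f. (\<forall>p. f p \<noteq> 0 \<longrightarrow> p < n (atarget a) \<and> (grd \<longrightarrow> vdeg (atarget a) p = vdeg (asource a) q + adeg c d a)) \<and>
    opa a (lamF \<Phi> (asource a) q) = (\<Sum>p<n (atarget a). cscale (f p) (lamF \<Phi> (atarget a) p))"
  define F where "F a q = (SOME f. ?P a q f)" for a q
  have "?P a q (F a q)" if "arrow_ok c a" "q < n (asource a)" for a q
    unfolding F_def by (rule someI_ex[OF lamF_arrow[OF \<Phi> that]])
  then have F: "\<And>a q p. arrow_ok c a \<Longrightarrow> q < n (asource a) \<Longrightarrow> F a q p \<noteq> 0 \<Longrightarrow>
      p < n (atarget a) \<and> (grd \<longrightarrow> vdeg (atarget a) p = vdeg (asource a) q + adeg c d a)"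
    and Fop: "\<And>a q. arrow_ok c a \<Longrightarrow> q < n (asource a) \<Longrightarrow>
      opa a (lamF \<Phi> (asource a) q) = (\<Sum>p<n (atarget a). cscale (F a q p) (lamF \<Phi> (atarget a) p))"
    by blast+
  \<comment> \<open>Division by \<open>Gc\<close> recovers row m of a from the last row of a
    \<epsilon>^(l - 1 - m), the only kind of row visible in the frame.\<close>
  define x :: "'i rep" where "x z = (case z of
      CAlpha i j p q \<Rightarrow> if c i j < 0 \<and> q < n j then F (Al i j) q p else 0
    | CEps i p q \<Rightarrow> if q < n i then F (Ep i) q p else 0
    | CAs i p q \<Rightarrow> 0
    | CA i p q \<Rightarrow> if p < wd i \<and> q < n i then lamF \<Phi> i q (fst (rm i p), i,
        replicate (ll (fst (rm i p)) - 1 - snd (rm i p)) (Ep i)) / Gc (fst (rm i p)) (snd (rm i p)) else 0)" for z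
  have xe_x: "xe x a p q = F a q p" if "arrow_ok c a" "q < n (asource a)" for a p q
    using that by (cases a) (auto simp: xe_def x_def)
  have X: "x \<in> XX" unfolding XX_def
  proof (intro CollectI allI impI)
    fix z assume nz: "x z \<noteq> 0"
    show "z \<in> coords c n wd \<and> okc z"
    proof (cases z)
      case (CAlpha i j p q)
      then show ?thesis using nz F[of "Al i j" q p] by (auto simp: x_def coords_def split: if_splits)
    next
      case (CEps i p q)
      then show ?thesis using nz F[of "Ep i" q p] by (auto simp: x_def coords_def split: if_splits)
    next
      case (CAs i p q)
      then show ?thesis using nz by (simp add: x_def)
    next
      case (CA i p q)
      then have pq: "p < wd i" "q < n i" using nz by (auto simp: x_def split: if_splits)
      obtain r m where rm: "rm i p = (r, m)" by (cases "rm i p")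
      have r: "r \<in> RS" "ii r = i" "m < ll r" "p = wpos r m" using rm_spec[OF pq(1)] rm by auto
      have nz': "lamF \<Phi> i q (r, i, replicate (ll r - 1 - m) (Ep i)) \<noteq> 0" using nz pq CA rm by (auto simp: x_def)
      have "wdeg i p = vdeg i q - d i" if grd
      proof -
        have "pdeg c d (i, replicate (ll r - 1 - m) (Ep i)) = kk r + int (ll r) * d i - vdeg i q"
          using lamF_support(2)[OF \<Phi> pq(2) nz' that] r by simp
        moreover have "pdeg c d (i, replicate (ll r - 1 - m) (Ep i)) = int (ll r - 1 - m) * (2 * d i)"
          by (simp add: pdeg_def sum_list_replicate)
        moreover have "wdeg i p = kk r - (int (ll r) - 1) * d i + 2 * int m * d i"
          using wdeg_wpos[OF r(1,3)] r by simp
        moreover have "int (ll r - 1 - m) = int (ll r) - 1 - int m" using r by (simp add: of_nat_diff)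
        ultimately show ?thesis by (simp add: algebra_simps)
      qed
      then show ?thesis using CA pq by (auto simp: coords_def)
    qed
  qed
  have CA: "x (CA (ii r) (wpos r m) p) * Gc r m = lamF \<Phi> (ii r) p (r, ii r, replicate (ll r - 1 - m) (Ep (ii r)))"
    if "r \<in> RS" "m < ll r" "p < n (ii r)" for r m p
    using that rm_wpos[OF that(1,2)] wpos_less[OF that(1,2)] Gc_nz[OF that(1), of m] by (simp add: x_def)
  have lamF_nz: "r \<in> RS \<and> is_path c y \<and> psource y = ii r \<and> fst y = i"
    if "lamF \<Phi> i p (r, y) \<noteq> 0" "p < n i" for i p r y
    using KP_D(1-3)[OF lamF_KP[OF \<Phi> that(2)]] lamF_support(1)[OF \<Phi> that(2,1)] that(1) by blast
  have lam: "lamv x i (ev p) = lamF \<Phi> i p" if p: "p < n i" for i p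
  proof -
    \<comment> \<open>The first letter a of the argument corresponds to \<open>aflip a\<close>, the
      arrow that acts first on the vector; so the induction along the word must leave i and p
      free.\<close>
    have *: "row x (ii r) (wpos r (ll r - 1)) (opw n x (flipw w) (ev p)) = lamF \<Phi> i p (r, i, w)"
      if "r \<in> RS" "is_path c (i, w)" "psource (i, w) = ii r" "p < n i" for r w i p
      using that
    proof (induction w arbitrary: i p)
      case Nil
      then show ?case using CA[of r "ll r - 1" p] ll_pos[of r] by (simp add: row_ev)
    next
      case (Cons a w)
      let ?b = "aflip a"
      have a: "atarget a = i" "arrow_ok c a" "is_path c (asource a, w)" "psource (asource a, w) = ii r"
        using Cons.prems(2,3) by (auto simp: is_path_Cons simp del: is_path.simps(2))
      have ok: "arrow_ok c ?b" using a(2) by (cases a) (auto intro: c_sym)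
      have p: "p < n (asource ?b)" using Cons.prems(4) a by simp
      have "aop n x ?b (ev p) = (\<Sum>p'<n (asource a). cscale (F ?b p p') (ev p'))"
        using VV_expand[OF aop_V[OF X], of ?b "ev p"] aop_ev[OF p] xe_x[OF ok p] by simp
      then have "row x (ii r) (wpos r (ll r - 1)) (opw n x (flipw (a # w)) (ev p))
        = (\<Sum>p'<n (asource a). F ?b p p' * row x (ii r) (wpos r (ll r - 1)) (opw n x (flipw w) (ev p')))"
        by (simp add: clin_unhat_like[OF clin_opw] row_sum)
      also have "\<dots> = (\<Sum>p'<n (asource a). F ?b p p' * lamF \<Phi> (asource a) p' (r, asource a, w))"
        using Cons.IH[OF Cons.prems(1) a(3,4)] by (intro sum.cong) auto
      also have "\<dots> = opa ?b (lamF \<Phi> (asource ?b) p) (r, asource a, w)"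
        unfolding Fop[OF ok p] sum_cscale by simp
      also have "\<dots> = lamF \<Phi> i p (r, i, a # w)" using a by (simp add: opa_def)
      finally show ?case .
    qed
    show ?thesis
    proof
      fix y :: "nat \<times> 'i qpath"
      obtain r t w where y: "y = (r, t, w)" by (cases y) auto
      show "lamv x i (ev p) y = lamF \<Phi> i p y"
      proof (cases "r \<in> RS \<and> is_path c (t, w) \<and> psource (t, w) = ii r \<and> t = i")
        case True
        then have t: "t = i" "r \<in> RS" "is_path c (i, w)" "psource (i, w) = ii r" by auto
        have "lamv x i (ev p) (r, i, w) = row x (ii r) (wpos r (ll r - 1)) (opw n x (flipw w) (ev p))"
          unfolding lamv_def using t by simp
        then show ?thesis unfolding y t(1) using *[OF t(2-4) p] by (rule trans)
      next
        case False
        have "lamF \<Phi> i p (r, t, w) = 0"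
        proof (rule ccontr)
          assume "lamF \<Phi> i p (r, t, w) \<noteq> 0"
          then show False using lamF_nz[OF _ p] False by fastforce
        qed
        moreover have "lamv x i (ev p) (r, t, w) = 0"
        proof (rule ccontr)
          assume "lamv x i (ev p) (r, t, w) \<noteq> 0"
          then show False using lamv_support False by fastforce
        qed
        ultimately show ?thesis by (simp add: y)
      qed
    qed
  qed
  have lamu: "lamv x i u = (\<Sum>p<n i. cscale (u p) (lamF \<Phi> i p))" if "u \<in> V i" for i u
    using lamv_expand[OF that, of x] by (simp add: lam)
  have lam0: "u = 0" if u: "u \<in> V i" and 0: "lamv x i u = 0" for i u
  proof
    fix p
    show "u p = 0 p"
    proof (cases "p < n i")
      case True
      then show ?thesis using lamF_independent[OF \<Phi>, of u i p] lamu[OF u] 0 by simp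
    qed (use u in \<open>simp add: VV_def\<close>)
  qed
  have lamKP: "lamv x i u \<in> KP" if "u \<in> V i" for i u
    unfolding lamu[OF that] by (intro cfun.subspace_sum[OF subspace_KP] cfun.subspace_scale[OF subspace_KP] lamF_KP[OF \<Phi>]) simp
  \<comment> \<open>Vectors are compared through their functions, which determine them because the
    frame is independent; this turns the conditions of \<open>KP\<close> into relations for
    x.\<close>
  have lam_eq: "u = v" if uv: "u \<in> V i" "v \<in> V i" and eq: "\<And>r w. r \<in> RS \<Longrightarrow> lamv x i u (r, i, w) = lamv x i v (r, i, w)" for i u v
  proof -
    have "lamv x i (u - v) = 0"
    proof
      fix y :: "nat \<times> 'i qpath"
      obtain r t w where y: "y = (r, t, w)" by (cases y) auto
      show "lamv x i (u - v) y = 0 y"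
      proof (cases "t = i \<and> r \<in> RS")
        case False
        then show ?thesis by (auto simp: y lamv_def)
      qed (use eq in \<open>simp add: y clin_diff[OF clin_lamv]\<close>)
    qed
    then have "u - v = 0" by (rule lam0[OF cfun.subspace_diff[OF subspace_VV uv]])
    then show ?thesis by simp
  qed
  have sp: "sep x" unfolding sep_def
  proof (intro allI ballI impI)
    fix i u assume u: "u \<in> V i" and 0: "\<forall>i0 m w. m < wd i0 \<and> is_path c (i0, w) \<and> psource (i0, w) = i
      \<longrightarrow> row x i0 m (opw n x w u) = 0"
    have "lamv x i u = 0"
    proof
      fix y :: "nat \<times> 'i qpath"
      obtain r t w where y: "y = (r, t, w)" by (cases y) auto
      show "lamv x i u y = 0 y"
      proof (cases "r \<in> RS \<and> is_path c (t, w) \<and> psource (t, w) = ii r \<and> t = i")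
        case True
        then have t: "r \<in> RS" "is_path c (i, w)" "psource (i, w) = ii r" "t = i" by auto
        have "wpos r (ll r - 1) < wd (ii r)" using t(1) ll_pos by (intro wpos_less) auto
        moreover have "is_path c (ii r, flipw w)" "psource (ii r, flipw w) = i"
          using flip_path[OF t(2)] psource_flipw[OF t(2)] by (simp_all add: t(3))
        ultimately have "row x (ii r) (wpos r (ll r - 1)) (opw n x (flipw w) u) = 0" using 0 by blast
        then show ?thesis by (simp add: y lamv_def)
      qed (auto simp: y lamv_def)
    qed
    then show "u = 0" by (rule lam0[OF u])
  qed
  have "EQc x" unfolding EQc_def
  proof (intro allI impI)
    fix i j p q assume a: "c i j < 0 \<and> q < n j"
    have eV: "ev q \<in> V j" using a by (intro ev_VV) simp
    let ?l = "opw n x (replicate (ff i j) (Ep i)) (aop n x (Al i j) (ev q))"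
    let ?r = "aop n x (Al i j) (opw n x (replicate (ff j i) (Ep j)) (ev q))"
    \<comment> \<open>The flips of these words are the two sides of the relation for (i, j);
      equality of the values is the condition of \<open>KP\<close> for (j, i).\<close>
    let ?u = "[Al j i] @ replicate (ff i j) (Ep i)" and ?v = "replicate (ff j i) (Ep j) @ [Al j i]"
    have cji: "c j i < 0" using a c_sym by blast
    have paths: "is_path c (j, ?u)" "psource (j, ?u) = i" "is_path c (j, ?v)" "psource (j, ?v) = i"
      using a cji by (auto simp: is_path_append psource_append)
    have f: "flipw ?u = replicate (ff i j) (Ep i) @ [Al i j]" "flipw ?v = [Al i j] @ replicate (ff j i) (Ep j)" by simp_all
    have "?l = ?r"
    proof (rule lam_eq)
      show "?l \<in> V i" using aop_V[OF X, of "Al i j"] by (intro E_V[OF X]) simp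
      show "?r \<in> V i" using aop_V[OF X, of "Al i j"] by simp
      fix r w
      have "lamv x i ?l (r, i, w) = lamv x j (ev q) (r, j, ?u @ w)"
        using lamv_append[OF X paths(1), of "ev q" r w] unfolding paths(2) f by simp
      also have "\<dots> = lamv x j (ev q) (r, j, ?v @ w)"
        using KP_D(4)[OF lamKP[OF eV] cji, of r j "[]" w] by simp
      also have "\<dots> = lamv x i ?r (r, i, w)"
        using lamv_append[OF X paths(3), of "ev q" r w] unfolding paths(4) f by simp
      finally show "lamv x i ?l (r, i, w) = lamv x i ?r (r, i, w)" .
    qed
    then show "?l p = ?r p" by simp
  qed
  moreover have "EQm x" unfolding EQm_def
  proof (intro allI impI)
    fix i p q assume q: "q < n i"
    have eV: "ev q \<in> V i" using q by (intro ev_VV) simp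
    let ?o = "\<lambda>j k. opw n x (replicate k (Ep i)) (aop n x (Al i j) (aop n x (Al j i)
          (opw n x (replicate (ff i j - 1 - k) (Ep i)) (ev q))))"
    let ?s = "\<Sum>j\<in>UNIV. \<Sum>k<ff i j. cscale (osign Or i j) (?o j k)"
    have "?s = 0"
    proof (rule lam_eq)
      show "?s \<in> V i" using aop_V[OF X, of "Al i _"]
        by (intro cfun.subspace_sum[OF subspace_VV] cfun.subspace_scale[OF subspace_VV] E_V[OF X]) simp
      show "0 \<in> V i" by (rule zero_V)
      fix r w
      have e: "lamv x i (?o j k) (r, i, w) = lamv x i (ev q) (r, i, [] @
         (replicate (ff i j - 1 - k) (Ep i) @ [Al i j, Al j i] @ replicate (ff i j - 1 - (ff i j - 1 - k)) (Ep i)) @ w)"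
        if k: "k < ff i j" for j k
      proof -
        let ?w = "replicate (ff i j - 1 - k) (Ep i) @ [Al i j, Al j i] @ replicate k (Ep i)"
        have cij: "c i j < 0" using k by simp
        have "is_path c (i, ?w)" "psource (i, ?w) = i"
          using cij c_sym[OF cij] by (auto simp: is_path_append psource_append)
        then show ?thesis using lamv_append[OF X, of i ?w "ev q" r w] k by simp
      qed
      have "lamv x i ?s (r, i, w) = (\<Sum>j\<in>UNIV. \<Sum>k<ff i j. osign Or i j * lamv x i (?o j k) (r, i, w))"
        unfolding clin_sum[OF clin_lamv] clin_scale[OF clin_lamv] sum_apply by (simp only: cscale_def)
      also have "\<dots> = (\<Sum>j\<in>UNIV. \<Sum>k<ff i j. osign Or i j * lamv x i (ev q) (r, i, [] @
         (replicate k (Ep i) @ [Al i j, Al j i] @ replicate (ff i j - 1 - k) (Ep i)) @ w))"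
      proof (rule sum.cong[OF refl])
        fix j
        have "(\<Sum>k<ff i j. osign Or i j * lamv x i (?o j k) (r, i, w))
          = (\<Sum>k<ff i j. osign Or i j * lamv x i (ev q) (r, i, [] @
         (replicate (ff i j - 1 - k) (Ep i) @ [Al i j, Al j i] @ replicate (ff i j - 1 - (ff i j - 1 - k)) (Ep i)) @ w))"
          by (intro sum.cong refl arg_cong2[of _ _ _ _ "(*)"] e) simp
        also have "\<dots> = (\<Sum>k<ff i j. osign Or i j * lamv x i (ev q) (r, i, [] @
         (replicate k (Ep i) @ [Al i j, Al j i] @ replicate (ff i j - 1 - k) (Ep i)) @ w))"
          by (rule sum.reindex_bij_witness[of _ "\<lambda>k. ff i j - 1 - k" "\<lambda>k. ff i j - 1 - k"]) auto
        finally show "(\<Sum>k<ff i j. osign Or i j * lamv x i (?o j k) (r, i, w))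
          = (\<Sum>k<ff i j. osign Or i j * lamv x i (ev q) (r, i, [] @
         (replicate k (Ep i) @ [Al i j, Al j i] @ replicate (ff i j - 1 - k) (Ep i)) @ w))" .
      qed
      also have "\<dots> = 0" by (rule KP_D(5)[OF lamKP[OF eV]])
      also have "\<dots> = lamv x i 0 (r, i, w)" by (simp add: clin_0[OF clin_lamv])
      finally show "lamv x i ?s (r, i, w) = lamv x i 0 (r, i, w)" .
    qed
    then have "?s p = 0" by simp
    then show "(\<Sum>j\<in>UNIV. \<Sum>k<ff i j. osign Or i j * ?o j k p) = 0" unfolding sum_apply by (simp only: cscale_def)
  qed
  moreover have "EQa x" unfolding EQa_def
  proof (intro allI impI)
    fix r m q assume a: "r \<in> RS \<and> m < ll r \<and> q < n (ii r)"
    let ?i = "ii r"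
    have R: "Gc r m * row x ?i (wpos r m) u = lamv x ?i u (r, ?i, replicate (ll r - 1 - m) (Ep ?i))"
      if u: "u \<in> V ?i" and m: "m < ll r" for u m
    proof -
      have "row x ?i (wpos r m) u = (\<Sum>p<n ?i. u p * row x ?i (wpos r m) (ev p))"
        using VV_expand[OF u] row_sum[of x ?i "wpos r m" u ev "{..<n ?i}"] by simp
      then have "Gc r m * row x ?i (wpos r m) u = (\<Sum>p<n ?i. u p * lamF \<Phi> ?i p (r, ?i, replicate (ll r - 1 - m) (Ep ?i)))"
        using CA a m by (simp add: row_ev sum_distrib_left mult_ac)
      then show ?thesis unfolding lamu[OF u] sum_cscale .
    qed
    have eV: "ev q \<in> V ?i" using a by (intro ev_VV) simp
    have AV: "aop n x (Ep ?i) (ev q) \<in> V ?i" using aop_V[OF X, of "Ep ?i"] by simp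
    have "Gc r m * row x ?i (wpos r m) (aop n x (Ep ?i) (ev q))
      = lamv x ?i (ev q) (r, ?i, replicate (Suc (ll r - 1 - m)) (Ep ?i))"
      using R[OF AV, of m] a lamv_append[OF X, of ?i "[Ep ?i]" "ev q" r] by simp
    also have "\<dots> = Gc r m * (case m of 0 \<Rightarrow> 0 | Suc m' \<Rightarrow> gs r m' * row x ?i (wpos r m') (ev q))"
    proof (cases m)
      \<comment> \<open>The word has become \<epsilon>^l, on which elements of \<open>KP\<close>
        vanish.\<close>
      case 0
      then show ?thesis using KP_D(6)[OF lamKP[OF eV], of r ?i "[]"] a by simp
    next
      case (Suc m')
      have "m < ll r" using a by simp
      then have "Suc (ll r - 1 - m) = ll r - 1 - m'" using Suc by linarith
      then show ?thesis using R[OF eV, of m'] Gc_step[of m' r] a Suc by (simp add: mult_ac)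
    qed
    finally show "row x ?i (wpos r m) (aop n x (Ep ?i) (ev q))
      = (case m of 0 \<Rightarrow> 0 | Suc m' \<Rightarrow> gs r m' * row x ?i (wpos r m') (ev q))"
      using Gc_nz[of r m] a by simp
  qed
  moreover have "as0 x" by (simp add: as0_def x_def)
  ultimately have xP: "x \<in> PS" unfolding PS_def using X sp stable_iff_sep[OF X] by blast
  obtain U where UG: "U \<in> Gset" "pi_submodule c Or KG U" and UK: "U \<subseteq> mcarrier KG" and Uh: "hsub (hat ` U)"
    and b: "\<And>j. ordered_basis (vj j) (pcs U j) (\<lambda>p z. \<Phi> (j, p, z))" and b0: "\<And>j p z. vj j \<le> p \<Longrightarrow> \<Phi> (j, p, z) = 0"
    using FS_E[OF \<Phi>] by blast
  have "Psi x = \<Phi>"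
  proof
    fix y :: "'j \<times> nat \<times> nat \<times> 'i palg set set"
    obtain j q z where y: "y = (j, q, z)" by (cases y) auto
    show "Psi x y = \<Phi> y"
    proof (cases "q < vj j")
      case True
      have "lamv x (vt j) (ev (pos j q)) = hat (\<lambda>z. \<Phi> (j, q, z))"
        using lam[of "pos j q" "vt j"] idx2[OF True] by (simp add: lamF_def)
      moreover have "(\<lambda>z. \<Phi> (j, q, z)) \<in> mcarrier KG"
        using obasis_D(4)[OF b True] UK by (auto simp: pcs_def)
      ultimately show ?thesis using True by (simp add: y Psi_def unhat_hat)
    next
      case False
      then show ?thesis using b0[of j q z] by (simp add: y Psi_def)
    qed
  qed
  then show ?thesis using xP by blast
qed

lemma Theta:
  assumes "\<Phi> \<in> FS" shows "Theta \<Phi> \<in> PS" "Psi (Theta \<Phi>) = \<Phi>"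
proof -
  obtain x where "x \<in> PS" "Psi x = \<Phi>" using Psi_surj[OF assms] by blast
  then show "Theta \<Phi> \<in> PS" "Psi (Theta \<Phi>) = \<Phi>" using Theta_Psi by auto
qed

section \<open>Continuity of the frame map and of its inverse\<close>

lemma polyfun_aop:
  assumes "\<And>p. polyfun (\<lambda>x. f x p)" shows "polyfun (\<lambda>x. aop n x a (f x) p)"
  unfolding aop_def xe_def
  by (cases a) (auto intro!: polyfun_sum polyfun_mult polyfun_coord assms)

lemma polyfun_opw:
  assumes "\<And>p. polyfun (\<lambda>x. f x p)" shows "polyfun (\<lambda>x. opw n x w (f x) p)"
proof (induction w arbitrary: p)
  case (Cons a w)
  then show ?case unfolding opw_simps by (intro polyfun_aop)
qed (simp add: assms)

lemma polyfun_row: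
  assumes "\<And>p. polyfun (\<lambda>x. f x p)" shows "polyfun (\<lambda>x. row x i m (f x))"
  unfolding row_def by (intro polyfun_sum polyfun_mult polyfun_coord assms)

lemma polyfun_lamv: "polyfun (\<lambda>x. lamv x i u z)"
proof -
  obtain r t w where z: "z = (r, t, w)" by (cases z) auto
  show ?thesis unfolding z lamv_def prod.case
    by (intro polyfun_if polyfun_row polyfun_opw polyfun_const)
qed

text \<open>\<open>unhat\<close> evaluates at representatives that do not depend on x, so each
  coordinate of \<open>Psi\<close> is a fixed finite combination of polynomial functions.\<close>

lemma polyfun_Psi: "polyfun (\<lambda>x. Psi x z)"
proof -
  obtain j q r A where z: "z = (j, q, r, A)" by (cases z) auto
  show ?thesis unfolding z Psi_def unhat_def plin_def prod.case
    by (intro polyfun_if polyfun_sum polyfun_cmult polyfun_lamv polyfun_const)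
qed

lemma polyfun_lamF: "polyfun (\<lambda>\<Phi>. lamF \<Phi> i p z)"
proof -
  obtain r y where z: "z = (r, y)" by (cases z) auto
  show ?thesis unfolding z lamF_def hat_def prod.case
    by (intro polyfun_if polyfun_coord polyfun_const)
qed

lemma polyfun_opa_lamF: "polyfun (\<lambda>\<Phi>. opa a (lamF \<Phi> i p) z)"
proof -
  obtain r y where z: "z = (r, y)" by (cases z) auto
  show ?thesis unfolding z opa_def prod.case
    by (intro polyfun_if polyfun_lamF polyfun_const)
qed

text \<open>Near a given frame, Cramer's rule for suitable evaluation points recovers the entries of the arrows.\<close>

lemma locally_rational_Theta: "locally_rational FS Theta"
  unfolding locally_rational_def
proof
  fix \<Phi>0 assume \<Phi>0: "\<Phi>0 \<in> FS"
  have "\<exists>z. det (mat (n i) (n i) (\<lambda>(m, p). lamF \<Phi>0 i p (z m))) \<noteq> 0" for i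
  proof (rule independent_minor)
    fix u assume "\<And>y. (\<Sum>p<n i. u p * lamF \<Phi>0 i p y) = 0"
    then have "(\<Sum>p<n i. cscale (u p) (lamF \<Phi>0 i p)) = 0" by (auto simp: fun_eq_iff sum_cscale)
    then show "\<forall>p<n i. u p = 0" using lamF_independent[OF \<Phi>0] by blast
  qed
  \<comment> \<open>Evaluation points at which the functions of \<Phi>0 at each vertex have a
    nonzero determinant; they are kept fixed for all other frames.\<close>
  then obtain z where z: "\<And>i. det (mat (n i) (n i) (\<lambda>(m, p). lamF \<Phi>0 i p (z i m))) \<noteq> 0" by metis
  define M where "M \<Phi> i = mat (n i) (n i) (\<lambda>(m, p). lamF \<Phi> i p (z i m))" for \<Phi> i
  define D where "D \<Phi> = (\<Prod>i\<in>UNIV. det (M \<Phi> i))" for \<Phi>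
  \<comment> \<open>Multiplying by the determinants at the other vertices brings all entries to the
    common denominator D.\<close>
  define D' where "D' i \<Phi> = (\<Prod>k\<in>UNIV - {i}. det (M \<Phi> k))" for i \<Phi>
  have DD: "D \<Phi> = D' i \<Phi> * det (M \<Phi> i)" for i \<Phi>
    unfolding D_def D'_def by (subst prod.remove[of UNIV i]) auto
  have pd: "polyfun (\<lambda>\<Phi>. det (M \<Phi> i))" for i unfolding M_def by (intro polyfun_det polyfun_lamF)
  define Nar where "Nar a p q \<Phi> = (if arrow_ok c a \<and> p < n (atarget a) \<and> q < n (asource a) then D' (atarget a) \<Phi> *
    (\<Sum>m<n (atarget a). adj_mat (M \<Phi> (atarget a)) $$ (p, m) * opa a (lamF \<Phi> (asource a) q) (z (atarget a) m)) else 0)" for a p q \<Phi>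
  define N where "N y \<Phi> = (case y of CAlpha i j p q \<Rightarrow> Nar (Al i j) p q \<Phi> | CEps i p q \<Rightarrow> Nar (Ep i) p q \<Phi> | CAs i p q \<Rightarrow> 0
    | CA i p q \<Rightarrow> if p < wd i \<and> q < n i then (1 / Gc (fst (rm i p)) (snd (rm i p))) * (D \<Phi> * lamF \<Phi> i q (fst (rm i p), i,
        replicate (ll (fst (rm i p)) - 1 - snd (rm i p)) (Ep i))) else 0)" for y \<Phi>
  have pNar: "polyfun (Nar a p q)" for a p q
    unfolding Nar_def D'_def
    by (intro polyfun_if polyfun_mult polyfun_prod pd polyfun_sum polyfun_opa_lamF polyfun_const)
      (auto simp: M_def intro!: polyfun_adj polyfun_lamF)
  have pN: "polyfun (N y)" for y
    unfolding N_def D_def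
    by (cases y) (auto intro!: polyfun_if polyfun_mult polyfun_prod pd pNar polyfun_lamF polyfun_const simp del: times_divide_eq_left)
  show "\<exists>D N. polyfun D \<and> (\<forall>z. polyfun (N z)) \<and> D \<Phi>0 \<noteq> 0 \<and>
     (\<forall>\<Phi>\<in>FS. D \<Phi> \<noteq> 0 \<longrightarrow> (\<forall>z. Theta \<Phi> z = N z \<Phi> / D \<Phi>))"
  proof (intro exI[of _ D] exI[of _ N] conjI allI ballI impI pN)
    show "polyfun D" unfolding D_def by (intro polyfun_prod pd)
    show "D \<Phi>0 \<noteq> 0" using z by (simp add: D_def M_def)
    fix \<Phi> y assume \<Phi>: "\<Phi> \<in> FS" and nz: "D \<Phi> \<noteq> 0"
    define x where "x = Theta \<Phi>"
    have x: "x \<in> PS" "Psi x = \<Phi>" using Theta[OF \<Phi>] by (simp_all add: x_def)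
    have X: "x \<in> XX" using x by (simp add: PS_def)
    have ar: "xe x a p q = Nar a p q \<Phi> / D \<Phi>" for a p q
    proof (cases "arrow_ok c a \<and> p < n (atarget a) \<and> q < n (asource a)")
      case True
      let ?i = "atarget a"
      have "det (M \<Phi> ?i) * xe x a p q
        = (\<Sum>m<n ?i. adj_mat (M \<Phi> ?i) $$ (p, m) * opa a (lamF \<Phi> (asource a) q) (z ?i m))"
        unfolding M_def using True frame_arrow[OF x(1), of a q] x(2)
        by (intro cramer) auto
      then have "Nar a p q \<Phi> = D \<Phi> * xe x a p q" using True DD[of \<Phi> ?i] by (simp add: Nar_def mult.assoc)
      then show ?thesis using nz by simp
    next
      case False
      then have "xe x a p q = 0" using XX_supp[OF X, of a p q] by blast
      then show ?thesis using False by (auto simp: Nar_def)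
    qed
    have "x y = N y \<Phi> / D \<Phi>"
    proof (cases y)
      case (CAlpha i j p q)
      then show ?thesis using ar[of "Al i j" p q] by (simp add: N_def xe_def)
    next
      case (CEps i p q)
      then show ?thesis using ar[of "Ep i" p q] by (simp add: N_def xe_def)
    next
      case (CAs i p q)
      then show ?thesis using PS_D(6)[OF x(1)] by (simp add: N_def as0_def)
    next
      case (CA i p q)
      show ?thesis
      proof (cases "p < wd i \<and> q < n i")
        case True
        obtain r m where rm: "rm i p = (r, m)" by (cases "rm i p")
        have r: "r \<in> RS" "ii r = i" "m < ll r" "p = wpos r m" using rm_spec[of p i] True rm by auto
        have "x (CA i p q) = lamF \<Phi> i q (r, i, replicate (ll r - 1 - m) (Ep i)) / Gc r m"
          using frame_CA[OF x(1) r(1,3), of q] True r x(2) by simp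
        then show ?thesis using nz True CA rm by (simp add: N_def)
      next
        case False
        then have "x (CA i p q) = 0" using XX_CA[OF X, of i p q] by blast
        then show ?thesis using False CA by (auto simp: N_def)
      qed
    qed
    then show "Theta \<Phi> y = N y \<Phi> / D \<Phi>" by (simp add: x_def)
  qed
qed

end

section \<open>Orbits\<close>

definition gop :: "complex mat \<Rightarrow> nat \<Rightarrow> (nat \<Rightarrow> complex) \<Rightarrow> nat \<Rightarrow> complex" where
  "gop M k u = (\<lambda>p. if p < k then \<Sum>q<k. M $$ (p, q) * u q else 0)"

lemma clin_gop: "clin (gop M k)"
  by (auto simp: clin_def gop_def cscale_def fun_eq_iff distrib_left sum.distrib sum_distrib_left mult.left_commute)

lemma gop_VV: "gop M (n i) u \<in> VV n i"
  by (simp add: gop_def VV_def)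

lemma gop_ev: "q < k \<Longrightarrow> gop M k (ev q) = (\<lambda>p. if p < k then M $$ (p, q) else 0)"
proof
  fix p assume q: "q < k"
  have "(\<Sum>q'<k. M $$ (p, q') * ev q q') = (\<Sum>q'<k. if q' = q then M $$ (p, q) else 0)"
    by (intro sum.cong) (auto simp: ev_def)
  then show "gop M k (ev q) p = (if p < k then M $$ (p, q) else 0)" using q by (simp add: gop_def)
qed

lemma gop_mult:
  assumes "M \<in> carrier_mat k k" "N \<in> carrier_mat k k"
  shows "gop (M * N) k u = gop M k (gop N k u)"
proof
  fix p
  show "gop (M * N) k u p = gop M k (gop N k u) p"
  proof (cases "p < k")
    case True
    have "(\<Sum>q<k. (M * N) $$ (p, q) * u q) = (\<Sum>q<k. \<Sum>m<k. M $$ (p, m) * (N $$ (m, q) * u q))"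
      using assms True by (intro sum.cong refl)
        (auto simp: scalar_prod_def atLeast0LessThan sum_distrib_right mult.assoc intro!: sum.cong)
    also have "\<dots> = (\<Sum>m<k. M $$ (p, m) * (\<Sum>q<k. N $$ (m, q) * u q))"
      by (subst sum.swap) (simp add: sum_distrib_left)
    finally show ?thesis using True by (simp add: gop_def)
  qed (simp add: gop_def)
qed

lemma gop_one: "u \<in> VV n i \<Longrightarrow> gop (1\<^sub>m (n i)) (n i) u = u"
proof
  fix p assume u: "u \<in> VV n i"
  show "gop (1\<^sub>m (n i)) (n i) u p = u p"
  proof (cases "p < n i")
    case True
    have "(\<Sum>q<n i. 1\<^sub>m (n i) $$ (p, q) * u q) = (\<Sum>q<n i. if q = p then u p else 0)"
      using True by (intro sum.cong) auto
    then show ?thesis using True by (simp add: gop_def)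
  qed (use u in \<open>simp add: gop_def VV_def\<close>)
qed

text \<open>\<open>invertible_mat\<close> does not fix the size of the inverse; comparing the
  numbers of columns in the two identities does.\<close>

lemma invertible_mat_inverse:
  assumes "M \<in> carrier_mat k k" "invertible_mat M"
  obtains B where "B \<in> carrier_mat k k" "M * B = 1\<^sub>m k" "B * M = 1\<^sub>m k"
proof -
  obtain B where B: "M * B = 1\<^sub>m (dim_row M)" "B * M = 1\<^sub>m (dim_row B)"
    using assms(2) unfolding invertible_mat_def inverts_mat_def by blast
  have "dim_col B = k" using arg_cong[OF B(1), of dim_col] assms(1) by simp
  moreover have "dim_row B = k" using arg_cong[OF B(2), of dim_col] assms(1) by simp
  ultimately show ?thesis using that[of B] B assms(1) by auto
qed

context setting
begin

lemma alphaM_gop: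
  assumes "M \<in> carrier_mat (n j) (n j)" "p < n i" "q < n j"
  shows "(alphaM n y i j * M) $$ (p, q) = aop n y (Al i j) (gop M (n j) (ev q)) p"
  using assms by (auto simp: alphaM_def scalar_prod_def atLeast0LessThan aop_def gop_ev xe_def intro!: sum.cong)

lemma gop_alphaM:
  assumes "M \<in> carrier_mat (n i) (n i)" "p < n i" "q < n j"
  shows "(M * alphaM n x i j) $$ (p, q) = gop M (n i) (aop n x (Al i j) (ev q)) p"
  using assms aop_ev[of q "Al i j" x]
  by (auto simp: alphaM_def scalar_prod_def atLeast0LessThan gop_def xe_def intro!: sum.cong)

lemma epsM_gop:
  assumes "M \<in> carrier_mat (n i) (n i)" "p < n i" "q < n i"
  shows "(epsM n y i * M) $$ (p, q) = aop n y (Ep i) (gop M (n i) (ev q)) p"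
  using assms by (auto simp: epsM_def scalar_prod_def atLeast0LessThan aop_def gop_ev xe_def intro!: sum.cong)

lemma gop_epsM:
  assumes "M \<in> carrier_mat (n i) (n i)" "p < n i" "q < n i"
  shows "(M * epsM n x i) $$ (p, q) = gop M (n i) (aop n x (Ep i) (ev q)) p"
  using assms aop_ev[of q "Ep i" x]
  by (auto simp: epsM_def scalar_prod_def atLeast0LessThan gop_def xe_def intro!: sum.cong)

lemma aM_gop:
  assumes "M \<in> carrier_mat (n i) (n i)" "m < wd i" "q < n i"
  shows "(aM n wd y i * M) $$ (m, q) = row y i m (gop M (n i) (ev q))"
  using assms by (auto simp: aM_def scalar_prod_def atLeast0LessThan row_def gop_ev intro!: sum.cong)

lemma GG_D: "g \<in> GG \<Longrightarrow> g i \<in> carrier_mat (n i) (n i)" "g \<in> GG \<Longrightarrow> invertible_mat (g i)"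
  by (auto simp: GG_def)

lemma acts_aop:
  assumes g: "g \<in> GG" and x: "x \<in> XX" and y: "y \<in> XX" and act: "acts_to n wd g x y" and u: "u \<in> V (asource a)"
  shows "aop n y a (gop (g (asource a)) (n (asource a)) u) = gop (g (atarget a)) (n (atarget a)) (aop n x a u)"
proof (rule clin_ext[OF clin_comp[OF clin_aop clin_gop] clin_comp[OF clin_gop clin_aop] _ u])
  fix q assume q: "q < n (asource a)"
  show "aop n y a (gop (g (asource a)) (n (asource a)) (ev q)) = gop (g (atarget a)) (n (atarget a)) (aop n x a (ev q))"
  proof
    fix p
    show "aop n y a (gop (g (asource a)) (n (asource a)) (ev q)) p = gop (g (atarget a)) (n (atarget a)) (aop n x a (ev q)) p"
    proof (cases "p < n (atarget a)")
      case True
      show ?thesis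
      proof (cases a)
        case (Al i j)
        have "alphaM n y i j * g j = g i * alphaM n x i j" using act by (simp add: acts_to_def)
        then show ?thesis using alphaM_gop[OF GG_D(1)[OF g], of p i q j y] gop_alphaM[OF GG_D(1)[OF g], of p i q j x] True q Al
          by simp
      next
        case (Ep i)
        have "epsM n y i * g i = g i * epsM n x i" using act by (simp add: acts_to_def)
        then show ?thesis using epsM_gop[OF GG_D(1)[OF g], of p i q y] gop_epsM[OF GG_D(1)[OF g], of p i q x] True q Ep
          by simp
      qed
    next
      case False
      then show ?thesis using aop_V[OF y, of a "gop (g (asource a)) (n (asource a)) (ev q)"]
        by (simp add: VV_def gop_def)
    qed
  qed
qed

lemma acts_row:
  assumes g: "g \<in> GG" and act: "acts_to n wd g x y" and u: "u \<in> V i" and m: "m < wd i"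
  shows "row y i m (gop (g i) (n i) u) = row x i m u"
proof -
  have "(\<lambda>_::nat. row y i m (gop (g i) (n i) u)) = (\<lambda>_. row x i m u)"
  proof (rule clin_ext[OF _ _ _ u])
    show "clin (\<lambda>u _::nat. row y i m (gop (g i) (n i) u))" "clin (\<lambda>u _::nat. row x i m u)"
      unfolding clin_def clin_add[OF clin_gop] clin_scale[OF clin_gop] row_add row_scale by (auto simp: cscale_def)
    fix q assume q: "q < n i"
    have "aM n wd y i * g i = aM n wd x i" using act by (simp add: acts_to_def)
    then show "(\<lambda>_::nat. row y i m (gop (g i) (n i) (ev q))) = (\<lambda>_. row x i m (ev q))"
      using aM_gop[OF GG_D(1)[OF g] m q, of y] q m by (simp add: row_ev aM_def)
  qed
  then show ?thesis by meson
qed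

lemma acts_opw:
  assumes g: "g \<in> GG" and x: "x \<in> XX" and y: "y \<in> XX" and act: "acts_to n wd g x y" and u: "u \<in> V i"
  shows "is_path c (t, w) \<Longrightarrow> psource (t, w) = i \<Longrightarrow>
    opw n y w (gop (g i) (n i) u) = gop (g t) (n t) (opw n x w u)"
proof (induction w arbitrary: t)
  case (Cons a w)
  then have a: "atarget a = t" "is_path c (asource a, w)" "psource (asource a, w) = i" by auto
  show ?case using acts_aop[OF g x y act opw_V[OF x a(2,3) u]] Cons.IH[OF a(2,3)] a(1) by simp
qed simp

text \<open>The function attached to u involves only rows of a w u, and a base change moves vectors
  and operators together.\<close>

lemma acts_lamv:
  assumes g: "g \<in> GG" and x: "x \<in> XX" and y: "y \<in> XX" and act: "acts_to n wd g x y" and u: "u \<in> V i"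
  shows "lamv y i (gop (g i) (n i) u) = lamv x i u"
proof
  fix z :: "nat \<times> 'i qpath"
  obtain r t w where z: "z = (r, t, w)" by (cases z) auto
  show "lamv y i (gop (g i) (n i) u) z = lamv x i u z"
  proof (cases "r \<in> RS \<and> is_path c (t, w) \<and> psource (t, w) = ii r \<and> t = i")
    case True
    then have p: "is_path c (ii r, flipw w)" "psource (ii r, flipw w) = i"
      using flip_path[of t w] psource_flipw[of c t w] by auto
    have "opw n x (flipw w) u \<in> V (ii r)" by (rule opw_V[OF x p u])
    moreover have "wpos r (ll r - 1) < wd (ii r)" using True wpos_less[of r "ll r - 1"] ll_pos[of r] by simp
    ultimately have "row y (ii r) (wpos r (ll r - 1)) (opw n y (flipw w) (gop (g i) (n i) u))
      = row x (ii r) (wpos r (ll r - 1)) (opw n x (flipw w) u)"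
      unfolding acts_opw[OF g x y act u p] by (rule acts_row[OF g act])
    then show ?thesis using True by (auto simp: z lamv_def)
  qed (auto simp: z lamv_def)
qed

lemma gop_onto:
  assumes "g \<in> GG" "u \<in> V i" obtains v where "v \<in> V i" "u = gop (g i) (n i) v"
proof -
  obtain B where B: "B \<in> carrier_mat (n i) (n i)" "g i * B = 1\<^sub>m (n i)"
    using invertible_mat_inverse[OF GG_D[OF assms(1)]] by metis
  have "gop (g i) (n i) (gop B (n i) u) = u"
    using gop_mult[OF GG_D(1)[OF assms(1)] B(1), of u] B(2) gop_one[OF assms(2)] by simp
  then show ?thesis using that[OF gop_VV[of B n i u]] by simp
qed

text \<open>Each relation compares operators along paths, so for y it can be tested on vectors of
  the form g v, where it becomes the relation for x.\<close>

lemma PS_invariant: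
  assumes g: "g \<in> GG" and x: "x \<in> PS" and y: "y \<in> XX" and act: "acts_to n wd g x y"
  shows "y \<in> PS" "HH y = HH x"
proof -
  note X = PS_D(1)[OF x]
  note op = acts_opw[OF g X y act]
  have sp: "sep y" unfolding sep_def
  proof (intro allI ballI impI)
    fix i u assume u: "u \<in> V i" and 0: "\<forall>i0 m w. m < wd i0 \<and> is_path c (i0, w) \<and> psource (i0, w) = i
      \<longrightarrow> row y i0 m (opw n y w u) = 0"
    obtain v where v: "v \<in> V i" "u = gop (g i) (n i) v" using gop_onto[OF g u] .
    have "v = 0"
    proof (rule PS_D(3)[OF x, unfolded sep_def, rule_format, OF v(1)])
      fix i0 m w assume a: "m < wd i0 \<and> is_path c (i0, w) \<and> psource (i0, w) = i"
      have "row x i0 m (opw n x w v) = row y i0 m (opw n y w u)"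
        using acts_row[OF g act opw_V[OF X _ _ v(1)], of i0 w m] op[OF v(1), of i0 w] v(2) a by simp
      then show "row x i0 m (opw n x w v) = 0" using 0 a by simp
    qed
    then show "u = 0" using v by (simp add: clin_0[OF clin_gop])
  qed
  have "EQc y" unfolding EQc_def
  proof (intro allI impI)
    fix i j p q assume a: "c i j < 0 \<and> q < n j"
    then have "ev q \<in> V j" by (intro ev_VV) simp
    then obtain v where v: "v \<in> V j" "ev q = gop (g j) (n j) v" using gop_onto[OF g] by metis
    have p: "is_path c (i, replicate (ff i j) (Ep i) @ [Al i j])" "psource (i, replicate (ff i j) (Ep i) @ [Al i j]) = j"
      "is_path c (i, Al i j # replicate (ff j i) (Ep j))" "psource (i, Al i j # replicate (ff j i) (Ep j)) = j"
      using a by (auto simp: is_path_append psource_append)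
    have "opw n y (replicate (ff i j) (Ep i)) (aop n y (Al i j) (ev q))
       = aop n y (Al i j) (opw n y (replicate (ff j i) (Ep j)) (ev q))"
      using op[OF v(1) p(1,2)] op[OF v(1) p(3,4)] EQc_D[OF PS_D(4)[OF x], of i j v] v a by simp
    then show "opw n y (replicate (ff i j) (Ep i)) (aop n y (Al i j) (ev q)) p
       = aop n y (Al i j) (opw n y (replicate (ff j i) (Ep j)) (ev q)) p" by simp
  qed
  moreover have "EQm y" unfolding EQm_def
  proof (intro allI impI)
    fix i p q assume q: "q < n i"
    then have "ev q \<in> V i" by (intro ev_VV) simp
    then obtain v where v: "v \<in> V i" "ev q = gop (g i) (n i) v" using gop_onto[OF g] by metis
    let ?o = "\<lambda>x j k u. opw n x (replicate k (Ep i)) (aop n x (Al i j) (aop n x (Al j i)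
          (opw n x (replicate (ff i j - 1 - k) (Ep i)) u)))"
    have o: "?o y j k (ev q) = gop (g i) (n i) (?o x j k v)" if k: "k < ff i j" for j k
    proof -
      have cij: "c i j < 0" using k by simp
      have "is_path c (i, replicate k (Ep i) @ [Al i j, Al j i] @ replicate (ff i j - 1 - k) (Ep i))"
        "psource (i, replicate k (Ep i) @ [Al i j, Al j i] @ replicate (ff i j - 1 - k) (Ep i)) = i"
        using cij c_sym[OF cij] by (auto simp: is_path_append psource_append)
      from op[OF v(1) this] show ?thesis by (simp add: v(2))
    qed
    have "(\<Sum>j\<in>UNIV. \<Sum>k<ff i j. cscale (osign Or i j) (?o y j k (ev q)))
      = (\<Sum>j\<in>UNIV. \<Sum>k<ff i j. cscale (osign Or i j) (gop (g i) (n i) (?o x j k v)))"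
      by (intro sum.cong refl arg_cong2[of _ _ _ _ cscale] o) simp
    also have "\<dots> = gop (g i) (n i) (\<Sum>j\<in>UNIV. \<Sum>k<ff i j. cscale (osign Or i j) (?o x j k v))"
      by (simp only: clin_sum[OF clin_gop] clin_scale[OF clin_gop])
    also have "\<dots> = 0" using EQm_D[OF PS_D(5)[OF x] v(1)] by (simp add: clin_0[OF clin_gop])
    finally have "(\<Sum>j\<in>UNIV. \<Sum>k<ff i j. cscale (osign Or i j) (?o y j k (ev q))) p = 0" by simp
    then show "(\<Sum>j\<in>UNIV. \<Sum>k<ff i j. osign Or i j * ?o y j k (ev q) p) = 0"
      unfolding sum_apply by (simp only: cscale_def)
  qed
  moreover have "EQa y" unfolding EQa_def
  proof (intro allI impI)
    fix r m q assume a: "r \<in> RS \<and> m < ll r \<and> q < n (ii r)"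
    then have "ev q \<in> V (ii r)" by (intro ev_VV) simp
    then obtain v where v: "v \<in> V (ii r)" "ev q = gop (g (ii r)) (n (ii r)) v" using gop_onto[OF g] by metis
    have l: "row y (ii r) (wpos r m) (aop n y (Ep (ii r)) (ev q)) = row x (ii r) (wpos r m) (aop n x (Ep (ii r)) v)"
      using acts_aop[OF g X y act, of v "Ep (ii r)"] acts_row[OF g act, of "aop n x (Ep (ii r)) v" "ii r" "wpos r m"]
        aop_V[OF X, of "Ep (ii r)"] wpos_less[of r m] a v by simp
    show "row y (ii r) (wpos r m) (aop n y (Ep (ii r)) (ev q)) = (case m of 0 \<Rightarrow> 0 | Suc m' \<Rightarrow> gs r m' * row y (ii r) (wpos r m') (ev q))"
    proof (cases m)
      case 0
      then show ?thesis using l EQa_D(1)[OF PS_D(2)[OF x] _ v(1)] a by simp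
    next
      case (Suc m')
      have "row y (ii r) (wpos r m') (ev q) = row x (ii r) (wpos r m') v"
        using acts_row[OF g act v(1), of "wpos r m'"] wpos_less[of r m'] a Suc v(2) by simp
      then show ?thesis using l EQa_D(2)[OF PS_D(2)[OF x] _ v(1), of m'] a Suc by simp
    qed
  qed
  moreover have "as0 y" unfolding as0_def
  proof (intro allI)
    fix i p m
    show "y (CAs i p m) = 0"
    proof (rule ccontr)
      assume nz: "y (CAs i p m) \<noteq> 0"
      then have pm: "p < n i" "m < wd i" using XX_CAs[OF y] by auto
      have "asM n wd x i = 0\<^sub>m (n i) (wd i)"
        using PS_D(6)[OF x] by (intro eq_matI) (auto simp: asM_def as0_def)
      then have "asM n wd y i = 0\<^sub>m (n i) (wd i)"
        using act right_mult_zero_mat[OF GG_D(1)[OF g], of i "wd i"] by (simp add: acts_to_def)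
      then have "asM n wd y i $$ (p, m) = 0" using pm by simp
      then show False using nz pm by (simp add: asM_def)
    qed
  qed
  ultimately show "y \<in> PS" unfolding PS_def using y sp stable_iff_sep[OF y] by blast
  show "HH y = HH x"
  proof
    show "HH x \<subseteq> HH y"
    proof
      fix f assume "f \<in> HH x"
      then obtain u where u: "f = (\<Sum>i\<in>UNIV. lamv x i (u i))" "\<And>i. u i \<in> V i" unfolding HH_def by blast
      have "f = (\<Sum>i\<in>UNIV. lamv y i (gop (g i) (n i) (u i)))"
        unfolding u(1) acts_lamv[OF g X y act u(2)] ..
      then show "f \<in> HH y" by (simp only: HH_I gop_VV)
    qed
    show "HH y \<subseteq> HH x"
    proof
      fix f assume "f \<in> HH y"
      then obtain u where u: "f = (\<Sum>i\<in>UNIV. lamv y i (u i))" "\<And>i. u i \<in> V i" unfolding HH_def by blast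
      have "\<exists>v. v \<in> V i \<and> u i = gop (g i) (n i) v" for i using gop_onto[OF g u(2)] by metis
      then obtain v where v: "\<And>i. v i \<in> V i" "\<And>i. u i = gop (g i) (n i) (v i)" by metis
      have "f = (\<Sum>i\<in>UNIV. lamv x i (v i))"
        unfolding u(1) v(2) acts_lamv[OF g X y act v(1)] ..
      then show "f \<in> HH x" using HH_I[of v x] v by simp
    qed
  qed
qed

text \<open>Both points have the same space of functions, so each \<open>lamv x i (ev q)\<close>
  comes from a vector for y; these vectors are the columns of M. By \<open>label_part\<close> they
  can be chosen inside the label of q, which will make M homogeneous of degree 0.\<close>

lemma transition:
  assumes x: "x \<in> PS" and y: "y \<in> PS" and H: "HH x = HH y"
  obtains M where "\<And>i. M i \<in> carrier_mat (n i) (n i)"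
    "\<And>i u. u \<in> V i \<Longrightarrow> lamv y i (gop (M i) (n i) u) = lamv x i u"
    "\<And>i p q. p < n i \<Longrightarrow> q < n i \<Longrightarrow> M i $$ (p, q) \<noteq> 0 \<Longrightarrow> jl i p = jl i q"
proof -
  have ex: "\<exists>u. u \<in> V i \<and> (\<forall>p. u p \<noteq> 0 \<longrightarrow> jl i p = jl i q) \<and> lamv x i (ev q) = lamv y i u" if q: "q < n i" for i q
  proof -
    have q': "vt (jl i q) = i" "rk i q < vj (jl i q)" "pos (jl i q) (rk i q) = q" using idx1[OF q] by auto
    have "lamv x i (ev q) \<in> HH y" using lamv_HH[OF ev_VV, of q i x] q H by simp
    then obtain u where "u \<in> V (vt (jl i q))" "\<And>p. u p \<noteq> 0 \<Longrightarrow> jl (vt (jl i q)) p = jl i q"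
      "lamv x i (ev q) = lamv y (vt (jl i q)) u"
    proof (rule label_part[OF y, of _ "jl i q"])
      fix r p assume "lamv x i (ev q) (r, p) \<noteq> 0"
      then show "fst p = vt (jl i q) \<and> (grd \<longrightarrow> pdeg c d p = kk r + int (ll r) * d (ii r) - dg (jl i q))"
        using label_lamv_support[OF PS_D(1)[OF x] q'(2)] q' by simp
    next
      fix u assume "u \<in> V (vt (jl i q))" "\<And>p. u p \<noteq> 0 \<Longrightarrow> jl (vt (jl i q)) p = jl i q"
        "lamv x i (ev q) = lamv y (vt (jl i q)) u"
      then show thesis by (rule that)
    qed
    then show ?thesis using q'(1) by (intro exI[of _ u]) simp
  qed
  define T where "T i q = (SOME u. u \<in> V i \<and> (\<forall>p. u p \<noteq> 0 \<longrightarrow> jl i p = jl i q) \<and> lamv x i (ev q) = lamv y i u)" for i q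
  have T: "T i q \<in> V i" "\<forall>p. T i q p \<noteq> 0 \<longrightarrow> jl i p = jl i q" "lamv x i (ev q) = lamv y i (T i q)" if "q < n i" for i q
    using someI_ex[OF ex[OF that]] unfolding T_def by blast+
  define M where "M i = mat (n i) (n i) (\<lambda>(p, q). T i q p)" for i
  show ?thesis
  proof (rule that[of M])
    show "M i \<in> carrier_mat (n i) (n i)" for i by (simp add: M_def)
    show "jl i p = jl i q" if "p < n i" "q < n i" "M i $$ (p, q) \<noteq> 0" for i p q
      using that T(2)[of q i] by (simp add: M_def)
    show "lamv y i (gop (M i) (n i) u) = lamv x i u" if u: "u \<in> V i" for i u
    proof (rule clin_ext[OF clin_comp[OF clin_lamv clin_gop] clin_lamv _ u])
      fix q assume q: "q < n i"
      have "gop (M i) (n i) (ev q) = T i q"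
        using T(1)[OF q] q by (auto simp: gop_ev M_def VV_def fun_eq_iff)
      then show "lamv y i (gop (M i) (n i) (ev q)) = lamv x i (ev q)" using T(3)[OF q] by simp
    qed
  qed
qed

lemma acts_toI:
  assumes x: "x \<in> XX" and y: "y \<in> XX" and M: "\<And>i. M i \<in> carrier_mat (n i) (n i)"
    and op: "\<And>a q p. arrow_ok c a \<Longrightarrow> q < n (asource a) \<Longrightarrow> p < n (atarget a) \<Longrightarrow>
      aop n y a (gop (M (asource a)) (n (asource a)) (ev q)) p = gop (M (atarget a)) (n (atarget a)) (aop n x a (ev q)) p"
    and r: "\<And>i m q. m < wd i \<Longrightarrow> q < n i \<Longrightarrow> row y i m (gop (M i) (n i) (ev q)) = x (CA i m q)"
    and as0: "as0 x" "as0 y"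
  shows "acts_to n wd M x y"
  unfolding acts_to_def
proof (intro conjI allI)
  fix i j
  show "alphaM n y i j * M j = M i * alphaM n x i j"
  proof (rule eq_matI)
    fix p q assume "p < dim_row (M i * alphaM n x i j)" "q < dim_col (M i * alphaM n x i j)"
    then have pq: "p < n i" "q < n j" using M[of i] by (auto simp: alphaM_def)
    show "(alphaM n y i j * M j) $$ (p, q) = (M i * alphaM n x i j) $$ (p, q)"
    proof (cases "c i j < 0")
      case True
      then show ?thesis unfolding alphaM_gop[OF M pq] gop_alphaM[OF M pq] using op[of "Al i j" q p] pq by simp
    next
      case False
      then have "xe x (Al i j) p q = 0" "xe y (Al i j) p q = 0" for p q
        using XX_supp(3)[OF x, of "Al i j" p q] XX_supp(3)[OF y, of "Al i j" p q] by auto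
      then have "aop n x (Al i j) u = 0" "aop n y (Al i j) u = 0" for u by (auto simp: aop_def fun_eq_iff)
      then show ?thesis unfolding alphaM_gop[OF M pq] gop_alphaM[OF M pq] by (simp add: clin_0[OF clin_gop])
    qed
  qed (use M[of i] M[of j] in \<open>auto simp: alphaM_def\<close>)
next
  fix i
  show "epsM n y i * M i = M i * epsM n x i"
  proof (rule eq_matI)
    fix p q assume "p < dim_row (M i * epsM n x i)" "q < dim_col (M i * epsM n x i)"
    then have pq: "p < n i" "q < n i" using M[of i] by (auto simp: epsM_def)
    show "(epsM n y i * M i) $$ (p, q) = (M i * epsM n x i) $$ (p, q)"
      unfolding epsM_gop[OF M pq] gop_epsM[OF M pq] using op[of "Ep i" q p] pq by simp
  qed (use M[of i] in \<open>auto simp: epsM_def\<close>)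
  show "aM n wd y i * M i = aM n wd x i"
  proof (rule eq_matI)
    fix m q assume "m < dim_row (aM n wd x i)" "q < dim_col (aM n wd x i)"
    then have mq: "m < wd i" "q < n i" by (auto simp: aM_def)
    then show "(aM n wd y i * M i) $$ (m, q) = aM n wd x i $$ (m, q)"
      unfolding aM_gop[OF M mq] r[OF mq] by (simp add: aM_def)
  qed (use M[of i] in \<open>auto simp: aM_def\<close>)
  have 0: "asM n wd z i = 0\<^sub>m (n i) (wd i)" if "as0 z" for z
    using that by (intro eq_matI) (auto simp: asM_def as0_def)
  show "asM n wd y i = M i * asM n wd x i" using 0[OF as0(1)] 0[OF as0(2)] right_mult_zero_mat[OF M] by simp
qed

text \<open>Since \<open>lamv y\<close> is injective and compatible with arrows, a base change that
  matches the functions intertwines the arrows by itself. The base changes in the two directions are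
  mutually inverse for the same reason. Rows of a are matched through \<open>Gc_row\<close>.\<close>

lemma transition_acts:
  assumes x: "x \<in> PS" and y: "y \<in> PS" and H: "HH x = HH y"
  shows "\<exists>g\<in>GG. acts_to n wd g x y"
proof -
  note X = PS_D(1)[OF x] and Y = PS_D(1)[OF y]
  obtain M where M: "\<And>i. M i \<in> carrier_mat (n i) (n i)" and Ml: "\<And>i u. u \<in> V i \<Longrightarrow> lamv y i (gop (M i) (n i) u) = lamv x i u"
    and Mj: "\<And>i p q. p < n i \<Longrightarrow> q < n i \<Longrightarrow> M i $$ (p, q) \<noteq> 0 \<Longrightarrow> jl i p = jl i q"
    by (rule transition[OF x y H]) blast
  obtain B where B: "\<And>i. B i \<in> carrier_mat (n i) (n i)" and BL: "\<And>i u. u \<in> V i \<Longrightarrow> lamv x i (gop (B i) (n i) u) = lamv y i u"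
    by (rule transition[OF y x H[symmetric]]) blast
  have inv: "invertible_mat (M i)" for i
  proof -
    have BM: "B i * M i = 1\<^sub>m (n i)"
    proof (rule eq_matI)
      fix p q assume "p < dim_row (1\<^sub>m (n i) :: complex mat)" "q < dim_col (1\<^sub>m (n i) :: complex mat)"
      then have pq: "p < n i" "q < n i" by simp_all
      have "gop (B i) (n i) (gop (M i) (n i) (ev q)) = ev q"
      proof (rule lamv_inj[OF PS_D(1-3)[OF x] gop_VV])
        show "ev q \<in> V i" using pq by (intro ev_VV)
        then show "lamv x i (gop (B i) (n i) (gop (M i) (n i) (ev q))) = lamv x i (ev q)"
          by (simp only: BL[OF gop_VV] Ml)
      qed
      then have "gop (B i * M i) (n i) (ev q) p = ev q p" by (simp only: gop_mult[OF B M])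
      then show "(B i * M i) $$ (p, q) = 1\<^sub>m (n i) $$ (p, q)" using pq unfolding gop_ev[OF pq(2)] by (simp add: ev_def)
    qed (use B[of i] M[of i] in auto)
    then have "M i * B i = 1\<^sub>m (n i)" using mat_mult_left_right_inverse[OF B M] by blast
    then show ?thesis using BM B[of i] M[of i] unfolding invertible_mat_def inverts_mat_def by auto
  qed
  have G: "M \<in> GG" unfolding GG_def
    using M inv Mj dg_jl by (auto; metis)
  have op: "aop n y a (gop (M (asource a)) (n (asource a)) u) = gop (M (atarget a)) (n (atarget a)) (aop n x a u)"
    if a: "arrow_ok c a" and u: "u \<in> V (asource a)" for a u
  proof (rule lamv_inj[OF PS_D(1-3)[OF y] aop_V[OF Y] gop_VV])
    have "lamv y (atarget a) (aop n y a (gop (M (asource a)) (n (asource a)) u))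
      = opa a (lamv y (asource a) (gop (M (asource a)) (n (asource a)) u))" by (simp add: opa_lamv[OF Y a])
    also have "\<dots> = lamv x (atarget a) (aop n x a u)" by (simp add: Ml[OF u] opa_lamv[OF X a])
    also have "\<dots> = lamv y (atarget a) (gop (M (atarget a)) (n (atarget a)) (aop n x a u))"
      by (simp add: Ml[OF aop_V[OF X]])
    finally show "lamv y (atarget a) (aop n y a (gop (M (asource a)) (n (asource a)) u)) =
      lamv y (atarget a) (gop (M (atarget a)) (n (atarget a)) (aop n x a u))" .
  qed
  have "acts_to n wd M x y"
  proof (rule acts_toI[OF X Y M])
    fix a q p assume "arrow_ok c a" "q < n (asource a)" "p < n (atarget a)"
    then show "aop n y a (gop (M (asource a)) (n (asource a)) (ev q)) p
      = gop (M (atarget a)) (n (atarget a)) (aop n x a (ev q)) p"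
      using op[of a "ev q"] by (simp add: ev_VV)
  next
    fix i m q assume mq: "m < wd i" "q < n i"
    obtain r m' where r: "r \<in> RS" "ii r = i" "m' < ll r" "m = wpos r m'" using wpos_surj[OF mq(1)] by blast
    have e: "ev q \<in> V (ii r)" using mq r by (intro ev_VV) simp
    have "Gc r m' * row y (ii r) (wpos r m') (gop (M i) (n i) (ev q)) = Gc r m' * row x (ii r) (wpos r m') (ev q)"
      using Gc_row[OF PS_D(1,2)[OF x] r(1,3) e] Gc_row[OF PS_D(1,2)[OF y] r(1,3), of "gop (M i) (n i) (ev q)"]
        Ml[OF e] gop_VV[of "M i" n i "ev q"] r(2) by (simp, metis)
    then have "row y i m (gop (M i) (n i) (ev q)) = row x i m (ev q)" using Gc_nz[OF r(1), of m'] r(2,4) by simp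
    then show "row y i m (gop (M i) (n i) (ev q)) = x (CA i m q)" using mq by (simp add: row_ev)
  qed (use PS_D(6) x y in auto)
  then show ?thesis using G by blast
qed

abbreviation "orb \<equiv> orbit_of n wd XX GG"

lemma orb_PS:
  assumes x: "x \<in> PS" shows "orb x = {y \<in> PS. HH y = HH x}"
proof (intro Set.set_eqI iffI)
  fix y assume "y \<in> orb x"
  then obtain g where "y \<in> XX" "g \<in> GG" "acts_to n wd g x y" unfolding orbit_of_def by auto
  then show "y \<in> {y \<in> PS. HH y = HH x}" using PS_invariant[OF _ x, of g y] by simp
next
  fix y assume "y \<in> {y \<in> PS. HH y = HH x}"
  then have y: "y \<in> PS" "HH x = HH y" by simp_all
  show "y \<in> orb x" using transition_acts[OF x y] PS_D(1)[OF y(1)] unfolding orbit_of_def by simp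
qed

lemma one_GG: "(\<lambda>i. 1\<^sub>m (n i)) \<in> GG"
proof -
  have "invertible_mat (1\<^sub>m k :: complex mat)" for k
    unfolding invertible_mat_def inverts_mat_def by (intro conjI exI[of _ "1\<^sub>m k"]) simp_all
  then show ?thesis unfolding GG_def by (auto split: if_splits)
qed

lemma orb_self: "x \<in> XX \<Longrightarrow> x \<in> orb x"
proof -
  assume x: "x \<in> XX"
  have "acts_to n wd (\<lambda>i. 1\<^sub>m (n i)) x x"
    unfolding acts_to_def
  proof (intro conjI allI)
    fix i j
    have c: "alphaM n x i j \<in> carrier_mat (n i) (n j)" "epsM n x i \<in> carrier_mat (n i) (n i)"
      "aM n wd x i \<in> carrier_mat (wd i) (n i)" "asM n wd x i \<in> carrier_mat (n i) (wd i)"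
      by (simp_all add: alphaM_def epsM_def aM_def asM_def)
    show "alphaM n x i j * 1\<^sub>m (n j) = 1\<^sub>m (n i) * alphaM n x i j"
      unfolding left_mult_one_mat[OF c(1)] right_mult_one_mat[OF c(1)] ..
    show "aM n wd x i * 1\<^sub>m (n i) = aM n wd x i" by (rule right_mult_one_mat[OF c(3)])
    show "asM n wd x i = 1\<^sub>m (n i) * asM n wd x i" by (rule left_mult_one_mat[OF c(4), symmetric])
    show "epsM n x i * 1\<^sub>m (n i) = 1\<^sub>m (n i) * epsM n x i"
      unfolding left_mult_one_mat[OF c(2)] right_mult_one_mat[OF c(2)] ..
  qed
  then show ?thesis unfolding orbit_of_def using one_GG x by blast
qed

end

section \<open>Critical points\<close>

lemma xe_line: "xe (\<lambda>z. x z + t * y z) a p q = xe x a p q + t * xe y a p q"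
  by (cases a) (simp_all add: xe_def)

text \<open>Leibniz rule along the word: each summand replaces one letter by the direction
  y.\<close>

lemma opw_has_derivative:
  "((\<lambda>t. opw n (\<lambda>z. x z + t * y z) w u p) has_field_derivative
     (\<Sum>k<length w. opw n x (take k w) (aop n y (w ! k) (opw n x (drop (Suc k) w) u)) p)) (at 0)"
proof (induction w arbitrary: p)
  case (Cons a w)
  let ?D = "\<lambda>q. \<Sum>k<length w. opw n x (take k w) (aop n y (w ! k) (opw n x (drop (Suc k) w) u)) q"
  have "((\<lambda>t. (xe x a p q + t * xe y a p q) * opw n (\<lambda>z. x z + t * y z) w u q) has_field_derivative
      (xe y a p q * opw n x w u q + xe x a p q * ?D q)) (at 0)" for q
    by (rule derivative_eq_intros Cons.IH refl)+ simp
  then have "((\<lambda>t. \<Sum>q<n (asource a). (xe x a p q + t * xe y a p q) * opw n (\<lambda>z. x z + t * y z) w u q)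
      has_field_derivative (\<Sum>q<n (asource a). xe y a p q * opw n x w u q + xe x a p q * ?D q)) (at 0)"
    by (intro DERIV_sum)
  moreover have "(\<Sum>q<n (asource a). xe y a p q * opw n x w u q + xe x a p q * ?D q)
    = (\<Sum>k<length (a # w). opw n x (take k (a # w)) (aop n y ((a # w) ! k) (opw n x (drop (Suc k) (a # w)) u)) p)"
  proof -
    have "(\<Sum>q<n (asource a). xe x a p q * ?D q)
      = (\<Sum>k<length w. aop n x a (opw n x (take k w) (aop n y (w ! k) (opw n x (drop (Suc k) w) u))) p)"
      unfolding aop_def[of n x a] sum_distrib_left by (rule sum.swap)
    then show ?thesis by (simp add: sum.distrib sum.lessThan_Suc_shift aop_def[of n y a] del: sum.lessThan_Suc)
  qed
  ultimately show ?case by (simp add: aop_def[of n _ a] xe_line del: sum.lessThan_Suc)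
qed simp

context setting
begin

lemma XX_line: "x \<in> XX \<Longrightarrow> y \<in> XX \<Longrightarrow> (\<lambda>z. x z + t * y z) \<in> XX"
  unfolding XX_def by (auto, metis add.right_neutral mult_zero_right, metis add.right_neutral mult_zero_right)

text \<open>The letter is appended on the right, as in the recursion for matrix powers.\<close>

lemma mat_snoc:
  assumes x: "x \<in> XX" and A: "A \<in> carrier_mat k (n (atarget a))"
    and Ae: "\<And>p m. p < k \<Longrightarrow> m < n (atarget a) \<Longrightarrow> A $$ (p, m) = opw n x w (ev m) p"
    and B: "B = mat (n (atarget a)) (n (asource a)) (\<lambda>(p, q). xe x a p q)"
    and pq: "p < k" "q < n (asource a)"
  shows "(A * B) $$ (p, q) = opw n x (w @ [a]) (ev q) p"
proof -
  have "aop n x a (ev q) = (\<Sum>m<n (atarget a). cscale (xe x a m q) (ev m))"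
    using VV_expand[OF aop_V[OF x], of a "ev q"] aop_ev[OF pq(2), of x] by simp
  then have "opw n x (w @ [a]) (ev q) = (\<Sum>m<n (atarget a). cscale (xe x a m q) (opw n x w (ev m)))"
    by (simp add: clin_sum[OF clin_opw] clin_scale[OF clin_opw])
  then have "opw n x (w @ [a]) (ev q) p = (\<Sum>m<n (atarget a). xe x a m q * opw n x w (ev m) p)"
    by (simp only: sum_cscale)
  also have "\<dots> = (A * B) $$ (p, q)"
    using A pq Ae by (auto simp: B scalar_prod_def atLeast0LessThan intro!: sum.cong)
  finally show ?thesis ..
qed

lemma epsM_pow:
  assumes x: "x \<in> XX"
  shows "epsM n x i ^\<^sub>m k \<in> carrier_mat (n i) (n i) \<and>
    (\<forall>p<n i. \<forall>q<n i. (epsM n x i ^\<^sub>m k) $$ (p, q) = opw n x (replicate k (Ep i)) (ev q) p)"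
proof (induction k)
  case 0
  then show ?case by (auto simp: epsM_def ev_def)
next
  case (Suc k)
  have B: "epsM n x i = mat (n (atarget (Ep i))) (n (asource (Ep i))) (\<lambda>(p, q). xe x (Ep i) p q)"
    by (simp add: epsM_def xe_def)
  have "(epsM n x i ^\<^sub>m k * epsM n x i) $$ (p, q) = opw n x (replicate k (Ep i) @ [Ep i]) (ev q) p"
    if "p < n i" "q < n i" for p q
    by (rule mat_snoc[OF x _ _ B, of _ "n i"]) (use Suc that in auto)
  moreover have "replicate k (Ep i) @ [Ep i] = replicate (Suc k) (Ep i)" by (simp add: replicate_append_same)
  ultimately show ?case using Suc by (auto simp: epsM_def simp del: replicate.simps opw_simps)
qed

lemma mtrace_word:
  assumes x: "x \<in> XX"
  shows "mtrace (epsM n x i ^\<^sub>m k * alphaM n x i j * alphaM n x j i)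
    = (\<Sum>p<n i. opw n x (replicate k (Ep i) @ [Al i j, Al j i]) (ev p) p)"
proof -
  have B: "alphaM n x i j = mat (n (atarget (Al i j))) (n (asource (Al i j))) (\<lambda>(p, q). xe x (Al i j) p q)" for i j
    by (simp add: alphaM_def xe_def)
  have 1: "(epsM n x i ^\<^sub>m k * alphaM n x i j) $$ (p, q) = opw n x (replicate k (Ep i) @ [Al i j]) (ev q) p"
    if "p < n i" "q < n j" for p q
    by (rule mat_snoc[OF x _ _ B, of _ "n i"]) (use epsM_pow[OF x, of i k] that in auto)
  have c: "epsM n x i ^\<^sub>m k * alphaM n x i j \<in> carrier_mat (n i) (n j)"
    using epsM_pow[OF x, of i k] by (auto simp: alphaM_def)
  have "(epsM n x i ^\<^sub>m k * alphaM n x i j * alphaM n x j i) $$ (p, q)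
     = opw n x ((replicate k (Ep i) @ [Al i j]) @ [Al j i]) (ev q) p"
    if "p < n i" "q < n i" for p q
    by (rule mat_snoc[OF x _ _ B, of _ "n i"]) (use c 1 that in auto)
  then show ?thesis using c unfolding mtrace_def by (intro sum.cong) auto
qed

lemma mtrace_framing:
  "mtrace (epsM n x i * asM n wd x i * aM n wd x i)
    = (\<Sum>p<n i. \<Sum>m<wd i. (\<Sum>q<n i. x (CEps i p q) * x (CAs i q m)) * x (CA i m p))"
  "mtrace (gamma_sum s ii \<gamma> i * aM n wd x i * asM n wd x i)
    = (\<Sum>m<wd i. \<Sum>p<n i. (\<Sum>m'<wd i. gamma_sum s ii \<gamma> i $$ (m, m') * x (CA i m' p)) * x (CAs i p m))"
  using gamma_sum_carrier[of i]
  by (auto simp: mtrace_def epsM_def asM_def aM_def scalar_prod_def atLeast0LessThan intro!: sum.cong)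

text \<open>The trace of the component of y at a, composed with the map in the opposite direction
  whose (q, p) entry is g p q; thus g plays the role of a gradient along a.\<close>

definition Tr :: "'i arrow \<Rightarrow> 'i rep \<Rightarrow> (nat \<Rightarrow> nat \<Rightarrow> complex) \<Rightarrow> complex" where
  "Tr a y g = (\<Sum>p<n (atarget a). \<Sum>q<n (asource a). xe y a p q * g p q)"

lemma Tr_linear:
  "Tr a y (\<lambda>p q. g p q + h p q) = Tr a y g + Tr a y h"
  "Tr a y (\<lambda>p q. k * g p q) = k * Tr a y g"
  "Tr a y (\<lambda>p q. \<Sum>i\<in>A. f i p q) = (\<Sum>i\<in>A. Tr a y (f i))"
proof -
  show "Tr a y (\<lambda>p q. g p q + h p q) = Tr a y g + Tr a y h"
    by (simp add: Tr_def distrib_left sum.distrib)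
  show "Tr a y (\<lambda>p q. k * g p q) = k * Tr a y g"
    by (simp add: Tr_def sum_distrib_left mult.left_commute)
  have "Tr a y (\<lambda>p q. \<Sum>i\<in>A. f i p q) = (\<Sum>p<n (atarget a). \<Sum>i\<in>A. \<Sum>q<n (asource a). xe y a p q * f i p q)"
    unfolding Tr_def sum_distrib_left by (intro sum.cong refl sum.swap)
  also have "\<dots> = (\<Sum>i\<in>A. Tr a y (f i))" unfolding Tr_def by (rule sum.swap)
  finally show "Tr a y (\<lambda>p q. \<Sum>i\<in>A. f i p q) = (\<Sum>i\<in>A. Tr a y (f i))" .
qed

text \<open>Cyclicity of the trace brings the varied letter to the front, so that the rest of the
  word becomes the gradient.\<close>

lemma trace_cyclic:
  assumes x: "x \<in> XX" and y: "y \<in> XX" and w: "is_path c (i, w1 @ a # w2)" "psource (i, w1 @ a # w2) = i"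
  shows "(\<Sum>p<n i. opw n x w1 (aop n y a (opw n x w2 (ev p))) p) = Tr a y (\<lambda>p q. opw n x (w2 @ w1) (ev p) q)"
proof -
  have w1: "is_path c (i, w1)" "psource (i, w1) = atarget a"
    and w2: "is_path c (asource a, w2)" "psource (asource a, w2) = i"
    using w by (auto simp: is_path_append psource_append is_path_Cons simp del: is_path.simps(2))
  have 1: "opw n x w1 (aop n y a u) p
    = (\<Sum>p0<n (atarget a). \<Sum>q0<n (asource a). xe y a p0 q0 * (opw n x w1 (ev p0) p * u q0))" for u p
  proof -
    have "opw n x w1 (aop n y a u) = opw n x w1 (\<Sum>p0<n (atarget a). cscale (aop n y a u p0) (ev p0))"
      using VV_expand[OF aop_V[OF y]] by (rule arg_cong)
    also have "\<dots> = (\<Sum>p0<n (atarget a). cscale (aop n y a u p0) (opw n x w1 (ev p0)))"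
      by (simp only: clin_sum[OF clin_opw] clin_scale[OF clin_opw])
    finally have "opw n x w1 (aop n y a u) p = (\<Sum>p0<n (atarget a). aop n y a u p0 * opw n x w1 (ev p0) p)"
      by (simp only: sum_cscale)
    then show ?thesis unfolding aop_def sum_distrib_right by (simp add: mult_ac)
  qed
  have 2: "opw n x (w2 @ w1) (ev p0) q0 = (\<Sum>p<n i. opw n x w1 (ev p0) p * opw n x w2 (ev p) q0)"
    if "p0 < n (atarget a)" for p0 q0
  proof -
    have "opw n x w1 (ev p0) \<in> V i" using that by (intro opw_V[OF x w1] ev_VV)
    then have "opw n x w2 (opw n x w1 (ev p0)) = opw n x w2 (\<Sum>p<n i. cscale (opw n x w1 (ev p0) p) (ev p))"
      using VV_expand by (intro arg_cong[of _ _ "opw n x w2"])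
    also have "\<dots> = (\<Sum>p<n i. cscale (opw n x w1 (ev p0) p) (opw n x w2 (ev p)))"
      by (simp only: clin_sum[OF clin_opw] clin_scale[OF clin_opw])
    finally show ?thesis by (simp only: opw_simps sum_cscale)
  qed
  have "Tr a y (\<lambda>p q. opw n x (w2 @ w1) (ev p) q)
    = (\<Sum>p0<n (atarget a). \<Sum>q0<n (asource a). \<Sum>p<n i. xe y a p0 q0 * (opw n x w1 (ev p0) p * opw n x w2 (ev p) q0))"
    unfolding Tr_def by (intro sum.cong refl) (simp only: 2 lessThan_iff sum_distrib_left)
  also have "\<dots> = (\<Sum>p0<n (atarget a). \<Sum>p<n i. \<Sum>q0<n (asource a). xe y a p0 q0 * (opw n x w1 (ev p0) p * opw n x w2 (ev p) q0))"
    by (intro sum.cong refl sum.swap)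
  also have "\<dots> = (\<Sum>p<n i. \<Sum>p0<n (atarget a). \<Sum>q0<n (asource a). xe y a p0 q0 * (opw n x w1 (ev p0) p * opw n x w2 (ev p) q0))"
    by (rule sum.swap)
  finally show ?thesis unfolding 1 ..
qed

text \<open>The gradient of the trace of \<epsilon>^f \<alpha>_ij \<alpha>_ji with respect to
  \<epsilon>_i, one term for each loop; its signed sum over j is the left side of the mesh
  relation.\<close>

definition Qg :: "'i rep \<Rightarrow> 'i \<Rightarrow> 'i \<Rightarrow> nat \<Rightarrow> nat \<Rightarrow> complex" where
  "Qg x i j p q = (\<Sum>k<ff i j. opw n x (replicate (ff i j - 1 - k) (Ep i) @ [Al i j, Al j i] @ replicate k (Ep i)) (ev p) q)"

lemma word_derivative:
  assumes x: "x \<in> XX" and y: "y \<in> XX" and ij: "c i j < 0"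
  shows "((\<lambda>t. \<Sum>p<n i. opw n (\<lambda>z. x z + t * y z) (replicate (ff i j) (Ep i) @ [Al i j, Al j i]) (ev p) p)
    has_field_derivative (Tr (Ep i) y (Qg x i j)
      + Tr (Al i j) y (\<lambda>p q. opw n x (Al j i # replicate (ff i j) (Ep i)) (ev p) q)
      + Tr (Al j i) y (\<lambda>p q. opw n x (replicate (ff i j) (Ep i) @ [Al i j]) (ev p) q))) (at 0)"
proof -
  let ?f = "ff i j" and ?E = "\<lambda>k. replicate k (Ep i)"
  let ?w = "?E ?f @ [Al i j, Al j i]"
  have w: "is_path c (i, ?w)" "psource (i, ?w) = i"
    using ij c_sym[OF ij] by (auto simp: is_path_append psource_append)
  have T: "(\<Sum>p<n i. opw n x (take k ?w) (aop n y (?w ! k) (opw n x (drop (Suc k) ?w) (ev p))) p)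
     = Tr (?w ! k) y (\<lambda>p q. opw n x (drop (Suc k) ?w @ take k ?w) (ev p) q)" if "k < length ?w" for k
    using w by (intro trace_cyclic[OF x y]) (simp_all only: id_take_nth_drop[OF that, symmetric])
  have "((\<lambda>t. \<Sum>p<n i. opw n (\<lambda>z. x z + t * y z) ?w (ev p) p) has_field_derivative
     (\<Sum>p<n i. \<Sum>k<length ?w. opw n x (take k ?w) (aop n y (?w ! k) (opw n x (drop (Suc k) ?w) (ev p))) p)) (at 0)"
    by (intro DERIV_sum opw_has_derivative)
  also have "(\<Sum>p<n i. \<Sum>k<length ?w. opw n x (take k ?w) (aop n y (?w ! k) (opw n x (drop (Suc k) ?w) (ev p))) p)
    = (\<Sum>k<length ?w. Tr (?w ! k) y (\<lambda>p q. opw n x (drop (Suc k) ?w @ take k ?w) (ev p) q))"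
    by (subst sum.swap) (intro sum.cong refl T, simp)
  also have "\<dots> = (\<Sum>k<?f. Tr (?w ! k) y (\<lambda>p q. opw n x (drop (Suc k) ?w @ take k ?w) (ev p) q))
      + Tr (Al i j) y (\<lambda>p q. opw n x (Al j i # ?E ?f) (ev p) q)
      + Tr (Al j i) y (\<lambda>p q. opw n x (?E ?f @ [Al i j]) (ev p) q)"
  proof -
    have l: "length ?w = Suc (Suc ?f)" by simp
    have "?w ! ?f = Al i j" "drop (Suc ?f) ?w @ take ?f ?w = Al j i # ?E ?f"
      "?w ! Suc ?f = Al j i" "drop (Suc (Suc ?f)) ?w @ take (Suc ?f) ?w = ?E ?f @ [Al i j]"
      by (simp_all add: nth_append Suc_diff_le del: int_nat_eq replicate.simps)
    then show ?thesis unfolding l sum.lessThan_Suc by (simp only:)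
  qed
  also have "(\<Sum>k<?f. Tr (?w ! k) y (\<lambda>p q. opw n x (drop (Suc k) ?w @ take k ?w) (ev p) q)) = Tr (Ep i) y (Qg x i j)"
    unfolding Qg_def Tr_linear(3)
  proof (intro sum.cong refl)
    fix k assume "k \<in> {..<?f}"
    then have k: "k < ?f" by simp
    have m: "min k ?f = k" "k - ?f = 0" "Suc k - ?f = 0" "?f - Suc k = ?f - 1 - k" using k by linarith+
    have "drop (Suc k) ?w @ take k ?w = ?E (?f - 1 - k) @ [Al i j, Al j i] @ ?E k"
      unfolding drop_append take_append length_replicate drop_replicate take_replicate m by simp
    moreover have "?w ! k = Ep i" unfolding nth_append length_replicate using k List.nth_replicate[OF k, of "Ep i"] by (simp only: if_True)
    ultimately have "drop (Suc k) ?w @ take k ?w = ?E (?f - 1 - k) @ [Al i j, Al j i] @ ?E k" "?w ! k = Ep i" .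
    then show "Tr (?w ! k) y (\<lambda>p q. opw n x (drop (Suc k) ?w @ take k ?w) (ev p) q)
      = Tr (Ep i) y (\<lambda>p q. opw n x (?E (?f - 1 - k) @ [Al i j, Al j i] @ ?E k) (ev p) q)"
      by (simp only:)
  qed
  finally show ?thesis .
qed

text \<open>The variable \<alpha>_ij occurs in the terms of (i, j) and of (j, i) of the potential,
  whose signs are opposite. The difference of the two contributions is the commutation relation for
  (j, i).\<close>

definition Pg :: "'i rep \<Rightarrow> 'i \<Rightarrow> 'i \<Rightarrow> nat \<Rightarrow> nat \<Rightarrow> complex" where
  "Pg x i j p q = opw n x (Al j i # replicate (ff i j) (Ep i)) (ev p) q
     - opw n x (replicate (ff j i) (Ep j) @ [Al j i]) (ev p) q"

definition Sg :: "'i rep \<Rightarrow> 'i \<Rightarrow> nat \<Rightarrow> nat \<Rightarrow> complex" where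
  "Sg x i q m = row x i m (aop n x (Ep i) (ev q)) - (\<Sum>m'<wd i. gamma_sum s ii \<gamma> i $$ (m, m') * x (CA i m' q))"

text \<open>The differential of the potential at a point with \<open>a\<^sup>* = 0\<close>. The
  derivatives along a and the framing part of the derivative along \<epsilon> contain a factor
  \<open>a\<^sup>*\<close>, so only these three families remain.\<close>

definition LF :: "'i rep \<Rightarrow> 'i rep \<Rightarrow> complex" where
  "LF x y = (\<Sum>i\<in>UNIV. Tr (Ep i) y (\<lambda>p q. \<Sum>j\<in>UNIV. osign Or i j * Qg x i j p q))
     + (\<Sum>i\<in>UNIV. \<Sum>j\<in>UNIV. Tr (Al i j) y (\<lambda>p q. osign Or i j * Pg x i j p q))
     + (\<Sum>i\<in>UNIV. \<Sum>q<n i. \<Sum>m<wd i. y (CAs i q m) * Sg x i q m)"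

lemma osign_0: "\<not> c i j < 0 \<Longrightarrow> osign Or i j = 0"
proof -
  assume n: "\<not> c i j < 0"
  have 1: "(a, b) \<in> Or \<Longrightarrow> c a b < 0" for a b using ori unfolding orientation_def by blast
  have "(i, j) \<notin> Or" "(j, i) \<notin> Or" using 1[of i j] 1[of j i] c_sym[of j i] n by blast+
  then show ?thesis by (simp add: osign_def)
qed

lemma potential_derivative:
  assumes x: "x \<in> XX" and y: "y \<in> XX" and as0: "as0 x"
  shows "((\<lambda>t. potential c Or (gamma_sum s ii \<gamma>) n wd (\<lambda>z. x z + t * y z)) has_field_derivative LF x y) (at 0)"
proof -
  let ?x = "\<lambda>t z. x z + t * y z"
  let ?A = "\<lambda>i j. Tr (Al i j) y (\<lambda>p q. opw n x (Al j i # replicate (ff i j) (Ep i)) (ev p) q)"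
  let ?B = "\<lambda>i j. Tr (Al j i) y (\<lambda>p q. opw n x (replicate (ff i j) (Ep i) @ [Al i j]) (ev p) q)"
  have a0: "x (CAs i p m) = 0" for i p m using as0 by (simp add: as0_def)
  have 1: "((\<lambda>t. \<Sum>i\<in>UNIV. \<Sum>j\<in>UNIV. osign Or i j * (\<Sum>p<n i. opw n (?x t) (replicate (ff i j) (Ep i) @ [Al i j, Al j i]) (ev p) p))
     has_field_derivative (\<Sum>i\<in>UNIV. \<Sum>j\<in>UNIV. osign Or i j * (Tr (Ep i) y (Qg x i j) + ?A i j + ?B i j))) (at 0)"
  proof (intro DERIV_sum)
    fix i j
    show "((\<lambda>t. osign Or i j * (\<Sum>p<n i. opw n (?x t) (replicate (ff i j) (Ep i) @ [Al i j, Al j i]) (ev p) p))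
      has_field_derivative osign Or i j * (Tr (Ep i) y (Qg x i j) + ?A i j + ?B i j)) (at 0)"
    proof (cases "c i j < 0")
      case True
      then show ?thesis by (intro DERIV_cmult word_derivative[OF x y])
    qed (simp add: osign_0)
  qed
  have 2: "((\<lambda>t. \<Sum>i\<in>UNIV. \<Sum>p<n i. \<Sum>m<wd i. (\<Sum>q<n i. ?x t (CEps i p q) * ?x t (CAs i q m)) * ?x t (CA i m p))
     has_field_derivative (\<Sum>i\<in>UNIV. \<Sum>p<n i. \<Sum>m<wd i. (\<Sum>q<n i. x (CEps i p q) * y (CAs i q m)) * x (CA i m p))) (at 0)"
  proof (intro DERIV_sum)
    fix i p m
    have "((\<lambda>t. \<Sum>q<n i. ?x t (CEps i p q) * ?x t (CAs i q m)) has_field_derivative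
       (\<Sum>q<n i. x (CEps i p q) * y (CAs i q m))) (at 0)"
      by (intro DERIV_sum) (auto intro!: derivative_eq_intros simp: a0)
    from DERIV_mult[OF this, of "\<lambda>t. ?x t (CA i m p)" "y (CA i m p)"]
    show "((\<lambda>t. (\<Sum>q<n i. ?x t (CEps i p q) * ?x t (CAs i q m)) * ?x t (CA i m p))
       has_field_derivative (\<Sum>q<n i. x (CEps i p q) * y (CAs i q m)) * x (CA i m p)) (at 0)"
      by (auto intro!: derivative_eq_intros simp: a0 mult.commute)
  qed
  have 3: "((\<lambda>t. \<Sum>i\<in>UNIV. \<Sum>m<wd i. \<Sum>p<n i. (\<Sum>m'<wd i. gamma_sum s ii \<gamma> i $$ (m, m') * ?x t (CA i m' p)) * ?x t (CAs i p m))
     has_field_derivative (\<Sum>i\<in>UNIV. \<Sum>m<wd i. \<Sum>p<n i. (\<Sum>m'<wd i. gamma_sum s ii \<gamma> i $$ (m, m') * x (CA i m' p)) * y (CAs i p m))) (at 0)"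
  proof (intro DERIV_sum)
    fix i m p
    have "((\<lambda>t. \<Sum>m'<wd i. gamma_sum s ii \<gamma> i $$ (m, m') * ?x t (CA i m' p)) has_field_derivative
       (\<Sum>m'<wd i. gamma_sum s ii \<gamma> i $$ (m, m') * y (CA i m' p))) (at 0)"
      by (intro DERIV_sum) (auto intro!: derivative_eq_intros)
    from DERIV_mult[OF this, of "\<lambda>t. ?x t (CAs i p m)" "y (CAs i p m)"]
    show "((\<lambda>t. (\<Sum>m'<wd i. gamma_sum s ii \<gamma> i $$ (m, m') * ?x t (CA i m' p)) * ?x t (CAs i p m))
       has_field_derivative (\<Sum>m'<wd i. gamma_sum s ii \<gamma> i $$ (m, m') * x (CA i m' p)) * y (CAs i p m)) (at 0)"
      by (auto intro!: derivative_eq_intros simp: a0)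
  qed
  have "((\<lambda>t. potential c Or (gamma_sum s ii \<gamma>) n wd (?x t)) has_field_derivative
      (\<Sum>i\<in>UNIV. \<Sum>j\<in>UNIV. osign Or i j * (Tr (Ep i) y (Qg x i j) + ?A i j + ?B i j))
      + (\<Sum>i\<in>UNIV. \<Sum>p<n i. \<Sum>m<wd i. (\<Sum>q<n i. x (CEps i p q) * y (CAs i q m)) * x (CA i m p))
      - (\<Sum>i\<in>UNIV. \<Sum>m<wd i. \<Sum>p<n i. (\<Sum>m'<wd i. gamma_sum s ii \<gamma> i $$ (m, m') * x (CA i m' p)) * y (CAs i p m))) (at 0)"
    unfolding potential_def mtrace_word[OF XX_line[OF x y]] mtrace_framing
    by (rule DERIV_diff[OF DERIV_add[OF 1 2] 3])
  also have "(\<Sum>i\<in>UNIV. \<Sum>j\<in>UNIV. osign Or i j * (Tr (Ep i) y (Qg x i j) + ?A i j + ?B i j))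
      = (\<Sum>i\<in>UNIV. Tr (Ep i) y (\<lambda>p q. \<Sum>j\<in>UNIV. osign Or i j * Qg x i j p q))
       + (\<Sum>i\<in>UNIV. \<Sum>j\<in>UNIV. Tr (Al i j) y (\<lambda>p q. osign Or i j * Pg x i j p q))"
  proof -
    \<comment> \<open>Renaming the indices moves this contribution from the direction \<alpha>_ji to
      \<alpha>_ij and reverses its sign.\<close>
    have "(\<Sum>i\<in>UNIV. \<Sum>j\<in>UNIV. osign Or i j * ?B i j) = (\<Sum>i\<in>UNIV. \<Sum>j\<in>UNIV. osign Or j i * ?B j i)"
      by (rule sum.swap)
    also have "\<dots> = (\<Sum>i\<in>UNIV. \<Sum>j\<in>UNIV. osign Or i j * - ?B j i)"
      by (intro sum.cong refl) (subst osign_swap, simp)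
    finally have B: "(\<Sum>i\<in>UNIV. \<Sum>j\<in>UNIV. osign Or i j * ?B i j) = (\<Sum>i\<in>UNIV. \<Sum>j\<in>UNIV. osign Or i j * - ?B j i)" .
    have P: "Tr (Al i j) y (\<lambda>p q. osign Or i j * Pg x i j p q) = osign Or i j * ?A i j + osign Or i j * - ?B j i" for i j
      unfolding Tr_linear(2) by (simp add: Pg_def Tr_def right_diff_distrib sum_subtractf)
    show ?thesis unfolding P unfolding Tr_linear(3) unfolding Tr_linear(2) using B by (simp add: distrib_left sum.distrib sum_negf sum_subtractf)
  qed
  also have "(\<Sum>i\<in>UNIV. \<Sum>p<n i. \<Sum>m<wd i. (\<Sum>q<n i. x (CEps i p q) * y (CAs i q m)) * x (CA i m p))
     = (\<Sum>i\<in>UNIV. \<Sum>q<n i. \<Sum>m<wd i. y (CAs i q m) * row x i m (aop n x (Ep i) (ev q)))"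
  proof (rule sum.cong[OF refl])
    fix i
    have "(\<Sum>p<n i. \<Sum>m<wd i. (\<Sum>q<n i. x (CEps i p q) * y (CAs i q m)) * x (CA i m p))
      = (\<Sum>m<wd i. \<Sum>p<n i. \<Sum>q<n i. y (CAs i q m) * (x (CA i m p) * x (CEps i p q)))"
      by (subst sum.swap) (simp add: sum_distrib_right sum_distrib_left mult_ac)
    also have "\<dots> = (\<Sum>m<wd i. \<Sum>q<n i. \<Sum>p<n i. y (CAs i q m) * (x (CA i m p) * x (CEps i p q)))"
      by (intro sum.cong refl sum.swap)
    also have "\<dots> = (\<Sum>q<n i. \<Sum>m<wd i. \<Sum>p<n i. y (CAs i q m) * (x (CA i m p) * x (CEps i p q)))"
      by (rule sum.swap)
    also have "\<dots> = (\<Sum>q<n i. \<Sum>m<wd i. y (CAs i q m) * row x i m (aop n x (Ep i) (ev q)))"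
      by (intro sum.cong refl) (simp add: row_def aop_ev xe_def sum_distrib_left)
    finally show "(\<Sum>p<n i. \<Sum>m<wd i. (\<Sum>q<n i. x (CEps i p q) * y (CAs i q m)) * x (CA i m p))
      = (\<Sum>q<n i. \<Sum>m<wd i. y (CAs i q m) * row x i m (aop n x (Ep i) (ev q)))" .
  qed
  also have "(\<Sum>i\<in>UNIV. \<Sum>m<wd i. \<Sum>p<n i. (\<Sum>m'<wd i. gamma_sum s ii \<gamma> i $$ (m, m') * x (CA i m' p)) * y (CAs i p m))
     = (\<Sum>i\<in>UNIV. \<Sum>q<n i. \<Sum>m<wd i. y (CAs i q m) * (\<Sum>m'<wd i. gamma_sum s ii \<gamma> i $$ (m, m') * x (CA i m' q)))"
    by (subst (2) sum.swap) (simp add: mult.commute)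
  also have "(\<Sum>i\<in>UNIV. Tr (Ep i) y (\<lambda>p q. \<Sum>j\<in>UNIV. osign Or i j * Qg x i j p q))
       + (\<Sum>i\<in>UNIV. \<Sum>j\<in>UNIV. Tr (Al i j) y (\<lambda>p q. osign Or i j * Pg x i j p q))
     + (\<Sum>i\<in>UNIV. \<Sum>q<n i. \<Sum>m<wd i. y (CAs i q m) * row x i m (aop n x (Ep i) (ev q)))
     - (\<Sum>i\<in>UNIV. \<Sum>q<n i. \<Sum>m<wd i. y (CAs i q m) * (\<Sum>m'<wd i. gamma_sum s ii \<gamma> i $$ (m, m') * x (CA i m' q)))
     = LF x y"
    by (simp add: LF_def Sg_def right_diff_distrib sum_subtractf)
  finally show ?thesis .
qed

end

section \<open>Coordinate directions and degrees\<close>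

context setting
begin

fun acoord :: "'i arrow \<Rightarrow> nat \<Rightarrow> nat \<Rightarrow> 'i coord" where
  "acoord (Al i j) p q = CAlpha i j p q"
| "acoord (Ep i) p q = CEps i p q"

definition uc :: "'i coord \<Rightarrow> 'i rep" where "uc z = (\<lambda>z'. if z' = z then 1 else 0)"

lemma xe_uc: "xe (uc (acoord a p q)) b p' q' = (if b = a \<and> p' = p \<and> q' = q then 1 else 0)"
  by (cases a; cases b) (auto simp: xe_def uc_def)

lemma Tr_uc:
  assumes "p < n (atarget a)" "q < n (asource a)"
  shows "Tr b (uc (acoord a p q)) g = (if b = a then g p q else 0)"
proof -
  have "Tr a (uc (acoord a p q)) g = (\<Sum>p'<n (atarget a). if p' = p then g p q else 0)" unfolding Tr_def
  proof (intro sum.cong refl)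
    fix p'
    have "(\<Sum>q'<n (asource a). xe (uc (acoord a p q)) a p' q' * g p' q')
      = (\<Sum>q'<n (asource a). if q' = q then (if p' = p then g p q else 0) else 0)"
      by (intro sum.cong) (auto simp: xe_uc)
    then show "(\<Sum>q'<n (asource a). xe (uc (acoord a p q)) a p' q' * g p' q') = (if p' = p then g p q else 0)"
      using assms by simp
  qed
  then show ?thesis using assms by (cases "b = a") (simp_all add: Tr_def xe_uc)
qed

lemma uc_CAs: "uc (acoord a p q) (CAs i m r) = 0" "xe (uc (CAs i m r)) a p q = 0"
  by (cases a; simp add: uc_def xe_def)+

lemma LF_uc_eps:
  assumes "p < n i" "q < n i"
  shows "LF x (uc (CEps i p q)) = (\<Sum>j\<in>UNIV. osign Or i j * Qg x i j p q)"
proof -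
  have "LF x (uc (acoord (Ep i) p q)) = (\<Sum>i'\<in>UNIV. if i' = i then (\<Sum>j\<in>UNIV. osign Or i j * Qg x i j p q) else 0)"
    unfolding LF_def using assms by (auto simp: Tr_uc uc_CAs intro!: sum.cong simp del: acoord.simps)
  then show ?thesis by simp
qed

lemma LF_uc_alpha:
  assumes "p < n i" "q < n j"
  shows "LF x (uc (CAlpha i j p q)) = osign Or i j * Pg x i j p q"
proof -
  have "LF x (uc (acoord (Al i j) p q))
    = (\<Sum>i'\<in>UNIV. \<Sum>j'\<in>UNIV. Tr (Al i' j') (uc (acoord (Al i j) p q)) (\<lambda>p q. osign Or i' j' * Pg x i' j' p q))"
    unfolding LF_def using assms by (simp add: Tr_uc uc_CAs del: acoord.simps)
  also have "\<dots> = (\<Sum>i'\<in>UNIV. \<Sum>j'\<in>UNIV. if j' = j then (if i' = i then osign Or i j * Pg x i j p q else 0) else 0)"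
    using assms by (intro sum.cong refl) (auto simp: Tr_uc simp del: acoord.simps)
  finally show ?thesis by simp
qed

lemma LF_uc_as:
  assumes "q < n i" "m < wd i"
  shows "LF x (uc (CAs i q m)) = Sg x i q m"
proof -
  have "LF x (uc (CAs i q m)) = (\<Sum>i'\<in>UNIV. \<Sum>q'<n i'. \<Sum>m'<wd i'. uc (CAs i q m) (CAs i' q' m') * Sg x i' q' m')"
    unfolding LF_def by (simp add: Tr_def uc_CAs)
  also have "\<dots> = (\<Sum>i'\<in>UNIV. if i' = i then Sg x i q m else 0)"
  proof (intro sum.cong refl)
    fix i'
    have "(\<Sum>q'<n i'. \<Sum>m'<wd i'. uc (CAs i q m) (CAs i' q' m') * Sg x i' q' m')
      = (\<Sum>q'<n i'. \<Sum>m'<wd i'. if m' = m then (if q' = q then (if i' = i then Sg x i q m else 0) else 0) else 0)"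
      by (intro sum.cong) (auto simp: uc_def)
    then show "(\<Sum>q'<n i'. \<Sum>m'<wd i'. uc (CAs i q m) (CAs i' q' m') * Sg x i' q' m') = (if i' = i then Sg x i q m else 0)"
      using assms by (cases "i' = i") (auto intro!: sum.neutral)
  qed
  finally show ?thesis by simp
qed

lemma word_degree:
  assumes x: "x \<in> XX" and g: grd and w: "is_path c (t, w)" "psource (t, w) = i" and nz: "opw n x w (ev p) q \<noteq> 0"
  shows "vdeg t q = vdeg i p + pdeg c d (t, w)"
  by (rule opw_degree[where i = i and u = "ev p", OF x _ g w nz]) (auto simp: ev_def split: if_splits)

lemma bform_ff: "c i j < 0 \<Longrightarrow> bform c d i j = - d i * int (ff i j)" "bform c d j i = bform c d i j"
  by (auto simp: bform_def d_sym)

text \<open>An entry of the gradient can be nonzero only at a position where graded directions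
  exist. Hence restricting the differential to graded directions loses none of the equations;
  \<open>Pg_degree\<close> and \<open>Sg_degree\<close> do the same for the other two
  families.\<close>

lemma Qg_degree:
  assumes x: "x \<in> XX" and g: grd and nz: "Qg x i j p q \<noteq> 0" shows "vdeg i p = vdeg i q + 2 * d i"
proof -
  obtain k where k: "k < ff i j"
    and nz': "opw n x (replicate (ff i j - 1 - k) (Ep i) @ [Al i j, Al j i] @ replicate k (Ep i)) (ev p) q \<noteq> 0"
    using nz unfolding Qg_def by (metis (mono_tags, lifting) lessThan_iff sum.neutral)
  have ij: "c i j < 0" using k by simp
  have "vdeg i q = vdeg i p + pdeg c d (i, replicate (ff i j - 1 - k) (Ep i) @ [Al i j, Al j i] @ replicate k (Ep i))"
    by (rule word_degree[OF x g _ _ nz']) (use ij c_sym[OF ij] in \<open>auto simp: is_path_append psource_append\<close>)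
  also have "pdeg c d (i, replicate (ff i j - 1 - k) (Ep i) @ [Al i j, Al j i] @ replicate k (Ep i))
    = (int (ff i j - 1 - k) + int k) * (2 * d i) + 2 * bform c d i j"
    unfolding pdeg_def by (simp add: sum_list_replicate bform_ff(2)[of j i] algebra_simps del: int_nat_eq)
  also have "int (ff i j - 1 - k) + int k = int (ff i j) - 1" using k by linarith
  finally show ?thesis using bform_ff(1)[OF ij] by (simp add: algebra_simps del: int_nat_eq)
qed

lemma Pg_degree:
  assumes x: "x \<in> XX" and g: grd and ij: "c i j < 0" and nz: "Pg x i j p q \<noteq> 0"
  shows "vdeg i p = vdeg j q + bform c d i j"
proof -
  have ji: "c j i < 0" by (rule c_sym[OF ij])
  have b: "bform c d j i = bform c d i j" "bform c d i j = - d i * int (ff i j)" "bform c d i j = - d j * int (ff j i)"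
    using bform_ff(1)[OF ij] bform_ff(1)[OF ji] bform_ff(2)[of i j] by simp_all
  have "opw n x (Al j i # replicate (ff i j) (Ep i)) (ev p) q \<noteq> 0 \<or> opw n x (replicate (ff j i) (Ep j) @ [Al j i]) (ev p) q \<noteq> 0"
    using nz unfolding Pg_def by auto
  then show ?thesis
  proof
    assume "opw n x (Al j i # replicate (ff i j) (Ep i)) (ev p) q \<noteq> 0"
    then have "vdeg j q = vdeg i p + pdeg c d (j, Al j i # replicate (ff i j) (Ep i))"
      using ji by (intro word_degree[OF x g]) (auto simp: is_path_append psource_append)
    then show ?thesis using b(1,2) by (simp add: pdeg_def sum_list_replicate algebra_simps del: int_nat_eq)
  next
    assume "opw n x (replicate (ff j i) (Ep j) @ [Al j i]) (ev p) q \<noteq> 0"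
    then have "vdeg j q = vdeg i p + pdeg c d (j, replicate (ff j i) (Ep j) @ [Al j i])"
      using ji by (intro word_degree[OF x g]) (auto simp: is_path_append psource_append)
    then show ?thesis using b(1,3) by (simp add: pdeg_def sum_list_replicate algebra_simps del: int_nat_eq)
  qed
qed

lemma Sg_wpos:
  assumes r: "r \<in> RS" "m < ll r"
  shows "Sg x (ii r) q (wpos r m) = row x (ii r) (wpos r m) (aop n x (Ep (ii r)) (ev q))
    - (case m of 0 \<Rightarrow> 0 | Suc m' \<Rightarrow> gs r m' * x (CA (ii r) (wpos r m') q))"
  unfolding Sg_def gamma_row[OF r] ..

lemma Sg_degree:
  assumes x: "x \<in> XX" and g: grd and q: "q < n i" "m < wd i" and nz: "Sg x i q m \<noteq> 0"
  shows "vdeg i q = wdeg i m - d i"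
proof -
  obtain r m' where r: "r \<in> RS" "ii r = i" "m' < ll r" "m = wpos r m'" using wpos_surj[OF q(2)] by blast
  have "row x i m (aop n x (Ep i) (ev q)) \<noteq> 0 \<or> (\<exists>m1. m' = Suc m1 \<and> x (CA i (wpos r m1) q) \<noteq> 0)"
    using nz Sg_wpos[OF r(1,3), of x q] r by (cases m') auto
  then show ?thesis
  proof (elim disjE exE conjE)
    assume "row x i m (aop n x (Ep i) (ev q)) \<noteq> 0"
    then obtain p where p: "x (CA i m p) \<noteq> 0" "opw n x [Ep i] (ev q) p \<noteq> 0"
      unfolding row_def by (metis (mono_tags, lifting) mult_eq_0_iff opw_simps(1,2) sum.neutral)
    have "vdeg i p = vdeg i q + pdeg c d (i, [Ep i])" by (rule word_degree[OF x g _ _ p(2)]) auto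
    then show ?thesis using XX_CA[OF x p(1)] g by (simp add: pdeg_def)
  next
    fix m1 assume m1: "m' = Suc m1" "x (CA i (wpos r m1) q) \<noteq> 0"
    then show ?thesis using XX_CA[OF x m1(2)] g wdeg_wpos[OF r(1,3)] wdeg_wpos[OF r(1), of m1] r
      by (simp add: algebra_simps)
  qed
qed

lemma uc_XX: "z \<in> coords c n wd \<Longrightarrow> okc z \<Longrightarrow> uc z \<in> XX"
  unfolding XX_def uc_def by auto

text \<open>Test on the directions with a single nonzero entry. At positions that the grading
  excludes, the gradient vanishes by the degree lemmas.\<close>

lemma LF_zero_iff:
  assumes x: "x \<in> XX"
  shows "(\<forall>y\<in>XX. LF x y = 0) \<longleftrightarrow>
    (\<forall>i. \<forall>p<n i. \<forall>q<n i. (\<Sum>j\<in>UNIV. osign Or i j * Qg x i j p q) = 0) \<and>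
    (\<forall>i j. c i j < 0 \<longrightarrow> (\<forall>p<n i. \<forall>q<n j. Pg x i j p q = 0)) \<and>
    (\<forall>i. \<forall>q<n i. \<forall>m<wd i. Sg x i q m = 0)" (is "?L \<longleftrightarrow> ?Q \<and> ?P \<and> ?S")
proof
  assume L: ?L
  have ?Q
  proof (intro allI impI)
    fix i p q assume pq: "p < n i" "q < n i"
    show "(\<Sum>j\<in>UNIV. osign Or i j * Qg x i j p q) = 0"
    proof (cases "grd \<longrightarrow> vdeg i p = vdeg i q + 2 * d i")
      case True
      then have "uc (CEps i p q) \<in> XX" using pq by (intro uc_XX) (auto simp: coords_def)
      then show ?thesis using L LF_uc_eps[OF pq, of x] by simp
    next
      case False
      then have "Qg x i j p q = 0" for j using Qg_degree[OF x, of i j p q] by blast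
      then show ?thesis by simp
    qed
  qed
  moreover have ?P
  proof (intro allI impI)
    fix i j p q assume ij: "c i j < 0" and pq: "p < n i" "q < n j"
    show "Pg x i j p q = 0"
    proof (cases "grd \<longrightarrow> vdeg i p = vdeg j q + bform c d i j")
      case True
      then have "uc (CAlpha i j p q) \<in> XX" using pq ij by (intro uc_XX) (auto simp: coords_def)
      then have "osign Or i j * Pg x i j p q = 0" using L LF_uc_alpha[OF pq, of x] by simp
      then show ?thesis using osign_sq[OF ij] by auto
    next
      case False
      then show ?thesis using Pg_degree[OF x _ ij, of p q] by blast
    qed
  qed
  moreover have ?S
  proof (intro allI impI)
    fix i q m assume qm: "q < n i" "m < wd i"
    show "Sg x i q m = 0"
    proof (cases "grd \<longrightarrow> vdeg i q = wdeg i m - d i")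
      case True
      then have "uc (CAs i q m) \<in> XX" using qm by (intro uc_XX) (auto simp: coords_def)
      then show ?thesis using L LF_uc_as[OF qm, of x] by simp
    next
      case False
      then show ?thesis using Sg_degree[OF x _ qm] by blast
    qed
  qed
  ultimately show "?Q \<and> ?P \<and> ?S" by blast
next
  assume H: "?Q \<and> ?P \<and> ?S"
  have P: "osign Or i j * Pg x i j p q = 0" if "p < n i" "q < n j" for i j p q
    using H osign_0[of i j] that by (cases "c i j < 0") auto
  show ?L
  proof
    fix y
    have "Tr (Ep i) y (\<lambda>p q. \<Sum>j\<in>UNIV. osign Or i j * Qg x i j p q) = 0" for i
      using H by (auto simp: Tr_def intro!: sum.neutral)
    moreover have "Tr (Al i j) y (\<lambda>p q. osign Or i j * Pg x i j p q) = 0" for i j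
      using P by (auto simp: Tr_def intro!: sum.neutral)
    moreover have "(\<Sum>q<n i. \<Sum>m<wd i. y (CAs i q m) * Sg x i q m) = 0" for i
      using H by (auto intro!: sum.neutral)
    ultimately show "LF x y = 0" by (simp add: LF_def)
  qed
qed

theorem critical_iff:
  assumes x: "x \<in> XX" and as0: "as0 x"
  shows "(\<forall>y\<in>XX. ((\<lambda>t. potential c Or (gamma_sum s ii \<gamma>) n wd (\<lambda>z. x z + t * y z)) has_field_derivative 0) (at 0))
    \<longleftrightarrow> EQc x \<and> EQm x \<and> EQa x" (is "?C \<longleftrightarrow> _")
proof -
  have h1: "?C \<longleftrightarrow> (\<forall>y\<in>XX. LF x y = 0)"
  proof (rule ball_cong[OF refl])
    fix y assume y: "y \<in> XX"
    show "((\<lambda>t. potential c Or (gamma_sum s ii \<gamma>) n wd (\<lambda>z. x z + t * y z)) has_field_derivative 0) (at 0)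
      \<longleftrightarrow> LF x y = 0"
      (is "(?F has_field_derivative 0) _ \<longleftrightarrow> _")
    proof
      assume "(?F has_field_derivative 0) (at 0)"
      then show "LF x y = 0" by (rule DERIV_unique[OF potential_derivative[OF x y as0]])
    next
      assume "LF x y = 0"
      then show "(?F has_field_derivative 0) (at 0)" using potential_derivative[OF x y as0] by simp
    qed
  qed
  have h2: "EQc x \<longleftrightarrow> (\<forall>i j. c i j < 0 \<longrightarrow> (\<forall>p<n i. \<forall>q<n j. Pg x i j p q = 0))"
  proof
    assume e: "EQc x"
    show "\<forall>i j. c i j < 0 \<longrightarrow> (\<forall>p<n i. \<forall>q<n j. Pg x i j p q = 0)"
    proof (intro allI impI)
      fix i j p q assume ij: "c i j < 0" and "p < n i" "q < n j"
      then have "ev p \<in> V i" by (intro ev_VV)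
      then show "Pg x i j p q = 0" using EQc_D[OF e c_sym[OF ij], of "ev p"] by (simp add: Pg_def)
    qed
  next
    assume P: "\<forall>i j. c i j < 0 \<longrightarrow> (\<forall>p<n i. \<forall>q<n j. Pg x i j p q = 0)"
    show "EQc x" unfolding EQc_def
    proof (intro allI impI)
      fix i j p q assume a: "c i j < 0 \<and> q < n j"
      let ?l = "opw n x (replicate (ff i j) (Ep i)) (aop n x (Al i j) (ev q))"
      let ?r = "aop n x (Al i j) (opw n x (replicate (ff j i) (Ep j)) (ev q))"
      show "?l p = ?r p"
      proof (cases "p < n i")
        case True
        then show ?thesis using P a c_sym[of i j] by (auto simp: Pg_def)
      next
        case False
        moreover have "?l \<in> V i" using aop_V[OF x, of "Al i j"] by (intro E_V[OF x]) simp
        moreover have "?r \<in> V i" using aop_V[OF x, of "Al i j"] by simp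
        ultimately show ?thesis by (simp add: VV_def)
      qed
    qed
  qed
  have h3: "EQm x \<longleftrightarrow> (\<forall>i. \<forall>p<n i. \<forall>q<n i. (\<Sum>j\<in>UNIV. osign Or i j * Qg x i j p q) = 0)"
  proof -
    let ?t = "\<lambda>i j k q p. opw n x (replicate k (Ep i)) (aop n x (Al i j) (aop n x (Al j i)
          (opw n x (replicate (ff i j - 1 - k) (Ep i)) (ev q)))) p"
    have Q: "Qg x i j q p = (\<Sum>k<ff i j. ?t i j k q p)" for i j p q
    proof -
      have "Qg x i j q p = (\<Sum>k<ff i j. ?t i j (ff i j - Suc k) q p)"
        unfolding Qg_def by (intro sum.cong refl) auto
      also have "\<dots> = (\<Sum>k<ff i j. ?t i j k q p)" by (rule sum.nat_diff_reindex)
      finally show ?thesis .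
    qed
    have 0: "?t i j k q p = 0" if "\<not> p < n i" for i j k p q
    proof -
      have "opw n x (replicate k (Ep i)) (aop n x (Al i j) (aop n x (Al j i)
          (opw n x (replicate (ff i j - 1 - k) (Ep i)) (ev q)))) \<in> V i"
        using aop_V[OF x, of "Al i j"] by (intro E_V[OF x]) simp
      then show ?thesis using that by (simp add: VV_def)
    qed
    have S: "(\<Sum>j\<in>UNIV. \<Sum>k<ff i j. osign Or i j * ?t i j k q p) = (\<Sum>j\<in>UNIV. osign Or i j * Qg x i j q p)" for i p q
      by (simp only: Q sum_distrib_left)
    have Q0: "Qg x i j q p = 0" if "\<not> p < n i" for i j p q
      unfolding Q by (intro sum.neutral ballI 0 that)
    show ?thesis unfolding EQm_def S using Q0 by (metis (no_types, lifting) mult_zero_right sum.neutral)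
  qed
  have h4: "EQa x \<longleftrightarrow> (\<forall>i. \<forall>q<n i. \<forall>m<wd i. Sg x i q m = 0)"
  proof
    assume e: "EQa x"
    show "\<forall>i. \<forall>q<n i. \<forall>m<wd i. Sg x i q m = 0"
    proof (intro allI impI)
      fix i q m assume q: "q < n i" and "m < wd i"
      then obtain r m' where r: "r \<in> RS" "ii r = i" "m' < ll r" "m = wpos r m'" using wpos_surj by blast
      then have "row x (ii r) (wpos r m') (aop n x (Ep (ii r)) (ev q))
         = (case m' of 0 \<Rightarrow> 0 | Suc m1 \<Rightarrow> gs r m1 * row x (ii r) (wpos r m1) (ev q))"
        using e q unfolding EQa_def by blast
      then show "Sg x i q m = 0" using Sg_wpos[OF r(1,3), of x q] r q by (simp add: row_ev split: nat.splits)
    qed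
  next
    assume S: "\<forall>i. \<forall>q<n i. \<forall>m<wd i. Sg x i q m = 0"
    show "EQa x" unfolding EQa_def
    proof (intro allI impI)
      fix r m q assume a: "r \<in> RS \<and> m < ll r \<and> q < n (ii r)"
      then have "Sg x (ii r) q (wpos r m) = 0" using S wpos_less[of r m] by blast
      then show "row x (ii r) (wpos r m) (aop n x (Ep (ii r)) (ev q))
         = (case m of 0 \<Rightarrow> 0 | Suc m1 \<Rightarrow> gs r m1 * row x (ii r) (wpos r m1) (ev q))"
        using a Sg_wpos[of r m x q] by (simp add: row_ev split: nat.splits)
    qed
  qed
  show ?thesis unfolding h1 LF_zero_iff[OF x] h2 h3 h4 by (rule conj_left_commute)
qed

end

section \<open>The nilpotent fibre\<close>

text \<open>Extend bases step by step along the filtration; the level of a basis vector is the first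
  step whose basis contains it. A vector of S k is then a combination of basis vectors of level at
  most k, and no level is 0 because S 0 contains only 0.\<close>

lemma adapted_basis:
  assumes sub: "\<And>k. cfun.subspace (S k)" and mono: "\<And>k. S k \<subseteq> S (Suc k)" and S0: "S 0 = {0}"
    and e: "ordered_basis m (S N) e"
  shows "\<exists>b lev. (\<forall>q<m. b q \<in> S (lev q) \<and> 0 < (lev q :: nat)) \<and>
    (\<forall>k\<le>N. \<forall>u\<in>S k. \<exists>c. u = (\<Sum>q<m. cscale (c q) (b q)) \<and> (\<forall>q<m. c q \<noteq> 0 \<longrightarrow> lev q \<le> k))"
proof -
  have "\<exists>B. \<forall>k. (\<not> cfun.dependent (B k) \<and> cfun.span (B k) = S k) \<and> B k \<subseteq> B (Suc k)"
  proof (rule dependent_nat_choice)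
    show "\<exists>B. \<not> cfun.dependent B \<and> cfun.span B = S 0"
      using cfun.independent_empty cfun.span_empty S0 by auto
    show "\<exists>B'. (\<not> cfun.dependent B' \<and> cfun.span B' = S (Suc k)) \<and> B \<subseteq> B'"
      if "\<not> cfun.dependent B \<and> cfun.span B = S k" for B k
    proof -
      note ind = conjunct1[OF that]
      have "B \<subseteq> S (Suc k)" using that mono[of k] cfun.span_superset[of B] by blast
      then obtain B' where B': "B \<subseteq> B'" "B' \<subseteq> S (Suc k)" "\<not> cfun.dependent B'" "S (Suc k) \<subseteq> cfun.span B'"
        by (rule cfun.maximal_independent_subset_extend[OF _ ind])
      show ?thesis using cfun.span_minimal[OF B'(2) sub] B' by (intro exI[of _ B'] conjI subset_antisym)
    qed
  qed
  then obtain B where B: "\<And>k. \<not> cfun.dependent (B k) \<and> cfun.span (B k) = S k" and Bm: "\<And>k. B k \<subseteq> B (Suc k)"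
    by blast
  have BN: "B k \<subseteq> B k'" if "k \<le> k'" for k k' using that by (rule lift_Suc_mono_le[of B, OF Bm])
  let ?E = "e ` {..<m}"
  have E: "inj_on e {..<m}" "\<not> cfun.dependent ?E" "cfun.span ?E = S N" using e by (auto simp: ordered_basis_def)
  have fB: "finite (B N) \<and> card (B N) \<le> card ?E"
    using B[of N] E(3) cfun.span_superset[of "B N"] by (intro indep_card_le) auto
  moreover have "finite ?E \<and> card ?E \<le> card (B N)"
    using B[of N] E fB cfun.span_superset[of ?E] by (intro indep_card_le) auto
  ultimately have cB: "card (B N) = m" using card_image[OF E(1)] by simp
  obtain h where h: "bij_betw h {..<m} (B N)"
    using ex_bij_betw_nat_finite[of "B N"] fB cB by (auto simp: atLeast0LessThan)
  define lev where "lev q = (LEAST k. h q \<in> B k)" for q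
  have hB: "h q \<in> B N" if "q < m" for q using h that by (auto simp: bij_betw_def)
  have levB: "h q \<in> B (lev q)" if "q < m" for q unfolding lev_def using hB[OF that] by (rule LeastI)
  have "h q \<in> S (lev q) \<and> 0 < lev q" if q: "q < m" for q
  proof
    show 1: "h q \<in> S (lev q)" using levB[OF q] B[of "lev q"] cfun.span_superset by blast
    have "h q \<noteq> 0" using hB[OF q] B[of N] cfun.dependent_zero by metis
    then show "0 < lev q" using 1 S0 by (cases "lev q") auto
  qed
  moreover have "\<exists>c. u = (\<Sum>q<m. cscale (c q) (h q)) \<and> (\<forall>q<m. c q \<noteq> 0 \<longrightarrow> lev q \<le> k)"
    if k: "k \<le> N" and u: "u \<in> S k" for k u
  proof -
    have f: "finite (B k)" using finite_subset[OF BN[OF k]] fB by blast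
    have "u \<in> cfun.span (B k)" using u B by blast
    then obtain g where g: "u = (\<Sum>v\<in>B k. cscale (g v) v)" unfolding cfun.span_finite[OF f] by blast
    let ?c = "\<lambda>q. if h q \<in> B k then g (h q) else 0"
    have "(\<Sum>q<m. cscale (?c q) (h q)) = (\<Sum>v\<in>B N. cscale (if v \<in> B k then g v else 0) v)"
      by (rule sum.reindex_bij_betw[OF h])
    also have "\<dots> = (\<Sum>v\<in>B k. cscale (if v \<in> B k then g v else 0) v)"
      using fB BN[OF k] by (intro sum.mono_neutral_right) auto
    also have "\<dots> = u" unfolding g by (intro sum.cong) auto
    finally have "u = (\<Sum>q<m. cscale (?c q) (h q))" ..
    moreover have "\<forall>q<m. ?c q \<noteq> 0 \<longrightarrow> lev q \<le> k" unfolding lev_def by (auto intro: Least_le split: if_splits)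
    ultimately show ?thesis by (intro exI[of _ ?c] conjI)
  qed
  ultimately show ?thesis by (intro exI[of _ h] exI[of _ lev]) blast
qed

lemma isCont_polyfun:
  assumes "polyfun f" "\<And>z. isCont (\<lambda>t. g t z) a" shows "isCont (\<lambda>t. f (g t)) a"
  using assms(1) by induction (auto intro: assms(2) continuous_intros)

context setting
begin

lemma invariant_poly_framing:
  assumes w: "is_path c (i0, w)" "psource (i0, w) = i" and m: "m < wd i0" "m' < wd i"
  shows "(\<lambda>x. row x i0 m (opw n x w (\<lambda>p. x (CAs i p m')))) \<in> invariant_polys n wd XX GG"
  unfolding invariant_polys_def
proof (intro CollectI conjI ballI impI)
  show "polyfun (\<lambda>x. row x i0 m (opw n x w (\<lambda>p. x (CAs i p m'))))"
    by (intro polyfun_row polyfun_opw polyfun_coord)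
  fix g x y assume g: "g \<in> GG" and x: "x \<in> XX" and y: "y \<in> XX" and act: "acts_to n wd g x y"
  have V: "(\<lambda>p. x (CAs i p m')) \<in> V i" using XX_CAs[OF x] by (force simp: VV_def)
  have "(\<lambda>p. y (CAs i p m')) = gop (g i) (n i) (\<lambda>p. x (CAs i p m'))"
  proof
    fix p
    show "y (CAs i p m') = gop (g i) (n i) (\<lambda>p. x (CAs i p m')) p"
    proof (cases "p < n i")
      case True
      have "asM n wd y i $$ (p, m') = (g i * asM n wd x i) $$ (p, m')" using act by (simp add: acts_to_def)
      then show ?thesis using True m(2) GG_D(1)[OF g, of i]
        by (auto simp: asM_def gop_def scalar_prod_def atLeast0LessThan intro!: sum.cong)
    next
      case False
      then show ?thesis using XX_CAs[OF y, of i p m'] by (auto simp: gop_def)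
    qed
  qed
  then show "row x i0 m (opw n x w (\<lambda>p. x (CAs i p m'))) = row y i0 m (opw n y w (\<lambda>p. y (CAs i p m')))"
    by (simp add: acts_opw[OF g x y act V w] acts_row[OF g act opw_V[OF x w V] m(1)])
qed

lemma nilpotent_as0:
  assumes x: "x \<in> XX" and st: "stable c n wd x" and 0: "\<forall>f\<in>invariant_polys n wd XX GG. f x = f (\<lambda>z. 0)"
  shows "as0 x"
  unfolding as0_def
proof (intro allI)
  fix i p m'
  show "x (CAs i p m') = 0"
  proof (cases "m' < wd i")
    case True
    have V: "(\<lambda>p. x (CAs i p m')) \<in> V i" using XX_CAs[OF x] by (force simp: VV_def)
    have "sep x" using st stable_iff_sep[OF x] by simp
    then have "(\<lambda>p. x (CAs i p m')) = 0"
    proof (rule sep_def[THEN iffD1, rule_format, OF _ V])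
      fix i0 m w assume a: "m < wd i0 \<and> is_path c (i0, w) \<and> psource (i0, w) = i"
      then have "row x i0 m (opw n x w (\<lambda>p. x (CAs i p m'))) = row (\<lambda>z. 0) i0 m (opw n (\<lambda>z. 0) w (\<lambda>p. 0))"
        by (intro 0[THEN bspec, OF invariant_poly_framing]) (use True in auto)
      then show "row x i0 m (opw n x w (\<lambda>p. x (CAs i p m'))) = 0" by (simp add: row_def)
    qed
    then show ?thesis by (metis zero_fun_apply)
  next
    case False
    then show ?thesis using XX_CAs[OF x, of i p m'] by auto
  qed
qed

lemma label_basis:
  "ordered_basis (vj j) {u \<in> V (vt j). \<forall>p. u p \<noteq> 0 \<longrightarrow> jl (vt j) p = j} (\<lambda>q. ev (pos j q))"
proof -
  let ?S = "{u \<in> V (vt j). \<forall>p. u p \<noteq> 0 \<longrightarrow> jl (vt j) p = j}"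
  have *: "(\<Sum>q<vj j. u q * ev (pos j q) p) = (if p < n (vt j) \<and> jl (vt j) p = j then u (rk (vt j) p) else 0)" for u p
  proof -
    have "(\<Sum>q<vj j. u q * ev (pos j q) p) = (\<Sum>q<vj j. if p < n (vt j) \<and> jl (vt j) p = j \<and> q = rk (vt j) p then u q else 0)"
      using idx1[of p "vt j"] idx2[of _ j] by (intro sum.cong refl) (auto simp: ev_def)
    also have "\<dots> = (if p < n (vt j) \<and> jl (vt j) p = j then u (rk (vt j) p) else 0)"
      using idx1[of p "vt j"] by auto
    finally show ?thesis .
  qed
  show ?thesis
  proof (rule obasis_I)
    fix u assume 0: "(\<Sum>q<vj j. cscale (u q) (ev (pos j q))) = 0"
    show "\<forall>q<vj j. u q = 0"
    proof (intro allI impI)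
      fix q assume q: "q < vj j"
      have "(\<Sum>q<vj j. cscale (u q) (ev (pos j q))) (pos j q) = u q"
        unfolding sum_cscale * using idx2[OF q] by simp
      then show "u q = 0" using 0 by simp
    qed
  next
    fix f
    show "f \<in> ?S \<longleftrightarrow> (\<exists>u. f = (\<Sum>q<vj j. cscale (u q) (ev (pos j q))))" (is "_ \<longleftrightarrow> (\<exists>u. ?E u)")
    proof
      assume f: "f \<in> ?S"
      have "f = (\<Sum>q<vj j. cscale (f (pos j q)) (ev (pos j q)))"
      proof
        fix p
        show "f p = (\<Sum>q<vj j. cscale (f (pos j q)) (ev (pos j q))) p"
          unfolding sum_cscale * using f idx1[of p "vt j"] by (auto simp: VV_def)
      qed
      then show "\<exists>u. ?E u" by (rule exI[of ?E "\<lambda>q. f (pos j q)"])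
    next
      assume "\<exists>u. f = (\<Sum>q<vj j. cscale (u q) (ev (pos j q)))"
      then obtain u where "f = (\<Sum>q<vj j. cscale (u q) (ev (pos j q)))" ..
      then have "f p = (if p < n (vt j) \<and> jl (vt j) p = j then u (rk (vt j) p) else 0)" for p
        by (simp only: sum_cscale *)
      then show "f \<in> ?S" by (simp add: VV_def)
    qed
  qed
qed

text \<open>Adapt a basis to the filtration \<open>FF\<close> separately in each label. Arrows send
  \<open>FF (Suc k)\<close> into \<open>FF k\<close>, so in this basis they lower the level
  strictly, and the base change respects degrees because it respects labels.\<close>

lemma strictly_triangular_basis:
  assumes x: "x \<in> PS"
  obtains bb lv C where "\<And>i q p. q < n i \<Longrightarrow> bb i q p \<noteq> 0 \<Longrightarrow> p < n i \<and> jl i p = jl i q"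
    "\<And>i q. q < n i \<Longrightarrow> 0 < (lv i q :: nat)"
    "\<And>i q. q < n i \<Longrightarrow> \<exists>c. ev q = (\<Sum>p<n i. cscale (c p) (bb i p)) \<and> (\<forall>p<n i. c p \<noteq> 0 \<longrightarrow> jl i p = jl i q)"
    "\<And>a q. arrow_ok c a \<Longrightarrow> q < n (asource a) \<Longrightarrow>
      aop n x a (bb (asource a) q) = (\<Sum>p<n (atarget a). cscale (C a q p) (bb (atarget a) p))"
    "\<And>a q p. arrow_ok c a \<Longrightarrow> q < n (asource a) \<Longrightarrow> p < n (atarget a) \<Longrightarrow> C a q p \<noteq> 0 \<Longrightarrow>
      lv (atarget a) p < lv (asource a) q \<and> (grd \<longrightarrow> vdeg (atarget a) p = vdeg (asource a) q + adeg c d a)"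
proof -
  note X = PS_D(1)[OF x]
  interpret q: qrep c d Or n x by (rule qrep_PS[OF x])
  obtain N where N: "\<And>i. q.FF N i = V i" using q.nilpotent by blast
  define S where "S j k = {u \<in> q.FF k (vt j). \<forall>p. u p \<noteq> 0 \<longrightarrow> jl (vt j) p = j}" for j k
  have sub: "cfun.subspace (S j k)" for j k
  proof -
    have "cfun.subspace {u. \<forall>p. u p \<noteq> 0 \<longrightarrow> jl (vt j) p = j}"
    proof (rule cfun.subspaceI)
      show "u + v \<in> {u. \<forall>p. u p \<noteq> 0 \<longrightarrow> jl (vt j) p = j}"
        if "u \<in> {u. \<forall>p. u p \<noteq> 0 \<longrightarrow> jl (vt j) p = j}" "v \<in> {u. \<forall>p. u p \<noteq> 0 \<longrightarrow> jl (vt j) p = j}" for u v :: "nat \<Rightarrow> complex"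
      proof (intro CollectI allI impI)
        fix p assume "(u + v) p \<noteq> 0"
        then have "u p \<noteq> 0 \<or> v p \<noteq> 0" by auto
        then show "jl (vt j) p = j" using that by blast
      qed
    qed (auto simp: cscale_def)
    from cfun.subspace_inter[OF q.subspace_FF this] show ?thesis by (simp add: S_def Collect_conj_eq)
  qed
  define A where "A j b lev \<longleftrightarrow> (\<forall>q<vj j. b q \<in> S j (lev q) \<and> 0 < (lev q :: nat)) \<and>
    (\<forall>k\<le>N. \<forall>u\<in>S j k. \<exists>c. u = (\<Sum>q<vj j. cscale (c q) (b q)) \<and> (\<forall>q<vj j. c q \<noteq> 0 \<longrightarrow> lev q \<le> k))"
    for j b lev
  have "\<exists>b lev. A j b lev" for j
    unfolding A_def
  proof (rule adapted_basis[OF sub])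
    show "S j k \<subseteq> S j (Suc k)" for k using q.FF_mono[of k "vt j"] by (auto simp: S_def)
    show "S j 0 = {0}" by (auto simp: S_def q.FF_0)
    show "ordered_basis (vj j) (S j N) (\<lambda>q. ev (pos j q))" using label_basis[of j] by (simp add: S_def N)
  qed
  then obtain b lev where A: "\<And>j. A j (b j) (lev j)" by metis
  have b: "b j q \<in> S j (lev j q) \<and> 0 < lev j q" if "q < vj j" for j q
    using A[of j] that unfolding A_def by blast
  have bs: "\<exists>c. u = (\<Sum>q<vj j. cscale (c q) (b j q)) \<and> (\<forall>q<vj j. c q \<noteq> 0 \<longrightarrow> lev j q \<le> k)"
    if "k \<le> N" "u \<in> S j k" for j k u
    using A[of j, unfolded A_def, THEN conjunct2] that by blast
  define bb where "bb i p = b (jl i p) (rk i p)" for i p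
  define lv where "lv i p = lev (jl i p) (rk i p)" for i p
  have bb: "bb i p \<in> q.FF (lv i p) i" "\<And>p'. bb i p p' \<noteq> 0 \<Longrightarrow> jl i p' = jl i p" "0 < lv i p" if "p < n i" for i p
    using b[of "rk i p" "jl i p"] idx1[OF that] unfolding bb_def lv_def S_def by auto
  have span: "\<exists>c. u = (\<Sum>p<n (vt j). cscale (c p) (bb (vt j) p)) \<and> (\<forall>p<n (vt j). c p \<noteq> 0 \<longrightarrow> jl (vt j) p = j \<and> lv (vt j) p \<le> k)"
    if k: "k \<le> N" and u: "u \<in> S j k" for j k u
  proof -
    obtain c' where c': "u = (\<Sum>q<vj j. cscale (c' q) (b j q))" "\<forall>q<vj j. c' q \<noteq> 0 \<longrightarrow> lev j q \<le> k"
      using bs[OF k u] by blast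
    let ?c = "\<lambda>p. if jl (vt j) p = j then c' (rk (vt j) p) else 0"
    have "u = (\<Sum>p<n (vt j). cscale (?c p) (bb (vt j) p))"
    proof
      fix y
      have "(\<Sum>p<n (vt j). ?c p * bb (vt j) p y) = (\<Sum>p<n (vt j). if jl (vt j) p = j then c' (rk (vt j) p) * bb (vt j) p y else 0)"
        by (intro sum.cong) auto
      also have "\<dots> = (\<Sum>q<vj j. c' (rk (vt j) (pos j q)) * bb (vt j) (pos j q) y)" by (rule label_sum)
      also have "\<dots> = (\<Sum>q<vj j. c' q * b j q y)" using idx2[of _ j] by (intro sum.cong) (auto simp: bb_def)
      finally show "u y = (\<Sum>p<n (vt j). cscale (?c p) (bb (vt j) p)) y" unfolding c'(1) sum_cscale ..
    qed
    moreover have "jl (vt j) p = j \<and> lv (vt j) p \<le> k" if "p < n (vt j)" "?c p \<noteq> 0" for p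
      using that c'(2) idx1[OF that(1)] unfolding lv_def by (auto split: if_splits)
    ultimately show ?thesis by (intro exI[of _ ?c]) blast
  qed
  have arr: "\<exists>f. aop n x a (bb (asource a) q) = (\<Sum>p<n (atarget a). cscale (f p) (bb (atarget a) p)) \<and>
      (\<forall>p<n (atarget a). f p \<noteq> 0 \<longrightarrow> lv (atarget a) p < lv (asource a) q \<and>
        (grd \<longrightarrow> vdeg (atarget a) p = vdeg (asource a) q + adeg c d a))"
    if a: "arrow_ok c a" and q: "q < n (asource a)" for a q
  proof -
    let ?s = "asource a" and ?t = "atarget a" and ?e = "vdeg (asource a) q + adeg c d a"
    let ?u = "aop n x a (bb (asource a) q)"
    obtain j where j: "vt j = ?t" "grd \<longrightarrow> dg j = ?e" using lab_ex by blast
    obtain k where k: "lv ?s q = Suc k" using bb(3)[OF q] by (cases "lv ?s q") auto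
    have "?u \<in> q.FF k ?t" using bb(1)[OF q] q.FF_Suc[of "bb ?s q" k ?s] a unfolding k by blast
    \<comment> \<open>The adapted basis controls the steps up to N only; at N the filtration is
      already all of V.\<close>
    moreover have "q.FF k ?t \<subseteq> q.FF (min k N) ?t"
      using N[of ?t] q.FF_V[of _ k ?t] by (cases "k \<le> N") (auto simp: min_def)
    moreover have lab: "jl ?t p = j" if nz: "?u p \<noteq> 0" for p
    proof -
      have "?u \<in> V ?t" by (rule aop_V[OF X])
      then have p: "p < n ?t" using nz by (auto simp: VV_def not_less[symmetric])
      have "vdeg ?t p = ?e" if g: grd
      proof (rule aop_degree[OF X _ nz g])
        fix p' assume p': "bb ?s q p' \<noteq> 0" and g: grd
        have "bb ?s q \<in> V ?s" using bb(1)[OF q] by (rule q.FF_V)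
        then have "p' < n ?s" using p' by (auto simp: VV_def not_less[symmetric])
        then show "vdeg ?s p' = vdeg ?s q" using bb(2)[OF q p'] dg_jl[OF g, of p' ?s] dg_jl[OF g q] by simp
      qed
      then show ?thesis using idx1[OF p] j dg_jl[OF _ p] by (intro lab_inj) auto
    qed
    ultimately have "?u \<in> S j (min k N)" unfolding S_def j(1) by blast
    then obtain f where f: "?u = (\<Sum>p<n ?t. cscale (f p) (bb ?t p))"
      "\<forall>p<n ?t. f p \<noteq> 0 \<longrightarrow> jl ?t p = j \<and> lv ?t p \<le> min k N"
      using span[of "min k N" ?u j] unfolding j(1) by auto
    have "\<forall>p<n ?t. f p \<noteq> 0 \<longrightarrow> lv ?t p < lv ?s q \<and> (grd \<longrightarrow> vdeg ?t p = ?e)"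
      using f(2) j(2) dg_jl k by (metis le_imp_less_Suc min.bounded_iff)
    then show ?thesis using f(1) by blast
  qed
  define C where "C a q = (SOME f. aop n x a (bb (asource a) q) = (\<Sum>p<n (atarget a). cscale (f p) (bb (atarget a) p)) \<and>
      (\<forall>p<n (atarget a). f p \<noteq> 0 \<longrightarrow> lv (atarget a) p < lv (asource a) q \<and>
        (grd \<longrightarrow> vdeg (atarget a) p = vdeg (asource a) q + adeg c d a)))" for a q
  have C: "aop n x a (bb (asource a) q) = (\<Sum>p<n (atarget a). cscale (C a q p) (bb (atarget a) p)) \<and>
      (\<forall>p<n (atarget a). C a q p \<noteq> 0 \<longrightarrow> lv (atarget a) p < lv (asource a) q \<and>
        (grd \<longrightarrow> vdeg (atarget a) p = vdeg (asource a) q + adeg c d a))"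
    if "arrow_ok c a" "q < n (asource a)" for a q
    unfolding C_def by (rule someI_ex[OF arr[OF that]])
  show ?thesis
  proof (rule that[of bb lv C])
    show "p < n i \<and> jl i p = jl i q" if q: "q < n i" and nz: "bb i q p \<noteq> 0" for i q p
      using bb(2)[OF q nz] q.FF_V[OF bb(1)[OF q]] nz by (auto simp: VV_def not_less[symmetric])
    show "\<exists>c. ev q = (\<Sum>p<n i. cscale (c p) (bb i p)) \<and> (\<forall>p<n i. c p \<noteq> 0 \<longrightarrow> jl i p = jl i q)" if q: "q < n i" for i q
    proof -
      have "ev q \<in> S (jl i q) N" unfolding S_def N using idx1[OF q] ev_VV[of q n i] q by (auto simp: ev_def)
      from span[OF _ this] show ?thesis using idx1[OF q] by auto
    qed
  qed (use bb C in auto)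
qed

end

context setting
begin

text \<open>Rescaling an adapted basis by powers of \<open>t\<close> according to the level moves \<open>x\<close> to \<open>0\<close> inside its orbit.\<close>

lemma invariant_poly_vanishes:
  assumes x: "x \<in> PS" and f: "f \<in> invariant_polys n wd XX GG"
  shows "f x = f (\<lambda>z. 0)"
proof -
  note X = PS_D(1)[OF x]
  show ?thesis
  proof (rule strictly_triangular_basis[OF x])
  fix bb lv C assume supp: "\<And>i q p. q < n i \<Longrightarrow> bb i q p \<noteq> 0 \<Longrightarrow> p < n i \<and> jl i p = jl i q"
    and lv: "\<And>i q. q < n i \<Longrightarrow> 0 < (lv i q :: nat)"
    and sp: "\<And>i q. q < n i \<Longrightarrow> \<exists>c. ev q = (\<Sum>p<n i. cscale (c p) (bb i p)) \<and> (\<forall>p<n i. c p \<noteq> 0 \<longrightarrow> jl i p = jl i q)"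
    and act: "\<And>a q. arrow_ok c a \<Longrightarrow> q < n (asource a) \<Longrightarrow>
      aop n x a (bb (asource a) q) = (\<Sum>p<n (atarget a). cscale (C a q p) (bb (atarget a) p))"
    and lvl: "\<And>a q p. arrow_ok c a \<Longrightarrow> q < n (asource a) \<Longrightarrow> p < n (atarget a) \<Longrightarrow> C a q p \<noteq> 0 \<Longrightarrow>
      lv (atarget a) p < lv (asource a) q \<and> (grd \<longrightarrow> vdeg (atarget a) p = vdeg (asource a) q + adeg c d a)"
  define P where "P t i = mat (n i) (n i) (\<lambda>(p, q). t ^ lv i q * bb i q p)" for t i
  \<comment> \<open>The entries of an arrow in the basis formed by the vectors t^lv bb. Levels drop
    strictly, so wherever the coefficient C is nonzero the exponent is positive and the entry
    vanishes at t = 0.\<close>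
  define D where "D t a p q = (if arrow_ok c a \<and> p < n (atarget a) \<and> q < n (asource a)
    then t ^ (lv (asource a) q - lv (atarget a) p) * C a q p else 0)" for t a p q
  define z where "z t u = (case u of CAlpha i j p q \<Rightarrow> D t (Al i j) p q | CEps i p q \<Rightarrow> D t (Ep i) p q
    | CA i m q \<Rightarrow> if m < wd i \<and> q < n i then t ^ lv i q * row x i m (bb i q) else 0 | CAs i p m \<Rightarrow> 0)" for t u
  have xe_z: "xe (z t) a p q = D t a p q" for t a p q by (cases a) (simp_all add: xe_def z_def)
  have Pc: "P t i \<in> carrier_mat (n i) (n i)" for t i by (simp add: P_def)
  have zX: "z t \<in> XX" for t
    unfolding XX_def
  proof (intro CollectI allI impI)
    fix u assume nz: "z t u \<noteq> 0"
    show "u \<in> coords c n wd \<and> okc u"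
    proof (cases u)
      case (CAlpha i j p q)
      then show ?thesis using nz lvl[of "Al i j" q p] by (auto simp: z_def D_def coords_def split: if_splits)
    next
      case (CEps i p q)
      then show ?thesis using nz lvl[of "Ep i" q p] by (auto simp: z_def D_def coords_def split: if_splits)
    next
      case (CA i m q)
      then have mq: "m < wd i" "q < n i" "row x i m (bb i q) \<noteq> 0" using nz by (auto simp: z_def split: if_splits)
      obtain p where p: "x (CA i m p) * bb i q p \<noteq> 0" using mq(3) unfolding row_def by (rule sum_nonzeroE)
      then have "x (CA i m p) \<noteq> 0" "bb i q p \<noteq> 0" by auto
      then have "grd \<longrightarrow> wdeg i m = vdeg i q - d i"
        using XX_CA[OF X] supp[OF mq(2)] dg_jl[of p i] dg_jl[of q i] mq(2) by fastforce
      then show ?thesis using CA mq by (auto simp: coords_def)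
    qed (use nz in \<open>simp add: z_def\<close>)
  qed
  have col: "gop (P t i) (n i) (ev q) = cscale (t ^ lv i q) (bb i q)" if q: "q < n i" for t i q
  proof
    fix p
    show "gop (P t i) (n i) (ev q) p = cscale (t ^ lv i q) (bb i q) p"
      using q supp[OF q, of p] by (cases "p < n i") (auto simp: gop_ev[OF q] P_def cscale_def)
  qed
  have PG: "P t \<in> GG" if t: "t \<noteq> 0" for t
  proof -
    have inv: "invertible_mat (P t i)" for i
    proof -
      have "\<exists>cc. \<forall>q<n i. ev q = (\<Sum>p<n i. cscale (cc q p) (bb i p))" using sp[of _ i] by metis
      then obtain cc where cc: "\<And>q. q < n i \<Longrightarrow> ev q = (\<Sum>p<n i. cscale (cc q p) (bb i p))" by blast
      define B where "B = mat (n i) (n i) (\<lambda>(m, q). inverse (t ^ lv i m) * cc q m)"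
      have Bc: "B \<in> carrier_mat (n i) (n i)" by (simp add: B_def)
      have PB: "P t i * B = 1\<^sub>m (n i)"
      proof (rule eq_matI)
        fix p q assume "p < dim_row (1\<^sub>m (n i) :: complex mat)" "q < dim_col (1\<^sub>m (n i) :: complex mat)"
        then have pq: "p < n i" "q < n i" by simp_all
        have "(P t i * B) $$ (p, q) = (\<Sum>m<n i. (t ^ lv i m * bb i m p) * (inverse (t ^ lv i m) * cc q m))"
          using pq by (simp add: P_def B_def scalar_prod_def atLeast0LessThan)
        also have "\<dots> = (\<Sum>m<n i. cc q m * bb i m p)" using t by (intro sum.cong refl) simp
        also have "\<dots> = (\<Sum>m<n i. cscale (cc q m) (bb i m)) p" unfolding sum_cscale ..
        also have "\<dots> = ev q p" using cc[OF pq(2)] by (simp only:)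
        finally show "(P t i * B) $$ (p, q) = 1\<^sub>m (n i) $$ (p, q)" using pq by (simp add: ev_def)
      qed (simp_all add: P_def B_def)
      moreover have "B * P t i = 1\<^sub>m (n i)" by (rule mat_mult_left_right_inverse[OF Pc Bc PB])
      ultimately show ?thesis using Pc[of t i] Bc unfolding invertible_mat_def inverts_mat_def by auto
    qed
    have "vdeg i p = vdeg i q" if "grd" "p < n i" "q < n i" "P t i $$ (p, q) \<noteq> 0" for i p q
      using that supp[OF that(3), of p] dg_jl[of p i] dg_jl[of q i] by (auto simp: P_def)
    then show ?thesis unfolding GG_def using inv Pc by blast
  qed
  have acts: "acts_to n wd (P t) (z t) x" for t
  proof (rule acts_toI[OF zX X Pc])
    fix a q p assume a: "arrow_ok c a" and q: "q < n (asource a)" and p: "p < n (atarget a)"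
    let ?s = "asource a" and ?t = "atarget a"
    have "gop (P t ?t) (n ?t) (aop n (z t) a (ev q)) p = (\<Sum>m<n ?t. P t ?t $$ (p, m) * D t a m q)"
      using p by (simp add: gop_def aop_ev[OF q] xe_z)
    also have "\<dots> = (\<Sum>m<n ?t. t ^ lv ?s q * (C a q m * bb ?t m p))"
    proof (intro sum.cong refl)
      fix m assume "m \<in> {..<n ?t}"
      then have m: "m < n ?t" by simp
      show "P t ?t $$ (p, m) * D t a m q = t ^ lv ?s q * (C a q m * bb ?t m p)"
      proof (cases "C a q m = 0")
        case False
        then have "t ^ lv ?s q = t ^ (lv ?s q - lv ?t m) * t ^ lv ?t m"
          using lvl[OF a q m] by (simp add: power_add[symmetric])
        then show ?thesis using a p q m by (simp add: P_def D_def)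
      qed (simp add: D_def)
    qed
    also have "\<dots> = t ^ lv ?s q * (\<Sum>m<n ?t. cscale (C a q m) (bb ?t m)) p"
      unfolding sum_cscale sum_distrib_left ..
    also have "\<dots> = aop n x a (gop (P t ?s) (n ?s) (ev q)) p"
      unfolding col[OF q] clin_scale[OF clin_aop] act[OF a q, symmetric] by (simp add: cscale_def)
    finally show "aop n x a (gop (P t ?s) (n ?s) (ev q)) p = gop (P t ?t) (n ?t) (aop n (z t) a (ev q)) p" ..
  next
    fix i m q assume m: "m < wd i" and q: "q < n i"
    show "row x i m (gop (P t i) (n i) (ev q)) = z t (CA i m q)"
      unfolding col[OF q] row_scale using m q by (simp add: z_def)
  qed (use PS_D(6)[OF x] in \<open>simp_all add: as0_def z_def\<close>)
  \<comment> \<open>At t = 0 the base change is in general no longer invertible; that value is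
    reached by continuity.\<close>
  have eq: "f (z t) = f x" if "t \<noteq> 0" for t
    using f PG[OF that] zX[of t] X acts[of t] unfolding invariant_polys_def by blast
  have cont: "isCont (\<lambda>t. z t u) 0" for u
  proof -
    have 1: "isCont (\<lambda>t. if b then t ^ k * y else 0) (0 :: complex)" for b k y
      by (cases b) (simp_all add: isCont_power)
    show ?thesis
    proof (cases u)
      case (CAlpha i j p q)
      show ?thesis unfolding CAlpha z_def D_def coord.case by (rule 1)
    next
      case (CEps i p q)
      show ?thesis unfolding CEps z_def D_def coord.case by (rule 1)
    next
      case (CA i m q)
      show ?thesis unfolding CA z_def coord.case by (rule 1)
    next
      case (CAs i p m)
      show ?thesis unfolding CAs z_def coord.case by (rule continuous_const)
    qed
  qed
  have "polyfun f" using f unfolding invariant_polys_def by simp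
  then have "isCont (\<lambda>t. f (z t)) 0" by (rule isCont_polyfun[OF _ cont])
  then have "(\<lambda>t. f (z t)) \<midarrow>0\<rightarrow> f (z 0)" by (simp add: isCont_def)
  moreover have "(\<lambda>t. f (z t)) \<midarrow>0\<rightarrow> f x"
    by (rule tendsto_eventually) (use eq in \<open>auto simp: eventually_at_filter\<close>)
  ultimately have "f (z 0) = f x" by (rule LIM_unique)
  moreover have "z 0 = (\<lambda>u. 0)"
  proof
    fix u
    have "D 0 a p q = 0" for a p q using lvl[of a q p] by (cases "C a q p = 0") (auto simp: D_def)
    then show "z 0 u = 0" using lv by (cases u) (auto simp: z_def)
  qed
  ultimately show ?thesis by simp
  qed
qed

section \<open>The homeomorphism\<close>

abbreviation "ST \<equiv> stable_points c n wd XX"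
abbreviation "CF \<equiv> critical_locus c n wd XX GG (potential c Or (gamma_sum s ii \<gamma>) n wd) \<inter> nilpotent_fibre c n wd XX GG"

text \<open>Membership in the critical locus and in the nilpotent fibre may be witnessed by
  different points of the orbit. Invariance of the polynomials transports the second condition to
  the first point, where both together give \<open>PS\<close>.\<close>

lemma orb_CF:
  assumes x: "x \<in> ST" shows "orb x \<in> CF \<longleftrightarrow> x \<in> PS"
proof
  assume cf: "orb x \<in> CF"
  have X: "x \<in> XX" using x by (simp add: stable_points_def)
  obtain x' where x': "orb x = orb x'" "x' \<in> ST"
    and cr: "\<forall>y\<in>XX. ((\<lambda>t. potential c Or (gamma_sum s ii \<gamma>) n wd (\<lambda>z. x' z + t * y z)) has_field_derivative 0) (at 0)"
    using cf unfolding critical_locus_def by auto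
  obtain x'' where x'': "orb x = orb x''" "x'' \<in> ST" and nl: "\<forall>f\<in>invariant_polys n wd XX GG. f x'' = f (\<lambda>z. 0)"
    using cf unfolding nilpotent_fibre_def by auto
  have X': "x' \<in> XX" "stable c n wd x'" and X'': "x'' \<in> XX" using x' x'' by (simp_all add: stable_points_def)
  have "x' \<in> orb x''" using orb_self[OF X'(1)] x' x'' by simp
  then obtain g where g: "g \<in> GG" "acts_to n wd g x'' x'" unfolding orbit_of_def by auto
  have "\<forall>f\<in>invariant_polys n wd XX GG. f x' = f (\<lambda>z. 0)"
  proof
    fix f assume f: "f \<in> invariant_polys n wd XX GG"
    then have "f x'' = f x'" using g X' X'' unfolding invariant_polys_def by blast
    moreover have "f x'' = f (\<lambda>z. 0)" using nl f by (rule bspec)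
    ultimately show "f x' = f (\<lambda>z. 0)" by (rule trans[OF sym])
  qed
  then have a: "as0 x'" by (rule nilpotent_as0[OF X'])
  then have "x' \<in> PS" using critical_iff[OF X'(1) a] cr X' by (simp add: PS_def)
  then show "x \<in> PS" using orb_PS[of x'] orb_self[OF X] x'(1) by blast
next
  assume p: "x \<in> PS"
  note X = PS_D(1)[OF p] and a = PS_D(6)[OF p]
  have "orb x \<in> critical_locus c n wd XX GG (potential c Or (gamma_sum s ii \<gamma>) n wd)"
    unfolding critical_locus_def using x critical_iff[OF X a] PS_D[OF p] by blast
  moreover have "orb x \<in> nilpotent_fibre c n wd XX GG"
    unfolding nilpotent_fibre_def using x invariant_poly_vanishes[OF p] by blast
  ultimately show "orb x \<in> CF" by blast
qed

lemma PS_stable: "PS \<subseteq> ST"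
  by (auto simp: PS_def stable_points_def)

lemma CF_eq: "CF = orb ` PS"
proof (intro Set.set_eqI iffI)
  fix A assume A: "A \<in> CF"
  then obtain x where x: "A = orb x" "x \<in> ST" unfolding critical_locus_def by auto
  then show "A \<in> orb ` PS" using orb_CF A by blast
next
  fix A assume "A \<in> orb ` PS"
  then show "A \<in> CF" using orb_CF PS_stable by blast
qed

text \<open>Among the stable points \<open>PS\<close> is cut out by the entries of the relations,
  which are polynomials in x, and by the coordinates of \<open>a\<^sup>*\<close>.\<close>

lemma PS_closed: "closedin (subtopology zariski ST) PS" "closedin (subtopology euclidean ST) PS"
proof -
  define f1 where "f1 i j p q x = opw n x (replicate (ff i j) (Ep i)) (aop n x (Al i j) (ev q)) p
       - aop n x (Al i j) (opw n x (replicate (ff j i) (Ep j)) (ev q)) p" for i j p q x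
  define f2 where "f2 i p q x = (\<Sum>j\<in>UNIV. \<Sum>k<ff i j. osign Or i j *
        opw n x (replicate k (Ep i)) (aop n x (Al i j) (aop n x (Al j i)
          (opw n x (replicate (ff i j - 1 - k) (Ep i)) (ev q)))) p)" for i p q x
  define f3 where "f3 r m q x = row x (ii r) (wpos r m) (aop n x (Ep (ii r)) (ev q))
       - (case m of 0 \<Rightarrow> 0 | Suc m' \<Rightarrow> gs r m' * row x (ii r) (wpos r m') (ev q))" for r m q x
  let ?F = "(\<lambda>(i, j, p, q). f1 i j p q) ` {(i, j, p, q). c i j < 0 \<and> q < n j} \<union> (\<lambda>(i, p, q). f2 i p q) ` {(i, p, q). q < n i}
    \<union> (\<lambda>(r, m, q). f3 r m q) ` {(r, m, q). r \<in> RS \<and> m < ll r \<and> q < n (ii r)} \<union> range (\<lambda>(i, p, m) x. x (CAs i p m))"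
  have "polyfun (f1 i j p q)" for i j p q
    unfolding f1_def by (intro polyfun_diff polyfun_opw polyfun_aop polyfun_const)
  moreover have "polyfun (f2 i p q)" for i p q
    unfolding f2_def by (intro polyfun_sum polyfun_cmult polyfun_opw polyfun_aop polyfun_const)
  moreover have "polyfun (f3 r m q)" for r m q
    unfolding f3_def by (cases m; simp only: nat.case; intro polyfun_diff polyfun_cmult polyfun_row polyfun_aop polyfun_const)
  ultimately have F: "\<forall>f\<in>?F. polyfun f" by (auto intro: polyfun_coord)
  have "PS = {x \<in> ST. \<forall>f\<in>?F. f x = 0}"
  proof (intro Set.set_eqI)
    fix x
    have 1: "EQc x \<longleftrightarrow> (\<forall>i j p q. c i j < 0 \<and> q < n j \<longrightarrow> f1 i j p q x = 0)" by (simp add: EQc_def f1_def)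
    have 2: "EQm x \<longleftrightarrow> (\<forall>i p q. q < n i \<longrightarrow> f2 i p q x = 0)" by (simp add: EQm_def f2_def)
    have 3: "EQa x \<longleftrightarrow> (\<forall>r m q. r \<in> RS \<and> m < ll r \<and> q < n (ii r) \<longrightarrow> f3 r m q x = 0)"
      unfolding EQa_def f3_def by (simp only: right_minus_eq)
    have "(\<forall>f\<in>(\<lambda>(i, j, p, q). f1 i j p q) ` {(i, j, p, q). c i j < 0 \<and> q < n j}. f x = 0) \<longleftrightarrow> EQc x" unfolding 1 by auto
    moreover have "(\<forall>f\<in>(\<lambda>(i, p, q). f2 i p q) ` {(i, p, q). q < n i}. f x = 0) \<longleftrightarrow> EQm x" unfolding 2 by auto
    moreover have "(\<forall>f\<in>(\<lambda>(r, m, q). f3 r m q) ` {(r, m, q). r \<in> RS \<and> m < ll r \<and> q < n (ii r)}. f x = 0) \<longleftrightarrow> EQa x"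
      unfolding 3 by auto
    moreover have "(\<forall>f\<in>range (\<lambda>(i, p, m) x. x (CAs i p m)). f x = 0) \<longleftrightarrow> as0 x" unfolding as0_def by auto
    ultimately have "(\<forall>f\<in>?F. f x = 0) \<longleftrightarrow> ((EQc x \<and> EQm x) \<and> EQa x) \<and> as0 x"
      unfolding ball_Un by (simp only:)
    then show "x \<in> PS \<longleftrightarrow> x \<in> {x \<in> ST. \<forall>f\<in>?F. f x = 0}" by (auto simp: PS_def stable_points_def)
  qed
  then show "closedin (subtopology zariski ST) PS" "closedin (subtopology euclidean ST) PS"
    using closedin_polynomial_zeros[OF F, of ST] by simp_all
qed

theorem homeomorphism:
  "\<exists>h. homeomorphic_map (subtopology (quotient_top (subtopology euclidean ST) orb) CF)
        (quotient_top (subtopology euclidean FS) frame_span) h \<and>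
      homeomorphic_map (subtopology (quotient_top (subtopology zariski ST) orb) CF)
        (quotient_top (subtopology zariski FS) frame_span) h"
proof -
  \<comment> \<open>A point of the orbit is chosen; by \<open>orb_PS\<close> the submodule does not
    depend on the choice.\<close>
  define h where "h A = frame_span (Psi (SOME x. x \<in> PS \<and> orb x = A))" for A
  have h: "h (orb x) = frame_span (Psi x)" if x: "x \<in> PS" for x
  proof -
    define y where "y = (SOME y. y \<in> PS \<and> orb y = orb x)"
    have y: "y \<in> PS \<and> orb y = orb x" unfolding y_def by (rule someI[of _ x]) (simp add: x)
    then have "y \<in> orb x" using orb_self[OF PS_D(1), of y] by simp
    then have "HH y = HH x" using orb_PS[OF x] by simp
    then show ?thesis unfolding h_def y_def[symmetric] using frame_span_Psi x y by simp
  qed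
  have inj: "orb x = orb y" if x: "x \<in> PS" and y: "y \<in> PS" and eq: "frame_span (Psi x) = frame_span (Psi y)" for x y
  proof -
    have "unhat ` HH x = unhat ` HH y" using eq frame_span_Psi x y by simp
    then have "hat ` (unhat ` HH x) = hat ` (unhat ` HH y)" by (rule arg_cong)
    then have "HH x = HH y" unfolding hat_unhat_HH[OF x] hat_unhat_HH[OF y] .
    then show ?thesis by (simp add: orb_PS x y)
  qed
  have sat: "\<And>x. x \<in> ST \<Longrightarrow> orb x \<in> CF \<longleftrightarrow> x \<in> PS" by (rule orb_CF)
  have PsiI: "Psi ` PS \<subseteq> FS" and ThI: "Theta ` FS \<subseteq> PS" using Psi_FS Theta by auto
  have PsiR: "locally_rational PS Psi" by (rule locally_rational_polynomial[OF polyfun_Psi])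
  have "homeomorphic_map (subtopology (quotient_top (subtopology euclidean ST) orb) CF)
        (quotient_top (subtopology euclidean FS) frame_span) h"
  proof (rule homeomorphic_quotients[where P = PS and \<Psi> = Psi and \<Theta> = Theta])
    show "closedin (subtopology euclidean ST) PS" by (rule PS_closed)
    show "CF = orb ` PS" by (rule CF_eq)
    show "continuous_map (subtopology euclidean PS) (subtopology euclidean FS) Psi" by (rule continuous_map_euclidean_rational[OF PsiR PsiI])
    show "continuous_map (subtopology euclidean FS) (subtopology euclidean PS) Theta"
      by (rule continuous_map_euclidean_rational[OF locally_rational_Theta ThI])
  qed (fact sat Theta_Psi Theta(2) h inj | simp)+
  moreover have "homeomorphic_map (subtopology (quotient_top (subtopology zariski ST) orb) CF)
        (quotient_top (subtopology zariski FS) frame_span) h"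
  proof (rule homeomorphic_quotients[where P = PS and \<Psi> = Psi and \<Theta> = Theta])
    show "closedin (subtopology zariski ST) PS" by (rule PS_closed)
    show "CF = orb ` PS" by (rule CF_eq)
    show "continuous_map (subtopology zariski PS) (subtopology zariski FS) Psi" by (rule continuous_map_zariski[OF PsiR PsiI])
    show "continuous_map (subtopology zariski FS) (subtopology zariski PS) Theta"
      by (rule continuous_map_zariski[OF locally_rational_Theta ThI])
  qed (fact sat Theta_Psi Theta(2) h inj | simp)+
  ultimately show ?thesis by blast
qed

end

section \<open>The two cases\<close>

context preproj_dual
begin

lemma sum_vertex_parts:
  assumes U: "pi_submodule c Or KG U" and \<phi>: "\<phi> \<in> U"
  shows "\<phi> = (\<Sum>i\<in>UNIV. mact KG (pi_e c Or i) \<phi>)"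
proof (rule hat_inj)
  have UK: "U \<subseteq> mcarrier KG" using U by (simp add: pi_submodule_iff)
  show "\<phi> \<in> mcarrier KG" using \<phi> UK by blast
  show "(\<Sum>i\<in>UNIV. mact KG (pi_e c Or i) \<phi>) \<in> mcarrier KG"
    using mact_ee(1)[OF U \<phi>] UK by (intro cfun.subspace_sum[OF subspace_carrier]) blast
  show "hat \<phi> = hat (\<Sum>i\<in>UNIV. mact KG (pi_e c Or i) \<phi>)"
  proof
    fix y :: "nat \<times> 'i qpath"
    obtain r t w where y: "y = (r, t, w)" by (cases y) auto
    have "hat (\<Sum>i\<in>UNIV. mact KG (pi_e c Or i) \<phi>) = (\<Sum>i\<in>UNIV. opr i (hat \<phi>))"
      by (simp only: hat_sum mact_ee(2)[OF U \<phi>])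
    then have "hat (\<Sum>i\<in>UNIV. mact KG (pi_e c Or i) \<phi>) y = (\<Sum>i\<in>UNIV. opr i (hat \<phi>) y)"
      by (simp only: sum_apply)
    also have "\<dots> = (\<Sum>i\<in>UNIV. if i = t then hat \<phi> y else 0)"
      unfolding y by (intro sum.cong) (auto simp: opr_def)
    finally show "hat \<phi> y = hat (\<Sum>i\<in>UNIV. mact KG (pi_e c Or i) \<phi>) y" by simp
  qed
qed

lemma span_pieces:
  assumes U: "pi_submodule c Or KG U" shows "U = cfun.span (\<Union>i. piece c Or KG U i)"
proof
  have "\<phi> \<in> cfun.span (\<Union>i. piece c Or KG U i)" if \<phi>: "\<phi> \<in> U" for \<phi>
  proof (subst sum_vertex_parts[OF U \<phi>], intro cfun.span_sum cfun.span_base)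
    fix i show "mact KG (pi_e c Or i) \<phi> \<in> (\<Union>i. piece c Or KG U i)" using \<phi> by (auto simp: piece_def)
  qed
  then show "U \<subseteq> cfun.span (\<Union>i. piece c Or KG U i)" by blast
  show "cfun.span (\<Union>i. piece c Or KG U i) \<subseteq> U"
    using piece_eq[OF U] by (intro cfun.span_minimal subspace_submodule[OF U]) auto
qed

text \<open>The idempotents e_i have degree 0, so the vertex components of a homogeneous element of
  U are homogeneous elements of U. Spanning by degrees and spanning by pairs of vertex and degree
  therefore amount to the same.\<close>

lemma graded_submodule_iff:
  assumes U: "pi_submodule c Or KG U"
  shows "graded_submodule c Or KG U \<longleftrightarrow> U = cfun.span (\<Union>j. piece_gr c Or KG U j)"
proof -
  have UK: "U \<subseteq> mcarrier KG" using U by (simp add: pi_submodule_iff)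
  have 1: "cfun.span (\<Union>j. piece_gr c Or KG U j) \<subseteq> cfun.span (\<Union>m. U \<inter> mdegree KG m)"
    using piece_eq[OF U] by (intro cfun.span_mono) (auto simp: piece_gr_def)
  have 2: "cfun.span (\<Union>m. U \<inter> mdegree KG m) \<subseteq> U"
    by (intro cfun.span_minimal subspace_submodule[OF U]) auto
  have "\<phi> \<in> cfun.span (\<Union>j. piece_gr c Or KG U j)" if \<phi>: "\<phi> \<in> U" "\<phi> \<in> mdegree KG m" for \<phi> m
  proof -
    have "mact KG (pi_e c Or i) \<phi> \<in> cfun.span (\<Union>j. piece_gr c Or KG U j)" for i
    proof (rule cfun.span_base)
      have "\<phi> \<in> mcarrier KG" using \<phi>(1) UK by blast
      note 1 = mdegree_hat[OF this, THEN iffD1, OF \<phi>(2), rule_format]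
      have "mact KG (pi_e c Or i) \<phi> \<in> mcarrier KG" using mact_ee(1)[OF U \<phi>(1)] UK by blast
      then have "mact KG (pi_e c Or i) \<phi> \<in> mdegree KG m"
      proof (rule mdegree_hat[THEN iffD2], intro allI impI)
        fix r p assume "hat (mact KG (pi_e c Or i) \<phi>) (r, p) \<noteq> 0"
        then have "hat \<phi> (r, p) \<noteq> 0" unfolding mact_ee(2)[OF U \<phi>(1)] by (auto simp: opr_def split: if_splits)
        then show "pdeg c d p = kk r + int (ll r) * d (ii r) - m" by (rule 1)
      qed
      then have "mact KG (pi_e c Or i) \<phi> \<in> piece_gr c Or KG U (i, m)" using \<phi> by (auto simp: piece_gr_def piece_def)
      then show "mact KG (pi_e c Or i) \<phi> \<in> (\<Union>j. piece_gr c Or KG U j)" by blast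
    qed
    then have "(\<Sum>i\<in>UNIV. mact KG (pi_e c Or i) \<phi>) \<in> cfun.span (\<Union>j. piece_gr c Or KG U j)" by (intro cfun.span_sum)
    then show ?thesis by (subst sum_vertex_parts[OF U \<phi>(1)])
  qed
  then have "cfun.span (\<Union>m. U \<inter> mdegree KG m) \<subseteq> cfun.span (\<Union>j. piece_gr c Or KG U j)"
    by (intro cfun.span_minimal cfun.subspace_span) blast
  with 1 have "cfun.span (\<Union>m. U \<inter> mdegree KG m) = cfun.span (\<Union>j. piece_gr c Or KG U j)" by blast
  then show ?thesis using U by (simp add: graded_submodule_def)
qed

end

lemma frames_cong:
  assumes "\<And>U j. U \<in> \<G> \<Longrightarrow> pc U j = pc' U j" shows "frames pc v \<G> = frames pc' v \<G>"
  unfolding frames_def using assms by auto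

text \<open>Vectors of one degree are consecutive in \<open>deg_list\<close>, so a position is the
  offset of its degree block plus a rank inside it. Finiteness matters since
  \<open>sorted_list_of_set\<close> is empty on infinite sets.\<close>

lemma deg_list_blocks:
  fixes v :: "'i \<Rightarrow> int \<Rightarrow> nat"
  assumes f: "finite {m. v i m \<noteq> 0}"
  defines "ms \<equiv> sorted_list_of_set {m. v i m \<noteq> 0}"
  shows "p < dims (deg_list v) i \<Longrightarrow> (let m = deg_list v i ! p in
      boff (v i) ms m \<le> p \<and> p - boff (v i) ms m < v i m)"
    "q < v i m \<Longrightarrow> boff (v i) ms m + q < dims (deg_list v) i \<and> deg_list v i ! (boff (v i) ms m + q) = m"
proof -
  have ms: "set ms = {m. v i m \<noteq> 0}" "distinct ms" using f by (simp_all add: ms_def)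
  have len: "dims (deg_list v) i = sum_list (map (v i) ms)"
    unfolding dims_def deg_list_def ms_def by (rule length_concat_blocks) simp
  have nth: "deg_list v i ! (boff (v i) ms m + q) = m" if "m \<in> set ms" "q < v i m" for m q
  proof -
    have "deg_list v i ! (boff (v i) ms m + q) = replicate (v i m) m ! q"
      unfolding deg_list_def ms_def[symmetric] by (rule concat_blocks_nth) (use that in auto)
    then show ?thesis using that(2) by simp
  qed
  show "q < v i m \<Longrightarrow> boff (v i) ms m + q < dims (deg_list v) i \<and> deg_list v i ! (boff (v i) ms m + q) = m"
    unfolding len using nth[of m q] boff_less[of m ms q "v i"] ms by auto
  assume "p < dims (deg_list v) i"
  then obtain m q where "m \<in> set ms" "q < v i m" "p = boff (v i) ms m + q"
    using boff_surj[OF ms(2), of p "v i"] len by auto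
  then show "let m = deg_list v i ! p in boff (v i) ms m \<le> p \<and> p - boff (v i) ms m < v i m"
    using nth[of m q] by (simp add: Let_def)
qed

theorem proposition5p1:
  fixes c :: "'i::finite \<Rightarrow> 'i \<Rightarrow> int" and d :: "'i \<Rightarrow> int" and Or :: "('i \<times> 'i) set"
    and s :: nat and ii :: "nat \<Rightarrow> 'i" and k :: "nat \<Rightarrow> int" and l :: "nat \<Rightarrow> nat"
    and \<gamma> :: "nat \<Rightarrow> complex mat"
  assumes "simple_cartan_matrix c"
    and "minimal_symmetrizer c d"
    and "orientation c Or"
    and "\<forall>r\<in>{1..s}. 0 < l r"
    and "\<forall>r\<in>{1..s}. regular_nilpotent (l r) (\<gamma> r) \<and>
           homogeneous_mat (2 * d (ii r)) (block_degs (d (ii r)) (k r) (l r))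
             (block_degs (d (ii r)) (k r) (l r)) (\<gamma> r)"
  shows "(\<forall>v :: 'i \<Rightarrow> nat. \<exists>h.
            homeomorphic_map
              (crit_fibre_top euclidean c Or (gamma_sum s ii \<gamma>) v (dims (W_degs d s ii k l)))
              (Gr_top euclidean c Or (K_gamma c d Or s ii k l) v) h \<and>
            homeomorphic_map
              (crit_fibre_top zariski c Or (gamma_sum s ii \<gamma>) v (dims (W_degs d s ii k l)))
              (Gr_top zariski c Or (K_gamma c d Or s ii k l) v) h) \<and>
         (\<forall>v :: 'i \<Rightarrow> int \<Rightarrow> nat. finite {(i, n). v i n \<noteq> 0} \<longrightarrow> (\<exists>h.
            homeomorphic_map
              (crit_fibre_top_gr euclidean c d Or (gamma_sum s ii \<gamma>) (deg_list v) (W_degs d s ii k l))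
              (Gr_gr_top euclidean c Or (K_gamma c d Or s ii k l) v) h \<and>
            homeomorphic_map
              (crit_fibre_top_gr zariski c d Or (gamma_sum s ii \<gamma>) (deg_list v) (W_degs d s ii k l))
              (Gr_gr_top zariski c Or (K_gamma c d Or s ii k l) v) h))"
proof (intro conjI allI impI)
  have csym: "c j i < 0" if "c i j < 0" for i j
  proof -
    have "c i i = 2" "c i j = 0 \<longleftrightarrow> c j i = 0" "i \<noteq> j \<Longrightarrow> c j i \<le> 0"
      using assms(1) unfolding simple_cartan_matrix_def by metis+
    then show ?thesis using that by (cases "i = j") auto
  qed
  interpret K: preproj_dual c d Or s ii k l
    by unfold_locales (use csym assms(4) in auto)
  let ?w = "dims (W_degs d s ii k l)" and ?K = "K_gamma c d Or s ii k l"
  {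
    fix v :: "'i \<Rightarrow> nat"
    \<comment> \<open>Ungraded case: labels are the vertices, positions and ranks coincide, and all
      degrees are set to 0.\<close>
    interpret S: setting c d Or s ii k l \<gamma> False v "\<lambda>_ _. 0" "\<lambda>i. i" "\<lambda>_. 0" v "\<lambda>_ q. q" "\<lambda>i p. i" "\<lambda>i p. p"
      by unfold_locales (use assms in auto)
    have okc: "S.okc z" for z by (cases z) simp_all
    have X: "S.XX = Xrep c v ?w" unfolding S.XX_def Xrep_def S.wd_def using okc by auto
    have G: "S.GG = GLrep v" unfolding S.GG_def GLrep_def by simp
    have pc: "S.pcs U i = piece c Or ?K U i" if "pi_submodule c Or ?K U" for U i
      unfolding S.pcs_def K.piece_eq[OF that] by simp
    have Gr: "S.Gset = Gr c Or ?K v"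
    proof (intro Set.set_eqI)
      fix U
      show "U \<in> S.Gset \<longleftrightarrow> U \<in> Gr c Or ?K v"
        unfolding S.Gset_def Gr_def using pc[of U] K.span_pieces[of U] by auto
    qed
    have F: "S.FS = frames (piece c Or ?K) v (Gr c Or ?K v)"
      unfolding S.FS_def Gr by (rule frames_cong) (auto simp: Gr_def pc)
    show "\<exists>h. homeomorphic_map (crit_fibre_top euclidean c Or (gamma_sum s ii \<gamma>) v ?w)
              (Gr_top euclidean c Or (K_gamma c d Or s ii k l) v) h \<and>
            homeomorphic_map (crit_fibre_top zariski c Or (gamma_sum s ii \<gamma>) v ?w)
              (Gr_top zariski c Or (K_gamma c d Or s ii k l) v) h"
      using S.homeomorphism unfolding crit_fibre_top_def Let_def quiver_variety_top_def Gr_top_def F X G S.wd_def .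
  next
    fix v :: "'i \<Rightarrow> int \<Rightarrow> nat" assume fin: "finite {(i, n). v i n \<noteq> 0}"
    have fi: "finite {m. v i m \<noteq> 0}" for i
      by (rule finite_subset[of _ "snd ` {(i, n). v i n \<noteq> 0}"]) (use fin in force)+
    let ?vd = "deg_list v"
    let ?b = "\<lambda>i. boff (v i) (sorted_list_of_set {m. v i m \<noteq> 0})"
    have b1: "?b i (?vd i ! p) \<le> p \<and> p - ?b i (?vd i ! p) < v i (?vd i ! p)" if "p < dims ?vd i" for i p
      using deg_list_blocks(1)[where v = v and i = i, OF fi that] by (simp add: Let_def)
    have b2: "?b i m + q < dims ?vd i \<and> ?vd i ! (?b i m + q) = m" if "q < v i m" for i m q
      by (rule deg_list_blocks(2)[where v = v and i = i and m = m, OF fi that])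
    \<comment> \<open>Graded case: labels are pairs of vertex and degree, and the q-th vector of a
      label stands at the offset of its degree block plus q.\<close>
    interpret S: setting c d Or s ii k l \<gamma> True "dims ?vd" "\<lambda>i p. ?vd i ! p" fst snd "\<lambda>(i, m). v i m"
      "\<lambda>(i, m) q. ?b i m + q" "\<lambda>i p. (i, ?vd i ! p)" "\<lambda>i p. p - ?b i (?vd i ! p)"
    proof unfold_locales
      fix i p assume "p < dims ?vd i"
      then show "fst (i, ?vd i ! p) = i \<and> p - ?b i (?vd i ! p) < (case (i, ?vd i ! p) of (i, m) \<Rightarrow> v i m) \<and>
        (case (i, ?vd i ! p) of (i, m) \<Rightarrow> \<lambda>q. ?b i m + q) (p - ?b i (?vd i ! p)) = p"
        using b1[of p i] by simp
    next
      fix j :: "'i \<times> int" and q assume "q < (case j of (i, m) \<Rightarrow> v i m)"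
      then show "(case j of (i, m) \<Rightarrow> \<lambda>q. ?b i m + q) q < dims ?vd (fst j) \<and>
        (fst j, ?vd (fst j) ! (case j of (i, m) \<Rightarrow> \<lambda>q. ?b i m + q) q) = j \<and>
        (case j of (i, m) \<Rightarrow> \<lambda>q. ?b i m + q) q -
          ?b (fst j) (?vd (fst j) ! (case j of (i, m) \<Rightarrow> \<lambda>q. ?b i m + q) q) = q"
        using b2 by (cases j) simp
    qed (use assms in \<open>auto simp: prod_eq_iff\<close>)
    have wd: "S.wd = ?w" by (rule S.wd_def)
    have X: "S.XX = Xrep_gr c d ?vd (W_degs d s ii k l)"
    proof (intro Set.set_eqI iffI)
      fix x assume x: "x \<in> S.XX"
      have nz: "z \<in> coords c (dims ?vd) ?w \<and> S.okc z" if "x z \<noteq> 0" for z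
        using S.XX_D[OF x that] unfolding wd .
      have "x \<in> Xrep c (dims ?vd) ?w" unfolding Xrep_def using nz by blast
      moreover have "homogeneous_mat (bform c d i j) (?vd i) (?vd j) (alphaM (dims ?vd) x i j)" for i j
        unfolding homogeneous_mat_def using nz[of "CAlpha i j _ _"] by (auto simp: alphaM_def dims_def)
      moreover have "homogeneous_mat (- d i) (W_degs d s ii k l i) (?vd i) (aM (dims ?vd) ?w x i)" for i
        unfolding homogeneous_mat_def using nz[of "CA i _ _"] by (auto simp: aM_def dims_def S.wdeg_def)
      moreover have "homogeneous_mat (- d i) (?vd i) (W_degs d s ii k l i) (asM (dims ?vd) ?w x i)" for i
        unfolding homogeneous_mat_def using nz[of "CAs i _ _"] by (auto simp: asM_def dims_def S.wdeg_def)
      moreover have "homogeneous_mat (2 * d i) (?vd i) (?vd i) (epsM (dims ?vd) x i)" for i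
        unfolding homogeneous_mat_def using nz[of "CEps i _ _"] by (auto simp: epsM_def dims_def)
      ultimately show "x \<in> Xrep_gr c d ?vd (W_degs d s ii k l)" unfolding Xrep_gr_def by blast
    next
      fix x assume x: "x \<in> Xrep_gr c d ?vd (W_degs d s ii k l)"
      have x1: "\<And>z. x z \<noteq> 0 \<Longrightarrow> z \<in> coords c (dims ?vd) ?w"
        and x2: "\<And>i j. homogeneous_mat (bform c d i j) (?vd i) (?vd j) (alphaM (dims ?vd) x i j)"
        and x3: "\<And>i. homogeneous_mat (- d i) (W_degs d s ii k l i) (?vd i) (aM (dims ?vd) ?w x i)"
        and x4: "\<And>i. homogeneous_mat (- d i) (?vd i) (W_degs d s ii k l i) (asM (dims ?vd) ?w x i)"
        and x5: "\<And>i. homogeneous_mat (2 * d i) (?vd i) (?vd i) (epsM (dims ?vd) x i)"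
        using x unfolding Xrep_gr_def Xrep_def by auto
      have "S.okc z" if nz: "x z \<noteq> 0" for z
      proof (cases z)
        case (CAlpha i j p q)
        then show ?thesis using x1[OF nz] x2[of i j] nz by (auto simp: homogeneous_mat_def alphaM_def dims_def coords_def)
      next
        case (CA i p q)
        then show ?thesis using x1[OF nz] x3[of i] nz
          by (auto simp: homogeneous_mat_def aM_def dims_def coords_def S.wdeg_def)
      next
        case (CAs i p q)
        then show ?thesis using x1[OF nz] x4[of i] nz
          by (auto simp: homogeneous_mat_def asM_def dims_def coords_def S.wdeg_def)
      next
        case (CEps i p q)
        then show ?thesis using x1[OF nz] x5[of i] nz by (auto simp: homogeneous_mat_def epsM_def dims_def coords_def)
      qed
      then show "x \<in> S.XX" unfolding S.XX_def wd using x1 by blast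
    qed
    have G: "S.GG = GLrep_gr ?vd"
      unfolding S.GG_def GLrep_gr_def GLrep_def homogeneous_mat_def dims_def by auto
    have pc: "S.pcs U j = piece_gr c Or ?K U j" if U: "pi_submodule c Or ?K U" for U j
    proof -
      obtain i m where j: "j = (i, m)" by (cases j) auto
      have UK: "U \<subseteq> mcarrier ?K" using U by (simp add: K.pi_submodule_iff)
      show ?thesis unfolding j
      proof (intro Set.set_eqI)
        fix \<phi>
        have "\<phi> \<in> mdegree ?K m \<longleftrightarrow> (\<forall>r p. K.hat \<phi> (r, p) \<noteq> 0 \<longrightarrow> pdeg c d p = k r + int (l r) * d (ii r) - m)"
          if "\<phi> \<in> U" using that UK by (intro K.mdegree_hat) blast
        then show "\<phi> \<in> S.pcs U (i, m) \<longleftrightarrow> \<phi> \<in> piece_gr c Or ?K U (i, m)"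
          unfolding piece_gr_def prod.case S.pcs_def K.piece_eq[OF U] Int_iff mem_Collect_eq fst_conv snd_conv
          by blast
      qed
    qed
    have Gr: "S.Gset = Gr_gr c Or ?K v"
    proof (intro Set.set_eqI)
      fix U
      show "U \<in> S.Gset \<longleftrightarrow> U \<in> Gr_gr c Or ?K v"
      proof (cases "pi_submodule c Or ?K U")
        case True
        have e: "S.pcs U = piece_gr c Or ?K U" by (rule ext) (rule pc[OF True])
        show ?thesis
          unfolding S.Gset_def Gr_gr_def mem_Collect_eq e K.graded_submodule_iff[OF True] split_paired_All prod.case
          using True by blast
      qed (simp add: S.Gset_def Gr_gr_def graded_submodule_def)
    qed
    have F: "S.FS = frames (piece_gr c Or ?K) (\<lambda>(i, n). v i n) (Gr_gr c Or ?K v)"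
      unfolding S.FS_def Gr by (rule frames_cong) (auto simp: Gr_gr_def graded_submodule_def pc)
    show "\<exists>h. homeomorphic_map
              (crit_fibre_top_gr euclidean c d Or (gamma_sum s ii \<gamma>) ?vd (W_degs d s ii k l))
              (Gr_gr_top euclidean c Or (K_gamma c d Or s ii k l) v) h \<and>
            homeomorphic_map
              (crit_fibre_top_gr zariski c d Or (gamma_sum s ii \<gamma>) ?vd (W_degs d s ii k l))
              (Gr_gr_top zariski c Or (K_gamma c d Or s ii k l) v) h"
      using S.homeomorphism unfolding crit_fibre_top_gr_def Let_def quiver_variety_top_def Gr_gr_top_def F X G wd .
  }
qed

end
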